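(* There exists a constant $C>0$ such that for every $y>0$, $$\lim_{T\to\infty}m\Bigl\{v\in T^1\mathcal M:\ \max_{0\le t\le T}d_{\mathcal M}(\pi(i),\gamma^v(t))-\log T\le\log(Cy)\Bigr\}=e^{-1/y},$$ where $m$ is the Liouville measure on $T^1\mathcal M$, normalized to be a probability measure.
   Context: $\mathbb H^2$ is the upper half plane with its hyperbolic metric of curvature $-1$. The theta group is $$\Theta=\left\{\begin{pmatrix}a&b\\c&d\end{pmatrix}\in\mathrm{SL}(2,\mathbb Z):\begin{pmatrix}a&b\\c&d\end{pmatrix}\equiv\begin{pmatrix}1&0\\0&1\end{pmatrix}\text{ or }\begin{pmatrix}0&-1\\1&0\end{pmatrix}\pmod 2\right\},$$ acting on $\mathbb H^2$ by Möbius transformations; $\mathcal M=\Theta\backslash\mathbb H^2$ is the quotient hyperbolic surface (orbifold), with projection $\pi:\mathbb H^2\to\mathcal M$, quotient distance $d_{\mathcal M}$ and unit tangent bundle $T^1\mathcal M=\Theta\backslash T^1\mathbb H^2$. The point $i\in\mathbb H^2$ is the imaginary unit. For $v\in T^1\mathcal M$, $\gamma^v$ is the unit speed geodesic on $\mathcal M$ with initial tangent vector $v$ at time $0$. The Liouville measure is the natural geodesic-flow-invariant measure on $T^1\mathcal M$ (locally hyperbolic area times angle), which is finite here. *)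

theory Defs
  imports "HOL-Analysis.Analysis"
begin

section \<open>The hyperbolic plane\<close>

definition upper_half_plane :: "complex set" where
  "upper_half_plane = {z. Im z > 0}"

text \<open>The distance of the Riemannian metric \<open>(dx\<^sup>2 + dy\<^sup>2) / y\<^sup>2\<close>, which has curvature \<open>-1\<close>.\<close>

definition hyp_dist :: "complex \<Rightarrow> complex \<Rightarrow> real" where
  "hyp_dist z w = arcosh (1 + (cmod (z - w))\<^sup>2 / (2 * Im z * Im w))"

text \<open>A pair \<open>(z, w)\<close> is the tangent vector \<open>w\<close> at the base point \<open>z\<close>;
  its hyperbolic length is \<open>cmod w / Im z\<close>.\<close>

definition unit_tangent :: "(complex \<times> complex) set" where
  "unit_tangent = {(z, w). Im z > 0 \<and> cmod w / Im z = 1}"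

text \<open>In the hyperbolic plane every geodesic is globally length minimising, so that the complete
  unit speed geodesics are exactly the isometric embeddings of the real line.\<close>

definition unit_speed_geodesic :: "(real \<Rightarrow> complex) \<Rightarrow> bool" where
  "unit_speed_geodesic \<gamma> \<longleftrightarrow>
     range \<gamma> \<subseteq> upper_half_plane \<and> (\<forall>s t. hyp_dist (\<gamma> s) (\<gamma> t) = \<bar>s - t\<bar>)"

definition geodesic_from :: "complex \<times> complex \<Rightarrow> real \<Rightarrow> complex" where
  "geodesic_from v = (THE \<gamma>. unit_speed_geodesic \<gamma> \<and> \<gamma> 0 = fst v \<and>
                               (\<gamma> has_vector_derivative snd v) (at 0))"

text \<open>Hyperbolic area \<open>dx dy / y\<^sup>2\<close>, and the Liouville measure (area times angle) on the unit
  tangent bundle, as a Borel measure on \<open>\<complex> \<times> \<complex>\<close> concentrated on \<open>unit_tangent\<close>.\<close>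

definition hyp_area :: "complex measure" where
  "hyp_area = density lborel (\<lambda>z. ennreal (indicator upper_half_plane z / (Im z)\<^sup>2))"

definition liouville_plane :: "(complex \<times> complex) measure" where
  "liouville_plane =
     distr (hyp_area \<Otimes>\<^sub>M restrict_space lborel {0..<2 * pi}) borel
           (\<lambda>(z, \<theta>). (z, of_real (Im z) * cis \<theta>))"


section \<open>The theta group and its quotient surface\<close>

definition mat2 :: "int \<Rightarrow> int \<Rightarrow> int \<Rightarrow> int \<Rightarrow> int^2^2" where
  "mat2 a b c d = vector [vector [a, b], vector [c, d]]"

definition mat_cong2 :: "int^2^2 \<Rightarrow> int^2^2 \<Rightarrow> bool" where
  "mat_cong2 A B \<longleftrightarrow> (\<forall>i j. A $ i $ j mod 2 = B $ i $ j mod 2)"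

definition theta_group :: "(int^2^2) set" where
  "theta_group = {A. det A = 1 \<and> (mat_cong2 A (mat2 1 0 0 1) \<or> mat_cong2 A (mat2 0 (-1) 1 0))}"

definition moebius :: "int^2^2 \<Rightarrow> complex \<Rightarrow> complex" where
  "moebius A z = (of_int (A $ 1 $ 1) * z + of_int (A $ 1 $ 2)) /
                 (of_int (A $ 2 $ 1) * z + of_int (A $ 2 $ 2))"

definition moebius_tangent :: "int^2^2 \<Rightarrow> complex \<times> complex \<Rightarrow> complex \<times> complex" where
  "moebius_tangent A v = (moebius A (fst v), deriv (moebius A) (fst v) * snd v)"

definition theta_orbit :: "complex \<Rightarrow> complex set" where
  "theta_orbit z = (\<lambda>A. moebius A z) ` theta_group"

definition theta_tangent_orbit :: "complex \<times> complex \<Rightarrow> (complex \<times> complex) set" where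
  "theta_tangent_orbit v = (\<lambda>A. moebius_tangent A v) ` theta_group"

definition theta_unit_tangent :: "(complex \<times> complex) set set" where
  "theta_unit_tangent = theta_tangent_orbit ` unit_tangent"

definition theta_dist :: "complex set \<Rightarrow> complex set \<Rightarrow> real" where
  "theta_dist P Q = (INF (z, w)\<in>P \<times> Q. hyp_dist z w)"

text \<open>The geodesic on the quotient is the projection of the geodesic of any lift of the initial
  vector.  As the group acts by isometries, the points at time \<open>t\<close> of the geodesics of all the
  lifts form a single orbit, which is therefore the projected point.\<close>

definition theta_geodesic :: "(complex \<times> complex) set \<Rightarrow> real \<Rightarrow> complex set" where
  "theta_geodesic V t = (\<lambda>v. geodesic_from v t) ` V"

text \<open>The Liouville measure on the quotient is the image of the one upstairs restricted to the
  vectors with base point in a fundamental domain.  Since only \<open>\<plusminus>1\<close> acts trivially and no other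
  element fixes a unit tangent vector, the projection is injective there.
  See \<open>theta_domain_inj\<close> and \<open>theta_domain_cover\<close> below; the boundary of the
  domain is a null set.  The quotient carries the
  Borel sigma-algebra of the quotient topology.\<close>

definition theta_domain :: "complex set" where
  "theta_domain = {z. Im z > 0 \<and> \<bar>Re z\<bar> < 1 \<and> cmod z > 1}"

definition theta_liouville :: "(complex \<times> complex) set measure" where
  "theta_liouville =
     distr (restrict_space liouville_plane {v \<in> unit_tangent. fst v \<in> theta_domain})
           (sigma theta_unit_tangent
              {A. A \<subseteq> theta_unit_tangent \<and>
                  {v \<in> unit_tangent. theta_tangent_orbit v \<in> A} \<in> sets borel})
           theta_tangent_orbit"

definition theta_liouville_prob :: "(complex \<times> complex) set measure" where
  "theta_liouville_prob = uniform_measure theta_liouville (space theta_liouville)"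


section \<open>Adequacy of the definitions\<close>

lemma mat2_nth [simp]:
  "mat2 a b c d $ 1 $ 1 = a" "mat2 a b c d $ 1 $ 2 = b"
  "mat2 a b c d $ 2 $ 1 = c" "mat2 a b c d $ 2 $ 2 = d"
  by (simp_all add: mat2_def)

lemma mem_theta_group_iff:
  "A \<in> theta_group \<longleftrightarrow>
     A $ 1 $ 1 * A $ 2 $ 2 - A $ 1 $ 2 * A $ 2 $ 1 = 1 \<and>
     (odd (A $ 1 $ 1) \<and> even (A $ 1 $ 2) \<and> even (A $ 2 $ 1) \<and> odd (A $ 2 $ 2) \<or>
      even (A $ 1 $ 1) \<and> odd (A $ 1 $ 2) \<and> odd (A $ 2 $ 1) \<and> even (A $ 2 $ 2))"
  unfolding theta_group_def mat_cong2_def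
  by (simp add: det_2 forall_2 odd_iff_mod_2_eq_one even_iff_mod_2_eq_zero)

lemma moebius_denominator_nonzero:
  fixes a b c d :: int
  assumes "z \<in> upper_half_plane" "a * d - b * c = 1"
  shows "of_int c * z + of_int d \<noteq> 0"
proof
  assume *: "of_int c * z + of_int d = 0"
  have "Im (of_int c * z + of_int d) = 0" "Re (of_int c * z + of_int d) = 0"
    using * by simp_all
  then show False using assms by (auto simp: upper_half_plane_def)
qed

lemma Im_moebius:
  assumes "A \<in> theta_group" "z \<in> upper_half_plane"
  shows "Im (moebius A z) = Im z / (cmod (of_int (A $ 2 $ 1) * z + of_int (A $ 2 $ 2)))\<^sup>2"
proof -
  define a b c d where "a = A $ 1 $ 1" and "b = A $ 1 $ 2" and "c = A $ 2 $ 1" and "d = A $ 2 $ 2"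
  have "a * d - b * c = 1"
    using assms(1) by (simp add: mem_theta_group_iff a_def b_def c_def d_def)
  then have "real_of_int a * of_int d - of_int b * of_int c = 1"
    by (metis of_int_1 of_int_diff of_int_mult)
  then have "(real_of_int a * of_int d - of_int b * of_int c) * Im z = Im z"
    by simp
  then have "a * Im z * (c * Re z + d) - (a * Re z + b) * (c * Im z) = Im z"
    by (simp add: algebra_simps)
  then show ?thesis
    by (simp add: moebius_def Im_divide cmod_power2 flip: a_def b_def c_def d_def)
qed

text \<open>Two points of the domain in the same orbit are equal, and only \<open>\<plusminus>1\<close> identifies them.\<close>

lemma theta_domain_cmod:
  fixes c d :: int
  assumes "z \<in> theta_domain" "c \<noteq> 0" "odd (c + d)"
  shows "cmod (of_int c * z + of_int d) > 1"
proof -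
  have z: "(Re z)\<^sup>2 + (Im z)\<^sup>2 > 1" "\<bar>Re z\<bar> < 1"
    using assms(1) by (auto simp: theta_domain_def cmod_def real_less_rsqrt)
  have "\<bar>c\<bar> \<noteq> \<bar>d\<bar>" using assms(3) by (auto simp: abs_if split: if_splits)
  then have "\<bar>\<bar>c\<bar> - \<bar>d\<bar>\<bar> \<ge> 1" by linarith
  then have "\<bar>\<bar>c\<bar> - \<bar>d\<bar>\<bar>\<^sup>2 \<ge> 1" using one_le_power by blast
  then have 1: "(\<bar>c\<bar> - \<bar>d\<bar>)\<^sup>2 \<ge> 1" by simp
  have "real_of_int ((\<bar>c\<bar> - \<bar>d\<bar>)\<^sup>2) \<ge> 1" using 1 by linarith
  then have 2: "(real_of_int \<bar>c\<bar> - real_of_int \<bar>d\<bar>)\<^sup>2 \<ge> 1" by simp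
  have 3: "(real_of_int c)\<^sup>2 * ((Re z)\<^sup>2 + (Im z)\<^sup>2) > (real_of_int c)\<^sup>2"
    using z(1) assms(2) by simp
  have "\<bar>real_of_int c * real_of_int d * Re z\<bar> \<le> \<bar>real_of_int c * real_of_int d\<bar>"
    using z(2) by (simp add: abs_mult mult_left_le)
  then have 4: "2 * (real_of_int c * real_of_int d * Re z) \<ge> - 2 * \<bar>real_of_int c\<bar> * \<bar>real_of_int d\<bar>"
    using abs_mult[of "real_of_int c" "real_of_int d"] by linarith
  have "(cmod (of_int c * z + of_int d))\<^sup>2 =
      (real_of_int c)\<^sup>2 * ((Re z)\<^sup>2 + (Im z)\<^sup>2) + 2 * (real_of_int c * real_of_int d * Re z) + (real_of_int d)\<^sup>2"
    unfolding cmod_power2 by (simp add: power2_eq_square algebra_simps)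
  moreover have "(real_of_int \<bar>c\<bar> - real_of_int \<bar>d\<bar>)\<^sup>2 = (real_of_int c)\<^sup>2 + (real_of_int d)\<^sup>2 - 2 * \<bar>real_of_int c\<bar> * \<bar>real_of_int d\<bar>"
    by (simp add: power2_diff)
  ultimately have "(cmod (of_int c * z + of_int d))\<^sup>2 > 1"
    using 2 3 4 by linarith
  then show ?thesis
    by (smt (verit) norm_ge_zero power_le_one)
qed

lemma theta_domain_inj:
  assumes "A \<in> theta_group" "z \<in> theta_domain" "moebius A z \<in> theta_domain"
  shows "A = mat2 1 0 0 1 \<or> A = mat2 (-1) 0 0 (-1)"
proof -
  define a b c d where "a = A $ 1 $ 1" and "b = A $ 1 $ 2" and "c = A $ 2 $ 1" and "d = A $ 2 $ 2"
  have A: "a * d - b * c = 1" "odd (c + d)"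
       "odd a \<and> even b \<and> even c \<and> odd d \<or> even a \<and> odd b \<and> odd c \<and> even d"
    using assms(1) by (auto simp add: mem_theta_group_iff a_def b_def c_def d_def)
  have z: "z \<in> upper_half_plane" "Im z > 0" and mz: "Im (moebius A z) > 0"
    using assms by (auto simp: theta_domain_def upper_half_plane_def)
  let ?q = "of_int c * z + of_int d"
  have q0: "?q \<noteq> 0" using moebius_denominator_nonzero[OF z(1) A(1)] .
  have c0: "c = 0"
  proof (rule ccontr)
    assume c: "c \<noteq> 0"
    then have "cmod ?q > 1" using theta_domain_cmod assms(2) A(2) by blast
    moreover have "cmod (of_int (-c) * moebius A z + of_int a) > 1"
      using c A(3) by (intro theta_domain_cmod[OF assms(3)]) auto
    moreover have "of_int (-c) * moebius A z + of_int a = 1 / ?q"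
    proof -
      have "(of_int (-c) * moebius A z + of_int a) * ?q = of_int (a * d - b * c)"
        using q0 by (simp add: moebius_def field_simps flip: a_def b_def c_def d_def)
      then show ?thesis using q0 A(1) by (simp add: field_simps)
    qed
    ultimately have "1 < cmod ?q" "1 < 1 / cmod ?q" by (simp_all add: norm_divide)
    then show False by (smt (verit) divide_less_eq_1)
  qed
  then have ad: "a = 1 \<and> d = 1 \<or> a = -1 \<and> d = -1"
    using A(1) by (auto simp: zmult_eq_1_iff)
  then have "moebius A z = z + of_int (a * b)"
    using c0 by (auto simp: moebius_def simp flip: a_def b_def c_def d_def)
  then have "\<bar>Re z + of_int (a * b)\<bar> < 1" "\<bar>Re z\<bar> < 1"
    using assms by (auto simp: theta_domain_def)
  then have "\<bar>real_of_int (a * b)\<bar> < 2" by linarith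
  then have "\<bar>a * b\<bar> < 2" by linarith
  then have "\<bar>b\<bar> < 2" using ad by auto
  moreover have "even b" using A(3) c0 by auto
  ultimately have "b = 0" by presburger
  then show ?thesis
    using ad c0 by (auto simp: vec_eq_iff forall_2 a_def b_def c_def d_def)
qed

lemma theta_domain_cover:
  assumes z: "z \<in> upper_half_plane"
  shows "\<exists>A\<in>theta_group. \<bar>Re (moebius A z)\<bar> \<le> 1 \<and> cmod (moebius A z) \<ge> 1"
proof -
  have Imz: "Im z > 0" using z by (simp add: upper_half_plane_def)
  define f where "f = (\<lambda>A::int^2^2. cmod (of_int (A $ 2 $ 1) * z + of_int (A $ 2 $ 2)))"
  define h where "h = (\<lambda>(c::int, d::int). cmod (of_int c * z + of_int d))"
  define row where "row = (\<lambda>A::int^2^2. (A $ 2 $ 1, A $ 2 $ 2))"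
  define R where "R = row ` theta_group \<inter> {p. h p \<le> 1}"
  have "R \<subseteq> {-\<lceil>1 / Im z\<rceil>..\<lceil>1 / Im z\<rceil>} \<times> {-\<lceil>1 + (1 / Im z) * cmod z\<rceil>..\<lceil>1 + (1 / Im z) * cmod z\<rceil>}"
  proof
    fix p assume "p \<in> R"
    then obtain c d where p: "p = (c, d)" and h: "cmod (of_int c * z + of_int d) \<le> 1"
      by (cases p) (auto simp: R_def h_def)
    have "\<bar>real_of_int c\<bar> * Im z = \<bar>Im (of_int c * z + of_int d)\<bar>"
      using Imz by (simp add: abs_mult)
    also have "\<dots> \<le> 1" using abs_Im_le_cmod[of "of_int c * z + of_int d"] h by linarith
    finally have c: "\<bar>real_of_int c\<bar> \<le> 1 / Im z" using Imz by (simp add: field_simps)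
    have "\<bar>real_of_int d\<bar> = cmod ((of_int c * z + of_int d) - of_int c * z)" by simp
    also have "\<dots> \<le> 1 + \<bar>real_of_int c\<bar> * cmod z"
      using norm_triangle_ineq4[of "of_int c * z + of_int d" "of_int c * z"] h
      by (simp add: norm_mult)
    also have "\<dots> \<le> 1 + (1 / Im z) * cmod z"
      using mult_right_mono[OF c norm_ge_zero[of z]] by simp
    finally have d: "\<bar>real_of_int d\<bar> \<le> 1 + (1 / Im z) * cmod z" .
    show "p \<in> {-\<lceil>1 / Im z\<rceil>..\<lceil>1 / Im z\<rceil>} \<times> {-\<lceil>1 + (1 / Im z) * cmod z\<rceil>..\<lceil>1 + (1 / Im z) * cmod z\<rceil>}"
      unfolding p using c d by (simp only: mem_Times_iff fst_conv snd_conv atLeastAtMost_iff) linarith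
  qed
  then have fin: "finite R" by (rule finite_subset) simp
  have one: "mat2 1 0 0 1 \<in> theta_group" by (simp add: mem_theta_group_iff)
  then have "row (mat2 1 0 0 1) \<in> R" by (simp add: R_def) (simp add: h_def row_def)
  then have ne: "R \<noteq> {}" by blast
  obtain p where p: "p \<in> R" "\<And>q. q \<in> R \<Longrightarrow> h p \<le> h q"
    using arg_min_if_finite[OF fin ne, of h] by (meson not_less)
  obtain A where A: "A \<in> theta_group" "p = row A" using p(1) by (auto simp: R_def)
  have min: "f A \<le> f B" if "B \<in> theta_group" for B
  proof (cases "f B \<le> 1")
    case True
    then have "row B \<in> R" using that by (auto simp: R_def f_def h_def row_def)
    then show ?thesis using p(2) A(2) by (force simp: f_def h_def row_def)
  next
    case False
    have "f A \<le> 1" using p(1) A(2) by (simp add: R_def f_def h_def row_def)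
    then show ?thesis using False by linarith
  qed
  define a b c d where "a = A $ 1 $ 1" and "b = A $ 1 $ 2" and "c = A $ 2 $ 1" and "d = A $ 2 $ 2"
  have abcd: "a * d - b * c = 1"
       "odd a \<and> even b \<and> even c \<and> odd d \<or> even a \<and> odd b \<and> odd c \<and> even d"
    using A(1) by (auto simp add: mem_theta_group_iff a_def b_def c_def d_def)
  let ?q = "of_int c * z + of_int d"
  have q0: "?q \<noteq> 0" using moebius_denominator_nonzero[OF z abcd(1)] .
  define k where "k = - round (Re (moebius A z) / 2)"
  define B where "B = mat2 (a + 2 * k * c) (b + 2 * k * d) c d"
  define B' where "B' = mat2 (- c) (- d) (a + 2 * k * c) (b + 2 * k * d)"
  have B: "B \<in> theta_group" and B': "B' \<in> theta_group"
    using abcd by (auto simp: mem_theta_group_iff B_def B'_def algebra_simps)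
  have mB: "moebius B z = moebius A z + of_int (2 * k)"
    using q0 by (simp add: moebius_def B_def field_simps flip: a_def b_def c_def d_def)
  have "\<bar>Re (moebius A z) / 2 + of_int k\<bar> \<le> 1 / 2"
    using of_int_round_abs_le[of "Re (moebius A z) / 2"] unfolding k_def by linarith
  then have "\<bar>Re (moebius B z)\<bar> \<le> 1" unfolding mB abs_le_iff by simp
  moreover have "cmod (moebius B z) \<ge> 1"
  proof -
    have "f A = cmod ?q" by (simp add: f_def c_def d_def)
    moreover have "f B' = cmod (moebius B z) * cmod ?q"
      using q0 by (simp add: f_def B'_def B_def moebius_def norm_divide)
    ultimately show ?thesis using min[OF B'] q0 by simp
  qed
  ultimately show ?thesis using B by blast
qed

text \<open>Existence, uniqueness and a formula for the geodesic with given initial vector.\<close>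

lemma cosh_hyp_dist:
  assumes "z \<in> upper_half_plane" "w \<in> upper_half_plane"
  shows "cosh (hyp_dist z w) = 1 + (cmod (z - w))\<^sup>2 / (2 * Im z * Im w)"
  using assms unfolding hyp_dist_def upper_half_plane_def by (intro cosh_arcosh_real) auto

lemma cosh_minus_pos:
  fixes b t :: real
  assumes "\<bar>b\<bar> \<le> 1"
  shows "cosh t - b * sinh t > 0"
proof -
  have "\<bar>b * sinh t\<bar> \<le> 1 * \<bar>sinh t\<bar>" unfolding abs_mult using assms by (intro mult_right_mono) auto
  also have "\<dots> < cosh t" using sinh_less_cosh_real[of "\<bar>t\<bar>"] by simp
  finally show ?thesis by linarith
qed


lemma ex1_geodesic:
  assumes "Im z > 0" "cmod w / Im z = 1"
  defines "\<delta> \<equiv> \<lambda>t. cosh t - Im w / Im z * sinh t"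
  defines "\<beta> \<equiv> \<lambda>t. Complex (Re z + Re w * sinh t / \<delta> t) (Im z / \<delta> t)"
  defines "P \<equiv> \<lambda>\<gamma>. unit_speed_geodesic \<gamma> \<and> \<gamma> 0 = z \<and> (\<gamma> has_vector_derivative w) (at 0)"
  shows "P \<beta>" and "P \<gamma> \<Longrightarrow> \<gamma> = \<beta>"
proof -
  define x y a b where "x = Re z" and "y = Im z" and "a = Re w / Im z" and "b = Im w / Im z"
  have y: "y > 0" and w: "Re w = y * a" "Im w = y * b"
    using assms(1) by (auto simp: y_def a_def b_def)
  have "(cmod w)\<^sup>2 = (Im z)\<^sup>2" using assms(1,2) by simp
  then have "y\<^sup>2 * (a\<^sup>2 + b\<^sup>2) = y\<^sup>2"
    by (simp add: cmod_power2 w y_def[symmetric] power_mult_distrib distrib_left)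
  then have ab: "a\<^sup>2 + b\<^sup>2 = 1" using y by simp
  then have b1: "\<bar>b\<bar> \<le> 1" using abs_square_le_1[of b] by (smt (verit) zero_le_power2)
  have \<delta>: "\<delta> t = cosh t - b * sinh t" for t by (simp add: \<delta>_def b_def)
  have \<delta>pos: "\<delta> t > 0" for t unfolding \<delta> using cosh_minus_pos[OF b1] .
  have \<beta>: "Re (\<beta> t) = x + y * a * sinh t / \<delta> t" "Im (\<beta> t) = y / \<delta> t" for t
    by (simp_all add: \<beta>_def x_def w) (simp add: y_def)
  show "P \<beta>"
    unfolding P_def unit_speed_geodesic_def
  proof (intro conjI allI)
    show "range \<beta> \<subseteq> upper_half_plane"
      using y \<delta>pos by (auto simp: upper_half_plane_def \<beta>)
    show "\<beta> 0 = z" by (simp add: complex_eq_iff \<beta> \<delta> x_def y_def)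
    have d: "((\<lambda>t. Re (\<beta> t)) has_real_derivative y * a) (at 0)"
            "((\<lambda>t. Im (\<beta> t)) has_real_derivative y * b) (at 0)"
      unfolding \<beta> \<delta> by (auto intro!: derivative_eq_intros)
    then show "(\<beta> has_vector_derivative w) (at 0)"
      by (simp add: has_vector_derivative_complex_iff w)
    fix s t :: real
    define r where "r = s - t"
    define C S K M where "C = cosh t" and "S = sinh t" and "K = cosh r" and "M = sinh r"
    have st: "cosh s = C * K + S * M" "sinh s = S * K + C * M"
      using cosh_add[of t r] sinh_add[of t r] by (simp_all add: r_def C_def S_def K_def M_def)
    have CS: "C\<^sup>2 = S\<^sup>2 + 1" "K\<^sup>2 = M\<^sup>2 + 1"
      by (simp_all add: C_def S_def K_def M_def cosh_square_eq)
    define D where "D = \<delta> s" define E where "E = \<delta> t"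
    have DE: "D = C * K + S * M - b * (S * K + C * M)" "E = C - b * S"
      by (simp_all add: D_def E_def \<delta> st) (simp add: C_def S_def)
    have pos: "D > 0" "E > 0" by (simp_all add: D_def E_def \<delta>pos)
    have 1: "(S * K + C * M) * E - S * D = M" using CS(1) unfolding DE by algebra
    define F where "F = S - b * C"
    have F: "E\<^sup>2 - F\<^sup>2 = a\<^sup>2" using CS(1) ab unfolding DE F_def by algebra
    have D: "D = K * E + M * F" unfolding DE F_def by (simp add: algebra_simps)
    have 2: "a\<^sup>2 * M\<^sup>2 + (E - D)\<^sup>2 = 2 * D * E * (K - 1)" using CS(2) unfolding F[symmetric] D by algebra
    have "(cmod (\<beta> s - \<beta> t))\<^sup>2 = (y * a * (S * K + C * M) / D - y * a * S / E)\<^sup>2 + (y / D - y / E)\<^sup>2"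
      by (simp add: cmod_power2 \<beta> st D_def E_def S_def)
    also have "\<dots> = (y / (D * E))\<^sup>2 * (a\<^sup>2 * ((S * K + C * M) * E - S * D)\<^sup>2 + (E - D)\<^sup>2)"
    proof -
      have "p / D - q / E = (p * E - q * D) / (D * E)" for p q :: real
        using pos by (simp add: diff_frac_eq)
      from this[of "y * a * (S * K + C * M)" "y * a * S"] this[of y y]
      have "y * a * (S * K + C * M) / D - y * a * S / E = y / (D * E) * (a * ((S * K + C * M) * E - S * D))"
                "y / D - y / E = y / (D * E) * (E - D)"
        by (simp_all only: times_divide_eq_left) (simp_all add: algebra_simps)
      then show ?thesis by (simp only: power_mult_distrib distrib_left)
    qed
    also have "\<dots> = (y / (D * E))\<^sup>2 * (2 * D * E * (K - 1))"
      by (simp only: 1 2)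
    finally have 3: "(cmod (\<beta> s - \<beta> t))\<^sup>2 = (y / (D * E))\<^sup>2 * (2 * D * E * (K - 1))" .
    have "1 + (cmod (\<beta> s - \<beta> t))\<^sup>2 / (2 * Im (\<beta> s) * Im (\<beta> t)) = K"
      unfolding 3 \<beta> D_def[symmetric] E_def[symmetric] using pos y
      by (simp add: field_simps power2_eq_square)
    then have "hyp_dist (\<beta> s) (\<beta> t) = arcosh (cosh \<bar>r\<bar>)"
      by (simp add: hyp_dist_def K_def)
    then show "hyp_dist (\<beta> s) (\<beta> t) = \<bar>s - t\<bar>"
      unfolding r_def by (subst (asm) arcosh_cosh_real) auto
  qed
  show "\<gamma> = \<beta>" if "P \<gamma>"
  proof
    fix t
    have uhp: "\<gamma> s \<in> upper_half_plane" for s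
      using that by (auto simp: P_def unit_speed_geodesic_def)
    have dist: "hyp_dist (\<gamma> s) (\<gamma> t) = \<bar>s - t\<bar>" for s
      using that by (auto simp: P_def unit_speed_geodesic_def)
    have \<gamma>0: "Re (\<gamma> 0) = x" "Im (\<gamma> 0) = y" using that by (simp_all add: P_def x_def y_def)
    have der: "((\<lambda>s. Re (\<gamma> s)) has_real_derivative y * a) (at 0)"
              "((\<lambda>s. Im (\<gamma> s)) has_real_derivative y * b) (at 0)"
      using that by (simp_all add: P_def has_vector_derivative_complex_iff w)
    define u v where "u = Re (\<gamma> t)" and "v = Im (\<gamma> t)"
    have v: "v > 0" using uhp[of t] by (simp add: v_def upper_half_plane_def)
    define C S where "C = cosh t" and "S = sinh t"
    have CS: "C\<^sup>2 = S\<^sup>2 + 1" by (simp add: C_def S_def cosh_square_eq)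
    have eq: "(Re (\<gamma> s) - u)\<^sup>2 + (Im (\<gamma> s) - v)\<^sup>2 = (cosh (s - t) - 1) * (2 * Im (\<gamma> s) * v)" for s
    proof -
      have "cosh (s - t) = 1 + (cmod (\<gamma> s - \<gamma> t))\<^sup>2 / (2 * Im (\<gamma> s) * v)"
        using cosh_hyp_dist[OF uhp[of s] uhp[of t]] dist[of s] by (simp add: v_def)
      moreover have "Im (\<gamma> s) > 0" using uhp[of s] by (simp add: upper_half_plane_def)
      ultimately show ?thesis using v by (simp add: cmod_power2 u_def v_def)
    qed
    have "((\<lambda>s. (Re (\<gamma> s) - u)\<^sup>2 + (Im (\<gamma> s) - v)\<^sup>2) has_real_derivative
             2 * (x - u) * (y * a) + 2 * (y - v) * (y * b)) (at 0)"
      by (rule der derivative_eq_intros refl)+ (simp add: \<gamma>0 algebra_simps)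
    moreover have "((\<lambda>s. (cosh (s - t) - 1) * (2 * Im (\<gamma> s) * v)) has_real_derivative
             - S * (2 * y * v) + (C - 1) * (2 * (y * b) * v)) (at 0)"
      by (rule der derivative_eq_intros refl)+ (simp add: \<gamma>0 C_def S_def)
    ultimately have "2 * (x - u) * (y * a) + 2 * (y - v) * (y * b) =
             - S * (2 * y * v) + (C - 1) * (2 * (y * b) * v)"
      unfolding eq by (rule DERIV_unique)
    then have "2 * y * ((u - x) * a + (C * v - y) * b - S * v) = 0" by algebra
    then have 1: "(u - x) * a + (C * v - y) * b = S * v" using y by simp
    have 2: "(x - u)\<^sup>2 + (y - v)\<^sup>2 = (C - 1) * (2 * y * v)"
      using eq[of 0] by (simp add: \<gamma>0 C_def)
    have "(u - x)\<^sup>2 + (C * v - y)\<^sup>2 = (C\<^sup>2 - 1) * v\<^sup>2" using 2 by algebra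
    moreover have "((u - x) - a * S * v)\<^sup>2 + ((C * v - y) - b * S * v)\<^sup>2 =
        (u - x)\<^sup>2 + (C * v - y)\<^sup>2 - 2 * (S * v) * ((u - x) * a + (C * v - y) * b) + (S * v)\<^sup>2 * (a\<^sup>2 + b\<^sup>2)"
      by algebra
    ultimately have "((u - x) - a * S * v)\<^sup>2 + ((C * v - y) - b * S * v)\<^sup>2 = 0"
      unfolding 1 ab CS by algebra
    then have 3: "u - x = a * S * v" "v * \<delta> t = y"
      by (auto simp: sum_power2_eq_zero_iff \<delta> C_def S_def algebra_simps)
    then have "v = y / \<delta> t" using \<delta>pos[of t] by (simp add: field_simps)
    then show "\<gamma> t = \<beta> t"
      using 3(1) by (simp add: complex_eq_iff \<beta> S_def algebra_simps flip: u_def v_def)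
  qed
qed

lemma geodesic_from_eq:
  assumes "v \<in> unit_tangent"
  shows "geodesic_from v = (\<lambda>t.
    let \<delta> = cosh t - Im (snd v) / Im (fst v) * sinh t
    in Complex (Re (fst v) + Re (snd v) * sinh t / \<delta>) (Im (fst v) / \<delta>))"
  unfolding geodesic_from_def Let_def
  using ex1_geodesic[of "fst v" "snd v"] assms
  by (intro the_equality) (auto simp: unit_tangent_def)

text \<open>The maps along which measures are transported are measurable.\<close>

lemma liouville_plane_measurable:
  "(\<lambda>(z, \<theta>). (z, of_real (Im z) * cis \<theta>)) \<in>
     hyp_area \<Otimes>\<^sub>M restrict_space lborel {0..<2 * pi} \<rightarrow>\<^sub>M borel"
proof -
  have c: "cis \<in> borel_measurable borel"
    by (intro borel_measurable_continuous_onI continuous_intros)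
  have "cis \<in> restrict_space lborel {0..<2 * pi} \<rightarrow>\<^sub>M borel"
    using c by (intro measurable_restrict_space1) simp
  moreover have "(\<lambda>z. z) \<in> hyp_area \<rightarrow>\<^sub>M borel" "(\<lambda>z. of_real (Im z) :: complex) \<in> hyp_area \<rightarrow>\<^sub>M borel"
    by (simp_all add: hyp_area_def)
  ultimately show ?thesis
    unfolding split_beta' by (intro borel_measurable_Pair borel_measurable_times)
      (auto intro: measurable_compose[OF measurable_fst] measurable_compose[OF measurable_snd])
qed

lemma unit_tangent_borel [measurable]: "unit_tangent \<in> sets borel"
proof -
  have eq: "unit_tangent = {v. Im (fst v) > 0} \<inter> {v. cmod (snd v) = Im (fst v)}"
    by (auto simp: unit_tangent_def)
  have "open {v :: complex \<times> complex. Im (fst v) > 0}"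
    by (intro open_Collect_less continuous_intros)
  moreover have "closed {v :: complex \<times> complex. cmod (snd v) = Im (fst v)}"
    by (intro closed_Collect_eq continuous_intros)
  ultimately show ?thesis
    unfolding eq by (intro sets.Int borel_open borel_closed)
qed

lemma theta_domain_borel:
  "{v \<in> unit_tangent. fst v \<in> theta_domain} \<in> sets borel"
proof -
  have "open {v :: complex \<times> complex. 0 < Im (fst v) \<and> \<bar>Re (fst v)\<bar> < 1 \<and> 1 < cmod (fst v)}"
    by (intro open_Collect_conj open_Collect_less continuous_intros)
  from sets.Int[OF unit_tangent_borel borel_open[OF this]] show ?thesis
    by (simp add: theta_domain_def Int_def)
qed

lemma theta_liouville_sigma:
  "sigma_algebra theta_unit_tangent
     {A. A \<subseteq> theta_unit_tangent \<and> {v \<in> unit_tangent. theta_tangent_orbit v \<in> A} \<in> sets borel}"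
proof (unfold sigma_algebra_iff2, safe)
  fix A assume "{v \<in> unit_tangent. theta_tangent_orbit v \<in> A} \<in> sets borel"
  moreover have "{v \<in> unit_tangent. theta_tangent_orbit v \<in> theta_unit_tangent - A} =
      unit_tangent - {v \<in> unit_tangent. theta_tangent_orbit v \<in> A}"
    by (auto simp: theta_unit_tangent_def)
  ultimately show "{v \<in> unit_tangent. theta_tangent_orbit v \<in> theta_unit_tangent - A} \<in> sets borel"
    by auto
next
  fix A :: "nat \<Rightarrow> (complex \<times> complex) set set"
  assume "range A \<subseteq> {A. A \<subseteq> theta_unit_tangent \<and> {v \<in> unit_tangent. theta_tangent_orbit v \<in> A} \<in> sets borel}"
  then have "(\<Union>i. {v \<in> unit_tangent. theta_tangent_orbit v \<in> A i}) \<in> sets borel" by blast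
  moreover have "(\<Union>i. {v \<in> unit_tangent. theta_tangent_orbit v \<in> A i}) =
      {v \<in> unit_tangent. theta_tangent_orbit v \<in> \<Union> (range A)}" by auto
  ultimately show "{v \<in> unit_tangent. theta_tangent_orbit v \<in> \<Union> (range A)} \<in> sets borel" by simp
qed auto

lemma theta_tangent_orbit_measurable:
  "theta_tangent_orbit \<in>
     restrict_space liouville_plane {v \<in> unit_tangent. fst v \<in> theta_domain} \<rightarrow>\<^sub>M
     sigma theta_unit_tangent
       {A. A \<subseteq> theta_unit_tangent \<and> {v \<in> unit_tangent. theta_tangent_orbit v \<in> A} \<in> sets borel}"
  (is "_ \<in> restrict_space _ ?F \<rightarrow>\<^sub>M _")
proof (rule measurable_measure_of)
  have sp: "space (restrict_space liouville_plane ?F) = ?F"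
    by (simp add: space_restrict_space liouville_plane_def)
  then show "theta_tangent_orbit \<in> space (restrict_space liouville_plane ?F) \<rightarrow> theta_unit_tangent"
    by (auto simp: theta_unit_tangent_def)
  fix A assume "A \<in> {A. A \<subseteq> theta_unit_tangent \<and> {v \<in> unit_tangent. theta_tangent_orbit v \<in> A} \<in> sets borel}"
  then have "{v \<in> unit_tangent. theta_tangent_orbit v \<in> A} \<in> sets liouville_plane"
    by (simp add: liouville_plane_def)
  moreover have "theta_tangent_orbit -` A \<inter> ?F = ?F \<inter> {v \<in> unit_tangent. theta_tangent_orbit v \<in> A}"
    by auto
  ultimately show "theta_tangent_orbit -` A \<inter> space (restrict_space liouville_plane ?F)
      \<in> sets (restrict_space liouville_plane ?F)"
    unfolding sp sets_restrict_space by auto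
qed auto

end

theory Submission
  imports Defs "HOL-Real_Asymp.Real_Asymp"
begin

text \<open>
  The orbit of \<open>\<i>\<close> stays far from \<open>z\<close> exactly when \<open>z\<close> lies deep in a horoball at some rational
  \<open>p/q\<close>, that is, when the form \<open>|q z - p|\<^sup>2 / Im z\<close> is small; fractions with \<open>p\<close>, \<open>q\<close> both odd belong to
  the second cusp of \<open>\<Theta>\<close> and count with weight 2. For a geodesic ending in \<open>\<xi>\<close>, an excursion to height
  \<open>\<kappa> T\<close> before time \<open>T\<close> therefore means, up to factors \<open>1 \<plusminus> \<epsilon>\<close>, that \<open>q |q \<xi> - p| < \<rho> w(p, q)\<close> for
  some \<open>q \<le> exp (T/2)\<close>, where \<open>\<rho> = 1 / (2 \<kappa> T)\<close>.

  The measure of the \<open>\<xi>\<close> avoiding all these intervals is found by a renewal argument over the last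
  interval \<open>p/q\<close> visited. Writing \<open>x = p/q + r/q\<^sup>2\<close>, the inversion \<open>y = a/q - 1/r\<close> turns later visits of \<open>x\<close>
  into visits of \<open>y\<close> with the bound \<open>Q\<close> replaced by about \<open>Q/q\<close>, and since \<open>r\<close> ranges over a short interval
  around 0, \<open>y\<close> is nearly uniform modulo 2. As the fractions with denominator up to \<open>Q\<close> have total mass
  \<open>c (v - u) ln Q + O(1)\<close>, the resulting equation forces the avoidance probability to be close to
  \<open>Q\<close> to the power \<open>-2 c \<rho>\<close>, which is \<open>exp (-2 c s)\<close> for \<open>Q = exp (s/\<rho>)\<close>. The end point of a Liouville random
  geodesic has an absolutely continuous distribution, so the same limit holds for it.
\<close>

section \<open>Coprime fractions\<close>

text \<open>The obstacle is that the renewal equation does not close up: moving \<open>p/q\<close>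
  to infinity changes the class \<open>e\<close>, and it is exact only after changing the bound
  \<open>Q/q\<close> by a factor of order \<rho>^2 and \<rho> by a factor
  \<open>1 \<plusminus> \<rho>\<close>. So the counting must hold with one constant \<open>c\<close>
  for all three admissible classes; a union bound shows that the other changes cost O(\<rho> ln
  (1/\<rho>)) as long as \<rho> ln Q stays bounded. The exponent comes from a fixed point:
  \<open>2 * \<rho> * c\<close> times the integral of (Q/q)^(-\<sigma>) dq/q over [1, Q] equals 1 -
  Q^(-\<sigma>) exactly for \<sigma> = 2 c \<rho>. Errors measured in multiples of Q^(8 c \<rho>)
  are contracted, since the same integral with that exponent is at most 1/4 of Q^(8 c \<rho>). Thus
  an error bound valid for all classes and all Q at once improves itself, starting from the trivial
  one. For \<rho> = 1 / (2 \<kappa> T) and Q = exp (T/2) one has s = \<rho> ln Q = 1 / (4 \<kappa>),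
  so the limit is exp (- c / (2 \<kappa>)), and \<kappa> = c y / 2 gives exp (- 1 / y).\<close>

lemma sum_gcd_classes:
  fixes h :: "nat \<Rightarrow> nat \<Rightarrow> real"
  shows "(\<Sum>q=1..n. \<Sum>g\<in>{g. g dvd q}. h g (q div g)) = (\<Sum>g=1..n. \<Sum>m=1..n div g. h g m)"
proof -
  have 1: "(\<Sum>q=1..n. \<Sum>g\<in>{g. g dvd q}. h g (q div g)) =
      (\<Sum>(q, g)\<in>Sigma {1..n} (\<lambda>q. {g. g dvd q}). h g (q div g))"
    by (subst sum.Sigma) auto
  have 2: "(\<Sum>g=1..n. \<Sum>m=1..n div g. h g m) =
      (\<Sum>(g, m)\<in>Sigma {1..n} (\<lambda>g. {1..n div g}). h g m)"
    by (subst sum.Sigma) auto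
  show ?thesis unfolding 1 2
  proof (rule sum.reindex_bij_witness[where i = "\<lambda>(g, m). (g * m, g)" and j = "\<lambda>(q, g). (g, q div g)"])
    fix a :: "nat \<times> nat" assume a: "a \<in> Sigma {1..n} (\<lambda>q. {g. g dvd q})"
    then obtain q g where qg: "a = (q, g)" "1 \<le> q" "q \<le> n" "g dvd q" by auto
    then obtain m where m: "q = g * m" by auto
    then have pos: "g > 0" "m > 0" using qg(2) by (auto intro: Nat.gr0I)
    show "(case case a of (q, g) \<Rightarrow> (g, q div g) of (g, m) \<Rightarrow> (g * m, g)) = a"
      using qg by simp
    show "(case a of (q, g) \<Rightarrow> (g, q div g)) \<in> Sigma {1..n} (\<lambda>g. {1..n div g})"
      using qg m pos order.trans[OF dvd_imp_le[of g q] qg(3)] by (auto simp: less_eq_div_iff_mult_less_eq mult.commute)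
    show "(case case a of (q, g) \<Rightarrow> (g, q div g) of (g, m) \<Rightarrow> h g m) = (case a of (q, g) \<Rightarrow> h g (q div g))"
      using qg by simp
  next
    fix b :: "nat \<times> nat" assume "b \<in> Sigma {1..n} (\<lambda>g. {1..n div g})"
    then obtain g m where gm: "b = (g, m)" "1 \<le> g" "g \<le> n" "1 \<le> m" "m \<le> n div g" by auto
    then have "g * m \<le> n" by (simp add: less_eq_div_iff_mult_less_eq mult.commute)
    then show "(case b of (g, m) \<Rightarrow> (g * m, g)) \<in> Sigma {1..n} (\<lambda>q. {g. g dvd q})"
      using gm by auto
    show "(case case b of (g, m) \<Rightarrow> (g * m, g) of (q, g) \<Rightarrow> (g, q div g)) = b"
      using gm by simp
  qed
qed

lemma ln_div_bounds:
  fixes n g :: nat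
  assumes "1 \<le> g" "g \<le> n"
  shows "0 \<le> ln n - ln (n div g)" "ln n - ln (n div g) \<le> ln (2 * real g)"
proof -
  have d: "n div g \<ge> 1" using assms by (simp add: less_eq_div_iff_mult_less_eq)
  have "real (n div g) \<le> n" by simp
  then show "0 \<le> ln n - ln (n div g)" using d assms by simp
  have "n < (n div g + 1) * g" using assms
    by (metis Suc_eq_plus1 add.commute div_less_iff_less_mult lessI less_le_trans zero_less_one)
  also have "\<dots> \<le> (2 * (n div g)) * g" using d by (intro mult_right_mono) auto
  finally have "real n \<le> real (2 * (n div g) * g)" by linarith
  then have "ln n \<le> ln (real (2 * (n div g) * g))" using assms d by (subst ln_le_cancel_iff) (auto intro!: mult_pos_pos)
  also have "real (2 * (n div g) * g) = (2 * real g) * real (n div g)" by simp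
  also have "ln \<dots> = ln (2 * real g) + ln (n div g)" using d assms by (subst ln_mult) auto
  finally show "ln n - ln (n div g) \<le> ln (2 * real g)" by simp
qed

text \<open>The limit is pi^2/6 - 1. What matters is a bound below 1: it lets the induction in
  \<open>gcd_inversion\<close> absorb all terms with \<open>g \<ge> 2\<close>.\<close>

lemma sum_inverse_squares_from_2:
  "(\<Sum>g=2..n::nat. 1 / (real g)\<^sup>2) \<le> 3 / 4"
proof -
  \<comment> \<open>Telescoping works from 4 on, since 1/4 + 1/9 + 1/16 is below 3/4 - 1/4.\<close>
  have *: "(\<Sum>g=2..n. 1 / (real g)\<^sup>2) \<le> 3 / 4 - 1 / (real n)" if "n \<ge> 4" for n :: nat
    using that
  proof (induction n rule: dec_induct)
    case base
    have "{2..4::nat} = {2,3,4}" by auto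
    then show ?case by (simp add: power2_eq_square)
  next
    case (step n)
    then have n: "real n \<ge> 4" by simp
    have "{2..Suc n} = insert (Suc n) {2..n}" using step by auto
    moreover have "1 / (real (Suc n))\<^sup>2 \<le> 1 / real n - 1 / real (Suc n)"
      using n by (simp add: divide_simps) (simp add: power2_eq_square algebra_simps)
    ultimately show ?case using step by simp
  qed
  show ?thesis
  proof (cases "n \<ge> 4")
    case True then show ?thesis using *[OF True] by (smt (verit) zero_le_divide_1_iff of_nat_0_le_iff)
  next
    case False
    then have "(\<Sum>g=2..n. 1 / (real g)\<^sup>2) \<le> (\<Sum>g=2..4::nat. 1 / (real g)\<^sup>2)"
      by (intro sum_mono2) auto
    also have "\<dots> \<le> 3 / 4 - 1 / real (4::nat)" using *[of 4] by simp
    finally show ?thesis by simp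
  qed
qed

lemma sum_inverse_squares_from_1:
  "(\<Sum>g=1..n::nat. 1 / (real g)\<^sup>2) \<le> 7 / 4"
proof (cases "n = 0")
  case False
  then have "{1..n} = insert 1 {2..n}" by auto
  then show ?thesis using sum_inverse_squares_from_2[of n] by simp
qed simp

text \<open>Replacing \<open>ln (n div g)\<close> by \<open>ln n\<close> costs at most ln (2 g) /
  g^2 for each g, which is summable, and cutting the series \<open>Z\<close> at n costs at most (ln
  n) / n.\<close>

lemma weighted_log_sum:
  fixes X :: "nat \<Rightarrow> real"
  assumes X: "\<And>g. 0 \<le> X g" "\<And>g. X g \<le> 1"
  defines "Z \<equiv> \<Sum>g. X (Suc g) / (real (Suc g))\<^sup>2"
  shows "\<exists>K. \<forall>n\<ge>1. \<bar>(\<Sum>g=1..n. X g / (real g)\<^sup>2 * ln (real (n div g))) - Z * ln (real n)\<bar> \<le> K"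
proof -
  have sq: "summable (\<lambda>g. 1 / (real (Suc g))\<^sup>2)"
    using inverse_squares_sums by (simp add: sums_iff)
  have sZ: "summable (\<lambda>g. X (Suc g) / (real (Suc g))\<^sup>2)"
    by (rule summable_comparison_test[OF _ sq]) (use X in \<open>auto simp: divide_right_mono\<close>)
  have ps: "summable (\<lambda>g. 2 * (real (Suc g) powr (- 3 / 2)))"
    by (subst summable_Suc_iff, intro summable_mult) (simp add: summable_real_powr_iff)
  define f where "f = (\<lambda>g. X (Suc g) / (real (Suc g))\<^sup>2)"
  \<comment> \<open>The exponent -3/2 is that of ln (2 x) \<le> 2 x^(1/2) divided by x^2; the 1 pays
    for the tail of \<open>Z\<close>.\<close>
  define K where "K = (\<Sum>g. 2 * (real (Suc g) powr (- 3 / 2))) + 1"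
  have f0: "f g \<ge> 0" for g using X by (simp add: f_def)
  show ?thesis
  proof (intro exI[of _ K] allI impI)
    fix n :: nat assume n: "n \<ge> 1"
    have tele: "(\<lambda>k. 1 / real (k + n) - 1 / real (Suc k + n)) sums (1 / real n - 0)"
    proof -
      have "(\<lambda>k. 1 / real (k + n)) \<longlonglongrightarrow> 0"
        using LIMSEQ_ignore_initial_segment[OF lim_1_over_n, of n] by simp
      from telescope_sums'[OF this] show ?thesis by simp
    qed
    have tailf: "summable (\<lambda>k. f (k + n))" using sZ unfolding f_def by (subst summable_iff_shift)
    have "Z - (\<Sum>g<n. f g) = (\<Sum>k. f (k + n))"
      unfolding Z_def using suminf_minus_initial_segment[OF sZ, of n] by (simp add: f_def)
    also have "\<dots> \<le> (\<Sum>k. 1 / real (k + n) - 1 / real (Suc k + n))"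
    proof (intro suminf_le tailf)
      fix k
      have "f (k + n) \<le> 1 / (real (Suc (k + n)))\<^sup>2" unfolding f_def using X by (intro divide_right_mono) auto
      also have "\<dots> \<le> 1 / real (k + n) - 1 / real (Suc k + n)"
        using n by (simp add: divide_simps) (simp add: power2_eq_square algebra_simps)
      finally show "f (k + n) \<le> 1 / real (k + n) - 1 / real (Suc k + n)" .
    qed (use tele in \<open>simp add: sums_iff\<close>)
    also have "\<dots> = 1 / real n" using tele by (simp add: sums_iff)
    finally have tail: "Z - (\<Sum>g<n. f g) \<le> 1 / real n" .
    have tail0: "Z - (\<Sum>g<n. f g) \<ge> 0"
      unfolding Z_def using sum_le_suminf[OF sZ, of "{..<n}"] f0 by (simp add: f_def)
    have shift: "(\<Sum>g=1..n. X g / (real g)\<^sup>2 * u g) = (\<Sum>g<n. f g * u (Suc g))" for u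
      by (rule sum.reindex_bij_witness[where i = Suc and j = "\<lambda>g. g - 1"]) (auto simp: f_def)
    have lnn: "0 \<le> ln n" "ln n \<le> real n" using n ln_le_minus_one[of "real n"] by auto
    define d where "d = (\<Sum>g<n. f g * (ln n - ln (n div Suc g)))"
    have "(\<Sum>g=1..n. X g / (real g)\<^sup>2 * ln (real (n div g))) - Z * ln (real n) =
        - d - (Z - (\<Sum>g<n. f g)) * ln n"
      unfolding shift d_def by (simp add: sum_subtractf right_diff_distrib left_diff_distrib flip: sum_distrib_right)
    moreover have "0 \<le> d" unfolding d_def
      by (intro sum_nonneg mult_nonneg_nonneg f0 ln_div_bounds(1)) auto
    moreover have "d \<le> K - 1"
    proof -
      have "d \<le> (\<Sum>g<n. 2 * (real (Suc g) powr (- 3 / 2)))"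
        unfolding d_def
      proof (intro sum_mono)
        fix g assume g: "g \<in> {..<n}"
        define x where "x = real (Suc g)"
        have x: "x \<ge> 1" by (simp add: x_def)
        have "ln n - ln (n div Suc g) \<le> ln (2 * x)"
          using ln_div_bounds(2)[of "Suc g" n] g by (simp add: x_def)
        also have "\<dots> \<le> 2 * x powr (1/2)"
        proof -
          have "ln (2 * x) = ln 2 + 2 * ln (x powr (1/2))" using x by (simp add: ln_mult ln_powr)
          also have "\<dots> \<le> 1 + 2 * (x powr (1/2) - 1)"
            using x ln_le_minus_one[of "x powr (1/2)"] ln_2_less_1 by (intro add_mono) auto
          finally show ?thesis by simp
        qed
        finally have 1: "ln n - ln (n div Suc g) \<le> 2 * x powr (1/2)" .
        have "f g \<le> 1 / x\<^sup>2" unfolding f_def x_def using X by (intro divide_right_mono) auto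
        then have "f g * (ln n - ln (n div Suc g)) \<le> 1 / x\<^sup>2 * (2 * x powr (1/2))"
          using 1 g by (intro mult_mono ln_div_bounds(1)) auto
        also have "\<dots> = 2 * (x powr (1/2) / x powr 2)" using x by (simp add: powr_numeral)
        also have "x powr (1/2) / x powr 2 = x powr (-3/2)" by (simp flip: powr_diff)
        finally show "f g * (ln n - ln (n div Suc g)) \<le> 2 * (real (Suc g) powr (- 3 / 2))"
          by (simp add: x_def)
      qed
      also have "\<dots> \<le> K - 1" unfolding K_def using sum_le_suminf[OF ps, of "{..<n}"] by simp
      finally show ?thesis .
    qed
    moreover have "0 \<le> (Z - (\<Sum>g<n. f g)) * ln n" using tail0 lnn by simp
    moreover have "(Z - (\<Sum>g<n. f g)) * ln n \<le> 1 / real n * real n"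
      using tail tail0 lnn by (intro mult_mono) auto
    ultimately show "\<bar>(\<Sum>g=1..n. X g / (real g)\<^sup>2 * ln (real (n div g))) - Z * ln (real n)\<bar> \<le> K"
      using n by auto
  qed
qed

text \<open>Inversion without the Moebius function: the term g = 1 is \<open>W n\<close> itself, and
  the others have total weight at most 3/4, so a bounded error stays bounded by strong induction.
  \<open>B'\<close> is chosen before \<open>W\<close>, which makes the later bounds uniform in the
  parity class.\<close>

lemma gcd_inversion:
  fixes X :: "nat \<Rightarrow> real"
  assumes X: "\<And>g. 0 \<le> X g" "\<And>g. X g \<le> 1" "X 1 = 1"
  defines "Z \<equiv> \<Sum>g. X (Suc g) / (real (Suc g))\<^sup>2"
  shows "\<exists>B'. \<forall>W::nat \<Rightarrow> real. (\<forall>n\<ge>1. \<bar>(\<Sum>g=1..n. X g / (real g)\<^sup>2 * W (n div g)) - a * ln (real n)\<bar> \<le> B) \<longrightarrow>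
      (\<forall>n\<ge>1. \<bar>W n - a / Z * ln (real n)\<bar> \<le> B')"
    and "Z > 0"
proof -
  have sq: "summable (\<lambda>g. 1 / (real (Suc g))\<^sup>2)"
    using inverse_squares_sums by (simp add: sums_iff)
  have sZ: "summable (\<lambda>g. X (Suc g) / (real (Suc g))\<^sup>2)"
    by (rule summable_comparison_test[OF _ sq]) (use X in \<open>auto simp: divide_right_mono\<close>)
  show Z: "Z > 0" unfolding Z_def
    by (rule suminf_pos2[OF sZ, of 0]) (use X in auto)
  obtain K where K: "\<And>n::nat. n \<ge> 1 \<Longrightarrow>
      \<bar>(\<Sum>g=1..n. X g / (real g)\<^sup>2 * ln (real (n div g))) - Z * ln (real n)\<bar> \<le> K"
    using weighted_log_sum[of X] X unfolding Z_def by blast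
  define B1 where "B1 = B + \<bar>a / Z\<bar> * K"
  show "\<exists>B'. \<forall>W::nat \<Rightarrow> real. (\<forall>n\<ge>1. \<bar>(\<Sum>g=1..n. X g / (real g)\<^sup>2 * W (n div g)) - a * ln (real n)\<bar> \<le> B) \<longrightarrow>
      (\<forall>n\<ge>1. \<bar>W n - a / Z * ln (real n)\<bar> \<le> B')"
  \<comment> \<open>\<open>4 * B1\<close> solves x = B1 + 3/4 x.\<close>
  proof (intro exI[of _ "4 * B1"] allI impI)
    fix W :: "nat \<Rightarrow> real" and n :: nat
    assume W: "\<forall>n\<ge>1. \<bar>(\<Sum>g=1..n. X g / (real g)\<^sup>2 * W (n div g)) - a * ln (real n)\<bar> \<le> B"
    define R where "R = (\<lambda>n. W n - a / Z * ln (real n))"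
    have R: "\<bar>\<Sum>g=1..n. X g / (real g)\<^sup>2 * R (n div g)\<bar> \<le> B1" if "n \<ge> 1" for n
    proof -
      define U V where "U = (\<Sum>g=1..n. X g / (real g)\<^sup>2 * W (n div g)) - a * ln (real n)"
        and "V = (\<Sum>g=1..n. X g / (real g)\<^sup>2 * ln (real (n div g))) - Z * ln (real n)"
      have "(\<Sum>g=1..n. X g / (real g)\<^sup>2 * R (n div g)) = U - a / Z * V"
        unfolding R_def U_def V_def using Z by (simp add: sum_subtractf sum_distrib_left algebra_simps)
      moreover have "\<bar>a / Z * V\<bar> \<le> \<bar>a / Z\<bar> * K"
        unfolding abs_mult V_def using K[OF that] by (intro mult_left_mono) auto
      moreover have "\<bar>U\<bar> \<le> B" unfolding U_def using W that by blast
      ultimately show ?thesis unfolding B1_def by linarith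
    qed
    have B1: "B1 \<ge> 0" using R[of 1] by linarith
    assume "1 \<le> n"
    then show "\<bar>W n - a / Z * ln (real n)\<bar> \<le> 4 * B1"
    proof (induction n rule: less_induct)
      case (less n)
      have "{1..n} = insert 1 {2..n}" using less.prems by auto
      then have "R n = (\<Sum>g=1..n. X g / (real g)\<^sup>2 * R (n div g)) - (\<Sum>g=2..n. X g / (real g)\<^sup>2 * R (n div g))"
        using X(3) by simp
      moreover have "\<bar>\<Sum>g=2..n. X g / (real g)\<^sup>2 * R (n div g)\<bar> \<le> (\<Sum>g=2..n. 1 / (real g)\<^sup>2 * (4 * B1))"
      proof (intro order.trans[OF sum_abs] sum_mono)
        fix g assume g: "g \<in> {2..n}"
        have "n div g < n" "n div g \<ge> 1" using g by (auto simp: less_eq_div_iff_mult_less_eq)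
        then have "\<bar>R (n div g)\<bar> \<le> 4 * B1" using less.IH unfolding R_def by blast
        then show "\<bar>X g / (real g)\<^sup>2 * R (n div g)\<bar> \<le> 1 / (real g)\<^sup>2 * (4 * B1)"
          unfolding abs_mult using X by (intro mult_mono) (auto simp: divide_right_mono)
      qed
      moreover have "\<dots> = (\<Sum>g=2..n. 1 / (real g)\<^sup>2) * (4 * B1)" by (simp add: sum_distrib_right)
      moreover have "\<dots> \<le> 3 / 4 * (4 * B1)"
        using sum_inverse_squares_from_2[of n] B1 by (intro mult_right_mono) auto
      ultimately have "\<bar>R n\<bar> \<le> 4 * B1" using R[OF less.prems] by linarith
      then show ?case by (simp add: R_def)
    qed
  qed
qed

text \<open>The flag \<open>b\<close> switches the parity condition off.\<close>

definition class_fracs :: "bool \<Rightarrow> int \<times> int \<Rightarrow> real \<Rightarrow> real \<Rightarrow> nat \<Rightarrow> int set" where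
  "class_fracs b e u v q = {p. u \<le> real_of_int p / real q \<and> real_of_int p / real q < v \<and>
     (b \<or> even (p - fst e) \<and> even (int q - snd e))}"

lemma card_int_interval:
  fixes \<alpha> \<beta> :: real
  assumes "\<alpha> \<le> \<beta>"
  shows "finite {j::int. \<alpha> \<le> j \<and> j < \<beta>}"
    and "\<bar>real (card {j::int. \<alpha> \<le> j \<and> j < \<beta>}) - (\<beta> - \<alpha>)\<bar> \<le> 1"
proof -
  have eq: "{j::int. \<alpha> \<le> j \<and> j < \<beta>} = {\<lceil>\<alpha>\<rceil>..<\<lceil>\<beta>\<rceil>}"
    by (auto simp: ceiling_le_iff less_ceiling_iff)
  show "finite {j::int. \<alpha> \<le> j \<and> j < \<beta>}" unfolding eq by simp
  have "\<lceil>\<alpha>\<rceil> \<le> \<lceil>\<beta>\<rceil>" using assms by (rule ceiling_mono)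
  then have "real (card {j::int. \<alpha> \<le> j \<and> j < \<beta>}) = real_of_int \<lceil>\<beta>\<rceil> - real_of_int \<lceil>\<alpha>\<rceil>"
    unfolding eq by simp
  then show "\<bar>real (card {j::int. \<alpha> \<le> j \<and> j < \<beta>}) - (\<beta> - \<alpha>)\<bar> \<le> 1" by linarith
qed

lemma card_class_fracs:
  assumes "u \<le> v" "q \<ge> 1"
  shows "finite (class_fracs b e u v q)"
    and "\<bar>real (card (class_fracs True e u v q)) - q * (v - u)\<bar> \<le> 1"
    and "\<bar>real (card (class_fracs False e u v q)) - (if even (int q - snd e) then q * (v - u) / 2 else 0)\<bar> \<le> 1"
proof -
  have q: "real q > 0" using assms by simp
  have T: "class_fracs True e u v q = {j::int. u * q \<le> j \<and> j < v * q}"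
    using q by (auto simp: class_fracs_def field_simps)
  have uv: "u * q \<le> v * q" using assms by (simp add: mult_right_mono)
  show "\<bar>real (card (class_fracs True e u v q)) - q * (v - u)\<bar> \<le> 1"
    unfolding T using card_int_interval(2)[OF uv] by (simp add: algebra_simps)
  have fT: "finite (class_fracs True e u v q)" unfolding T by (rule card_int_interval(1)[OF uv])
  show "finite (class_fracs b e u v q)"
    by (rule finite_subset[OF _ fT]) (auto simp: class_fracs_def)
  show "\<bar>real (card (class_fracs False e u v q)) - (if even (int q - snd e) then q * (v - u) / 2 else 0)\<bar> \<le> 1"
  proof (cases "even (int q - snd e)")
    case False
    then have "class_fracs False e u v q = {}" by (auto simp: class_fracs_def)
    then show ?thesis using False by simp
  next
    case True
    let ?a = "(u * q - fst e) / 2" and ?b = "(v * q - fst e) / 2"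
    have "class_fracs False e u v q = (\<lambda>j. 2 * j + fst e) ` {j::int. ?a \<le> j \<and> j < ?b}"
    proof (intro set_eqI iffI)
      fix p assume p: "p \<in> class_fracs False e u v q"
      then have "even (p - fst e)" by (simp add: class_fracs_def)
      then obtain j where "p - fst e = 2 * j" by (elim evenE)
      then have pj: "p = 2 * j + fst e" by simp
      have "?a \<le> j \<and> j < ?b" using p q unfolding pj class_fracs_def by (auto simp: field_simps)
      then show "p \<in> (\<lambda>j. 2 * j + fst e) ` {j::int. ?a \<le> j \<and> j < ?b}" using pj by auto
    next
      fix p assume "p \<in> (\<lambda>j. 2 * j + fst e) ` {j::int. ?a \<le> j \<and> j < ?b}"
      then show "p \<in> class_fracs False e u v q" using q True
        by (auto simp: class_fracs_def field_simps)
    qed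
    moreover have "inj (\<lambda>j. 2 * j + fst e)" by (auto intro: injI)
    ultimately have "card (class_fracs False e u v q) = card {j::int. ?a \<le> j \<and> j < ?b}"
      by (simp add: card_image inj_on_subset[OF _ subset_UNIV])
    moreover have "?b - ?a = q * (v - u) / 2" by (simp add: field_simps)
    moreover have "?a \<le> ?b" using uv by simp
    ultimately show ?thesis using card_int_interval(2)[of ?a ?b] by (simp only: if_P[OF True])
  qed
qed

text \<open>Cancel g = gcd p q. An odd g leaves both parities alone, whereas an even g makes p and q
  even, which \<open>e\<close> excludes. So with the parity condition on, only odd g
  contribute.\<close>

lemma card_class_fracs_gcd:
  assumes e: "\<not> (even (fst e) \<and> even (snd e))" and "u \<le> v" "q \<ge> 1"
  shows "real (card (class_fracs b e u v q)) =
    (\<Sum>g\<in>{g. g dvd q}. (if b \<or> odd g then 1 else 0) *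
      real (card {p \<in> class_fracs b e u v (q div g). coprime p (int (q div g))}))"
proof -
  define G where "G = {g. g dvd q \<and> (b \<or> odd g)}"
  define S where "S = (\<lambda>g. {p \<in> class_fracs b e u v (q div g). coprime p (int (q div g))})"
  have fin: "finite {g. g dvd q}" using assms by simp
  then have finG: "finite G" unfolding G_def by (rule rev_finite_subset) auto
  have U: "class_fracs b e u v q = (\<Union>g\<in>G. (\<lambda>p. int g * p) ` S g)"
  proof (intro set_eqI iffI)
    fix p assume p: "p \<in> class_fracs b e u v q"
    define g where "g = nat (gcd p (int q))"
    have g: "int g = gcd p (int q)" by (simp add: g_def)
    have "g > 0" using assms by (simp add: g_def)
    have gq: "g dvd q" using g by (metis gcd_dvd2 int_dvd_int_iff)
    then obtain m where m: "q = g * m" by auto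
    have mpos: "m > 0" using m assms by (auto intro: Nat.gr0I)
    obtain p' where p': "p = int g * p'" using g by (metis dvdE gcd_dvd1)
    have "int g * gcd p' (int m) = gcd (int g * p') (int g * int m)" by (simp add: gcd_mult_left)
    also have "\<dots> = int g" using g p' m by simp
    finally have cop: "coprime p' (int m)" using \<open>g > 0\<close> by (simp add: coprime_iff_gcd_eq_1)
    have par: "b \<or> odd g \<and> even (p' - fst e) \<and> even (int m - snd e)"
    proof (cases b)
      case False
      then have "even (int g * p' - fst e)" "even (int g * int m - snd e)"
        using p unfolding p' m class_fracs_def by auto
      then show ?thesis using e by auto
    qed simp
    have "real_of_int p / real q = real_of_int p' / real m"
      using \<open>g > 0\<close> by (simp add: p' m)
    then have "p' \<in> S g" using p cop par m \<open>g > 0\<close> by (auto simp: S_def class_fracs_def)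
    moreover have "g \<in> G" using gq par by (auto simp: G_def)
    ultimately show "p \<in> (\<Union>g\<in>G. (\<lambda>p. int g * p) ` S g)" using p' by blast
  next
    fix p assume "p \<in> (\<Union>g\<in>G. (\<lambda>p. int g * p) ` S g)"
    then obtain g p' where g: "g \<in> G" "p' \<in> S g" "p = int g * p'" by blast
    then obtain m where m: "q = g * m" by (auto simp: G_def)
    have pos: "g > 0" "m > 0" using m assms by (auto intro: Nat.gr0I)
    have "real_of_int p / real q = real_of_int p' / real m"
      using pos by (simp add: g m)
    then show "p \<in> class_fracs b e u v q"
      using g m pos by (auto simp: S_def G_def class_fracs_def)
  qed
  have pos: "g > 0" if "g \<in> G" for g using that assms by (auto simp: G_def intro: Nat.gr0I)
  have finS: "finite (S g)" if "g \<in> G" for g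
  proof -
    have "q div g \<ge> 1" using that assms pos[OF that] by (auto simp: G_def less_eq_div_iff_mult_less_eq dvd_imp_le)
    then show ?thesis unfolding S_def using card_class_fracs(1)[OF assms(2)] by auto
  qed
  have gcdS: "gcd p (int q) = int g" if "g \<in> G" "p \<in> (\<lambda>p. int g * p) ` S g" for g p
  proof -
    from that(2) obtain p' where p': "p = int g * p'" "p' \<in> S g" by blast
    from that(1) obtain m where m: "q = g * m" by (auto simp: G_def)
    have "gcd p (int q) = int g * gcd p' (int m)" by (simp add: p' m gcd_mult_left)
    then show ?thesis using p'(2) m pos[OF that(1)] by (simp add: S_def coprime_iff_gcd_eq_1)
  qed
  have "card (class_fracs b e u v q) = (\<Sum>g\<in>G. card ((\<lambda>p. int g * p) ` S g))"
    unfolding U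
  proof (rule card_UN_disjoint[OF finG])
    show "\<forall>i\<in>G. finite ((*) (int i) ` S i)" using finS by auto
    show "\<forall>i\<in>G. \<forall>j\<in>G. i \<noteq> j \<longrightarrow> (*) (int i) ` S i \<inter> (*) (int j) ` S j = {}"
      using gcdS by (metis disjoint_iff of_nat_eq_iff)
  qed
  also have "\<dots> = (\<Sum>g\<in>G. card (S g))"
  proof (intro sum.cong refl card_image inj_onI)
    fix g x y assume "g \<in> G" "int g * x = int g * y"
    then show "x = y" using pos[of g] by simp
  qed
  finally have "real (card (class_fracs b e u v q)) = (\<Sum>g\<in>G. real (card (S g)))" by simp
  also have "\<dots> = (\<Sum>g\<in>{g. g dvd q}. (if b \<or> odd g then 1 else 0) * real (card (S g)))"
    by (rule sum.mono_neutral_cong_left[OF fin]) (auto simp: G_def)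
  finally show ?thesis unfolding S_def .
qed

lemma harm_ln_bound:
  assumes "n \<ge> 1"
  shows "\<bar>harm n - ln (real n)\<bar> \<le> 1"
proof -
  have "ln (real n) \<le> ln (real n + 1)" using assms by simp
  also have "\<dots> \<le> harm n" by (rule ln_le_harm)
  finally have 1: "ln (real n) \<le> harm n" .
  have "harm n \<le> 1 + ln (real n)" using assms
  proof (induction n rule: dec_induct)
    case (step n)
    have "inverse (real (Suc n)) \<le> ln (real (Suc n)) - ln (real n)"
      using ln_le_minus_one[of "real n / real (Suc n)"] step
      by (simp add: ln_div field_simps)
    then show ?case using step by (simp add: harm_Suc)
  qed (simp add: harm_expand)
  then show ?thesis using 1 by linarith
qed

lemma harm_even_part:
  "(\<Sum>q\<in>{q\<in>{1..n}. even q}. 1 / real q) = harm (n div 2) / 2"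
proof -
  have "(\<Sum>q\<in>{q\<in>{1..n}. even q}. 1 / real q) = (\<Sum>j=1..n div 2. 1 / real (2 * j))"
    by (rule sum.reindex_bij_witness[where i = "\<lambda>j. 2 * j" and j = "\<lambda>q. q div 2"]) auto
  also have "\<dots> = harm (n div 2) / 2"
    by (simp add: harm_def sum_divide_distrib field_simps)
  finally show ?thesis .
qed

text \<open>Even denominators give half a harmonic sum up to n/2 and odd ones the remainder of the
  full sum; both are (ln n) / 2 up to a bounded error.\<close>

lemma harm_parity_bound:
  assumes "n \<ge> 1"
  shows "\<bar>(\<Sum>q=1..n. if even (int q - f) then 1 / real q else 0) - ln (real n) / 2\<bar> \<le> 3"
proof -
  have E: "\<bar>harm (n div 2) / 2 - ln (real n) / 2\<bar> \<le> 3/2"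
  proof (cases "n = 1")
    case False
    then have n: "n div 2 \<ge> 1" "2 \<le> n" using assms by auto
    have "\<bar>harm (n div 2) - ln (real (n div 2))\<bar> \<le> 1" by (rule harm_ln_bound[OF n(1)])
    moreover have "ln (2 * real 2) \<le> 2" using ln_2_less_1 ln_mult[of 2 "2::real"] by simp
    ultimately show ?thesis using ln_div_bounds[of 2 n] n by linarith
  qed (simp add: harm_expand)
  have part: "(\<Sum>q=1..n. if even q then 1 / real q else 0) = harm (n div 2) / 2"
    unfolding harm_even_part[symmetric] by (subst sum.inter_filter) auto
  have "(\<Sum>q=1..n. if odd q then 1 / real q else 0) =
      (\<Sum>q=1..n. 1 / real q) - (\<Sum>q=1..n. if even q then 1 / real q else 0)"
    unfolding sum_subtractf[symmetric] by (rule sum.cong) auto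
  also have "(\<Sum>q=1..n. 1 / real q) = harm n" by (simp add: harm_def inverse_eq_divide)
  finally have odd: "(\<Sum>q=1..n. if odd q then 1 / real q else 0) = harm n - harm (n div 2) / 2"
    using part by simp
  show ?thesis
  proof (cases "even f")
    case True
    then have "(\<Sum>q=1..n. if even (int q - f) then 1 / real q else 0) = harm (n div 2) / 2"
      unfolding part[symmetric] by (intro sum.cong) auto
    then show ?thesis using E by linarith
  next
    case False
    then have "(\<Sum>q=1..n. if even (int q - f) then 1 / real q else 0) = harm n - harm (n div 2) / 2"
      unfolding odd[symmetric] by (intro sum.cong) auto
    then show ?thesis using E harm_ln_bound[OF assms] by linarith
  qed
qed

text \<open>The density 1/4 is one half for the parity of the denominator times one half for that of
  the numerator. The counting error is at most 1 for each q, hence summable after division by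
  q^2.\<close>

lemma class_fracs_total:
  assumes "u \<le> v" "n \<ge> 1"
  shows "\<bar>(\<Sum>q=1..n. real (card (class_fracs b e u v q)) / (real q)\<^sup>2) -
      (v - u) * (if b then 1 else 1 / 4) * ln n\<bar> \<le> 2 + 2 * (v - u)"
proof -
  define t where "t = (\<lambda>q. (v - u) * (if b then 1 / real q else (if even (int q - snd e) then 1 / real q else 0) / 2))"
  have "\<bar>(\<Sum>q=1..n. real (card (class_fracs b e u v q)) / (real q)\<^sup>2) - (\<Sum>q=1..n. t q)\<bar> \<le>
      (\<Sum>q=1..n. 1 / (real q)\<^sup>2)"
    unfolding sum_subtractf[symmetric]
  proof (intro order.trans[OF sum_abs] sum_mono)
    fix q assume q: "q \<in> {1..n}"
    define c where "c = real (card (class_fracs b e u v q))"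
    have "\<bar>c - (real q)\<^sup>2 * t q\<bar> \<le> 1"
      using card_class_fracs(2,3)[OF assms(1), of q e] q unfolding c_def t_def
      by (cases b) (auto simp: power2_eq_square split: if_splits)
    then have "\<bar>c - (real q)\<^sup>2 * t q\<bar> / (real q)\<^sup>2 \<le> 1 / (real q)\<^sup>2" by (intro divide_right_mono) auto
    moreover have "c / (real q)\<^sup>2 - t q = (c - (real q)\<^sup>2 * t q) / (real q)\<^sup>2"
      using q by (simp add: diff_divide_distrib)
    ultimately show "\<bar>c / (real q)\<^sup>2 - t q\<bar> \<le> 1 / (real q)\<^sup>2"
      by (simp add: abs_divide)
  qed
  also have "\<dots> \<le> 7 / 4" by (rule sum_inverse_squares_from_1)
  finally have 1: "\<bar>(\<Sum>q=1..n. real (card (class_fracs b e u v q)) / (real q)\<^sup>2) - (\<Sum>q=1..n. t q)\<bar> \<le> 7 / 4" .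
  define H where "H = (if b then harm n else (\<Sum>q=1..n. if even (int q - snd e) then 1 / real q else 0) / 2)"
  define G where "G = (if b then 1 else 1 / 4) * ln (real n)"
  have t: "(\<Sum>q=1..n. t q) = (v - u) * H"
    unfolding t_def H_def by (simp add: sum_distrib_left sum_divide_distrib harm_def inverse_eq_divide)
  have "\<bar>H - G\<bar> \<le> 2"
    using harm_ln_bound[OF assms(2)] harm_parity_bound[OF assms(2), of "snd e"]
    unfolding H_def G_def by (cases b; simp only: if_True if_False; linarith)
  then have "\<bar>(v - u) * (H - G)\<bar> \<le> (v - u) * 2"
    unfolding abs_mult using assms by (intro mult_mono) auto
  then have "\<bar>(v - u) * H - (v - u) * G\<bar> \<le> (v - u) * 2" by (simp only: right_diff_distrib)
  then show ?thesis using 1 unfolding t G_def mult.assoc by linarith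
qed

text \<open>The class \<open>e\<close> prescribes the parities of the fractions of weight 2; the theta group itself
  corresponds to \<open>e = (1, 1)\<close>, and the other two nonzero classes arise by moving cusps to infinity.\<close>

definition wt :: "int \<times> int \<Rightarrow> int \<Rightarrow> int \<Rightarrow> real" where
  "wt e p q = (if even (p - fst e) \<and> even (q - snd e) then 2 else 1)"

definition fracs :: "real set \<Rightarrow> real \<Rightarrow> (int \<times> int) set" where
  "fracs J Q = {(p, q). 1 \<le> q \<and> real_of_int q \<le> Q \<and> coprime p q \<and> real_of_int p / real_of_int q \<in> J}"

text \<open>Multiplied by \<open>2 * \<rho>\<close> this is the total length of the visit intervals
  around the reduced fractions in [u, v) with denominator \<open>q\<close>.\<close>

definition fweight :: "int \<times> int \<Rightarrow> real \<Rightarrow> real \<Rightarrow> nat \<Rightarrow> real" where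
  "fweight e u v q = (\<Sum>p\<in>{p \<in> class_fracs True e u v q. coprime p (int q)}. wt e p (int q)) / (real q)\<^sup>2"

text \<open>A weight is 1 plus the indicator of the class \<open>e\<close>, so the sum splits into a
  count without and a count with the parity condition, and \<open>gcd_inversion\<close> passes from
  all fractions to reduced ones in each.\<close>

lemma fweight_moment:
  "\<exists>c>0. \<forall>u v. u \<le> v \<longrightarrow> (\<exists>B. \<forall>e. \<not> (even (fst e) \<and> even (snd e)) \<longrightarrow>
     (\<forall>n\<ge>1. \<bar>(\<Sum>q=1..n. fweight e u v q) - c * (v - u) * ln (real n)\<bar> \<le> B))"
proof -
  define X where "X = (\<lambda>b (g::nat). (if b \<or> odd g then 1 else 0) :: real)"
  define Z where "Z = (\<lambda>b. \<Sum>g. X b (Suc g) / (real (Suc g))\<^sup>2)"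
  \<comment> \<open>\<open>Z True\<close> is pi^2/6, and \<open>Z False\<close>, the sum over odd g,
    is pi^2/8; so \<open>c\<close> is 8/pi^2.\<close>
  define c where "c = 1 / Z True + (1 / 4) / Z False"
  have X: "0 \<le> X b g" "X b g \<le> 1" "X b 1 = 1" for b g by (auto simp: X_def)
  have Zpos: "Z b > 0" for b unfolding Z_def by (rule gcd_inversion(2)) (rule X)+
  have "c > 0" unfolding c_def using Zpos[of True] Zpos[of False] by (intro add_pos_pos) auto
  moreover have "\<exists>B. \<forall>e. \<not> (even (fst e) \<and> even (snd e)) \<longrightarrow>
     (\<forall>n\<ge>1. \<bar>(\<Sum>q=1..n. fweight e u v q) - c * (v - u) * ln (real n)\<bar> \<le> B)" if uv: "u \<le> v" for u v
  proof -
    define a where "a = (\<lambda>b. (v - u) * (if b then 1 else 1 / 4))"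
    define N where "N = (\<lambda>b e q. real (card {p \<in> class_fracs b e u v q. coprime p (int q)}))"
    define W where "W = (\<lambda>b e n. \<Sum>q=1..n. N b e q / (real q)\<^sup>2)"
    have "\<exists>B. \<forall>e. \<not> (even (fst e) \<and> even (snd e)) \<longrightarrow> (\<forall>n\<ge>1. \<bar>W b e n - a b / Z b * ln (real n)\<bar> \<le> B)" for b
    proof -
      obtain B' where B': "\<And>W::nat \<Rightarrow> real. (\<forall>n\<ge>1. \<bar>(\<Sum>g=1..n. X b g / (real g)\<^sup>2 * W (n div g)) - a b * ln (real n)\<bar> \<le> 2 + 2 * (v - u)) \<Longrightarrow>
          (\<forall>n\<ge>1. \<bar>W n - a b / Z b * ln (real n)\<bar> \<le> B')"
        using gcd_inversion(1)[of "X b" "a b" "2 + 2 * (v - u)"] X unfolding Z_def by blast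
      have "\<forall>n\<ge>1. \<bar>W b e n - a b / Z b * ln (real n)\<bar> \<le> B'" if e: "\<not> (even (fst e) \<and> even (snd e))" for e
      proof (rule B', intro allI impI)
        fix n :: nat assume n: "n \<ge> 1"
        have "(\<Sum>q=1..n. real (card (class_fracs b e u v q)) / (real q)\<^sup>2) =
            (\<Sum>q=1..n. \<Sum>g\<in>{g. g dvd q}. X b g / (real g)\<^sup>2 * (N b e (q div g) / (real (q div g))\<^sup>2))"
        proof (intro sum.cong refl)
          fix q assume q: "q \<in> {1..n}"
          have "real (card (class_fracs b e u v q)) = (\<Sum>g\<in>{g. g dvd q}. X b g * N b e (q div g))"
            using card_class_fracs_gcd[OF e uv, of q b] q unfolding X_def N_def by simp
          then have "real (card (class_fracs b e u v q)) / (real q)\<^sup>2 =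
              (\<Sum>g\<in>{g. g dvd q}. X b g * N b e (q div g) / (real q)\<^sup>2)"
            by (simp add: sum_divide_distrib)
          also have "\<dots> = (\<Sum>g\<in>{g. g dvd q}. X b g / (real g)\<^sup>2 * (N b e (q div g) / (real (q div g))\<^sup>2))"
          proof (intro sum.cong refl)
            fix g assume "g \<in> {g. g dvd q}"
            then obtain m where m: "q = g * m" by auto
            then show "X b g * N b e (q div g) / (real q)\<^sup>2 = X b g / (real g)\<^sup>2 * (N b e (q div g) / (real (q div g))\<^sup>2)"
              using q by (simp add: power_mult_distrib)
          qed
          finally show "real (card (class_fracs b e u v q)) / (real q)\<^sup>2 = \<dots>" .
        qed
        also have "\<dots> = (\<Sum>g=1..n. \<Sum>m=1..n div g. X b g / (real g)\<^sup>2 * (N b e m / (real m)\<^sup>2))"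
          by (rule sum_gcd_classes)
        also have "\<dots> = (\<Sum>g=1..n. X b g / (real g)\<^sup>2 * W b e (n div g))"
          unfolding W_def by (simp add: sum_distrib_left)
        finally show "\<bar>(\<Sum>g=1..n. X b g / (real g)\<^sup>2 * W b e (n div g)) - a b * ln (real n)\<bar> \<le> 2 + 2 * (v - u)"
          using class_fracs_total[OF uv n, of b e] unfolding a_def by simp
      qed
      then show ?thesis by blast
    qed
    then obtain B where B: "\<And>b e n. \<not> (even (fst e) \<and> even (snd e)) \<Longrightarrow> n \<ge> 1 \<Longrightarrow>
        \<bar>W b e n - a b / Z b * ln (real n)\<bar> \<le> B b" by metis
    show ?thesis
    proof (intro exI[of _ "B True + B False"] allI impI)
      fix e :: "int \<times> int" and n :: nat
      assume e: "\<not> (even (fst e) \<and> even (snd e))" and n: "n \<ge> 1"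
      have fw: "fweight e u v q = N True e q / (real q)\<^sup>2 + N False e q / (real q)\<^sup>2" if "q \<ge> 1" for q
      proof -
        let ?A = "{p \<in> class_fracs True e u v q. coprime p (int q)}"
        have fin: "finite ?A" using card_class_fracs(1)[OF uv that] by auto
        have "(\<Sum>p\<in>?A. wt e p (int q)) = (\<Sum>p\<in>?A. 1 + (if even (p - fst e) \<and> even (int q - snd e) then 1 else 0))"
          by (intro sum.cong) (auto simp: wt_def)
        also have "\<dots> = real (card ?A) + real (card {p\<in>?A. even (p - fst e) \<and> even (int q - snd e)})"
          using fin by (simp add: sum.distrib flip: sum.inter_filter)
        also have "{p\<in>?A. even (p - fst e) \<and> even (int q - snd e)} = {p \<in> class_fracs False e u v q. coprime p (int q)}"
          by (auto simp: class_fracs_def)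
        finally show ?thesis unfolding fweight_def N_def by (simp add: add_divide_distrib)
      qed
      have "(\<Sum>q=1..n. fweight e u v q) = W True e n + W False e n"
        unfolding W_def sum.distrib[symmetric] by (intro sum.cong refl fw) auto
      moreover have "c * (v - u) * ln (real n) = a True / Z True * ln (real n) + a False / Z False * ln (real n)"
        unfolding c_def a_def by (simp add: algebra_simps)
      ultimately show "\<bar>(\<Sum>q=1..n. fweight e u v q) - c * (v - u) * ln (real n)\<bar> \<le> B True + B False"
        using B[OF e n, of True] B[OF e n, of False] by linarith
    qed
  qed
  ultimately show ?thesis by blast
qed

section \<open>Partial summation against powers\<close>

lemma nat_floor_bounds:
  fixes Q :: real
  assumes "Q \<ge> 1"
  shows "nat \<lfloor>Q\<rfloor> \<ge> 1" "real (nat \<lfloor>Q\<rfloor>) \<le> Q" "Q \<le> 2 * real (nat \<lfloor>Q\<rfloor>)"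
proof -
  have f: "\<lfloor>Q\<rfloor> \<ge> 1" using assms by (simp add: le_floor_iff)
  then have r: "real (nat \<lfloor>Q\<rfloor>) = of_int \<lfloor>Q\<rfloor>" by simp
  show "nat \<lfloor>Q\<rfloor> \<ge> 1" using f by arith
  show "real (nat \<lfloor>Q\<rfloor>) \<le> Q" unfolding r by simp
  have "real_of_int \<lfloor>Q\<rfloor> \<ge> 1" using f by simp
  then show "Q \<le> 2 * real (nat \<lfloor>Q\<rfloor>)" unfolding r using real_of_int_floor_add_one_gt[of Q] by linarith
qed

lemma le_nat_floor_iff:
  assumes "n \<ge> 1"
  shows "n \<le> nat \<lfloor>Q\<rfloor> \<longleftrightarrow> real n \<le> Q"
proof -
  have "n \<le> nat \<lfloor>Q\<rfloor> \<longleftrightarrow> int n \<le> \<lfloor>Q\<rfloor>" using assms by arith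
  then show ?thesis by (simp add: le_floor_iff)
qed

lemma sum_abs_diff_monotone:
  fixes f :: "nat \<Rightarrow> real"
  assumes f: "mono_on {1..} f \<or> antimono_on {1..} f" and n: "n \<ge> 1"
  shows "(\<Sum>q=1..<n. \<bar>f (Suc q) - f q\<bar>) = \<bar>f n - f 1\<bar>"
  using f
proof
  assume m: "mono_on {1..} f"
  have "(\<Sum>q=1..<n. \<bar>f (Suc q) - f q\<bar>) = (\<Sum>q=1..<n. f (Suc q) - f q)"
    by (intro sum.cong refl abs_of_nonneg) (auto intro!: mono_onD[OF m])
  also have "\<dots> = f n - f 1" using n by (rule sum_Suc_diff')
  finally show ?thesis using mono_onD[OF m, of 1 n] n by simp
next
  assume m: "antimono_on {1..} f"
  have "(\<Sum>q=1..<n. \<bar>f (Suc q) - f q\<bar>) = (\<Sum>q=1..<n. - (f (Suc q) - f q))"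
    by (intro sum.cong refl abs_of_nonpos) (auto intro!: monotone_onD[OF m])
  also have "\<dots> = - (f n - f 1)" unfolding sum_negf using sum_Suc_diff'[OF n, of f] by simp
  finally show ?thesis using monotone_onD[OF m, of 1 n] n by simp
qed

text \<open>Summation by parts; a monotone \<open>f\<close> has total variation
  \<open>\<bar>f n - f 1\<bar>\<close>, so only its end values enter.\<close>

lemma abel_summation_bound:
  fixes v f :: "nat \<Rightarrow> real"
  assumes V: "\<And>n. n \<ge> 1 \<Longrightarrow> \<bar>\<Sum>q=1..n. v q\<bar> \<le> B"
    and f: "mono_on {1..} f \<or> antimono_on {1..} f" and n: "n \<ge> 1"
  shows "\<bar>\<Sum>q=1..n. v q * f q\<bar> \<le> B * (\<bar>f n\<bar> + \<bar>f n - f 1\<bar>)"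
proof -
  define V where "V = (\<lambda>n. \<Sum>q=1..n. v q)"
  have eq: "(\<Sum>q=1..n. v q * f q) = V n * f n - (\<Sum>q=1..<n. V q * (f (Suc q) - f q))"
    using n by (induction n rule: dec_induct) (simp_all add: V_def algebra_simps)
  have "(\<Sum>q=1..<n. \<bar>f (Suc q) - f q\<bar>) = \<bar>f n - f 1\<bar>"
    using f n by (rule sum_abs_diff_monotone)
  moreover have "\<bar>\<Sum>q=1..<n. V q * (f (Suc q) - f q)\<bar> \<le> (\<Sum>q=1..<n. B * \<bar>f (Suc q) - f q\<bar>)"
    unfolding V_def by (intro order.trans[OF sum_abs] sum_mono) (use V in \<open>auto simp: abs_mult intro!: mult_right_mono\<close>)
  ultimately have "\<bar>\<Sum>q=1..<n. V q * (f (Suc q) - f q)\<bar> \<le> B * \<bar>f n - f 1\<bar>"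
    by (simp flip: sum_distrib_left)
  moreover have "\<bar>V n * f n\<bar> \<le> B * \<bar>f n\<bar>"
    unfolding abs_mult V_def by (intro mult_right_mono V n) auto
  ultimately show ?thesis unfolding eq by (simp add: distrib_left)
qed

lemma powr_mono_cases:
  "mono_on {1..} (\<lambda>q::nat. real q powr \<sigma>) \<or> antimono_on {1..} (\<lambda>q::nat. real q powr \<sigma>)"
proof (cases "\<sigma> \<ge> 0")
  case True
  then show ?thesis by (intro disjI1 mono_onI powr_mono2) auto
next
  case False
  then show ?thesis by (intro disjI2 monotone_onI powr_mono2') auto
qed

text \<open>The quotient is the integral of x^(\<sigma> - 1) over [a, b]. Keeping the division by
  \<sigma> makes the bounds the same for both signs of \<sigma>.\<close>

lemma powr_diff_bound:
  fixes a b \<sigma> :: real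
  assumes "0 < a" "a \<le> b" "\<sigma> \<noteq> 0"
  shows "0 \<le> (b powr \<sigma> - a powr \<sigma>) / \<sigma>"
    and "(b powr \<sigma> - a powr \<sigma>) / \<sigma> \<le> (ln b - ln a) * max (a powr \<sigma>) (b powr \<sigma>)"
    and "(ln b - ln a) * min (a powr \<sigma>) (b powr \<sigma>) \<le> (b powr \<sigma> - a powr \<sigma>) / \<sigma>"
proof -
  define s t where "s = \<sigma> * ln a" and "t = \<sigma> * ln b"
  have p: "a powr \<sigma> = exp s" "b powr \<sigma> = exp t" using assms by (simp_all add: powr_def s_def t_def)
  have l: "ln a \<le> ln b" using assms by simp
  have 1: "exp t - exp s \<le> (t - s) * exp t"
  proof -
    have "1 + (s - t) \<le> exp (s - t)" by (rule exp_ge_add_one_self)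
    then have "(1 + (s - t)) * exp t \<le> exp (s - t) * exp t" by (intro mult_right_mono) auto
    then show ?thesis by (simp add: exp_diff algebra_simps)
  qed
  have 2: "(t - s) * exp s \<le> exp t - exp s"
  proof -
    have "1 + (t - s) \<le> exp (t - s)" by (rule exp_ge_add_one_self)
    then have "(1 + (t - s)) * exp s \<le> exp (t - s) * exp s" by (intro mult_right_mono) auto
    then show ?thesis by (simp add: exp_diff algebra_simps)
  qed
  have ts: "t - s = \<sigma> * (ln b - ln a)" by (simp add: s_def t_def algebra_simps)
  have "0 \<le> (exp t - exp s) / \<sigma> \<and> (exp t - exp s) / \<sigma> \<le> (ln b - ln a) * max (exp s) (exp t)
     \<and> (ln b - ln a) * min (exp s) (exp t) \<le> (exp t - exp s) / \<sigma>"
  proof (cases "\<sigma> > 0")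
    case True
    then have st: "s \<le> t" using ts l by (smt (verit) mult_nonneg_nonneg)
    have m: "max (exp s) (exp t) = exp t" "min (exp s) (exp t) = exp s" using st by auto
    show ?thesis unfolding m using 1 2 st True ts by (auto simp: field_simps)
  next
    case False
    then have neg: "\<sigma> < 0" using assms by simp
    then have st: "t \<le> s" using ts l by (smt (verit) mult_nonpos_nonneg)
    have m: "max (exp s) (exp t) = exp s" "min (exp s) (exp t) = exp t" using st by auto
    show ?thesis unfolding m using 1 2 st neg ts by (auto simp: field_simps)
  qed
  then show "0 \<le> (b powr \<sigma> - a powr \<sigma>) / \<sigma>"
    "(b powr \<sigma> - a powr \<sigma>) / \<sigma> \<le> (ln b - ln a) * max (a powr \<sigma>) (b powr \<sigma>)"
    "(ln b - ln a) * min (a powr \<sigma>) (b powr \<sigma>) \<le> (b powr \<sigma> - a powr \<sigma>) / \<sigma>"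
    unfolding p by auto
qed

lemma powr_le_max_one:
  fixes a Q \<sigma> :: real
  assumes "1 \<le> a" "a \<le> Q"
  shows "a powr \<sigma> \<le> max 1 (Q powr \<sigma>)"
proof (cases "\<sigma> \<ge> 0")
  case True
  then show ?thesis using assms by (intro order.trans[OF powr_mono2[of \<sigma> a Q]]) auto
next
  case False
  then have "a powr \<sigma> \<le> 1 powr \<sigma>" using assms by (intro powr_mono2') auto
  then show ?thesis by simp
qed

text \<open>The main term is c times the integral of x^(\<sigma> - 1) over [1, Q]. The error must
  not contain 1/\<sigma>, because the exponents used later tend to 0 with \<rho>; hence each
  comparison in the proof loses only boundary values and total variation of x^\<sigma>.\<close>

lemma log_density_powr_sum:
  fixes w :: "nat \<Rightarrow> real" and Q \<sigma> :: real
  assumes W: "\<And>n. n \<ge> 1 \<Longrightarrow> \<bar>(\<Sum>q=1..n. w q) - c * ln (real n)\<bar> \<le> B"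
    and Q: "Q \<ge> 1" and \<sigma>: "\<sigma> \<noteq> 0"
  shows "\<bar>(\<Sum>q=1..nat \<lfloor>Q\<rfloor>. w q * real q powr \<sigma>) - c * ((Q powr \<sigma> - 1) / \<sigma>)\<bar> \<le>
    (2 * B + 2 * \<bar>c\<bar>) * max 1 (Q powr \<sigma>)"
proof -
  define n where "n = nat \<lfloor>Q\<rfloor>"
  define M where "M = max 1 (Q powr \<sigma>)"
  define f where "f = (\<lambda>q::nat. real q powr \<sigma>)"
  have n: "n \<ge> 1" "real n \<le> Q" "Q \<le> 2 * real n" using nat_floor_bounds[OF Q] unfolding n_def by auto
  have B: "B \<ge> 0" using W[of 1] by linarith
  have M1: "M \<ge> 1" by (simp add: M_def)
  have fM: "f q \<le> M" "0 \<le> f q" if "1 \<le> q" "q \<le> n" for q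
    using that n powr_le_max_one[of "real q" Q \<sigma>] by (auto simp: f_def M_def)
  have f1: "f 1 = 1" by (simp add: f_def)
  have fn1: "\<bar>f n - f 1\<bar> \<le> M" using fM[of n] n M1 f1 by auto
  \<comment> \<open>The increments of \<open>c * ln\<close>: a model density whose partial sums
    agree with those of \<open>w\<close> up to \<open>B\<close>.\<close>
  define w0 where "w0 = (\<lambda>q::nat. if q \<ge> 2 then c * (ln (real q) - ln (real (q - 1))) else 0)"
  have w0: "(\<Sum>q=1..n. w0 q) = c * ln (real n)" if "n \<ge> 1" for n
    using that by (induction n rule: dec_induct) (auto simp: w0_def algebra_simps)
  have 1: "\<bar>\<Sum>q=1..n. (w q - w0 q) * f q\<bar> \<le> B * (\<bar>f n\<bar> + \<bar>f n - f 1\<bar>)"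
    unfolding f_def by (rule abel_summation_bound[OF _ powr_mono_cases n(1)]) (use W w0 in \<open>simp add: sum_subtractf\<close>)
  have "\<bar>f n\<bar> + \<bar>f n - f 1\<bar> \<le> 2 * M" using fM[of n] n fn1 by auto
  then have 1: "\<bar>(\<Sum>q=1..n. w q * f q) - (\<Sum>q=1..n. w0 q * f q)\<bar> \<le> 2 * B * M"
    using 1 B mult_left_mono[of "\<bar>f n\<bar> + \<bar>f n - f 1\<bar>" "2 * M" B]
    by (simp add: left_diff_distrib sum_subtractf algebra_simps)
  \<comment> \<open>These telescope to the main term at n. Since ln q - ln (q - 1) \<le> 1, they
    differ from \<open>w0 q * f q\<close> by no more than \<open>\<bar>c\<bar>\<close> times the
    increment of \<open>f\<close>.\<close>
  define d where "d = (\<lambda>q::nat. if q \<ge> 2 then c * ((f q - f (q - 1)) / \<sigma>) else 0)"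
  have d: "(\<Sum>q=1..n. d q) = c * ((f n - 1) / \<sigma>)"
    using n(1) \<sigma> by (induction n rule: dec_induct) (auto simp: d_def f1[simplified] field_simps)
  have "\<bar>(\<Sum>q=1..n. w0 q * f q) - (\<Sum>q=1..n. d q)\<bar> \<le> (\<Sum>q=2..n. \<bar>c\<bar> * \<bar>f q - f (q - 1)\<bar>)"
  proof -
    have set: "{1..n} = insert 1 {2..n}" using n by auto
    have "(\<Sum>q=1..n. w0 q * f q) - (\<Sum>q=1..n. d q) = (\<Sum>q=2..n. w0 q * f q - d q)"
      unfolding sum_subtractf[symmetric] set by (simp add: w0_def d_def)
    also have "\<bar>\<dots>\<bar> \<le> (\<Sum>q=2..n. \<bar>c\<bar> * \<bar>f q - f (q - 1)\<bar>)"
    proof (intro order.trans[OF sum_abs] sum_mono)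
      fix q assume q: "q \<in> {2..n}"
      define l where "l = ln (real q) - ln (real (q - 1))"
      have l: "0 \<le> l" "l \<le> 1"
      proof -
        show "0 \<le> l" using q by (simp add: l_def)
        have "ln (real q / real (q - 1)) \<le> real q / real (q - 1) - 1"
          using q by (intro ln_le_minus_one) auto
        also have "\<dots> \<le> 1" using q by (auto simp: field_simps of_nat_diff)
        finally show "l \<le> 1" using q by (simp add: l_def ln_div)
      qed
      have b: "l * min (f (q - 1)) (f q) \<le> (f q - f (q - 1)) / \<sigma>"
        "(f q - f (q - 1)) / \<sigma> \<le> l * max (f (q - 1)) (f q)"
        using powr_diff_bound[of "real (q - 1)" "real q" \<sigma>] q \<sigma> by (auto simp: l_def f_def)
      have "\<bar>l * f q - (f q - f (q - 1)) / \<sigma>\<bar> \<le> l * \<bar>f q - f (q - 1)\<bar>"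
      proof (cases "f q \<le> f (q - 1)")
        case True
        then have "l * f q \<le> (f q - f (q - 1)) / \<sigma>" "(f q - f (q - 1)) / \<sigma> \<le> l * f (q - 1)"
          using b by (auto simp: min_absorb2 max_absorb1)
        moreover have "l * \<bar>f q - f (q - 1)\<bar> = l * f (q - 1) - l * f q" using True by (simp add: right_diff_distrib)
        ultimately show ?thesis by linarith
      next
        case False
        then have "l * f (q - 1) \<le> (f q - f (q - 1)) / \<sigma>" "(f q - f (q - 1)) / \<sigma> \<le> l * f q"
          using b by (auto simp: min_absorb1 max_absorb2)
        moreover have "l * \<bar>f q - f (q - 1)\<bar> = l * f q - l * f (q - 1)" using False by (simp add: right_diff_distrib)
        ultimately show ?thesis by linarith
      qed
      also have "\<dots> \<le> \<bar>f q - f (q - 1)\<bar>" using l by (simp add: mult_left_le_one_le)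
      finally have "\<bar>c\<bar> * \<bar>l * f q - (f q - f (q - 1)) / \<sigma>\<bar> \<le> \<bar>c\<bar> * \<bar>f q - f (q - 1)\<bar>"
        by (intro mult_left_mono) auto
      moreover have "w0 q * f q - d q = c * (l * f q - (f q - f (q - 1)) / \<sigma>)"
        using q by (simp add: w0_def d_def l_def algebra_simps)
      ultimately show "\<bar>w0 q * f q - d q\<bar> \<le> \<bar>c\<bar> * \<bar>f q - f (q - 1)\<bar>" by (simp add: abs_mult)
    qed
    finally show ?thesis .
  qed
  also have "\<dots> = \<bar>c\<bar> * (\<Sum>q=2..n. \<bar>f q - f (q - 1)\<bar>)" by (simp add: sum_distrib_left)
  also have "(\<Sum>q=2..n. \<bar>f q - f (q - 1)\<bar>) = (\<Sum>q=1..<n. \<bar>f (Suc q) - f q\<bar>)"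
    by (rule sum.reindex_bij_witness[where i = Suc and j = "\<lambda>q. q - 1"]) auto
  also have "\<dots> = \<bar>f n - f 1\<bar>"
    unfolding f_def using powr_mono_cases n(1) by (rule sum_abs_diff_monotone)
  finally have 2: "\<bar>(\<Sum>q=1..n. w0 q * f q) - c * ((f n - 1) / \<sigma>)\<bar> \<le> \<bar>c\<bar> * M"
    unfolding d using fn1 mult_left_mono[of "\<bar>f n - f 1\<bar>" M "\<bar>c\<bar>"] by linarith
  have 3: "\<bar>c * ((f n - 1) / \<sigma>) - c * ((Q powr \<sigma> - 1) / \<sigma>)\<bar> \<le> \<bar>c\<bar> * M"
  proof -
    have pb: "0 \<le> (Q powr \<sigma> - f n) / \<sigma>" "(Q powr \<sigma> - f n) / \<sigma> \<le> (ln Q - ln n) * max (f n) (Q powr \<sigma>)"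
      using powr_diff_bound[of "real n" Q \<sigma>] n \<sigma> by (auto simp: f_def)
    have "ln Q \<le> ln (2 * real n)" using n Q by simp
    also have "\<dots> \<le> 1 + ln n" using n ln_2_less_1 by (simp add: ln_mult)
    finally have "ln Q - ln n \<le> 1" by simp
    then have "(ln Q - ln n) * max (f n) (Q powr \<sigma>) \<le> 1 * M"
      using fM[of n] n by (intro mult_mono) (auto simp: M_def)
    then have "\<bar>(Q powr \<sigma> - f n) / \<sigma>\<bar> \<le> M" using pb by simp
    then have "\<bar>c\<bar> * \<bar>(Q powr \<sigma> - f n) / \<sigma>\<bar> \<le> \<bar>c\<bar> * M" by (intro mult_left_mono) auto
    moreover have "c * ((f n - 1) / \<sigma>) - c * ((Q powr \<sigma> - 1) / \<sigma>) = - (c * ((Q powr \<sigma> - f n) / \<sigma>))"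
      using \<sigma> by (simp add: field_simps)
    ultimately show ?thesis by (simp add: abs_mult)
  qed
  have tri: "\<bar>x - t\<bar> \<le> p + r + k" if "\<bar>x - y\<bar> \<le> p" "\<bar>y - z\<bar> \<le> r" "\<bar>z - t\<bar> \<le> k" for x y z t p r k :: real
    using that by linarith
  have "2 * B * M + \<bar>c\<bar> * M + \<bar>c\<bar> * M = (2 * B + 2 * \<bar>c\<bar>) * M" by (simp add: algebra_simps)
  then show ?thesis using tri[OF 1 2 3] unfolding n_def M_def f_def by simp
qed

lemma fracs_finite: "finite (fracs {u..<v} Q)"
proof (cases "u \<le> v")
  case True
  have "fracs {u..<v} Q \<subseteq> (\<Union>n\<in>{1..nat \<lfloor>Q\<rfloor>}. (\<lambda>p. (p, int n)) ` class_fracs True (0,0) u v n)"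
  proof
    fix x assume "x \<in> fracs {u..<v} Q"
    then obtain p q where x: "x = (p, q)" "1 \<le> q" "real_of_int q \<le> Q" "u \<le> real_of_int p / real_of_int q"
      "real_of_int p / real_of_int q < v" by (auto simp: fracs_def)
    have "nat q \<in> {1..nat \<lfloor>Q\<rfloor>}" using x le_nat_floor_iff[of "nat q" Q] by auto
    moreover have "p \<in> class_fracs True (0,0) u v (nat q)" using x by (auto simp: class_fracs_def)
    ultimately show "x \<in> (\<Union>n\<in>{1..nat \<lfloor>Q\<rfloor>}. (\<lambda>p. (p, int n)) ` class_fracs True (0,0) u v n)"
      using x by (intro UN_I[of "nat q"]) auto
  qed
  then show ?thesis by (rule finite_subset) (use card_class_fracs(1)[OF True] in auto)
next
  case False
  then show ?thesis by (auto simp: fracs_def)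
qed

lemma sum_fracs_eq:
  assumes "u \<le> v"
  shows "(\<Sum>(p, q)\<in>fracs {u..<v} Q. wt e p q / (real_of_int q)\<^sup>2 * \<phi> (real_of_int q)) =
    (\<Sum>n=1..nat \<lfloor>Q\<rfloor>. fweight e u v n * \<phi> (real n))"
proof -
  define A where "A = (\<lambda>n. {p \<in> class_fracs True e u v n. coprime p (int n)})"
  have fin: "finite (A n)" if "n \<in> {1..nat \<lfloor>Q\<rfloor>}" for n
    unfolding A_def using card_class_fracs(1)[OF assms] that by auto
  have "(\<Sum>n=1..nat \<lfloor>Q\<rfloor>. fweight e u v n * \<phi> (real n)) =
      (\<Sum>n=1..nat \<lfloor>Q\<rfloor>. \<Sum>p\<in>A n. wt e p (int n) / (real n)\<^sup>2 * \<phi> (real n))"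
    unfolding fweight_def A_def by (simp add: sum_divide_distrib sum_distrib_right)
  also have "\<dots> = (\<Sum>(n, p)\<in>Sigma {1..nat \<lfloor>Q\<rfloor>} A. wt e p (int n) / (real n)\<^sup>2 * \<phi> (real n))"
    by (rule sum.Sigma) (use fin in auto)
  also have "\<dots> = (\<Sum>(p, q)\<in>fracs {u..<v} Q. wt e p q / (real_of_int q)\<^sup>2 * \<phi> (real_of_int q))"
  proof (rule sum.reindex_bij_witness[where i = "\<lambda>(p, q). (nat q, p)" and j = "\<lambda>(n, p). (p, int n)"])
    fix a assume a: "a \<in> Sigma {1..nat \<lfloor>Q\<rfloor>} A"
    then show "(case a of (n, p) \<Rightarrow> (p, int n)) \<in> fracs {u..<v} Q"
      by (auto simp: A_def fracs_def class_fracs_def le_nat_floor_iff)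
  next
    fix b assume b: "b \<in> fracs {u..<v} Q"
    then show "(case b of (p, q) \<Rightarrow> (nat q, p)) \<in> Sigma {1..nat \<lfloor>Q\<rfloor>} A"
      by (auto simp: A_def fracs_def class_fracs_def le_nat_floor_iff)
  qed (auto simp: fracs_def)
  finally show ?thesis by simp
qed

definition admissible :: "int \<times> int \<Rightarrow> bool" where
  "admissible e \<longleftrightarrow> \<not> (even (fst e) \<and> even (snd e))"

lemma wt_cases: "wt e p q = 1 \<or> wt e p q = 2" by (simp add: wt_def)

text \<open>All that the renewal argument uses about fractions. The quantifiers matter:
  \<open>c\<close> serves every interval and class, and \<open>B\<close> every class, bound
  \<open>Q\<close> and exponent. The exponents that occur later are \<open>2 * c * \<rho>\<close>
  and \<open>- 8 * c * \<rho>\<close>.\<close>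

lemma fracs_moment:
  "\<exists>c>0. \<forall>u v. u \<le> v \<longrightarrow> (\<exists>B\<ge>0. \<forall>e. admissible e \<longrightarrow> (\<forall>Q\<ge>1.
     \<bar>(\<Sum>(p, q)\<in>fracs {u..<v} Q. wt e p q / (real_of_int q)\<^sup>2) - c * (v - u) * ln Q\<bar> \<le> B \<and>
     (\<forall>\<sigma>. \<sigma> \<noteq> 0 \<longrightarrow>
     \<bar>(\<Sum>(p, q)\<in>fracs {u..<v} Q. wt e p q / (real_of_int q)\<^sup>2 * real_of_int q powr \<sigma>) -
        c * (v - u) * ((Q powr \<sigma> - 1) / \<sigma>)\<bar> \<le> B * max 1 (Q powr \<sigma>))))"
proof -
  obtain c where c: "c > 0" and *: "\<And>u v. u \<le> v \<Longrightarrow> \<exists>B. \<forall>e. \<not> (even (fst e) \<and> even (snd e)) \<longrightarrow>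
     (\<forall>n\<ge>1. \<bar>(\<Sum>q=1..n. fweight e u v q) - c * (v - u) * ln (real n)\<bar> \<le> B)"
    using fweight_moment by blast
  show ?thesis
  proof (rule exI[of _ c], intro conjI c allI impI)
    fix u v :: real assume uv: "u \<le> v"
    obtain B where B: "\<And>e n. admissible e \<Longrightarrow> n \<ge> 1 \<Longrightarrow>
        \<bar>(\<Sum>q=1..n. fweight e u v q) - c * (v - u) * ln (real n)\<bar> \<le> B"
      using *[OF uv] unfolding admissible_def by blast
    define c' where "c' = c * (v - u)"
    have c': "c' \<ge> 0" using c uv by (simp add: c'_def)
    have B0: "B \<ge> 0" using B[of "(1,1)" 1] by (simp add: admissible_def)
    define B' where "B' = 2 * B + 2 * c'"
    have B'0: "B' \<ge> 0" "B + c' \<le> B'" using B0 c' by (auto simp: B'_def)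
    show "\<exists>B\<ge>0. \<forall>e. admissible e \<longrightarrow> (\<forall>Q\<ge>1.
     \<bar>(\<Sum>(p, q)\<in>fracs {u..<v} Q. wt e p q / (real_of_int q)\<^sup>2) - c * (v - u) * ln Q\<bar> \<le> B \<and>
     (\<forall>\<sigma>. \<sigma> \<noteq> 0 \<longrightarrow>
     \<bar>(\<Sum>(p, q)\<in>fracs {u..<v} Q. wt e p q / (real_of_int q)\<^sup>2 * real_of_int q powr \<sigma>) -
        c * (v - u) * ((Q powr \<sigma> - 1) / \<sigma>)\<bar> \<le> B * max 1 (Q powr \<sigma>)))"
    proof (intro exI[of _ B'] conjI allI impI B'0(1))
      fix e :: "int \<times> int" and Q :: real assume e: "admissible e" and Q: "Q \<ge> 1"
      define n where "n = nat \<lfloor>Q\<rfloor>"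
      have n: "n \<ge> 1" "real n \<le> Q" "Q \<le> 2 * real n" using nat_floor_bounds[OF Q] unfolding n_def by auto
      have "ln Q \<le> ln (2 * real n)" using n Q by simp
      also have "\<dots> \<le> 1 + ln n" using n ln_2_less_1 by (simp add: ln_mult)
      finally have "ln Q - ln n \<le> 1" by simp
      moreover have "0 \<le> ln Q - ln n" using n Q by simp
      ultimately have "\<bar>c' * (ln Q - ln n)\<bar> \<le> c' * 1"
        unfolding abs_mult using c' by (intro mult_mono) auto
      then have "\<bar>c' * ln Q - c' * ln n\<bar> \<le> c'" by (simp add: right_diff_distrib)
      moreover have "(\<Sum>(p, q)\<in>fracs {u..<v} Q. wt e p q / (real_of_int q)\<^sup>2) = (\<Sum>q=1..n. fweight e u v q)"
        using sum_fracs_eq[OF uv, where \<phi> = "\<lambda>_. 1"] by (simp add: n_def)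
      ultimately show "\<bar>(\<Sum>(p, q)\<in>fracs {u..<v} Q. wt e p q / (real_of_int q)\<^sup>2) - c * (v - u) * ln Q\<bar> \<le> B'"
        using B[OF e n(1)] B'0 unfolding c'_def by linarith
    next
      fix e :: "int \<times> int" and Q \<sigma> :: real assume e: "admissible e" and Q: "Q \<ge> 1" and \<sigma>: "\<sigma> \<noteq> 0"
      have "\<bar>(\<Sum>q=1..nat \<lfloor>Q\<rfloor>. fweight e u v q * real q powr \<sigma>) - c' * ((Q powr \<sigma> - 1) / \<sigma>)\<bar> \<le>
         (2 * B + 2 * \<bar>c'\<bar>) * max 1 (Q powr \<sigma>)"
        by (rule log_density_powr_sum) (use B e Q \<sigma> in \<open>auto simp: c'_def\<close>)
      then show "\<bar>(\<Sum>(p, q)\<in>fracs {u..<v} Q. wt e p q / (real_of_int q)\<^sup>2 * real_of_int q powr \<sigma>) -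
        c * (v - u) * ((Q powr \<sigma> - 1) / \<sigma>)\<bar> \<le> B' * max 1 (Q powr \<sigma>)"
        unfolding sum_fracs_eq[OF uv, where \<phi> = "\<lambda>x. x powr \<sigma>"]
        by (simp only: abs_of_nonneg[OF c'] B'_def c'_def[symmetric])
    qed
  qed
qed

section \<open>Visits and their renewal equation\<close>

lemma measure_lborel_affine:
  fixes S :: "real set"
  assumes [measurable]: "S \<in> sets borel" and c: "c \<noteq> 0"
  shows "measure lborel S = \<bar>c\<bar> * measure lborel {x. t + c * x \<in> S}"
proof -
  have "emeasure lborel S = emeasure (density (distr lborel borel (\<lambda>x. t + c * x)) (\<lambda>_. ennreal \<bar>c\<bar>)) S"
    using lborel_affine[OF c, of t] by simp
  also have "\<dots> = ennreal \<bar>c\<bar> * emeasure (distr lborel borel (\<lambda>x. t + c * x)) S"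
    by (subst emeasure_density_const) auto
  also have "emeasure (distr lborel borel (\<lambda>x. t + c * x)) S = emeasure lborel {x. t + c * x \<in> S}"
    by (subst emeasure_distr) (auto simp: vimage_def)
  finally show ?thesis by (simp add: measure_def enn2real_mult)
qed

lemma measure_lborel_Un_disjoint:
  fixes A B :: "real set"
  assumes "A \<in> sets borel" "B \<in> sets borel" "bounded A" "bounded B" "A \<inter> B = {}"
  shows "measure lborel (A \<union> B) = measure lborel A + measure lborel B"
  using assms emeasure_bounded_finite[OF assms(3)] emeasure_bounded_finite[OF assms(4)]
  by (intro measure_Union) auto

lemma measure_lborel_mono:
  fixes A B :: "real set"
  assumes "A \<subseteq> B" "A \<in> sets borel" "B \<in> sets borel" "bounded B"
  shows "measure lborel A \<le> measure lborel B"
  using assms emeasure_bounded_finite[OF assms(4)]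
  by (intro measure_mono_fmeasurable) (auto simp: fmeasurable_def)

lemma measure_lborel_subadditive:
  fixes A B C :: "real set"
  assumes "A \<subseteq> B \<union> C" "A \<in> sets borel" "B \<in> sets borel" "C \<in> sets borel" "bounded B" "bounded C"
  shows "measure lborel A \<le> measure lborel B + measure lborel C"
proof -
  have "measure lborel A \<le> measure lborel (B \<union> C)"
    using assms by (intro measure_lborel_mono) auto
  also have "\<dots> \<le> measure lborel B + measure lborel C"
    using assms emeasure_bounded_finite[OF assms(5)] emeasure_bounded_finite[OF assms(6)]
    by (intro measure_Un_le) auto
  finally show ?thesis .
qed

section \<open>Periodic sets under inversion\<close>

definition periodic2 :: "real set \<Rightarrow> bool" where
  "periodic2 N \<longleftrightarrow> (\<forall>x. x + 2 \<in> N \<longleftrightarrow> x \<in> N)"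

lemma periodic2_int:
  assumes "periodic2 N"
  shows "x + 2 * real_of_int k \<in> N \<longleftrightarrow> x \<in> N"
proof (induction k arbitrary: x rule: int_induct[where k = 0])
  case (step1 i)
  have "x + 2 * real_of_int (i + 1) = (x + 2 * real_of_int i) + 2" by simp
  then show ?case using assms step1.IH[of x] unfolding periodic2_def by metis
next
  case (step2 i)
  have "x + 2 * real_of_int i = (x + 2 * real_of_int (i - 1)) + 2" by simp
  then show ?case using assms step2.IH[of x] unfolding periodic2_def by metis
qed simp

lemma measure_periodic2:
  assumes N: "periodic2 N" and [measurable]: "N \<in> sets borel"
  shows "measure lborel (N \<inter> {a..<a+2}) = measure lborel (N \<inter> {0..<2})"
proof -
  define k where "k = \<lfloor>a / 2\<rfloor>"
  define b where "b = 2 * real_of_int k"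
  have "real_of_int k \<le> a / 2" "a / 2 < real_of_int k + 1" unfolding k_def by linarith+
  then have b: "b \<le> a" "a < b + 2" by (auto simp: b_def)
  have 1: "measure lborel (N \<inter> {b..<b+2}) = measure lborel (N \<inter> {0..<2})"
  proof -
    have "{x. b + 1 * x \<in> N \<inter> {b..<b+2}} = N \<inter> {0..<2}"
      using periodic2_int[OF N, of _ k] by (auto simp: b_def add.commute)
    then show ?thesis using measure_lborel_affine[of "N \<inter> {b..<b+2}" 1 b] by simp
  qed
  have 2: "measure lborel (N \<inter> {b+2..<a+2}) = measure lborel (N \<inter> {b..<a})"
  proof -
    have "{x. 2 + 1 * x \<in> N \<inter> {b+2..<a+2}} = N \<inter> {b..<a}"
      using N by (auto simp: periodic2_def add.commute)
    then show ?thesis using measure_lborel_affine[of "N \<inter> {b+2..<a+2}" 1 2] by simp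
  qed
  have "N \<inter> {a..<a+2} = (N \<inter> {a..<b+2}) \<union> (N \<inter> {b+2..<a+2})"
       "N \<inter> {b..<b+2} = (N \<inter> {a..<b+2}) \<union> (N \<inter> {b..<a})" using b by auto
  moreover have "bounded (N \<inter> {x..<y})" for x y by (rule bounded_subset[of "{x..y}"]) auto
  ultimately have "measure lborel (N \<inter> {a..<a+2}) = measure lborel (N \<inter> {a..<b+2}) + measure lborel (N \<inter> {b+2..<a+2})"
    "measure lborel (N \<inter> {b..<b+2}) = measure lborel (N \<inter> {a..<b+2}) + measure lborel (N \<inter> {b..<a})"
    by (simp_all only:) (subst measure_lborel_Un_disjoint; auto)+
  then show ?thesis using 1 2 by simp
qed

text \<open>The map h - 1/r carries this interval once over a full period of \<open>N\<close>, and
  its derivative 1/r^2 lies between U^2 and (U + 2)^2.\<close>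

lemma inversion_block:
  fixes h U :: real
  assumes N: "periodic2 N" and [measurable]: "N \<in> sets borel" and U: "U > 0"
  defines "\<mu> \<equiv> measure lborel (N \<inter> {0..<2})"
    and "m \<equiv> measure lborel {r. 1 / (U + 2) < r \<and> r \<le> 1 / U \<and> h - 1 / r \<in> N}"
  shows "m \<le> \<mu> / U\<^sup>2" and "\<mu> / (U + 2)\<^sup>2 \<le> m"
proof -
  define a b where "a = 1 / (U + 2)" and "b = 1 / U"
  have ab: "0 < a" "a < b" using U by (auto simp: a_def b_def field_simps)
  define M where "M = {x. h + x \<in> N}"
  have M[measurable]: "M \<in> sets borel" unfolding M_def by measurable
  define S where "S = {r. a < r \<and> r \<le> b \<and> h - 1 / r \<in> N}"
  have S[measurable]: "S \<in> sets borel" unfolding S_def by measurable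
  have bS: "bounded S" by (rule bounded_subset[of "{a..b}"]) (auto simp: S_def)
  have emS: "emeasure lborel S = ennreal m"
    unfolding m_def S_def[symmetric, unfolded a_def b_def] using emeasure_bounded_finite[OF bS]
    by (simp add: emeasure_eq_ennreal_measure S_def a_def b_def)
  have m0: "m \<ge> 0" by (simp add: m_def)
  \<comment> \<open>The substitution rule works with closed intervals; the additional endpoint is a
    null set.\<close>
  have aeS: "AE r in lborel. (r \<in> S) = (r \<in> {a..b} \<and> - (1 / r) \<in> M)"
    using AE_lborel_singleton[of a] by eventually_elim (auto simp: S_def M_def)
  have gab: "- (1 / a) = - (U + 2)" "- (1 / b) = - U" by (simp_all add: a_def b_def)
  have "(\<integral>\<^sup>+x. ennreal (indicator M x * indicator {- (1 / a)..- (1 / b)} x) \<partial>lborel) =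
      (\<integral>\<^sup>+x. ennreal (indicator M (- (1 / x)) * (1 / x\<^sup>2) * indicator {a..b} x) \<partial>lborel)"
  proof (rule nn_integral_substitution[where g = "\<lambda>x. - (1 / x)" and g' = "\<lambda>x. 1 / x\<^sup>2"])
    fix x assume "x \<in> {a..b}"
    then have "x \<noteq> 0" using ab by auto
    then show "((\<lambda>x. - (1 / x)) has_real_derivative 1 / x\<^sup>2) (at x)"
      by (auto intro!: derivative_eq_intros simp: power2_eq_square)
  next
    show "continuous_on {a..b} (\<lambda>x. 1 / x\<^sup>2)" using ab by (intro continuous_intros) auto
  qed (use ab in \<open>auto simp: set_borel_measurable_def\<close>)
  also have "(\<integral>\<^sup>+x. ennreal (indicator M x * indicator {- (1 / a)..- (1 / b)} x) \<partial>lborel) = ennreal \<mu>"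
  proof -
    have "(\<integral>\<^sup>+x. ennreal (indicator M x * indicator {- (1 / a)..- (1 / b)} x) \<partial>lborel) =
        (\<integral>\<^sup>+x. indicator (M \<inter> {- (U + 2)..< - U}) x \<partial>lborel)"
      unfolding gab using AE_lborel_singleton[of "-U"]
      by (intro nn_integral_cong_AE, eventually_elim) (auto simp: indicator_def)
    also have "\<dots> = emeasure lborel (M \<inter> {- (U + 2)..< - U})" by simp
    also have "\<dots> = ennreal (measure lborel (M \<inter> {- (U + 2)..< - U}))"
    proof -
      have "bounded (M \<inter> {- (U + 2)..< - U})" by (rule bounded_subset[of "{-(U+2)..-U}"]) auto
      from emeasure_bounded_finite[OF this] show ?thesis by (simp add: emeasure_eq_ennreal_measure)
    qed
    also have "measure lborel (M \<inter> {- (U + 2)..< - U}) = \<mu>"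
    proof -
      have "{x. h + 1 * x \<in> N \<inter> {h - U - 2..<h - U - 2 + 2}} = M \<inter> {- (U + 2)..< - U}"
        by (auto simp: M_def)
      then have "measure lborel (M \<inter> {- (U + 2)..< - U}) = measure lborel (N \<inter> {h - U - 2..<h - U - 2 + 2})"
        using measure_lborel_affine[of "N \<inter> {h - U - 2..<h - U - 2 + 2}" 1 h] by simp
      also have "\<dots> = \<mu>" unfolding \<mu>_def by (rule measure_periodic2[OF N]) simp
      finally show ?thesis .
    qed
    finally show ?thesis .
  qed
  finally have eq: "ennreal \<mu> = (\<integral>\<^sup>+x. ennreal (indicator M (- (1 / x)) * (1 / x\<^sup>2) * indicator {a..b} x) \<partial>lborel)" .
  have sq: "U\<^sup>2 \<le> 1 / x\<^sup>2" "1 / x\<^sup>2 \<le> (U + 2)\<^sup>2" if "x \<in> {a..b}" for x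
  proof -
    have x0: "x > 0" using that ab by auto
    have x: "U \<le> 1 / x" "1 / x \<le> U + 2"
      using that x0 U unfolding a_def b_def by (auto simp: field_simps)
    then show "U\<^sup>2 \<le> 1 / x\<^sup>2" "1 / x\<^sup>2 \<le> (U + 2)\<^sup>2"
      using power_mono[of U "1 / x" 2] power_mono[of "1 / x" "U + 2" 2] U x0 by (auto simp: power_divide)
  qed
  have "ennreal (U\<^sup>2 * m) = (\<integral>\<^sup>+x. ennreal (U\<^sup>2) * indicator S x \<partial>lborel)"
    by (simp add: nn_integral_cmult emS ennreal_mult m0)
  also have "\<dots> \<le> ennreal \<mu>"
    unfolding eq using aeS
    by (intro nn_integral_mono_AE, eventually_elim) (auto simp: indicator_def sq)
  finally have "U\<^sup>2 * m \<le> \<mu>" by (simp add: \<mu>_def)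
  then show "m \<le> \<mu> / U\<^sup>2" using U by (simp add: field_simps)
  have "ennreal \<mu> \<le> (\<integral>\<^sup>+x. ennreal ((U + 2)\<^sup>2) * indicator S x \<partial>lborel)"
    unfolding eq using aeS
    by (intro nn_integral_mono_AE, eventually_elim) (auto simp: indicator_def sq intro!: ennreal_leI)
  also have "\<dots> = ennreal ((U + 2)\<^sup>2 * m)"
    by (simp add: nn_integral_cmult emS ennreal_mult m0)
  finally have "\<mu> \<le> (U + 2)\<^sup>2 * m" using m0 by simp
  then show "\<mu> / (U + 2)\<^sup>2 \<le> m" using U by (simp add: field_simps)
qed

text \<open>Stack the blocks at U, U + 2, and so on, and compare each 2 / V^2 with a telescoping
  difference. The set thus occupies the proportion \<pi> of the whole interval up to a relative
  error of order 1/U: h - 1/r is nearly uniform modulo 2.\<close>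

lemma inversion_blocks:
  fixes h U :: real
  assumes N: "periodic2 N" and [measurable]: "N \<in> sets borel" and U: "U > 2"
  defines "\<pi> \<equiv> measure lborel (N \<inter> {0..<2}) / 2"
  shows "measure lborel {r. 1 / (U + 2 * real k) < r \<and> r \<le> 1 / U \<and> h - 1 / r \<in> N} \<le> \<pi> * (1 / (U - 2) - 1 / (U + 2 * real k - 2))"
    and "\<pi> * (1 / (U + 2) - 1 / (U + 2 * real k + 2)) \<le> measure lborel {r. 1 / (U + 2 * real k) < r \<and> r \<le> 1 / U \<and> h - 1 / r \<in> N}"
proof (induction k)
  case 0
  {
    case 1
    have "{r. 1 / (U + 2 * real 0) < r \<and> r \<le> 1 / U \<and> h - 1 / r \<in> N} = {}" by auto
    then show ?case by (simp only: measure_empty) simp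
  next
    case 2
    show ?case by simp
  }
next
  case (Suc k)
  define V where "V = U + 2 * real k"
  have V: "V > 2" "V \<ge> U" using U by (auto simp: V_def)
  have \<pi>0: "\<pi> \<ge> 0" by (simp add: \<pi>_def)
  define A where "A = {r. 1 / V < r \<and> r \<le> 1 / U \<and> h - 1 / r \<in> N}"
  define B where "B = {r. 1 / (V + 2) < r \<and> r \<le> 1 / V \<and> h - 1 / r \<in> N}"
  have [measurable]: "A \<in> sets borel" "B \<in> sets borel" unfolding A_def B_def by measurable
  have bd: "bounded A" "bounded B"
    by (rule bounded_subset[of "{1/V..1/U}"], auto simp: A_def) (rule bounded_subset[of "{1/(V+2)..1/V}"], auto simp: B_def)
  have lt: "1 / (V + 2) \<le> 1 / V" "1 / V \<le> 1 / U" using V U by (auto simp: field_simps)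
  have "{r. 1 / (U + 2 * real (Suc k)) < r \<and> r \<le> 1 / U \<and> h - 1 / r \<in> N} = A \<union> B"
    using lt by (auto simp: A_def B_def V_def algebra_simps)
  moreover have "A \<inter> B = {}" by (auto simp: A_def B_def)
  ultimately have eq: "measure lborel {r. 1 / (U + 2 * real (Suc k)) < r \<and> r \<le> 1 / U \<and> h - 1 / r \<in> N} =
      measure lborel A + measure lborel B" using bd by (simp add: measure_lborel_Un_disjoint)
  have B: "measure lborel B \<le> \<pi> * (2 / V\<^sup>2)" "\<pi> * (2 / (V + 2)\<^sup>2) \<le> measure lborel B"
    using inversion_block[OF N, of V h] V unfolding B_def \<pi>_def by auto
  have d1: "2 / V\<^sup>2 \<le> 1 / (V - 2) - 1 / V"
    using V by (simp add: divide_simps) (simp add: power2_eq_square algebra_simps)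
  have d2: "1 / (V + 2) - 1 / (V + 4) \<le> 2 / (V + 2)\<^sup>2"
    using V by (simp add: divide_simps) (simp add: power2_eq_square algebra_simps)
  {
    case 1
    have "measure lborel A \<le> \<pi> * (1 / (U - 2) - 1 / (V - 2))"
      using Suc.IH(1) by (simp add: A_def V_def)
    moreover have "measure lborel B \<le> \<pi> * (1 / (V - 2) - 1 / V)"
      using B(1) mult_left_mono[OF d1 \<pi>0] by linarith
    ultimately have "measure lborel A + measure lborel B \<le> \<pi> * (1 / (U - 2) - 1 / V)"
      by (simp add: algebra_simps)
    then show ?case unfolding eq by (simp add: V_def algebra_simps)
  next
    case 2
    have "\<pi> * (1 / (U + 2) - 1 / (V + 2)) \<le> measure lborel A"
      using Suc.IH(2) by (simp add: A_def V_def)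
    moreover have "\<pi> * (1 / (V + 2) - 1 / (V + 4)) \<le> measure lborel B"
      using B(2) mult_left_mono[OF d2 \<pi>0] by linarith
    ultimately have "\<pi> * (1 / (U + 2) - 1 / (V + 4)) \<le> measure lborel A + measure lborel B"
      by (simp add: algebra_simps)
    then show ?case unfolding eq by (simp add: V_def algebra_simps)
  }
qed

text \<open>The sign of \<open>q\<close> matters: for q \<le> 0 and \<rho> > 0 this is the whole
  line. Images of fractions that come out with a negative denominator are therefore renormalised, as
  in \<open>visits_neg_frac\<close>.\<close>

definition visits :: "int \<times> int \<Rightarrow> real \<Rightarrow> int \<Rightarrow> int \<Rightarrow> real set" where
  "visits e \<rho> p q = {x. real_of_int q * \<bar>real_of_int q * x - real_of_int p\<bar> < \<rho> * wt e p q}"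

definition avoid :: "int \<times> int \<Rightarrow> real \<Rightarrow> real \<Rightarrow> real set" where
  "avoid e Q \<rho> = {x. \<forall>p q. coprime p q \<longrightarrow> 1 \<le> q \<longrightarrow> real_of_int q \<le> Q \<longrightarrow> x \<notin> visits e \<rho> p q}"

text \<open>The last visit is the one with the largest denominator; along a geodesic ending in x
  this is the order of time.\<close>

definition last_visit :: "int \<times> int \<Rightarrow> real \<Rightarrow> real \<Rightarrow> int \<Rightarrow> int \<Rightarrow> real set" where
  "last_visit e Q \<rho> p q = {x \<in> visits e \<rho> p q.
     \<forall>p' q'. coprime p' q' \<longrightarrow> q < q' \<longrightarrow> real_of_int q' \<le> Q \<longrightarrow> x \<notin> visits e \<rho> p' q'}"

definition avoid_prob :: "int \<times> int \<Rightarrow> real \<Rightarrow> real \<Rightarrow> real" where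
  "avoid_prob e Q \<rho> = measure lborel (avoid e Q \<rho> \<inter> {0..<2}) / 2"

lemma visits_borel [measurable]: "visits e \<rho> p q \<in> sets borel"
  unfolding visits_def by measurable

lemma avoid_borel [measurable]: "avoid e Q \<rho> \<in> sets borel"
proof -
  have "avoid e Q \<rho> = (\<Inter>p. \<Inter>q. (if coprime p q \<and> 1 \<le> q \<and> real_of_int q \<le> Q then - visits e \<rho> p q else UNIV))"
    unfolding avoid_def by (auto split: if_splits)
  also have "\<dots> \<in> sets borel" by (intro sets.countable_INT'') auto
  finally show ?thesis .
qed

lemma last_visit_borel [measurable]: "last_visit e Q \<rho> p q \<in> sets borel"
proof -
  have "last_visit e Q \<rho> p q = visits e \<rho> p q \<inter>
     (\<Inter>p'. \<Inter>q'. (if coprime p' q' \<and> q < q' \<and> real_of_int q' \<le> Q then - visits e \<rho> p' q' else UNIV))"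
    unfolding last_visit_def by (auto split: if_splits)
  also have "\<dots> \<in> sets borel" by (intro sets.Int visits_borel sets.countable_INT'') auto
  finally show ?thesis .
qed

text \<open>Translation by 2 fixes the parities of numerator and denominator, while translation by 1
  permutes the classes; this is why the period is 2.\<close>

lemma visits_shift: "x + 2 \<in> visits e \<rho> (p + 2 * q) q \<longleftrightarrow> x \<in> visits e \<rho> p q"
proof -
  have "real_of_int q * (x + 2) - real_of_int (p + 2 * q) = real_of_int q * x - real_of_int p"
    by (simp add: algebra_simps)
  moreover have "even (p + 2 * q - fst e) \<longleftrightarrow> even (p - fst e)" by auto
  ultimately show ?thesis unfolding visits_def wt_def mem_Collect_eq by (simp only:)
qed

lemma visits_uminus: "- x \<in> visits e \<rho> (- p) q \<longleftrightarrow> x \<in> visits e \<rho> p q"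
proof -
  have "\<bar>real_of_int q * (- x) - real_of_int (- p)\<bar> = \<bar>real_of_int q * x - real_of_int p\<bar>" by simp
  moreover have "even (- p - fst e) \<longleftrightarrow> even (p - fst e)" by auto
  ultimately show ?thesis unfolding visits_def wt_def by simp
qed

lemma visits_neg_frac: "visits e \<rho> (- p) (- q) = {x. - real_of_int q * \<bar>real_of_int q * x - real_of_int p\<bar> < \<rho> * wt e p q}"
proof -
  have "\<bar>real_of_int (- q) * x - real_of_int (- p)\<bar> = \<bar>real_of_int q * x - real_of_int p\<bar>" for x by simp
  moreover have "even (- p - fst e) \<longleftrightarrow> even (p - fst e)" "even (- q - snd e) \<longleftrightarrow> even (q - snd e)" by auto
  ultimately show ?thesis unfolding visits_def wt_def by simp
qed

lemma avoid_periodic2: "periodic2 (avoid e Q \<rho>)"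
  unfolding periodic2_def
proof (intro allI iffI)
  fix x assume a: "x + 2 \<in> avoid e Q \<rho>"
  show "x \<in> avoid e Q \<rho>" unfolding avoid_def
  proof (safe)
    fix p q assume "coprime p q" "1 \<le> q" "real_of_int q \<le> Q" "x \<in> visits e \<rho> p q"
    moreover have "coprime (p + 2 * q) q" using \<open>coprime p q\<close>
      by (metis add.commute coprime_iff_gcd_eq_1 gcd_add_mult gcd.commute)
    ultimately show False using a visits_shift[of x e \<rho> p q] unfolding avoid_def by blast
  qed
next
  fix x assume a: "x \<in> avoid e Q \<rho>"
  show "x + 2 \<in> avoid e Q \<rho>" unfolding avoid_def
  proof (safe)
    fix p q assume "coprime p q" "1 \<le> q" "real_of_int q \<le> Q" "x + 2 \<in> visits e \<rho> p q"
    moreover have "coprime (p - 2 * q) q" using \<open>coprime p q\<close>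
      by (metis add.commute coprime_iff_gcd_eq_1 gcd_add_mult gcd.commute diff_add_cancel)
    ultimately show False using a visits_shift[of x e \<rho> "p - 2 * q" q] unfolding avoid_def by auto
  qed
qed

lemma avoid_uminus: "- x \<in> avoid e Q \<rho> \<longleftrightarrow> x \<in> avoid e Q \<rho>"
proof -
  have "- x \<in> avoid e Q \<rho>" if a: "x \<in> avoid e Q \<rho>" for x
    unfolding avoid_def
  proof (safe)
    fix p q assume "coprime p q" "1 \<le> q" "real_of_int q \<le> Q" "- x \<in> visits e \<rho> p q"
    then show False using a visits_uminus[of "- x" e \<rho> p q] unfolding avoid_def by fastforce
  qed
  from this[of x] this[of "- x"] show ?thesis by auto
qed

lemma avoid_prob_bounds: "0 \<le> avoid_prob e Q \<rho>" "avoid_prob e Q \<rho> \<le> 1"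
proof -
  show "0 \<le> avoid_prob e Q \<rho>" by (simp add: avoid_prob_def)
  have "measure lborel (avoid e Q \<rho> \<inter> {0..<2}) \<le> measure lborel {0..<2::real}"
    by (intro measure_lborel_mono) auto
  then show "avoid_prob e Q \<rho> \<le> 1" by (simp add: avoid_prob_def)
qed

text \<open>The matrix with rows \<open>(a, b)\<close> and \<open>(q, -p)\<close> moves \<open>p/q\<close> to infinity; it acts on the two
  columns of parities as on fractions.\<close>

definition move_class :: "int \<Rightarrow> int \<Rightarrow> int \<Rightarrow> int \<Rightarrow> int \<times> int \<Rightarrow> int \<times> int" where
  "move_class a b p q e = (a * fst e + b * snd e, q * fst e - p * snd e)"

text \<open>The matrix with rows (a, b) and (q, -p) has determinant 1 and is thus invertible modulo
  2: a vector is even in both entries exactly when its image is. The next lemma rests on the same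
  inverse.\<close>

lemma wt_move_class:
  assumes "a * p + b * q = - 1"
  shows "wt (move_class a b p q e) (a * p' + b * q') (q * p' - p * q') = wt e p' q'"
proof -
  define s t where "s = p' - fst e" and "t = q' - snd e"
  have 1: "a * p' + b * q' - (a * fst e + b * snd e) = a * s + b * t"
    "q * p' - p * q' - (q * fst e - p * snd e) = q * s - p * t"
    by (simp_all add: s_def t_def algebra_simps)
  have "s = - (p * (a * s + b * t)) - b * (q * s - p * t)"
    "t = - (q * (a * s + b * t)) + a * (q * s - p * t)" using assms by algebra+
  then have "even (a * s + b * t) \<and> even (q * s - p * t) \<longleftrightarrow> even s \<and> even t"
    by (smt (verit) dvd_add dvd_diff dvd_minus_iff dvd_mult)
  then show ?thesis unfolding wt_def move_class_def fst_conv snd_conv 1 by (simp add: s_def t_def)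
qed

lemma admissible_move_class:
  assumes "a * p + b * q = - 1" "admissible e"
  shows "admissible (move_class a b p q e)"
proof -
  obtain s t where e: "e = (s, t)" by (cases e)
  have "s = - (p * (a * s + b * t)) - b * (q * s - p * t)"
    "t = - (q * (a * s + b * t)) + a * (q * s - p * t)" using assms by algebra+
  then have "even (a * s + b * t) \<and> even (q * s - p * t) \<Longrightarrow> even s \<and> even t"
    by (smt (verit) dvd_add dvd_diff dvd_minus_iff dvd_mult)
  then show ?thesis using assms(2) unfolding admissible_def move_class_def e by auto
qed

text \<open>y is the image of x under the Moebius map with rows (a, b) and (q, -p), and P/R the
  image of p'/q'. The first identity says that the visit quantity \<open>R * \<delta>\<close> is
  distorted only by \<open>r * \<delta>\<^sup>2\<close>, the second that q' is about q R /
  r.\<close>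

lemma move_fraction:
  fixes r x y :: real and a b p q p' q' :: int
  assumes ab: "a * p + b * q = - 1" and q: "q \<ge> 1" and r: "r \<noteq> 0"
  defines "x \<equiv> p / q + r / (real_of_int q)\<^sup>2" and "y \<equiv> a / q - 1 / r"
  defines "P \<equiv> a * p' + b * q'" and "R \<equiv> q * p' - p * q'"
  defines "\<delta> \<equiv> R * y - P"
  shows "real_of_int q' * (q' * x - p') = \<delta> * (R + r * \<delta>)"
    and "r * q' = q * (R + r * \<delta>)"
proof -
  have abr: "real_of_int a * p + real_of_int b * q = - 1" using ab by (metis of_int_add of_int_minus of_int_mult of_int_1)
  have q0: "real_of_int q \<noteq> 0" using q by simp
  have R: "real_of_int R = real_of_int q * p' - real_of_int p * q'"
    and P: "real_of_int P = real_of_int a * p' + real_of_int b * q'" by (simp_all add: R_def P_def)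
  have bq: "real_of_int b = (- 1 - real_of_int a * p) / q" using abr q0 by (simp add: field_simps)
  have d: "\<delta> = real_of_int q' / q - R / r"
    unfolding \<delta>_def y_def R P bq using q0 r by (simp add: field_simps)
  then have rd: "R + r * \<delta> = r * q' / q" using r q0 by (simp add: field_simps)
  then show "r * q' = q * (R + r * \<delta>)" using q0 by simp
  have "q' * x - p' = (r * q' / q - R) / q"
    unfolding x_def R using q0 by (simp add: field_simps power2_eq_square)
  also have "\<dots> = r * \<delta> / q" unfolding d using r q0 by (simp add: field_simps)
  finally show "real_of_int q' * (q' * x - p') = \<delta> * (R + r * \<delta>)"
    unfolding rd by simp
qed

lemma coprime_move:
  fixes a b p q p' q' :: int
  assumes ab: "a * p + b * q = - 1"
  shows "coprime (a * p' + b * q') (q * p' - p * q') \<longleftrightarrow> coprime p' q'"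
proof -
  have "d dvd a * p' + b * q' \<and> d dvd q * p' - p * q' \<longleftrightarrow> d dvd p' \<and> d dvd q'" for d
  proof -
    have "p' = - (p * (a * p' + b * q')) - b * (q * p' - p * q')"
      "q' = - (q * (a * p' + b * q')) + a * (q * p' - p * q')" using assms by algebra+
    then show ?thesis by (metis dvd_add dvd_diff dvd_minus_iff dvd_mult)
  qed
  then show ?thesis unfolding coprime_def by blast
qed

lemma visits_eq:
  assumes "real_of_int q * (q * x - p) = z" "q > 0"
  shows "x \<in> visits e \<rho> p q \<longleftrightarrow> \<bar>z\<bar> < \<rho> * wt e p q"
  using assms by (auto simp: visits_def abs_mult)

text \<open>The visited P/R is pulled back to a fraction with denominator q (R + r \<delta>) / r.
  Smallness of r makes it exceed q; the lower bound on \<bar>r\<bar> keeps it below Q, at the price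
  of the factor \<open>\<rho>\<^sup>2 / 10\<close>. The margin 1 - \<rho> absorbs the distortion
  \<open>1 + 4 * \<rho>\<^sup>2\<close>.\<close>

lemma later_visit_of_moved:
  fixes r \<rho> Q :: real and a b p q P R :: int
  assumes ab: "a * p + b * q = - 1" and q: "q \<ge> 1" and \<rho>: "0 < \<rho>" "\<rho> \<le> 1 / 16"
    and r: "\<bar>r\<bar> < 2 * \<rho>" "\<rho>\<^sup>2 / 5 \<le> \<bar>r\<bar>"
    and y: "a / q - 1 / r \<in> visits (move_class a b p q e) (\<rho> * (1 - \<rho>)) P R"
    and PR: "coprime P R" "1 \<le> R" "real_of_int R \<le> \<rho>\<^sup>2 / 10 * Q / q"
  shows "\<exists>p' q'. coprime p' q' \<and> q < q' \<and> real_of_int q' \<le> Q \<and> p / q + r / (real_of_int q)\<^sup>2 \<in> visits e \<rho> p' q'"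
proof -
  \<comment> \<open>The inverse matrix applied to the column (P, R).\<close>
  define p0 q0 where "p0 = - p * P - b * R" and "q0 = - q * P + a * R"
  have PR0: "P = a * p0 + b * q0" "R = q * p0 - p * q0" unfolding p0_def q0_def using ab by algebra+
  have r0: "r \<noteq> 0" "\<bar>r\<bar> > 0" using r \<rho> by auto
  define x where "x = p / q + r / (real_of_int q)\<^sup>2"
  define y' where "y' = a / q - 1 / r"
  define \<delta> where "\<delta> = R * y' - P"
  have mv: "real_of_int q0 * (q0 * x - p0) = \<delta> * (R + r * \<delta>)" "r * q0 = q * (R + r * \<delta>)"
    using move_fraction[OF ab q r0(1), of q0 p0] unfolding x_def \<delta>_def y'_def PR0 by auto
  define k where "k = wt e p0 q0"
  have k: "1 \<le> k" "k \<le> 2" using wt_cases[of e p0 q0] by (auto simp: k_def)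
  have R1: "real_of_int R \<ge> 1" using PR by simp
  have "R * \<bar>\<delta>\<bar> < \<rho> * (1 - \<rho>) * k"
    using y unfolding visits_def \<delta>_def k_def y'_def PR0 wt_move_class[OF ab] by simp
  moreover have "\<bar>\<delta>\<bar> \<le> R * \<bar>\<delta>\<bar>" using R1 mult_right_mono[of 1 "real_of_int R" "\<bar>\<delta>\<bar>"] by simp
  ultimately have d: "R * \<bar>\<delta>\<bar> < \<rho> * (1 - \<rho>) * k" "\<bar>\<delta>\<bar> < \<rho> * (1 - \<rho>) * k" by linarith+
  have "\<rho> * (1 - \<rho>) * k \<le> \<rho> * 1 * 2" using \<rho> k by (intro mult_mono) auto
  then have d2: "\<bar>\<delta>\<bar> \<le> 2 * \<rho>" using d by linarith
  have rd: "\<bar>r * \<delta>\<bar> \<le> 4 * \<rho>\<^sup>2"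
    unfolding abs_mult using mult_mono[of "\<bar>r\<bar>" "2 * \<rho>" "\<bar>\<delta>\<bar>" "2 * \<rho>"] r d2 by (simp add: power2_eq_square)
  have "\<rho> * \<rho> \<le> 1 / 16 * (1 / 16)" using \<rho> by (intro mult_mono) auto
  then have \<rho>2: "\<rho>\<^sup>2 \<le> 1 / 256" by (simp add: power2_eq_square)
  have z: "\<bar>R + r * \<delta>\<bar> \<le> R * (1 + 4 * \<rho>\<^sup>2)" "\<bar>R + r * \<delta>\<bar> \<ge> R / 2" "R + r * \<delta> > 0"
  proof -
    have "4 * \<rho>\<^sup>2 \<le> R * (4 * \<rho>\<^sup>2)" using R1 mult_right_mono[of 1 "real_of_int R" "4 * \<rho>\<^sup>2"] by simp
    then show "\<bar>R + r * \<delta>\<bar> \<le> R * (1 + 4 * \<rho>\<^sup>2)" using rd R1 by (simp add: distrib_left)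
    show "\<bar>R + r * \<delta>\<bar> \<ge> R / 2" "R + r * \<delta> > 0" using rd R1 \<rho>2 by linarith+
  qed
  have "\<bar>\<delta> * (R + r * \<delta>)\<bar> \<le> \<bar>\<delta>\<bar> * (R * (1 + 4 * \<rho>\<^sup>2))"
    unfolding abs_mult using z by (intro mult_left_mono) auto
  also have "\<dots> = (R * \<bar>\<delta>\<bar>) * (1 + 4 * \<rho>\<^sup>2)" by simp
  also have "\<dots> < (\<rho> * (1 - \<rho>) * k) * (1 + 4 * \<rho>\<^sup>2)"
    using d by (intro mult_strict_right_mono) (auto simp: add_pos_nonneg)
  also have "\<dots> = (\<rho> * k) * ((1 - \<rho>) * (1 + 4 * \<rho>\<^sup>2))" by simp
  also have "\<dots> \<le> (\<rho> * k) * 1"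
  proof (intro mult_left_mono)
    have "4 * \<rho> \<le> 1" using \<rho> by simp
    then have "\<rho> * (4 * \<rho>) \<le> \<rho> * 1" using \<rho> by (intro mult_left_mono) auto
    moreover have "0 \<le> \<rho> * (4 * \<rho> * \<rho>)" using \<rho> by auto
    ultimately show "(1 - \<rho>) * (1 + 4 * \<rho>\<^sup>2) \<le> 1" by (simp add: algebra_simps power2_eq_square)
  qed (use \<rho> k in auto)
  finally have vis: "\<bar>\<delta> * (R + r * \<delta>)\<bar> < \<rho> * k" by simp
  have absq: "\<bar>r\<bar> * \<bar>real_of_int q0\<bar> = q * \<bar>R + r * \<delta>\<bar>"
    using arg_cong[OF mv(2), of abs] q by (simp add: abs_mult)
  have q_lt: "real_of_int q < \<bar>real_of_int q0\<bar>"
  proof -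
    have "\<bar>r\<bar> * real_of_int q < (R / 2) * q" using r \<rho> R1 q by (intro mult_strict_right_mono) auto
    also have "\<dots> \<le> q * \<bar>R + r * \<delta>\<bar>" using z q by (simp add: mult_left_mono)
    finally show ?thesis unfolding absq[symmetric] using r0 by simp
  qed
  have q_le: "\<bar>real_of_int q0\<bar> \<le> Q"
  proof -
    have "\<rho>\<^sup>2 / 5 * \<bar>real_of_int q0\<bar> \<le> \<bar>r\<bar> * \<bar>real_of_int q0\<bar>" using r by (intro mult_right_mono) auto
    also have "\<dots> \<le> real_of_int q * (real_of_int R * 2)" unfolding absq using z(1) q R1 \<rho>2
      by (intro mult_left_mono order.trans[OF z(1)]) auto
    also have "\<dots> \<le> \<rho>\<^sup>2 / 5 * Q" using PR(3) q by (simp add: field_simps)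
    finally show ?thesis using \<rho> by simp
  qed
  have cop: "coprime p0 q0" using PR(1) coprime_move[OF ab, of p0 q0] by (simp flip: PR0)
  show ?thesis
  proof (cases "q0 > 0")
    case True
    then have "x \<in> visits e \<rho> p0 q0" using visits_eq[OF mv(1)] vis by (simp add: k_def)
    then show ?thesis using q_lt q_le True cop unfolding x_def by (intro exI[of _ p0] exI[of _ q0]) auto
  next
    case False
    then have neg: "q0 < 0" using q_lt q by (cases "q0 = 0") auto
    have "real_of_int (- q0) * (real_of_int (- q0) * x - real_of_int (- p0)) = \<delta> * (R + r * \<delta>)"
      using mv(1) by (simp add: algebra_simps)
    moreover have "wt e (- p0) (- q0) = k" unfolding k_def wt_def by auto
    ultimately have "x \<in> visits e \<rho> (- p0) (- q0)" using visits_eq[of "- q0" x "- p0"] vis neg by simp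
    then show ?thesis using q_lt q_le neg cop unfolding x_def by (intro exI[of _ "- p0"] exI[of _ "- q0"]) auto
  qed
qed

text \<open>The converse inclusion, with margin 1 + \<rho>. Now q < q' itself forces \<bar>r\<bar> <
  \<bar>R + r \<delta>\<bar>, which takes over the part of a lower bound on \<bar>r\<bar>.\<close>

lemma moved_of_later_visit:
  fixes r \<rho> Q :: real and a b p q p' q' :: int
  assumes ab: "a * p + b * q = - 1" and q: "q \<ge> 1" and \<rho>: "0 < \<rho>" "\<rho> \<le> 1 / 16"
    and r: "r \<noteq> 0" "\<bar>r\<bar> < 2 * \<rho>"
    and x: "p / q + r / (real_of_int q)\<^sup>2 \<in> visits e \<rho> p' q'"
    and pq: "coprime p' q'" "q < q'" "real_of_int q' \<le> Q"
  shows "\<exists>P R. coprime P R \<and> 1 \<le> R \<and> real_of_int R \<le> Q / q \<and>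
     a / q - 1 / r \<in> visits (move_class a b p q e) (\<rho> * (1 + \<rho>)) P R"
proof -
  define P R where PR0: "P = a * p' + b * q'" "R = q * p' - p * q'"
  define x' where "x' = p / q + r / (real_of_int q)\<^sup>2"
  define y where "y = a / q - 1 / r"
  define \<delta> where "\<delta> = R * y - P"
  have mv: "real_of_int q' * (q' * x' - p') = \<delta> * (R + r * \<delta>)" "r * q' = q * (R + r * \<delta>)"
    using move_fraction[OF ab q r(1), of q' p'] unfolding x'_def \<delta>_def y_def PR0 by auto
  define z where "z = R + r * \<delta>"
  define k where "k = wt e p' q'"
  have k: "1 \<le> k" "k \<le> 2" using wt_cases[of e p' q'] by (auto simp: k_def)
  have wPR: "wt (move_class a b p q e) P R = k" unfolding PR0 k_def by (rule wt_move_class[OF ab])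
  have q'0: "q' > 0" using pq q by simp
  have cop: "coprime P R" using pq(1) coprime_move[OF ab, of p' q'] by (simp add: PR0)
  \<comment> \<open>If R were 0, p'/q' would be p/q, contrary to q < q' for reduced
    fractions.\<close>
  have R0: "R \<noteq> 0"
  proof
    assume "R = 0"
    then have eq: "q * p' = p * q'" by (simp add: PR0)
    have "q' dvd q" using eq pq(1) by (metis coprime_commute coprime_dvd_mult_left_iff dvd_triv_right)
    then have "q' \<le> q" by (rule zdvd_imp_le) (use q in simp)
    then show False using pq(2) by simp
  qed
  then have R1: "\<bar>real_of_int R\<bar> \<ge> 1" by linarith
  have dz: "\<bar>\<delta>\<bar> * \<bar>z\<bar> < \<rho> * k"
    using x visits_eq[OF mv(1) q'0] unfolding x'_def k_def z_def by (simp add: abs_mult)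
  have "\<rho> * k \<le> \<rho> * 2" using \<rho> k by (intro mult_left_mono) auto
  then have dz2: "\<bar>\<delta>\<bar> * \<bar>z\<bar> < 2 * \<rho>" using dz by linarith
  have absq: "\<bar>r\<bar> * real_of_int q' = q * \<bar>z\<bar>"
    using arg_cong[OF mv(2), of abs] q q'0 by (simp add: abs_mult z_def)
  have rz: "\<bar>r\<bar> < \<bar>z\<bar>"
  proof -
    have "q * \<bar>r\<bar> < q' * \<bar>r\<bar>" using pq(2) r by (intro mult_strict_right_mono) auto
    then have "q * \<bar>r\<bar> < q * \<bar>z\<bar>" using absq by (simp add: mult.commute)
    then show ?thesis using q by simp
  qed
  \<comment> \<open>Bootstrapping: this crude bound keeps \<bar>z\<bar> above 1/2, which bounds
    \<delta> by \<open>4 * \<rho>\<close> and so improves the bound itself to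
    \<open>8 * \<rho>\<^sup>2\<close>.\<close>
  have rd: "\<bar>r * \<delta>\<bar> \<le> 2 * \<rho>"
    using mult_right_mono[of "\<bar>r\<bar>" "\<bar>z\<bar>" "\<bar>\<delta>\<bar>"] rz dz2 by (simp add: abs_mult mult.commute)
  have zR: "z = R + r * \<delta>" by (simp add: z_def)
  have z2: "\<bar>z\<bar> \<ge> \<bar>real_of_int R\<bar> - 2 * \<rho>" using rd zR by linarith
  then have "\<bar>z\<bar> \<ge> 1 / 2" using R1 \<rho> by linarith
  then have "\<bar>\<delta>\<bar> * (1 / 2) \<le> \<bar>\<delta>\<bar> * \<bar>z\<bar>" by (intro mult_left_mono) auto
  then have d: "\<bar>\<delta>\<bar> \<le> 4 * \<rho>" using dz2 by linarith
  have rd8: "\<bar>r * \<delta>\<bar> \<le> 8 * \<rho>\<^sup>2"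
    unfolding abs_mult using mult_mono[of "\<bar>r\<bar>" "2 * \<rho>" "\<bar>\<delta>\<bar>" "4 * \<rho>"] r d by (simp add: power2_eq_square)
  have "\<rho> * \<rho> \<le> 1 / 16 * (1 / 16)" using \<rho> by (intro mult_mono) auto
  then have \<rho>2: "\<rho>\<^sup>2 \<le> 1 / 256" by (simp add: power2_eq_square)
  have z3: "\<bar>z\<bar> \<ge> \<bar>real_of_int R\<bar> * (1 - 8 * \<rho>\<^sup>2)"
  proof -
    have "8 * \<rho>\<^sup>2 \<le> \<bar>real_of_int R\<bar> * (8 * \<rho>\<^sup>2)" using R1 mult_right_mono[of 1 "\<bar>real_of_int R\<bar>" "8 * \<rho>\<^sup>2"] by simp
    then show ?thesis using rd8 zR by (simp add: right_diff_distrib)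
  qed
  have vis: "\<bar>real_of_int R\<bar> * \<bar>\<delta>\<bar> < \<rho> * (1 + \<rho>) * k"
  proof -
    have "\<bar>real_of_int R\<bar> * \<bar>\<delta>\<bar> * (1 - 8 * \<rho>\<^sup>2) = \<bar>\<delta>\<bar> * (\<bar>real_of_int R\<bar> * (1 - 8 * \<rho>\<^sup>2))" by simp
    also have "\<dots> \<le> \<bar>\<delta>\<bar> * \<bar>z\<bar>" using z3 by (intro mult_left_mono) auto
    also have "\<dots> < \<rho> * k" by (rule dz)
    also have "\<dots> \<le> (\<rho> * k) * ((1 + \<rho>) * (1 - 8 * \<rho>\<^sup>2))"
    proof -
      have "8 * \<rho> + 8 * \<rho>\<^sup>2 \<le> 1" using \<rho> \<rho>2 by simp
      then have "\<rho> * (8 * \<rho> + 8 * \<rho>\<^sup>2) \<le> \<rho> * 1" using \<rho> by (intro mult_left_mono) auto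
      then have "1 \<le> (1 + \<rho>) * (1 - 8 * \<rho>\<^sup>2)" by (simp add: algebra_simps power2_eq_square)
      then have "(\<rho> * k) * 1 \<le> (\<rho> * k) * ((1 + \<rho>) * (1 - 8 * \<rho>\<^sup>2))" using \<rho> k by (intro mult_left_mono) auto
      then show ?thesis by simp
    qed
    also have "\<dots> = (\<rho> * (1 + \<rho>) * k) * (1 - 8 * \<rho>\<^sup>2)" by simp
    finally show ?thesis using \<rho>2 by (simp only: mult_less_cancel_right)
  qed
  have RQ: "\<bar>real_of_int R\<bar> \<le> Q / q"
  proof -
    have "q * (\<bar>real_of_int R\<bar> * (1 / 2)) \<le> q * \<bar>z\<bar>"
      using q \<rho>2 by (intro mult_left_mono order.trans[OF _ z3]) auto
    also have "\<dots> \<le> (1 / 8) * Q"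
      unfolding absq[symmetric] using r \<rho> pq q'0 by (intro mult_mono) auto
    finally have "q * \<bar>real_of_int R\<bar> \<le> Q" using pq q'0 by (simp add: field_simps)
    then show ?thesis using q by (simp add: field_simps)
  qed
  show ?thesis
  proof (cases "R > 0")
    case True
    have "y \<in> visits (move_class a b p q e) (\<rho> * (1 + \<rho>)) P R"
      using vis True unfolding visits_def mem_Collect_eq wPR \<delta>_def by simp
    then show ?thesis using True cop RQ unfolding y_def by (intro exI[of _ P] exI[of _ R]) auto
  next
    case False
    then have neg: "R < 0" using R0 by simp
    have "y \<in> visits (move_class a b p q e) (\<rho> * (1 + \<rho>)) (- P) (- R)"
      using vis neg unfolding visits_neg_frac mem_Collect_eq wPR \<delta>_def by simp
    then show ?thesis using neg cop RQ unfolding y_def by (intro exI[of _ "- P"] exI[of _ "- R"]) auto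
  qed
qed

lemma visits_interval:
  assumes "q \<ge> 1"
  shows "visits e \<rho> p q = {p / q - \<rho> * wt e p q / (real_of_int q)\<^sup>2 <..< p / q + \<rho> * wt e p q / (real_of_int q)\<^sup>2}"
proof -
  have q: "real_of_int q > 0" using assms by simp
  have *: "real_of_int q * \<bar>q * x - p\<bar> < \<rho> * wt e p q \<longleftrightarrow> \<bar>x - p / q\<bar> < \<rho> * wt e p q / (real_of_int q)\<^sup>2" for x :: real
  proof -
    have "q * x - p = q * (x - real_of_int p / q)" using q by (simp add: field_simps)
    then have "real_of_int q * \<bar>q * x - p\<bar> = (real_of_int q)\<^sup>2 * \<bar>x - p / q\<bar>"
      using q by (simp add: abs_mult power2_eq_square)
    then show ?thesis using q by (simp add: pos_less_divide_eq mult.commute)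
  qed
  have "\<bar>x - c\<bar> < w \<longleftrightarrow> x \<in> {c - w<..<c + w}" for x c w :: real by auto
  then show ?thesis unfolding visits_def * by blast
qed

lemma visits_near:
  assumes "q \<ge> 1" "0 < \<rho>" "x \<in> visits e \<rho> p q"
  shows "\<bar>x - p / q\<bar> < 2 * \<rho>"
proof -
  have "\<rho> * wt e p q / (real_of_int q)\<^sup>2 \<le> \<rho> * 2 / 1"
    using assms wt_cases[of e p q] by (intro frac_le mult_left_mono) (auto simp: one_le_power)
  moreover have "\<bar>x - p / q\<bar> < \<rho> * wt e p q / (real_of_int q)\<^sup>2"
    using assms(3) unfolding visits_interval[OF assms(1)] greaterThanLessThan_iff by linarith
  ultimately show ?thesis by linarith
qed

lemma bounded_visits: "q \<ge> 1 \<Longrightarrow> bounded (visits e \<rho> p q)"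
  by (subst visits_interval) auto

lemma last_visit_subset: "last_visit e Q \<rho> p q \<subseteq> visits e \<rho> p q"
  by (auto simp: last_visit_def)

lemma bounded_last_visit: "q \<ge> 1 \<Longrightarrow> bounded (last_visit e Q \<rho> p q)"
  using bounded_subset[OF bounded_visits last_visit_subset] .

lemma measure_reflect:
  fixes S :: "real set"
  assumes "S \<in> sets borel"
  shows "measure lborel {x. - x \<in> S} = measure lborel S"
  using measure_lborel_affine[OF assms, of "-1" 0] by simp

text \<open>In the coordinate r = q^2 (x - p/q) the visit is an interval around 0, and the absence
  of later visits says that a/q - 1/r avoids all visits of the moved class. As r is O(\<rho>),
  \<open>inversion_blocks\<close> applies with U = 1 / (\<rho> wt), so the proportion is
  \<open>avoid_prob\<close> up to O(\<rho>). \<open>W\<close> is the length of the visit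
  interval.\<close>

lemma measure_last_visit:
  fixes \<rho> Q :: real and a b p q :: int and e :: "int \<times> int"
  assumes ab: "a * p + b * q = - 1" and q: "q \<ge> 1" and \<rho>: "0 < \<rho>" "\<rho> \<le> 1 / 16"
  defines "e' \<equiv> move_class a b p q e" and "W \<equiv> 2 * \<rho> * wt e p q / (real_of_int q)\<^sup>2"
  shows "measure lborel (last_visit e Q \<rho> p q) \<le>
      W * (avoid_prob e' (\<rho>\<^sup>2 / 10 * Q / q) (\<rho> * (1 - \<rho>)) + 9 * \<rho>)" (is ?upper)
    and "W * (avoid_prob e' (Q / q) (\<rho> * (1 + \<rho>)) - 5 * \<rho>) \<le> measure lborel (last_visit e Q \<rho> p q)" (is ?lower)
proof -
  define k where "k = wt e p q"
  have k: "1 \<le> k" "k \<le> 2" using wt_cases[of e p q] by (auto simp: k_def)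
  have q0: "real_of_int q > 0" using q by simp
  define X where "X = (\<lambda>r::real. real_of_int p / real_of_int q + r / (real_of_int q)\<^sup>2)"
  define L where "L = {r. X r \<in> last_visit e Q \<rho> p q}"
  have [measurable]: "X \<in> borel_measurable borel" unfolding X_def by measurable
  have L_borel[measurable]: "L \<in> sets borel" unfolding L_def by measurable
  have vis: "X r \<in> visits e \<rho> p q \<longleftrightarrow> \<bar>r\<bar> < \<rho> * k" for r
  proof -
    have "real_of_int q * (q * X r - p) = r" using q0 by (simp add: X_def field_simps power2_eq_square)
    from visits_eq[OF this] q show ?thesis by (simp add: k_def)
  qed
  have ms: "measure lborel (last_visit e Q \<rho> p q) = measure lborel L / (real_of_int q)\<^sup>2"
    using measure_lborel_affine[OF last_visit_borel, where c = "1 / (real_of_int q)\<^sup>2" and t = "real_of_int p / real_of_int q"] q0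
    by (simp add: L_def X_def)
  define U where "U = 1 / (\<rho> * k)"
  \<comment> \<open>The blocks reach down to \<bar>r\<bar> = 1/M with M between
    \<open>2 / \<rho>\<^sup>2\<close> and \<open>5 / \<rho>\<^sup>2\<close>: large enough for the
    omitted middle to have measure O(\<rho>^2), small enough for the lower bound on \<bar>r\<bar> in
    \<open>later_visit_of_moved\<close>.\<close>
  define m where "m = nat \<lceil>1 / \<rho>\<^sup>2\<rceil>"
  define M where "M = U + 2 * real m"
  have \<rho>k: "0 < \<rho> * k" "\<rho> * k \<le> 1 / 8"
  proof -
    show "0 < \<rho> * k" using \<rho> k by simp
    have "\<rho> * k \<le> 1 / 16 * 2" using \<rho> k by (intro mult_mono) auto
    then show "\<rho> * k \<le> 1 / 8" by simp
  qed
  have "\<rho> * k \<le> \<rho> * 2" using \<rho> k by (intro mult_left_mono) auto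
  then have \<rho>k2: "\<rho> * k \<le> 2 * \<rho>" by simp
  have U: "U \<ge> 8" "1 / U = \<rho> * k" using \<rho>k by (auto simp: U_def field_simps)
  have \<rho>2: "\<rho>\<^sup>2 > 0" using \<rho> by simp
  have "real m \<ge> 1 / \<rho>\<^sup>2" unfolding m_def by (rule real_nat_ceiling_ge)
  then have M: "2 / \<rho>\<^sup>2 \<le> M" "U \<le> M" using U unfolding M_def by auto
  have "real m \<le> 1 / \<rho>\<^sup>2 + 1" unfolding m_def using \<rho>2 by (simp add: of_nat_ceiling)
  moreover have "U \<le> 1 / \<rho>\<^sup>2"
  proof -
    have "\<rho>\<^sup>2 \<le> \<rho> * k" using \<rho> k by (simp add: power2_eq_square mult_left_mono)
    then show ?thesis unfolding U_def using \<rho>2 \<rho>(1) k by (intro divide_left_mono mult_pos_pos) auto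
  qed
  moreover have "2 \<le> 1 / \<rho>\<^sup>2"
  proof -
    have "\<rho> * \<rho> \<le> 1 / 16 * (1 / 16)" using \<rho> by (intro mult_mono) auto
    then show ?thesis using \<rho>2 by (simp add: power2_eq_square field_simps)
  qed
  ultimately have M5: "M \<le> 5 / \<rho>\<^sup>2" unfolding M_def by simp
  have Mpos: "M > 0" using M U by linarith
  have rM: "\<rho>\<^sup>2 / 5 \<le> 1 / M" "1 / M \<le> \<rho>\<^sup>2 / 2" using M M5 Mpos \<rho>2 by (auto simp: field_simps)

  define half where "half = (\<lambda>N h. {r. 1 / M < r \<and> r \<le> 1 / U \<and> h - 1 / r \<in> N})"
  define h where "h = real_of_int a / q"
  have half_b[measurable]: "half N t \<in> sets borel" if [measurable]: "N \<in> sets borel" for N t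
    unfolding half_def by measurable
  have half_bd: "bounded (half N t)" for N t
    by (rule bounded_subset[of "{1/M..1/U}"]) (auto simp: half_def)
  have nhalf_bd: "bounded {r. - r \<in> half N t}" for N t
    by (rule bounded_subset[of "{-1/U..-1/M}"]) (auto simp: half_def)
  \<comment> \<open>Negative r are reflected: since the avoiding set is symmetric, they become
    positive r with - h in place of h.\<close>
  have neg_half: "{r. - r \<in> half (avoid e1 Q1 \<rho>1) (- h)} =
      {r. 1 / M < - r \<and> - r \<le> 1 / U \<and> h - 1 / r \<in> avoid e1 Q1 \<rho>1}" for e1 Q1 \<rho>1
  proof -
    have "- h - 1 / (- r) = - (h - 1 / r)" for r by simp
    then show ?thesis unfolding half_def mem_Collect_eq by (simp only: avoid_uminus)
  qed
  have blocks: "measure lborel (half (avoid e1 Q1 \<rho>1) t) \<le> avoid_prob e1 Q1 \<rho>1 * (1 / (U - 2))"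
      "avoid_prob e1 Q1 \<rho>1 * (1 / (U + 2) - 1 / (M + 2)) \<le> measure lborel (half (avoid e1 Q1 \<rho>1) t)" for e1 Q1 \<rho>1 t
  proof -
    have "measure lborel (half (avoid e1 Q1 \<rho>1) t) \<le> avoid_prob e1 Q1 \<rho>1 * (1 / (U - 2) - 1 / (M - 2))"
      using inversion_blocks(1)[OF avoid_periodic2 avoid_borel, where U = U and k = m and h = t] U
      by (simp add: half_def avoid_prob_def M_def)
    also have "\<dots> \<le> avoid_prob e1 Q1 \<rho>1 * (1 / (U - 2))"
      using avoid_prob_bounds M U by (intro mult_left_mono) auto
    finally show "measure lborel (half (avoid e1 Q1 \<rho>1) t) \<le> avoid_prob e1 Q1 \<rho>1 * (1 / (U - 2))" .
    show "avoid_prob e1 Q1 \<rho>1 * (1 / (U + 2) - 1 / (M + 2)) \<le> measure lborel (half (avoid e1 Q1 \<rho>1) t)"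
      using inversion_blocks(2)[OF avoid_periodic2 avoid_borel, where U = U and k = m and h = t] U
      by (simp add: half_def avoid_prob_def M_def)
  qed

  have "\<rho> * \<rho> \<le> \<rho> * (\<rho> * k)" using \<rho> k by (intro mult_left_mono) auto
  then have \<rho>\<rho>k: "\<rho>\<^sup>2 \<le> \<rho> * (\<rho> * k)" by (simp add: power2_eq_square)

  show ?upper
  proof -
    define N where "N = avoid e' (\<rho>\<^sup>2 / 10 * Q / q) (\<rho> * (1 - \<rho>))"
    define \<pi> where "\<pi> = avoid_prob e' (\<rho>\<^sup>2 / 10 * Q / q) (\<rho> * (1 - \<rho>))"
    have \<pi>: "0 \<le> \<pi>" "\<pi> \<le> 1" using avoid_prob_bounds by (auto simp: \<pi>_def)
    have [measurable]: "N \<in> sets borel" by (simp add: N_def)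
    have "L \<subseteq> {-1/M..1/M} \<union> (half N h \<union> {r. - r \<in> half N (- h)})"
    proof
      fix r assume r: "r \<in> L"
      then have rU: "\<bar>r\<bar> < 1 / U" using vis[of r] U(2) last_visit_subset[of e Q \<rho> p q] unfolding L_def by auto
      show "r \<in> {-1/M..1/M} \<union> (half N h \<union> {r. - r \<in> half N (- h)})"
      proof (cases "\<bar>r\<bar> \<le> 1 / M")
        case False
        have "h - 1 / r \<in> N"
        proof (rule ccontr)
          assume "h - 1 / r \<notin> N"
          then obtain P R where PR: "coprime P R" "1 \<le> R" "real_of_int R \<le> \<rho>\<^sup>2 / 10 * Q / q"
            "h - 1 / r \<in> visits e' (\<rho> * (1 - \<rho>)) P R" unfolding N_def avoid_def by blast
          have "\<bar>r\<bar> < 2 * \<rho>" using rU \<rho>k2 unfolding U(2) by linarith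
          moreover have "\<rho>\<^sup>2 / 5 \<le> \<bar>r\<bar>" using False rM by linarith
          ultimately show False
            using later_visit_of_moved[OF ab q \<rho>, of r e P R Q] PR r
            unfolding L_def X_def last_visit_def e'_def h_def by blast
        qed
        moreover have "1 / M < r \<or> 1 / M < - r" using False by auto
        ultimately have "r \<in> half N h \<or> r \<in> {r. 1 / M < - r \<and> - r \<le> 1 / U \<and> h - 1 / r \<in> N}"
          using rU unfolding half_def mem_Collect_eq by linarith
        then show ?thesis unfolding N_def neg_half by blast
      qed auto
    qed
    then have "measure lborel L \<le> measure lborel {-1/M..1/M} + measure lborel (half N h \<union> {r. - r \<in> half N (- h)})"
      using half_bd nhalf_bd by (intro measure_lborel_subadditive) auto
    also have "measure lborel (half N h \<union> {r. - r \<in> half N (- h)}) \<le> measure lborel (half N h) + measure lborel {r. - r \<in> half N (- h)}"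
      using half_bd nhalf_bd by (intro measure_lborel_subadditive) auto
    also have "measure lborel {r. - r \<in> half N (- h)} = measure lborel (half N (- h))"
      by (rule measure_reflect) simp
    also have "measure lborel {-1/M..1/M} = 2 / M" using Mpos by simp
    finally have "measure lborel L \<le> 2 / M + 2 * (\<pi> * (1 / (U - 2)))"
      using blocks(1)[of e' "\<rho>\<^sup>2 / 10 * Q / q" "\<rho> * (1 - \<rho>)" h]
        blocks(1)[of e' "\<rho>\<^sup>2 / 10 * Q / q" "\<rho> * (1 - \<rho>)" "- h"]
      unfolding N_def \<pi>_def by linarith
    moreover have "2 / M \<le> \<rho>\<^sup>2" using rM by simp
    moreover have "1 / (U - 2) \<le> \<rho> * k * (1 + 8 * \<rho>)"
    proof -
      define z where "z = \<rho> * k"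
      have z: "0 < z" "z \<le> 1 / 8" "z \<le> 2 * \<rho>" using \<rho>k \<rho> k by (auto simp: z_def mult.commute)
      have "1 / (U - 2) = z / (1 - 2 * z)" using z unfolding U_def z_def[symmetric] by (simp add: field_simps)
      also have "\<dots> \<le> z * (1 + 4 * z)"
        using z by (simp add: field_simps)
      also have "\<dots> \<le> z * (1 + 8 * \<rho>)" using z by (intro mult_left_mono) auto
      finally show ?thesis by (simp add: z_def)
    qed
    then have "\<pi> * (1 / (U - 2)) \<le> \<pi> * (\<rho> * k * (1 + 8 * \<rho>))" using \<pi> by (intro mult_left_mono) auto
    moreover have "\<pi> * (\<rho> * k * (1 + 8 * \<rho>)) \<le> \<rho> * k * (\<pi> + 8 * \<rho>)"
    proof -
      have "\<pi> * (\<rho> * k * (8 * \<rho>)) \<le> 1 * (\<rho> * k * (8 * \<rho>))" using \<pi> \<rho>k \<rho> by (intro mult_right_mono) auto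
      then show ?thesis by (simp add: algebra_simps)
    qed
    ultimately have "measure lborel L \<le> \<rho>\<^sup>2 + 2 * (\<rho> * k * (\<pi> + 8 * \<rho>))" by linarith
    also have "\<dots> \<le> 2 * \<rho> * k * (\<pi> + 9 * \<rho>)"
    proof -
      have "\<rho>\<^sup>2 \<le> 2 * (\<rho> * (\<rho> * k))" using \<rho>\<rho>k zero_le_power2[of \<rho>] by linarith
      then show ?thesis by (simp add: algebra_simps)
    qed
    finally have "measure lborel L / (real_of_int q)\<^sup>2 \<le> 2 * \<rho> * k * (\<pi> + 9 * \<rho>) / (real_of_int q)\<^sup>2"
      by (intro divide_right_mono) auto
    then show ?thesis unfolding ms W_def k_def \<pi>_def by (simp add: field_simps)
  qed

  show ?lower
  proof -
    define N where "N = avoid e' (Q / q) (\<rho> * (1 + \<rho>))"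
    define \<pi> where "\<pi> = avoid_prob e' (Q / q) (\<rho> * (1 + \<rho>))"
    have \<pi>: "0 \<le> \<pi>" "\<pi> \<le> 1" using avoid_prob_bounds by (auto simp: \<pi>_def)
    have [measurable]: "N \<in> sets borel" by (simp add: N_def)
    \<comment> \<open>The blocks contain their endpoint 1/U, the open visit interval does not; the
      two points are null.\<close>
    have sub: "half N h \<union> {r. - r \<in> half N (- h)} \<subseteq> L \<union> {1/U, -1/U}"
    proof
      fix r assume r: "r \<in> half N h \<union> {r. - r \<in> half N (- h)}"
      then have rr0: "h - 1 / r \<in> N" "1 / M < r \<and> r \<le> 1 / U \<or> 1 / M < - r \<and> - r \<le> 1 / U"
        unfolding N_def neg_half by (auto simp: half_def)
      have "0 < 1 / M" using Mpos by simp
      then have rr: "h - 1 / r \<in> N" "1 / M < \<bar>r\<bar>" "\<bar>r\<bar> \<le> 1 / U"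
        using rr0 by linarith+
      show "r \<in> L \<union> {1/U, -1/U}"
      proof (cases "\<bar>r\<bar> = 1 / U")
        case False
        then have rU: "\<bar>r\<bar> < \<rho> * k" using rr U(2) by simp
        have r0: "r \<noteq> 0" using rr Mpos by auto
        have "r \<in> L"
        proof (rule ccontr)
          assume "r \<notin> L"
          then obtain p' q' where pq: "coprime p' q'" "q < q'" "real_of_int q' \<le> Q" "X r \<in> visits e \<rho> p' q'"
            using vis rU unfolding L_def last_visit_def by blast
          have "\<bar>r\<bar> < 2 * \<rho>" using rU \<rho>k2 by linarith
          then show False using moved_of_later_visit[OF ab q \<rho> r0 _ _ pq(1-3), of e] pq(4) rr(1)
            unfolding X_def N_def avoid_def e'_def h_def by blast
        qed
        then show ?thesis by simp
      qed auto
    qed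
    have bdL: "bounded L"
    proof (rule bounded_subset[of "{-(\<rho>*k)..\<rho>*k}"])
      show "L \<subseteq> {-(\<rho>*k)..\<rho>*k}"
      proof
        fix r assume "r \<in> L"
        then have "X r \<in> visits e \<rho> p q" using last_visit_subset[of e Q \<rho> p q] unfolding L_def by blast
        then show "r \<in> {-(\<rho>*k)..\<rho>*k}" unfolding vis by auto
      qed
    qed simp
    have "half N h \<inter> {r. - r \<in> half N (- h)} = {}"
    proof -
      have "\<not> (1 / M < r \<and> 1 / M < - r)" for r using divide_pos_pos[OF zero_less_one Mpos] by linarith
      then show ?thesis unfolding half_def by blast
    qed
    then have "measure lborel (half N h) + measure lborel {r. - r \<in> half N (- h)} =
        measure lborel (half N h \<union> {r. - r \<in> half N (- h)})"
      using half_bd nhalf_bd by (subst measure_lborel_Un_disjoint) auto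
    also have "\<dots> \<le> measure lborel L + measure lborel {1/U, -1/U}"
      using sub bdL by (intro measure_lborel_subadditive) auto
    also have "measure lborel {1/U, -1/U} = 0"
      by (simp add: measure_def emeasure_lborel_countable)
    also have "measure lborel {r. - r \<in> half N (- h)} = measure lborel (half N (- h))"
      by (rule measure_reflect) simp
    finally have "2 * (\<pi> * (1 / (U + 2) - 1 / (M + 2))) \<le> measure lborel L"
      using blocks(2)[of e' "Q / q" "\<rho> * (1 + \<rho>)" h] blocks(2)[of e' "Q / q" "\<rho> * (1 + \<rho>)" "- h"]
      unfolding N_def \<pi>_def by linarith
    moreover have "\<rho> * k * (1 - 4 * \<rho>) - \<rho>\<^sup>2 / 2 \<le> 1 / (U + 2) - 1 / (M + 2)"
    proof -
      define z where "z = \<rho> * k"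
      have z: "0 < z" "z \<le> 1 / 8" "z \<le> 2 * \<rho>" using \<rho>k \<rho> k by (auto simp: z_def mult.commute)
      have "z * (1 - 4 * \<rho>) \<le> z * (1 - 2 * z)" using z by (intro mult_left_mono) auto
      also have "\<dots> \<le> z / (1 + 2 * z)"
        using z by (simp add: field_simps)
      also have "\<dots> = 1 / (U + 2)" using z unfolding U_def z_def[symmetric] by (simp add: field_simps)
      finally have "z * (1 - 4 * \<rho>) \<le> 1 / (U + 2)" .
      moreover have "1 / (M + 2) \<le> 1 / M" using Mpos by (simp add: field_simps)
      ultimately show ?thesis using rM unfolding z_def by linarith
    qed
    then have "\<pi> * (\<rho> * k * (1 - 4 * \<rho>) - \<rho>\<^sup>2 / 2) \<le> \<pi> * (1 / (U + 2) - 1 / (M + 2))"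
      using \<pi> by (intro mult_left_mono) auto
    moreover have "\<rho> * k * (\<pi> - 5 * \<rho>) \<le> \<pi> * (\<rho> * k * (1 - 4 * \<rho>) - \<rho>\<^sup>2 / 2)"
    proof -
      have "\<pi> * (\<rho> * k * (4 * \<rho>)) \<le> 1 * (\<rho> * k * (4 * \<rho>))" using \<pi> \<rho>k \<rho> by (intro mult_right_mono) auto
      moreover have "\<pi> * (\<rho>\<^sup>2 / 2) \<le> 1 * (\<rho>\<^sup>2 / 2)" using \<pi> \<rho>k \<rho> by (intro mult_right_mono) auto
      moreover have "\<rho>\<^sup>2 / 2 \<le> \<rho> * (\<rho> * k)" using \<rho>\<rho>k zero_le_power2[of \<rho>] by linarith
      ultimately show ?thesis by (simp add: algebra_simps)
    qed
    ultimately have "2 * \<rho> * k * (\<pi> - 5 * \<rho>) \<le> measure lborel L" by linarith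
    then have "2 * \<rho> * k * (\<pi> - 5 * \<rho>) / (real_of_int q)\<^sup>2 \<le> measure lborel L / (real_of_int q)\<^sup>2"
      by (intro divide_right_mono) auto
    then show ?thesis unfolding ms W_def k_def \<pi>_def by (simp add: field_simps)
  qed
qed

section \<open>The limit law for avoiding all visits\<close>

definition frac_mass :: "int \<times> int \<Rightarrow> real \<Rightarrow> real \<Rightarrow> real \<Rightarrow> real" where
  "frac_mass e u v Q = (\<Sum>(p, q)\<in>fracs {u..<v} Q. wt e p q / (real_of_int q)\<^sup>2)"

lemma measure_visits:
  assumes "q \<ge> 1" "0 \<le> \<rho>"
  shows "measure lborel (visits e \<rho> p q) = 2 * \<rho> * wt e p q / (real_of_int q)\<^sup>2"
proof -
  have "0 \<le> \<rho> * wt e p q / (real_of_int q)\<^sup>2" using assms by (simp add: wt_def)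
  moreover have "measure lborel {c - w<..<c + w} = 2 * w" if "0 \<le> w" for c w :: real using that by simp
  ultimately show ?thesis unfolding visits_interval[OF assms(1)] by simp
qed

text \<open>A union bound: a point that avoids the smaller family but not the larger lies in some
  visit interval minus the part already excluded. Visit intervals that meet [0, 2) have radius at
  most 1/2, so their centres lie in [-1, 3).\<close>

lemma avoid_prob_diff:
  assumes \<rho>: "0 < \<rho>1" "\<rho>1 \<le> \<rho>2" "\<rho>2 \<le> 1 / 4" and Q: "Q1 \<le> Q2"
  shows "avoid_prob e Q1 \<rho>1 - avoid_prob e Q2 \<rho>2 \<le> \<rho>2 * frac_mass e (-1) 3 Q2 - \<rho>1 * frac_mass e (-1) 3 Q1"
proof -
  define F where "F = fracs {-1..<3} Q2"
  define V where "V = (\<lambda>(p, q). visits e \<rho>2 p q - (if real_of_int q \<le> Q1 then visits e \<rho>1 p q else {}))"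
  have fin: "finite F" unfolding F_def by (rule fracs_finite)
  have mono: "visits e \<rho>1 p q \<subseteq> visits e \<rho>2 p q" for p q
  proof -
    have "\<rho>1 * wt e p q \<le> \<rho>2 * wt e p q" using \<rho> by (intro mult_right_mono) (auto simp: wt_def)
    then show ?thesis by (auto simp: visits_def)
  qed
  have sub: "avoid e Q1 \<rho>1 \<inter> {0..<2} \<subseteq> (avoid e Q2 \<rho>2 \<inter> {0..<2}) \<union> (\<Union>x\<in>F. V x)"
  proof
    fix x assume x: "x \<in> avoid e Q1 \<rho>1 \<inter> {0..<2}"
    show "x \<in> (avoid e Q2 \<rho>2 \<inter> {0..<2}) \<union> (\<Union>x\<in>F. V x)"
    proof (cases "x \<in> avoid e Q2 \<rho>2")
      case False
      then obtain p q where pq: "coprime p q" "1 \<le> q" "real_of_int q \<le> Q2" "x \<in> visits e \<rho>2 p q"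
        by (auto simp: avoid_def)
      have "\<bar>x - p / q\<bar> < 2 * \<rho>2" using visits_near[OF pq(2) _ pq(4)] \<rho> by simp
      then have "real_of_int p / q \<in> {-1..<3}" using x \<rho> by auto
      then have "(p, q) \<in> F" using pq by (auto simp: F_def fracs_def)
      moreover have "x \<in> V (p, q)" using x pq by (auto simp: V_def avoid_def)
      ultimately show ?thesis by blast
    qed (use x in auto)
  qed
  have V_b: "V x \<in> sets borel" for x by (auto simp: V_def split: prod.split)
  have V_bd: "bounded (V x)" if "x \<in> F" for x
  proof -
    from that obtain p q where x: "x = (p, q)" "q \<ge> 1" by (auto simp: F_def fracs_def)
    show ?thesis by (rule bounded_subset[OF bounded_visits[OF x(2), of e \<rho>2 p]]) (auto simp: x V_def)
  qed
  have "measure lborel (avoid e Q1 \<rho>1 \<inter> {0..<2}) \<le> measure lborel (avoid e Q2 \<rho>2 \<inter> {0..<2}) + measure lborel (\<Union>x\<in>F. V x)"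
    using sub V_bd V_b fin
    by (intro measure_lborel_subadditive) (auto intro: bounded_subset[of "{0..2}"] intro!: sets.finite_UN)
  also have "measure lborel (\<Union>x\<in>F. V x) \<le> (\<Sum>x\<in>F. measure lborel (V x))"
    using V_b V_bd emeasure_bounded_finite fin by (intro measure_UNION_le) (auto simp: less_top)
  also have "\<dots> = (\<Sum>(p, q)\<in>F. 2 * \<rho>2 * wt e p q / (real_of_int q)\<^sup>2 -
      (if real_of_int q \<le> Q1 then 2 * \<rho>1 * wt e p q / (real_of_int q)\<^sup>2 else 0))"
  proof (intro sum.cong refl)
    fix x assume "x \<in> F"
    then obtain p q where x: "x = (p, q)" "q \<ge> 1" by (auto simp: F_def fracs_def)
    have "measure lborel (visits e \<rho>2 p q - visits e \<rho>1 p q) = measure lborel (visits e \<rho>2 p q) - measure lborel (visits e \<rho>1 p q)"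
      using mono emeasure_bounded_finite[OF bounded_visits[OF x(2)]]
      by (intro measure_Diff) (auto simp: less_top)
    then show "measure lborel (V x) = (case x of (p, q) \<Rightarrow> 2 * \<rho>2 * wt e p q / (real_of_int q)\<^sup>2 -
      (if real_of_int q \<le> Q1 then 2 * \<rho>1 * wt e p q / (real_of_int q)\<^sup>2 else 0))"
      using measure_visits[OF x(2)] \<rho> by (simp add: x V_def)
  qed
  also have "\<dots> = 2 * \<rho>2 * frac_mass e (-1) 3 Q2 - 2 * \<rho>1 * frac_mass e (-1) 3 Q1"
  proof -
    have "(\<Sum>(p, q)\<in>F. if real_of_int q \<le> Q1 then 2 * \<rho>1 * wt e p q / (real_of_int q)\<^sup>2 else 0) =
        (\<Sum>(p, q)\<in>fracs {-1..<3} Q1. 2 * \<rho>1 * wt e p q / (real_of_int q)\<^sup>2)"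
      by (rule sum.mono_neutral_cong_right[OF fin]) (use Q in \<open>auto simp: F_def fracs_def split: if_splits\<close>)
    then show ?thesis unfolding frac_mass_def F_def[symmetric]
      by (simp add: sum_subtractf sum_distrib_left split_beta' mult.assoc)
  qed
  finally show ?thesis by (simp add: avoid_prob_def diff_divide_distrib[symmetric])
qed

lemma last_visit_exists:
  assumes "x \<notin> avoid e Q \<rho>"
  obtains p q where "coprime p q" "1 \<le> q" "real_of_int q \<le> Q" "x \<in> last_visit e Q \<rho> p q"
proof -
  define S where "S = {q. 1 \<le> q \<and> real_of_int q \<le> Q \<and> (\<exists>p. coprime p q \<and> x \<in> visits e \<rho> p q)}"
  have "S \<subseteq> {1..\<lfloor>Q\<rfloor>}" by (auto simp: S_def le_floor_iff)
  then have fin: "finite S" by (rule finite_subset) simp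
  have ne: "S \<noteq> {}" using assms by (auto simp: S_def avoid_def)
  have "Max S \<in> S" using fin ne by (rule Max_in)
  then obtain p where p: "1 \<le> Max S" "real_of_int (Max S) \<le> Q" "coprime p (Max S)" "x \<in> visits e \<rho> p (Max S)"
    by (auto simp: S_def)
  have "x \<in> last_visit e Q \<rho> p (Max S)"
    unfolding last_visit_def
  proof safe
    fix p' q' assume "coprime p' q'" "Max S < q'" "real_of_int q' \<le> Q" "x \<in> visits e \<rho> p' q'"
    then have "q' \<in> S" using p(1) by (auto simp: S_def)
    then show False using Max_ge[OF fin] \<open>Max S < q'\<close> by fastforce
  qed (rule p)
  then show ?thesis using that p by blast
qed

text \<open>Maximality gives equal denominators. Then \<open>\<rho> \<le> 1 / 16\<close> puts both
  numerators within 1/2 of q x.\<close>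

lemma last_visit_unique:
  assumes \<rho>: "0 < \<rho>" "\<rho> \<le> 1 / 16"
    and 1: "coprime p q" "1 \<le> q" "real_of_int q \<le> Q" "x \<in> last_visit e Q \<rho> p q"
    and 2: "coprime p' q'" "1 \<le> q'" "real_of_int q' \<le> Q" "x \<in> last_visit e Q \<rho> p' q'"
  shows "p = p' \<and> q = q'"
proof -
  have q: "q = q'"
    using 1 2 unfolding last_visit_def by (metis (no_types, lifting) linorder_neqE mem_Collect_eq)
  have near: "\<bar>q * x - p\<bar> < 1 / 2" if "x \<in> visits e \<rho> p q" for p
  proof -
    have "1 * \<bar>q * x - p\<bar> \<le> q * \<bar>q * x - p\<bar>" using 1(2) by (intro mult_right_mono) auto
    also have "\<dots> < \<rho> * wt e p q" using that by (simp add: visits_def)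
    also have "\<dots> \<le> 1 / 16 * 2" using \<rho> by (intro mult_mono) (auto simp: wt_def)
    finally show ?thesis by simp
  qed
  have "\<bar>real_of_int p - real_of_int p'\<bar> < 1"
  proof -
    have "x \<in> visits e \<rho> p q" "x \<in> visits e \<rho> p' q" using 1(4) 2(4) q by (auto simp: last_visit_def)
    from near[OF this(1)] near[OF this(2)] show ?thesis by linarith
  qed
  then have "p = p'" by linarith
  then show ?thesis using q by simp
qed

text \<open>The avoiding set and the disjoint last-visit sets partition [u, v) except near its ends:
  a visit interval reaches at most 2 \<rho> from its centre, so each end spoils a set of measure at
  most 4 \<rho>.\<close>

lemma renewal:
  assumes \<rho>: "0 < \<rho>" "\<rho> \<le> 1 / 16" and uv: "u \<le> v"
  shows "\<bar>measure lborel (avoid e Q \<rho> \<inter> {u..<v}) +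
     (\<Sum>(p, q)\<in>fracs {u..<v} Q. measure lborel (last_visit e Q \<rho> p q)) - (v - u)\<bar> \<le> 8 * \<rho>"
proof -
  define F where "F = fracs {u..<v} Q"
  define L where "L = (\<lambda>(p, q). last_visit e Q \<rho> p q)"
  define E where "E = {u - 2 * \<rho>..u + 2 * \<rho>} \<union> {v - 2 * \<rho>..v + 2 * \<rho>}"
  define A where "A = avoid e Q \<rho> \<inter> {u..<v}"
  have [measurable]: "A \<in> sets borel" by (simp add: A_def)
  have fin: "finite F" unfolding F_def by (rule fracs_finite)
  have L_b[measurable]: "L x \<in> sets borel" for x by (auto simp: L_def split: prod.split)
  have L_bd: "bounded (L x)" if "x \<in> F" for x
  proof -
    from that obtain p q where x: "x = (p, q)" "q \<ge> 1" by (auto simp: F_def fracs_def)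
    show ?thesis using bounded_last_visit[OF x(2), of e Q \<rho> p] by (simp add: x L_def)
  qed
  have LU_b[measurable]: "(\<Union>x\<in>F. L x) \<in> sets borel" using fin by (intro sets.finite_UN) auto
  have LU_bd: "bounded (\<Union>x\<in>F. L x)" using fin L_bd by auto
  have A_bd: "bounded A" by (rule bounded_subset[of "{u..v}"]) (auto simp: A_def)
  have near: "\<bar>x - p / q\<bar> < 2 * \<rho>" if "1 \<le> q" "x \<in> last_visit e Q \<rho> p q" for x p q
    using visits_near[OF that(1) \<rho>(1)] that(2) last_visit_subset by blast
  have E_m: "measure lborel E \<le> 8 * \<rho>" "bounded E" "E \<in> sets borel"
  proof -
    have "measure lborel E \<le> measure lborel {u - 2 * \<rho>..u + 2 * \<rho>} + measure lborel {v - 2 * \<rho>..v + 2 * \<rho>}"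
      unfolding E_def by (rule measure_lborel_subadditive) auto
    then show "measure lborel E \<le> 8 * \<rho>" using \<rho> by simp
  qed (auto simp: E_def)
  have disj: "A \<inter> (\<Union>x\<in>F. L x) = {}"
    by (auto simp: A_def F_def L_def avoid_def fracs_def last_visit_def)
  have disjF: "disjoint_family_on L F"
    unfolding disjoint_family_on_def
  proof (intro ballI impI)
    fix a b assume ab: "a \<in> F" "b \<in> F" "a \<noteq> b"
    obtain p q p' q' where pq: "a = (p, q)" "b = (p', q')" by (cases a, cases b)
    show "L a \<inter> L b = {}"
    proof (rule ccontr)
      assume "L a \<inter> L b \<noteq> {}"
      then obtain x where "x \<in> last_visit e Q \<rho> p q" "x \<in> last_visit e Q \<rho> p' q'" by (auto simp: L_def pq)
      then show False using last_visit_unique[OF \<rho>, of p q Q x e p' q'] ab by (auto simp: pq F_def fracs_def)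
    qed
  qed
  have "measure lborel (\<Union>x\<in>F. L x) = (\<Sum>x\<in>F. measure lborel (L x))"
    using fin disjF L_bd emeasure_bounded_finite
    by (intro measure_finite_Union) (auto simp: less_top)
  then have mU: "measure lborel (A \<union> (\<Union>x\<in>F. L x)) = measure lborel A + (\<Sum>x\<in>F. measure lborel (L x))"
    using disj A_bd LU_bd by (simp add: measure_lborel_Un_disjoint)
  have "{u..<v} \<subseteq> (A \<union> (\<Union>x\<in>F. L x)) \<union> E"
  proof
    fix x assume x: "x \<in> {u..<v}"
    show "x \<in> (A \<union> (\<Union>x\<in>F. L x)) \<union> E"
    proof (cases "x \<in> avoid e Q \<rho>")
      case False
      then obtain p q where pq: "coprime p q" "1 \<le> q" "real_of_int q \<le> Q" "x \<in> last_visit e Q \<rho> p q"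
        by (rule last_visit_exists)
      show ?thesis
      proof (cases "real_of_int p / q \<in> {u..<v}")
        case True
        then have "(p, q) \<in> F" using pq by (auto simp: F_def fracs_def)
        then show ?thesis using pq(4) by (auto simp: L_def)
      next
        case False
        then have "x \<in> E" using near[OF pq(2,4)] x by (auto simp: E_def abs_less_iff)
        then show ?thesis by simp
      qed
    qed (use x in \<open>auto simp: A_def\<close>)
  qed
  then have "measure lborel {u..<v} \<le> measure lborel (A \<union> (\<Union>x\<in>F. L x)) + measure lborel E"
    using E_m A_bd LU_bd by (intro measure_lborel_subadditive) auto
  then have 1: "v - u \<le> measure lborel A + (\<Sum>x\<in>F. measure lborel (L x)) + 8 * \<rho>"
    using E_m uv mU by simp
  have "A \<union> (\<Union>x\<in>F. L x) \<subseteq> {u..<v} \<union> E"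
  proof
    fix x assume "x \<in> A \<union> (\<Union>x\<in>F. L x)"
    then show "x \<in> {u..<v} \<union> E"
    proof
      assume "x \<in> (\<Union>x\<in>F. L x)"
      then obtain p q where pq: "1 \<le> q" "real_of_int p / q \<in> {u..<v}" "x \<in> last_visit e Q \<rho> p q"
        by (auto simp: F_def fracs_def L_def)
      then show ?thesis using near[OF pq(1,3)] by (auto simp: E_def abs_less_iff)
    qed (auto simp: A_def)
  qed
  then have "measure lborel (A \<union> (\<Union>x\<in>F. L x)) \<le> measure lborel {u..<v} + measure lborel E"
    using E_m A_bd LU_bd by (intro measure_lborel_subadditive) auto
  then have 2: "measure lborel A + (\<Sum>x\<in>F. measure lborel (L x)) \<le> v - u + 8 * \<rho>"
    using E_m uv mU by simp
  show ?thesis using 1 2 unfolding A_def L_def F_def by (simp add: split_beta')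
qed

section \<open>Solving the renewal equation\<close>

lemma bezout_minus_one:
  fixes p q :: int
  assumes "coprime p q"
  obtains a b where "a * p + b * q = - 1"
proof -
  obtain s t where "s * p + t * q = gcd p q" using bezout_int by blast
  then have "(- s) * p + (- t) * q = - 1" using assms by simp
  then show ?thesis using that by blast
qed

text \<open>Fixes the constants of \<open>fracs_moment\<close>, with the bound as a function of the
  interval, so that the errors below are explicit expressions that visibly vanish with
  \<rho>.\<close>

locale frac_moments =
  fixes c :: real and B :: "real \<Rightarrow> real \<Rightarrow> real"
  assumes c: "c > 0" and B: "B u v \<ge> 0"
    and mass: "u \<le> v \<Longrightarrow> admissible e \<Longrightarrow> Q \<ge> 1 \<Longrightarrow> \<bar>frac_mass e u v Q - c * (v - u) * ln Q\<bar> \<le> B u v"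
    and powr_mass: "u \<le> v \<Longrightarrow> admissible e \<Longrightarrow> Q \<ge> 1 \<Longrightarrow> \<sigma> \<noteq> 0 \<Longrightarrow>
      \<bar>(\<Sum>(p, q)\<in>fracs {u..<v} Q. wt e p q / (real_of_int q)\<^sup>2 * real_of_int q powr \<sigma>) -
        c * (v - u) * ((Q powr \<sigma> - 1) / \<sigma>)\<bar> \<le> B u v * max 1 (Q powr \<sigma>)"
begin

lemma frac_mass_nonneg: "frac_mass e u v Q \<ge> 0"
  unfolding frac_mass_def by (intro sum_nonneg) (auto simp: wt_def)

lemma frac_mass_mono:
  assumes "Q \<le> Q'"
  shows "frac_mass e u v Q \<le> frac_mass e u v Q'"
  unfolding frac_mass_def
  by (rule sum_mono2[OF fracs_finite]) (use assms in \<open>auto simp: fracs_def wt_def\<close>)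

text \<open>Extends the lower bound to Q < 1, where the logarithm is negative;
  \<open>last_visit_approx\<close> shrinks \<open>Q'\<close> by \<open>\<rho>\<^sup>2 / 10\<close>
  and may get there.\<close>

lemma frac_mass_lower:
  assumes "u \<le> v" "admissible e" "Q > 0"
  shows "frac_mass e u v Q \<ge> c * (v - u) * ln Q - B u v"
proof (cases "Q \<ge> 1")
  case True
  then show ?thesis using mass[OF assms(1,2) True] by linarith
next
  case False
  then have "ln Q \<le> 0" using assms by simp
  then have "c * (v - u) * ln Q \<le> 0" using c assms by (intro mult_nonneg_nonpos) auto
  then show ?thesis using B[of u v] frac_mass_nonneg[of e u v Q] by linarith
qed

text \<open>The relative error in the measure of a last-visit set. The three summands come from
  \<open>measure_last_visit\<close>, from shrinking the bound on denominators by
  \<open>\<rho>\<^sup>2 / 10\<close>, and from changing \<rho> by a factor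
  \<open>1 \<plusminus> \<rho>\<close>. \<open>S\<close> bounds \<rho> ln Q, and 4 is the length of
  [-1, 3).\<close>

definition eps :: "real \<Rightarrow> real \<Rightarrow> real" where
  "eps S \<rho> = 9 * \<rho> + (32 * c * sqrt \<rho> + 2 * \<rho> * B (-1) 3) + \<rho> * (4 * c * S + \<rho> * B (-1) 3)"

text \<open>A crude bound, but it makes \<rho> ln (10 / \<rho>^2) at most 8 times the square root of
  \<rho>, which tends to 0.\<close>

lemma ln_inverse_square_le:
  fixes \<rho> :: real
  assumes "0 < \<rho>"
  shows "ln (10 / \<rho>\<^sup>2) \<le> 8 / sqrt \<rho>"
proof -
  define t where "t = sqrt \<rho>"
  have t: "t > 0" "\<rho> = t\<^sup>2" using assms by (auto simp: t_def)
  have "10 / \<rho>\<^sup>2 \<le> (2 / t) ^ 4"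
    using t by (simp add: power_divide divide_right_mono flip: power_mult)
  then have "ln (10 / \<rho>\<^sup>2) \<le> ln ((2 / t) ^ 4)" using assms t by (subst ln_le_cancel_iff) auto
  also have "\<dots> = 4 * ln (2 / t)" using t by (subst ln_realpow) auto
  also have "\<dots> \<le> 4 * (2 / t)" using t ln_le_minus_one[of "2 / t"] by simp
  finally show ?thesis by (simp add: t_def)
qed

text \<open>Replaces the perturbed parameters of \<open>measure_last_visit\<close> by Q/q and
  \<rho>, paying with the mass of the extra intervals through \<open>avoid_prob_diff\<close>. Of the
  moved class only its admissibility is kept, so that the next estimates quantify over all
  classes.\<close>

lemma last_visit_approx:
  assumes \<rho>: "0 < \<rho>" "\<rho> \<le> 1 / 16" and e: "admissible e" and S: "\<rho> * ln Q \<le> S"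
    and pq: "coprime p q" "1 \<le> q" "real_of_int q \<le> Q"
  defines "W \<equiv> 2 * \<rho> * wt e p q / (real_of_int q)\<^sup>2"
  shows "\<exists>e'. admissible e' \<and>
    \<bar>measure lborel (last_visit e Q \<rho> p q) - W * avoid_prob e' (Q / q) \<rho>\<bar> \<le> W * eps S \<rho>"
proof -
  obtain a b where ab: "a * p + b * q = - 1" using bezout_minus_one[OF pq(1)] by blast
  define e' where "e' = move_class a b p q e"
  have e': "admissible e'" unfolding e'_def by (rule admissible_move_class[OF ab e])
  define Q' where "Q' = Q / q"
  define b0 where "b0 = B (-1) 3"
  have b0: "b0 \<ge> 0" by (simp add: b0_def B)
  have q: "real_of_int q \<ge> 1" using pq by simp
  have Q': "Q' \<ge> 1" using pq q by (simp add: Q'_def)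
  have "Q' \<le> Q" unfolding Q'_def using q pq by (simp add: field_simps mult_le_cancel_left1)
  then have "\<rho> * ln Q' \<le> \<rho> * ln Q" using Q' \<rho> by (intro mult_left_mono) auto
  then have "\<rho> * ln Q' \<le> S" using S by linarith
  then have "4 * c * (\<rho> * ln Q') \<le> 4 * c * S" using c by (intro mult_left_mono) auto
  define fm where "fm = frac_mass e' (-1) 3"
  have fmQ': "fm Q' \<le> 4 * c * ln Q' + b0"
    using mass[of "-1" 3 e' Q'] e' Q' unfolding fm_def b0_def by (simp add: abs_le_iff algebra_simps)
  have "\<rho> * fm Q' \<le> \<rho> * (4 * c * ln Q' + b0)" using fmQ' \<rho> by (intro mult_left_mono) auto
  also have "\<dots> = 4 * c * (\<rho> * ln Q') + \<rho> * b0" by (simp add: algebra_simps)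
  also have "\<dots> \<le> 4 * c * S + \<rho> * b0" using \<open>4 * c * (\<rho> * ln Q') \<le> 4 * c * S\<close> by simp
  finally have rfm: "\<rho> * (\<rho> * fm Q') \<le> \<rho> * (4 * c * S + \<rho> * b0)" using \<rho> by (intro mult_left_mono) auto
  have W: "W \<ge> 0" using \<rho> by (simp add: W_def wt_def)
  have x0: "32 * c * sqrt \<rho> + 2 * \<rho> * b0 \<ge> 0" using c \<rho> b0 by simp
  have upper: "avoid_prob e' (\<rho>\<^sup>2 / 10 * Q') (\<rho> * (1 - \<rho>)) - avoid_prob e' Q' \<rho> \<le> eps S \<rho> - 9 * \<rho>"
  proof -
    define Q1 where "Q1 = \<rho>\<^sup>2 / 10 * Q'"
    have Q1: "0 < Q1" "Q1 \<le> Q'"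
    proof -
      have "\<rho>\<^sup>2 / 10 \<le> 1" using \<rho> power_le_one[of \<rho> 2] by simp
      then show "Q1 \<le> Q'" unfolding Q1_def using Q' by (intro mult_left_le_one_le) auto
      show "0 < Q1" using \<rho> Q' by (simp add: Q1_def)
    qed
    have "avoid_prob e' Q1 (\<rho> * (1 - \<rho>)) - avoid_prob e' Q' \<rho> \<le> \<rho> * fm Q' - \<rho> * (1 - \<rho>) * fm Q1"
      unfolding fm_def using \<rho> Q1 by (intro avoid_prob_diff) (auto simp: mult_left_le)
    also have "\<dots> = \<rho> * (fm Q' - fm Q1) + \<rho> * (\<rho> * fm Q1)" by (simp add: algebra_simps)
    also have "\<rho> * (\<rho> * fm Q1) \<le> \<rho> * (\<rho> * fm Q')"
      unfolding fm_def using \<rho> Q1 by (intro mult_left_mono frac_mass_mono) auto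
    also have "\<rho> * (fm Q' - fm Q1) \<le> \<rho> * (4 * c * (8 / sqrt \<rho>) + 2 * b0)"
    proof (intro mult_left_mono)
      have "fm Q1 \<ge> 4 * c * ln Q1 - b0"
        using frac_mass_lower[of "-1" 3 e' Q1] e' Q1 unfolding fm_def b0_def by (simp add: algebra_simps)
      then have "fm Q' - fm Q1 \<le> 4 * c * (ln Q' - ln Q1) + 2 * b0"
        using fmQ' by (simp add: algebra_simps)
      also have "ln Q' - ln Q1 = ln (10 / \<rho>\<^sup>2)"
      proof -
        have "10 / \<rho>\<^sup>2 = Q' / Q1" using Q' \<rho> by (simp add: Q1_def)
        then show ?thesis using Q' Q1 by (simp add: ln_div)
      qed
      also have "4 * c * ln (10 / \<rho>\<^sup>2) \<le> 4 * c * (8 / sqrt \<rho>)"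
        using ln_inverse_square_le[OF \<rho>(1)] c by (intro mult_left_mono) auto
      finally show "fm Q' - fm Q1 \<le> 4 * c * (8 / sqrt \<rho>) + 2 * b0" by simp
    qed (use \<rho> in auto)
    also have "\<rho> * (4 * c * (8 / sqrt \<rho>) + 2 * b0) = 32 * c * sqrt \<rho> + 2 * \<rho> * b0"
    proof -
      have "\<rho> / sqrt \<rho> = sqrt \<rho>" using \<rho> by (simp add: real_div_sqrt)
      moreover have "\<rho> * (4 * c * (8 / sqrt \<rho>)) = 32 * c * (\<rho> / sqrt \<rho>)" by simp
      ultimately have "\<rho> * (4 * c * (8 / sqrt \<rho>)) = 32 * c * sqrt \<rho>" by (simp only:)
      then show ?thesis by (simp add: distrib_left)
    qed
    finally show ?thesis using rfm unfolding eps_def Q1_def[symmetric] b0_def by linarith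
  qed
  have lower: "avoid_prob e' Q' \<rho> - avoid_prob e' Q' (\<rho> * (1 + \<rho>)) \<le> eps S \<rho> - 9 * \<rho>"
  proof -
    have "\<rho> * (1 + \<rho>) \<le> 1 / 16 * 2" using \<rho> by (intro mult_mono) auto
    then have "avoid_prob e' Q' \<rho> - avoid_prob e' Q' (\<rho> * (1 + \<rho>)) \<le> \<rho> * (1 + \<rho>) * fm Q' - \<rho> * fm Q'"
      unfolding fm_def using \<rho> by (intro avoid_prob_diff) (auto simp: mult_le_cancel_left1)
    also have "\<dots> = \<rho> * (\<rho> * fm Q')" by (simp add: algebra_simps)
    finally show ?thesis using rfm x0 unfolding eps_def b0_def by linarith
  qed
  have "measure lborel (last_visit e Q \<rho> p q) \<le> W * (avoid_prob e' Q' \<rho> + eps S \<rho>)"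
    using upper W by (intro order.trans[OF measure_last_visit(1)[OF ab pq(2) \<rho>, of e Q, folded e'_def W_def]] mult_left_mono)
      (auto simp: Q'_def)
  moreover have "W * (avoid_prob e' Q' \<rho> - eps S \<rho>) \<le> measure lborel (last_visit e Q \<rho> p q)"
    using lower W \<rho> by (intro order.trans[OF _ measure_last_visit(2)[OF ab pq(2) \<rho>, of e Q, folded e'_def W_def]] mult_left_mono)
      (auto simp: Q'_def)
  ultimately show ?thesis using e' unfolding Q'_def by (intro exI[of _ e']) (auto simp: abs_le_iff algebra_simps)
qed

text \<open>Inserts an assumed error bound with constant \<open>K\<close>, for all classes and all
  smaller bounds on denominators, into the renewal equation. The power reproduces itself in the main
  sum, and \<open>K\<close> comes back multiplied by about a quarter of the length.\<close>

lemma renewal_estimate: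
  assumes \<rho>: "0 < \<rho>" "\<rho> \<le> 1 / 16" and e: "admissible e" and uv: "u \<le> v" and Q: "Q \<ge> 1" and S: "\<rho> * ln Q \<le> S"
    and K: "0 \<le> K" "\<And>e' Q'. admissible e' \<Longrightarrow> 1 \<le> Q' \<Longrightarrow> Q' \<le> Q \<Longrightarrow>
      \<bar>avoid_prob e' Q' \<rho> - Q' powr (- (2 * c * \<rho>))\<bar> \<le> K * Q' powr (8 * c * \<rho>)"
  shows "\<bar>measure lborel (avoid e Q \<rho> \<inter> {u..<v}) - (v - u) * Q powr (- (2 * c * \<rho>))\<bar> \<le>
    8 * \<rho> + 2 * \<rho> * B u v + eps S \<rho> * (2 * (c * (v - u) * S + \<rho> * B u v)) +
    K * Q powr (8 * c * \<rho>) * ((v - u) / 4 + 2 * \<rho> * B u v)"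
proof -
  define \<sigma> \<tau> where "\<sigma> = 2 * c * \<rho>" and "\<tau> = 8 * c * \<rho>"
  have \<sigma>\<tau>: "\<sigma> > 0" "\<tau> > 0" using c \<rho> by (auto simp: \<sigma>_def \<tau>_def)
  define F where "F = fracs {u..<v} Q"
  define w where "w = (\<lambda>(p, q). wt e p q / (real_of_int q)\<^sup>2)"
  define n where "n = (\<lambda>x::int \<times> int. real_of_int (snd x))"
  define L where "L = (\<lambda>(p, q). measure lborel (last_visit e Q \<rho> p q))"
  have w0: "w x \<ge> 0" for x by (simp add: w_def wt_def split_beta')
  have n1: "1 \<le> n x" "n x \<le> Q" if "x \<in> F" for x using that by (auto simp: F_def fracs_def n_def)
  have ln_Q: "0 \<le> ln Q" using Q by simp
  have S0: "0 \<le> S" using S mult_nonneg_nonneg[of \<rho> "ln Q"] ln_Q \<rho> by linarith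
  have eps0: "eps S \<rho> \<ge> 0"
    unfolding eps_def using \<rho> c B[of "-1" 3] S0 by (intro add_nonneg_nonneg mult_nonneg_nonneg) auto
  have fm: "frac_mass e u v Q = (\<Sum>x\<in>F. w x)" unfolding frac_mass_def F_def w_def ..
  have pm: "\<bar>(\<Sum>x\<in>F. w x * n x powr s) - c * (v - u) * ((Q powr s - 1) / s)\<bar> \<le> B u v * max 1 (Q powr s)" if "s \<noteq> 0" for s
    using powr_mass[OF uv e Q that] unfolding F_def w_def n_def by (simp add: split_beta')
  have Ql: "(Q / n x) powr s = Q powr s * n x powr (- s)" if "x \<in> F" for x s
    using n1[OF that] Q powr_divide[of Q "n x" s] by (simp add: powr_minus divide_inverse)
  have "\<bar>L x - 2 * \<rho> * w x * (Q / n x) powr (- \<sigma>)\<bar> \<le> 2 * \<rho> * w x * (eps S \<rho> + K * (Q / n x) powr \<tau>)" if "x \<in> F" for x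
  proof -
    obtain p q where x: "x = (p, q)" by (cases x)
    then have pq: "coprime p q" "1 \<le> q" "real_of_int q \<le> Q" using that by (auto simp: F_def fracs_def)
    define W where "W = 2 * \<rho> * wt e p q / (real_of_int q)\<^sup>2"
    have W: "W = 2 * \<rho> * w x" "0 \<le> W" using \<rho> by (auto simp: W_def w_def x wt_def)
    obtain e' where e': "admissible e'"
      "\<bar>L x - W * avoid_prob e' (Q / q) \<rho>\<bar> \<le> W * eps S \<rho>"
      using last_visit_approx[OF \<rho> e S pq] unfolding L_def x W_def by auto
    have Qq: "1 \<le> Q / q" "Q / q \<le> Q" using pq Q by (auto simp: field_simps mult_le_cancel_left1)
    have "\<bar>W * (avoid_prob e' (Q / q) \<rho> - (Q / q) powr (- \<sigma>))\<bar> \<le> W * (K * (Q / q) powr \<tau>)"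
      unfolding abs_mult using K(2)[OF e'(1) Qq] W(2) by (intro mult_mono) (auto simp: \<sigma>_def \<tau>_def)
    then have "\<bar>W * avoid_prob e' (Q / q) \<rho> - W * (Q / q) powr (- \<sigma>)\<bar> \<le> W * (K * (Q / q) powr \<tau>)"
      by (simp add: right_diff_distrib)
    then have "\<bar>L x - W * (Q / q) powr (- \<sigma>)\<bar> \<le> W * (eps S \<rho> + K * (Q / q) powr \<tau>)"
      using e'(2) unfolding distrib_left by linarith
    then show ?thesis unfolding W(1) by (simp add: n_def x)
  qed
  then have "\<bar>\<Sum>x\<in>F. L x - 2 * \<rho> * w x * (Q / n x) powr (- \<sigma>)\<bar> \<le> (\<Sum>x\<in>F. 2 * \<rho> * w x * (eps S \<rho> + K * (Q / n x) powr \<tau>))"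
    by (intro order.trans[OF sum_abs] sum_mono) auto
  also have "\<dots> = eps S \<rho> * (2 * (\<rho> * (\<Sum>x\<in>F. w x))) + K * Q powr \<tau> * (2 * \<rho> * (\<Sum>x\<in>F. w x * n x powr (- \<tau>)))"
    unfolding sum_distrib_left sum.distrib[symmetric]
    by (intro sum.cong refl) (simp add: Ql algebra_simps)
  also have "\<dots> \<le> eps S \<rho> * (2 * (c * (v - u) * S + \<rho> * B u v)) + K * Q powr \<tau> * ((v - u) / 4 + 2 * \<rho> * B u v)"
  proof (intro add_mono mult_left_mono)
    have "(\<Sum>x\<in>F. w x) \<le> c * (v - u) * ln Q + B u v" using mass[OF uv e Q] unfolding fm by linarith
    then have "\<rho> * (\<Sum>x\<in>F. w x) \<le> \<rho> * (c * (v - u) * ln Q + B u v)" using \<rho> by (intro mult_left_mono) auto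
    also have "\<dots> = c * (v - u) * (\<rho> * ln Q) + \<rho> * B u v" by (simp add: algebra_simps)
    also have "\<dots> \<le> c * (v - u) * S + \<rho> * B u v" using S c uv \<rho> by (intro add_mono mult_left_mono) auto
    finally show "\<rho> * (\<Sum>x\<in>F. w x) \<le> c * (v - u) * S + \<rho> * B u v" .
    have Qm: "0 < Q powr (- \<tau>)" "Q powr (- \<tau>) \<le> 1"
      using Q \<sigma>\<tau> powr_mono2'[of "- \<tau>" 1 Q] by auto
    have "(\<Sum>x\<in>F. w x * n x powr (- \<tau>)) \<le> c * (v - u) * ((Q powr (- \<tau>) - 1) / (- \<tau>)) + B u v * max 1 (Q powr (- \<tau>))"
      using pm[of "- \<tau>"] \<sigma>\<tau> by linarith
    also have "c * (v - u) * ((Q powr (- \<tau>) - 1) / (- \<tau>)) \<le> c * (v - u) * (1 / \<tau>)"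
    proof (intro mult_left_mono)
      have "(Q powr (- \<tau>) - 1) / (- \<tau>) = (1 - Q powr (- \<tau>)) / \<tau>" using \<sigma>\<tau> by (simp add: field_simps)
      also have "\<dots> \<le> 1 / \<tau>" using Qm \<sigma>\<tau> by (intro divide_right_mono) auto
      finally show "(Q powr (- \<tau>) - 1) / (- \<tau>) \<le> 1 / \<tau>" .
    qed (use c uv in auto)
    also have "max 1 (Q powr (- \<tau>)) = 1" using Qm by simp
    finally have "2 * \<rho> * (\<Sum>x\<in>F. w x * n x powr (- \<tau>)) \<le> 2 * \<rho> * (c * (v - u) * (1 / \<tau>) + B u v * 1)"
      using \<rho> by (intro mult_left_mono) auto
    \<comment> \<open>The exponent \<open>\<tau> = 8 * c * \<rho>\<close> is chosen for this factor
      1/4.\<close>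
    also have "\<dots> = (v - u) / 4 + 2 * \<rho> * B u v" using c \<rho> by (simp add: \<tau>_def field_simps)
    finally show "2 * \<rho> * (\<Sum>x\<in>F. w x * n x powr (- \<tau>)) \<le> (v - u) / 4 + 2 * \<rho> * B u v" .
  qed (use eps0 K in auto)
  finally have 1: "\<bar>(\<Sum>x\<in>F. L x) - (\<Sum>x\<in>F. 2 * \<rho> * w x * (Q / n x) powr (- \<sigma>))\<bar> \<le>
      eps S \<rho> * (2 * (c * (v - u) * S + \<rho> * B u v)) + K * Q powr \<tau> * ((v - u) / 4 + 2 * \<rho> * B u v)"
    by (simp add: sum_subtractf)
  have 2: "\<bar>(\<Sum>x\<in>F. 2 * \<rho> * w x * (Q / n x) powr (- \<sigma>)) - (v - u) * (1 - Q powr (- \<sigma>))\<bar> \<le> 2 * \<rho> * B u v"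
  proof -
    have Qp: "Q powr \<sigma> \<ge> 1" "Q powr (- \<sigma>) * Q powr \<sigma> = 1" "Q powr (- \<sigma>) > 0"
      using Q \<sigma>\<tau> by (auto simp: ge_one_powr_ge_zero simp flip: powr_add)
    have "(\<Sum>x\<in>F. 2 * \<rho> * w x * (Q / n x) powr (- \<sigma>)) = 2 * \<rho> * Q powr (- \<sigma>) * (\<Sum>x\<in>F. w x * n x powr \<sigma>)"
      unfolding sum_distrib_left by (intro sum.cong refl) (simp add: Ql algebra_simps)
    \<comment> \<open>This forces \<open>\<sigma> = 2 * c * \<rho>\<close>: the constant
      \<open>2 * \<rho> * c / \<sigma>\<close> has to be 1.\<close>
    moreover have "(v - u) * (1 - Q powr (- \<sigma>)) = 2 * \<rho> * Q powr (- \<sigma>) * (c * (v - u) * ((Q powr \<sigma> - 1) / \<sigma>))"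
    proof -
      have "2 * \<rho> * Q powr (- \<sigma>) * (c * (v - u) * ((Q powr \<sigma> - 1) / \<sigma>)) =
          (2 * \<rho> * c / \<sigma>) * ((v - u) * (Q powr (- \<sigma>) * Q powr \<sigma> - Q powr (- \<sigma>)))"
        by (simp add: right_diff_distrib left_diff_distrib diff_divide_distrib mult.commute mult.left_commute)
      also have "2 * \<rho> * c / \<sigma> = 1" using c \<rho> by (simp add: \<sigma>_def)
      finally show ?thesis using Qp by simp
    qed
    ultimately have "\<bar>(\<Sum>x\<in>F. 2 * \<rho> * w x * (Q / n x) powr (- \<sigma>)) - (v - u) * (1 - Q powr (- \<sigma>))\<bar> =
        2 * \<rho> * Q powr (- \<sigma>) * \<bar>(\<Sum>x\<in>F. w x * n x powr \<sigma>) - c * (v - u) * ((Q powr \<sigma> - 1) / \<sigma>)\<bar>"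
      using \<rho> Qp by (simp only: right_diff_distrib[symmetric] abs_mult)
    also have "\<dots> \<le> 2 * \<rho> * Q powr (- \<sigma>) * (B u v * Q powr \<sigma>)"
      using pm[of \<sigma>] \<sigma>\<tau> Qp \<rho> by (intro mult_left_mono) (auto simp: max_def split: if_splits)
    also have "\<dots> = 2 * \<rho> * B u v * (Q powr (- \<sigma>) * Q powr \<sigma>)" by (simp add: algebra_simps)
    finally show ?thesis using Qp by simp
  qed
  have 3: "\<bar>measure lborel (avoid e Q \<rho> \<inter> {u..<v}) + (\<Sum>x\<in>F. L x) - (v - u)\<bar> \<le> 8 * \<rho>"
    using renewal[OF \<rho> uv, of e Q] unfolding F_def L_def .
  have "(v - u) * (1 - Q powr (- \<sigma>)) = (v - u) - (v - u) * Q powr (- \<sigma>)" by (simp add: algebra_simps)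
  then show ?thesis using 1 2 3 unfolding \<sigma>_def[symmetric] \<tau>_def[symmetric] by linarith
qed

text \<open>The terms without \<open>K\<close> in \<open>renewal_estimate\<close> on [0, 2), halved
  because \<open>avoid_prob\<close> divides by the length 2.\<close>

definition kappa :: "real \<Rightarrow> real \<Rightarrow> real" where
  "kappa S \<rho> = 4 * \<rho> + \<rho> * B 0 2 + eps S \<rho> * (2 * c * S + \<rho> * B 0 2)"

text \<open>Each use of \<open>renewal_estimate\<close> turns the error constant K into
  \<open>kappa\<close> + K/2, for all classes and all Q at once, so the iteration runs over the
  constant and not over Q. It starts from a trivial bound and converges to the fixed point 2
  \<open>kappa\<close>.\<close>

lemma avoid_prob_estimate:
  assumes \<rho>: "0 < \<rho>" "\<rho> \<le> 1 / 16" "\<rho> * B 0 2 \<le> 1 / 4" and e: "admissible e" and Q: "Q \<ge> 1" and S: "\<rho> * ln Q \<le> S"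
  shows "\<bar>avoid_prob e Q \<rho> - Q powr (- (2 * c * \<rho>))\<bar> \<le> 2 * kappa S \<rho> * Q powr (8 * c * \<rho>)"
proof -
  define \<sigma> \<tau> where "\<sigma> = 2 * c * \<rho>" and "\<tau> = 8 * c * \<rho>"
  have \<sigma>\<tau>: "\<sigma> > 0" "\<tau> > 0" using c \<rho> by (auto simp: \<sigma>_def \<tau>_def)
  have "0 \<le> ln Q" using Q by simp
  then have S0: "0 \<le> S" using S \<rho> mult_nonneg_nonneg[of \<rho> "ln Q"] by linarith
  have eps0: "eps S \<rho> \<ge> 0"
    unfolding eps_def using \<rho> c B[of "-1" 3] S0 by (intro add_nonneg_nonneg mult_nonneg_nonneg) auto
  have k0: "kappa S \<rho> \<ge> 0"
    unfolding kappa_def using \<rho> c B[of 0 2] S0 eps0 by (intro add_nonneg_nonneg mult_nonneg_nonneg) auto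
  have it: "\<bar>avoid_prob e Q \<rho> - Q powr (- \<sigma>)\<bar> \<le> (2 * kappa S \<rho> + (1 / 2) ^ n) * Q powr \<tau>"
    if "admissible e" "Q \<ge> 1" "\<rho> * ln Q \<le> S" for e Q n
    using that
  proof (induction n arbitrary: e Q)
    case 0
    have "Q powr (- \<sigma>) \<le> 1" using 0 \<sigma>\<tau> powr_mono2'[of "- \<sigma>" 1 Q] by auto
    then have "\<bar>avoid_prob e Q \<rho> - Q powr (- \<sigma>)\<bar> \<le> 1"
      using avoid_prob_bounds[of e Q \<rho>] powr_ge_zero[of Q "- \<sigma>"] by linarith
    also have "1 \<le> (2 * kappa S \<rho> + (1 / 2) ^ 0) * Q powr \<tau>"
      using 0 \<sigma>\<tau> k0 mult_mono[of 1 "2 * kappa S \<rho> + 1" 1 "Q powr \<tau>"] by (auto simp: ge_one_powr_ge_zero)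
    finally show ?case .
  next
    case (Suc n)
    define K where "K = 2 * kappa S \<rho> + (1 / 2) ^ n"
    have K0: "0 \<le> K" using k0 by (simp add: K_def)
    have Qt: "Q powr \<tau> \<ge> 1" using Suc.prems \<sigma>\<tau> by (simp add: ge_one_powr_ge_zero)
    have est: "\<bar>measure lborel (avoid e Q \<rho> \<inter> {0..<2}) - (2 - 0) * Q powr (- \<sigma>)\<bar> \<le>
        8 * \<rho> + 2 * \<rho> * B 0 2 + eps S \<rho> * (2 * (c * (2 - 0) * S + \<rho> * B 0 2)) +
        K * Q powr \<tau> * ((2 - 0) / 4 + 2 * \<rho> * B 0 2)"
      unfolding \<sigma>_def \<tau>_def
    proof (rule renewal_estimate[OF \<rho>(1,2)])
      fix e' Q' assume e': "admissible e'" "1 \<le> Q'" "Q' \<le> Q"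
      then have "\<rho> * ln Q' \<le> \<rho> * ln Q" using \<rho> by (intro mult_left_mono) auto
      then have "\<rho> * ln Q' \<le> S" using Suc.prems by linarith
      from Suc.IH[OF e'(1,2) this]
      show "\<bar>avoid_prob e' Q' \<rho> - Q' powr - (2 * c * \<rho>)\<bar> \<le> K * Q' powr (8 * c * \<rho>)"
        by (simp add: K_def \<sigma>_def \<tau>_def)
    qed (use Suc.prems K0 in auto)
    have 1: "eps S \<rho> * (2 * (c * 2 * S + \<rho> * B 0 2)) = 2 * (eps S \<rho> * (2 * c * S + \<rho> * B 0 2))"
      by (simp add: algebra_simps)
    have 2: "K * Q powr \<tau> * (2 / 4 + 2 * \<rho> * B 0 2) \<le> K * Q powr \<tau> * 1"
      using \<rho> K0 by (intro mult_left_mono) auto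
    have "\<bar>measure lborel (avoid e Q \<rho> \<inter> {0..<2}) - 2 * Q powr (- \<sigma>)\<bar> \<le> 2 * kappa S \<rho> + K * Q powr \<tau>"
      using est[unfolded diff_zero 1] 2 unfolding kappa_def distrib_left by linarith
    then have "\<bar>avoid_prob e Q \<rho> - Q powr (- \<sigma>)\<bar> \<le> kappa S \<rho> * 1 + K / 2 * Q powr \<tau>"
      unfolding avoid_prob_def by (simp add: abs_le_iff field_simps)
    also have "kappa S \<rho> * 1 \<le> kappa S \<rho> * Q powr \<tau>" using Qt k0 by (intro mult_left_mono)
    finally show ?case by (simp add: K_def algebra_simps add_divide_distrib)
  qed
  have "(\<lambda>n. (2 * kappa S \<rho> + (1 / 2) ^ n) * Q powr \<tau>) \<longlonglongrightarrow> (2 * kappa S \<rho> + 0) * Q powr \<tau>"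
    by (intro tendsto_intros) auto
  then have "\<bar>avoid_prob e Q \<rho> - Q powr (- \<sigma>)\<bar> \<le> (2 * kappa S \<rho> + 0) * Q powr \<tau>"
    by (rule LIMSEQ_le_const) (use it[OF e Q S] in auto)
  then show ?thesis by (simp add: \<sigma>_def \<tau>_def)
qed

text \<open>One more use of \<open>renewal_estimate\<close> transfers the estimate from a full
  period to an arbitrary interval: on the right only period averages occur, on the left the interval
  is free. The powers are constants since \<rho> ln Q = s.\<close>

lemma avoid_limit:
  assumes e: "admissible e" and uv: "u \<le> v" and s: "s \<ge> 0"
  shows "((\<lambda>\<rho>. measure lborel (avoid e (exp (s / \<rho>)) \<rho> \<inter> {u..<v})) \<longlongrightarrow> (v - u) * exp (- 2 * c * s)) (at_right 0)"
proof -
  define f where "f = (\<lambda>\<rho>. 8 * \<rho> + 2 * \<rho> * B u v + eps s \<rho> * (2 * (c * (v - u) * s + \<rho> * B u v)) +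
    2 * kappa s \<rho> * exp (8 * c * s) * ((v - u) / 4 + 2 * \<rho> * B u v))"
  have "(f \<longlongrightarrow> 0) (at_right 0)"
    unfolding f_def kappa_def eps_def
    by (auto intro!: tendsto_eq_intros)
  moreover have "eventually (\<lambda>\<rho>. norm (measure lborel (avoid e (exp (s / \<rho>)) \<rho> \<inter> {u..<v}) - (v - u) * exp (- 2 * c * s)) \<le> f \<rho>) (at_right 0)"
  proof -
    have "((\<lambda>\<rho>. \<rho> * B 0 2) \<longlongrightarrow> 0) (at_right 0)" by (auto intro!: tendsto_eq_intros)
    then have "eventually (\<lambda>\<rho>. \<rho> * B 0 2 < 1 / 4) (at_right 0)" by (rule order_tendstoD) simp
    moreover have "eventually (\<lambda>\<rho>::real. \<rho> \<in> {0<..<1/16}) (at_right 0)"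
      by (rule eventually_at_right_real) simp
    ultimately show ?thesis
    proof eventually_elim
      case (elim \<rho>)
      then have \<rho>: "0 < \<rho>" "\<rho> \<le> 1 / 16" "\<rho> * B 0 2 \<le> 1 / 4" by auto
      define Q where "Q = exp (s / \<rho>)"
      have Q: "Q \<ge> 1" "\<rho> * ln Q \<le> s" using \<rho> s by (auto simp: Q_def)
      have Qp: "Q powr (- (2 * c * \<rho>)) = exp (- 2 * c * s)" "Q powr (8 * c * \<rho>) = exp (8 * c * s)"
        using \<rho> by (auto simp: Q_def powr_def)
      have S0: "0 \<le> s" by (rule s)
      have eps0: "eps s \<rho> \<ge> 0"
        unfolding eps_def using \<rho> c B[of "-1" 3] S0 by (intro add_nonneg_nonneg mult_nonneg_nonneg) auto
      have k0: "2 * kappa s \<rho> \<ge> 0"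
        unfolding kappa_def using \<rho> c B[of 0 2] S0 eps0 by (intro mult_nonneg_nonneg add_nonneg_nonneg) auto
      have "\<bar>measure lborel (avoid e Q \<rho> \<inter> {u..<v}) - (v - u) * Q powr (- (2 * c * \<rho>))\<bar> \<le>
        8 * \<rho> + 2 * \<rho> * B u v + eps s \<rho> * (2 * (c * (v - u) * s + \<rho> * B u v)) +
        2 * kappa s \<rho> * Q powr (8 * c * \<rho>) * ((v - u) / 4 + 2 * \<rho> * B u v)"
      proof (rule renewal_estimate[OF \<rho>(1,2) e uv Q k0])
        fix e' Q' assume e': "admissible e'" "1 \<le> Q'" "Q' \<le> Q"
        then have "\<rho> * ln Q' \<le> \<rho> * ln Q" using \<rho> by (intro mult_left_mono) auto
        then have "\<rho> * ln Q' \<le> s" using Q by linarith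
        then show "\<bar>avoid_prob e' Q' \<rho> - Q' powr - (2 * c * \<rho>)\<bar> \<le> 2 * kappa s \<rho> * Q' powr (8 * c * \<rho>)"
          using avoid_prob_estimate[OF \<rho> e'(1,2)] by blast
      qed
      then show ?case unfolding Qp f_def by (simp add: Q_def)
    qed
  qed
  ultimately have "((\<lambda>\<rho>. measure lborel (avoid e (exp (s / \<rho>)) \<rho> \<inter> {u..<v}) - (v - u) * exp (- 2 * c * s)) \<longlongrightarrow> 0) (at_right 0)"
    by (rule Lim_null_comparison[rotated])
  then show ?thesis by (rule LIM_zero_cancel)
qed

end

lemma avoid_equidistribution:
  "\<exists>c>0. \<forall>e u v s. admissible e \<longrightarrow> u \<le> v \<longrightarrow> s \<ge> 0 \<longrightarrow>
    ((\<lambda>\<rho>. measure lborel (avoid e (exp (s / \<rho>)) \<rho> \<inter> {u..<v})) \<longlongrightarrow> (v - u) * exp (- 2 * c * s)) (at_right 0)"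
proof -
  obtain c where c: "c > 0" and *: "\<forall>u v. u \<le> v \<longrightarrow> (\<exists>B\<ge>0. \<forall>e. admissible e \<longrightarrow> (\<forall>Q\<ge>1.
     \<bar>(\<Sum>(p, q)\<in>fracs {u..<v} Q. wt e p q / (real_of_int q)\<^sup>2) - c * (v - u) * ln Q\<bar> \<le> B \<and>
     (\<forall>\<sigma>. \<sigma> \<noteq> 0 \<longrightarrow>
     \<bar>(\<Sum>(p, q)\<in>fracs {u..<v} Q. wt e p q / (real_of_int q)\<^sup>2 * real_of_int q powr \<sigma>) -
        c * (v - u) * ((Q powr \<sigma> - 1) / \<sigma>)\<bar> \<le> B * max 1 (Q powr \<sigma>))))"
    using fracs_moment by blast
  \<comment> \<open>With \<open>u \<le> v\<close> inside \<open>P\<close>, the choice of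
    \<open>B\<close> becomes a total function.\<close>
  define P where "P = (\<lambda>u v B. 0 \<le> B \<and> (u \<le> v \<longrightarrow> (\<forall>e. admissible e \<longrightarrow> (\<forall>Q\<ge>1.
     \<bar>(\<Sum>(p, q)\<in>fracs {u..<v} Q. wt e p q / (real_of_int q)\<^sup>2) - c * (v - u) * ln Q\<bar> \<le> B \<and>
     (\<forall>\<sigma>. \<sigma> \<noteq> 0 \<longrightarrow>
     \<bar>(\<Sum>(p, q)\<in>fracs {u..<v} Q. wt e p q / (real_of_int q)\<^sup>2 * real_of_int q powr \<sigma>) -
        c * (v - u) * ((Q powr \<sigma> - 1) / \<sigma>)\<bar> \<le> B * max 1 (Q powr \<sigma>))))))"
  have "\<exists>B. P u v B" for u v
  proof (cases "u \<le> v")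
    case True
    show ?thesis using *[rule_format, OF True] unfolding P_def by blast
  qed (auto simp: P_def)
  then obtain B where P: "\<And>u v. P u v (B u v)" by metis
  interpret frac_moments c B
  proof
    show "c > 0" by (rule c)
  next
    fix u v show "B u v \<ge> 0" using P[of u v] by (simp add: P_def)
  next
    fix u v :: real and e and Q :: real assume "u \<le> v" "admissible e" "1 \<le> Q"
    then show "\<bar>frac_mass e u v Q - c * (v - u) * ln Q\<bar> \<le> B u v"
      using P[of u v] unfolding P_def frac_mass_def by blast
  next
    fix u v :: real and e and Q \<sigma> :: real assume "u \<le> v" "admissible e" "1 \<le> Q" "\<sigma> \<noteq> 0"
    then show "\<bar>(\<Sum>(p, q)\<in>fracs {u..<v} Q. wt e p q / (real_of_int q)\<^sup>2 * real_of_int q powr \<sigma>) -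
        c * (v - u) * ((Q powr \<sigma> - 1) / \<sigma>)\<bar> \<le> B u v * max 1 (Q powr \<sigma>)"
      using P[of u v] unfolding P_def by blast
  qed
  show ?thesis using c avoid_limit by blast
qed

section \<open>Absolutely continuous starting distributions\<close>

text \<open>Weak convergence of the indicators of \<open>N n\<close> to the constant
  \<open>l\<close>, tested against \<open>f\<close>.\<close>

definition samples :: "(nat \<Rightarrow> real set) \<Rightarrow> real \<Rightarrow> (real \<Rightarrow> real) \<Rightarrow> bool" where
  "samples N l f \<longleftrightarrow> (\<lambda>n. \<integral>x. indicator (N n) x * f x \<partial>lborel) \<longlonglongrightarrow> l * (\<integral>x. f x \<partial>lborel)"

lemma integrable_indicator_mult:
  fixes f :: "real \<Rightarrow> real"
  assumes "integrable lborel f" "N \<in> sets borel"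
  shows "integrable lborel (\<lambda>x. indicator N x * f x)"
  using integrable_mult_indicator[OF _ assms(1), of N] assms(2) by simp

lemma samples_add:
  assumes N: "\<And>n. N n \<in> sets borel" and "integrable lborel f" "integrable lborel g" "samples N l f" "samples N l g"
  shows "samples N l (\<lambda>x. f x + g x)"
proof -
  have "(\<lambda>n. (\<integral>x. indicator (N n) x * f x \<partial>lborel) + (\<integral>x. indicator (N n) x * g x \<partial>lborel)) \<longlonglongrightarrow>
      l * (\<integral>x. f x \<partial>lborel) + l * (\<integral>x. g x \<partial>lborel)"
    using assms(4,5) unfolding samples_def by (rule tendsto_add)
  then show ?thesis using assms(2,3) N unfolding samples_def
    by (simp add: distrib_left integrable_indicator_mult)
qed

lemma samples_scale:
  assumes "samples N l f"
  shows "samples N l (\<lambda>x. c * f x)"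
proof -
  have "(\<lambda>n. c * (\<integral>x. indicator (N n) x * f x \<partial>lborel)) \<longlonglongrightarrow> c * (l * (\<integral>x. f x \<partial>lborel))"
    using assms unfolding samples_def by (rule tendsto_mult_left)
  then show ?thesis unfolding samples_def by (simp add: mult.left_commute)
qed

text \<open>Domination by 3 \<bar>f\<bar> makes the approximations converge in L1, and since
  indicators are at most 1 the resulting error is uniform in n. The hypotheses have the shape that
  the induction over integrable functions provides.\<close>

lemma samples_lim:
  fixes s :: "nat \<Rightarrow> real \<Rightarrow> real"
  assumes N: "\<And>n. N n \<in> sets borel"
    and s: "\<And>i. integrable lborel (s i)" "\<And>i. samples N l (s i)"
    and lim: "\<And>x. (\<lambda>i. s i x) \<longlonglongrightarrow> f x" "\<And>i x. norm (s i x) \<le> 2 * norm (f x)" and f: "integrable lborel f"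
  shows "samples N l f"
proof -
  define d where "d = (\<lambda>i. \<integral>x. \<bar>s i x - f x\<bar> \<partial>lborel)"
  have "(\<lambda>i. \<integral>x. \<bar>s i x - f x\<bar> \<partial>lborel) \<longlonglongrightarrow> (\<integral>x. \<bar>f x - f x\<bar> \<partial>lborel)"
  proof (rule integral_dominated_convergence[where w = "\<lambda>x. 3 * norm (f x)"])
    show "AE x in lborel. (\<lambda>i. \<bar>s i x - f x\<bar>) \<longlonglongrightarrow> \<bar>f x - f x\<bar>"
      using lim(1) by (intro AE_I2 tendsto_intros) auto
    show "AE x in lborel. norm \<bar>s i x - f x\<bar> \<le> 3 * norm (f x)" for i
    proof (intro AE_I2)
      fix x show "norm \<bar>s i x - f x\<bar> \<le> 3 * norm (f x)"
        using norm_triangle_ineq4[of "s i x" "f x"] lim(2)[of i x] by simp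
    qed
  qed (use f s(1) in \<open>auto intro!: borel_measurable_abs borel_measurable_diff\<close>)
  then have d: "d \<longlonglongrightarrow> 0" by (simp add: d_def)
  define I where "I = (\<lambda>(g :: real \<Rightarrow> real) n. \<integral>x. indicator (N n) x * g x \<partial>lborel)"
  have dI: "\<bar>I (s i) n - I f n\<bar> \<le> d i" for i n
  proof -
    have "I (s i) n - I f n = (\<integral>x. indicator (N n) x * s i x - indicator (N n) x * f x \<partial>lborel)"
      unfolding I_def by (intro Bochner_Integration.integral_diff[symmetric] integrable_indicator_mult s f N)
    also have "\<bar>\<dots>\<bar> \<le> (\<integral>x. \<bar>indicator (N n) x * s i x - indicator (N n) x * f x\<bar> \<partial>lborel)"
      by (rule integral_abs_bound)
    also have "\<dots> \<le> d i" unfolding d_def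
      by (intro integral_mono integrable_abs Bochner_Integration.integrable_diff integrable_indicator_mult s f N) (auto simp: indicator_def)
    finally show ?thesis .
  qed
  have dl: "\<bar>(\<integral>x. s i x \<partial>lborel) - (\<integral>x. f x \<partial>lborel)\<bar> \<le> d i" for i
  proof -
    have "(\<integral>x. s i x \<partial>lborel) - (\<integral>x. f x \<partial>lborel) = (\<integral>x. s i x - f x \<partial>lborel)"
      by (intro Bochner_Integration.integral_diff[symmetric] s f)
    also have "\<bar>\<dots>\<bar> \<le> d i" unfolding d_def by (rule integral_abs_bound)
    finally show ?thesis .
  qed
  have "I f \<longlonglongrightarrow> l * (\<integral>x. f x \<partial>lborel)"
  proof (rule LIMSEQ_I)
    fix r :: real assume r: "r > 0"
    have "(\<lambda>i. (1 + \<bar>l\<bar>) * d i) \<longlonglongrightarrow> (1 + \<bar>l\<bar>) * 0" by (intro tendsto_intros d)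
    then have "eventually (\<lambda>i. (1 + \<bar>l\<bar>) * d i < r / 2) sequentially" using r order_tendstoD(2)[of _ "(1 + \<bar>l\<bar>) * 0" sequentially "r / 2"] by simp
    then obtain i where i: "(1 + \<bar>l\<bar>) * d i < r / 2" by (auto simp: eventually_sequentially)
    obtain n0 where n0: "\<And>n. n \<ge> n0 \<Longrightarrow> \<bar>I (s i) n - l * (\<integral>x. s i x \<partial>lborel)\<bar> < r / 2"
      using LIMSEQ_D[OF s(2)[of i, unfolded samples_def], of "r / 2"] r unfolding I_def by auto
    show "\<exists>no. \<forall>n\<ge>no. norm (I f n - l * (\<integral>x. f x \<partial>lborel)) < r"
    proof (intro exI[of _ n0] allI impI)
      fix n assume n: "n \<ge> n0"
      have "\<bar>l * ((\<integral>x. s i x \<partial>lborel) - (\<integral>x. f x \<partial>lborel))\<bar> \<le> \<bar>l\<bar> * d i"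
        unfolding abs_mult using dl[of i] by (intro mult_left_mono) auto
      then have "\<bar>l * (\<integral>x. s i x \<partial>lborel) - l * (\<integral>x. f x \<partial>lborel)\<bar> \<le> \<bar>l\<bar> * d i"
        by (simp add: right_diff_distrib)
      then show "norm (I f n - l * (\<integral>x. f x \<partial>lborel)) < r"
        using dI[of i n] n0[OF n] i unfolding real_norm_def distrib_right by linarith
    qed
  qed
  then show ?thesis unfolding samples_def I_def .
qed

text \<open>Intervals generate: first Borel sets within a bounded window, by closure under
  complements and disjoint unions, then integrable functions. The window keeps the measures finite
  when complements are taken.\<close>

lemma samples_all:
  assumes N: "\<And>n. N n \<in> sets borel"
    and int: "\<And>u v. u \<le> v \<Longrightarrow> (\<lambda>n. measure lborel (N n \<inter> {u..<v})) \<longlonglongrightarrow> l * (v - u)"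
    and f: "integrable lborel f"
  shows "samples N l f"
proof -
  have bounded_int: "integrable lborel (indicator A :: real \<Rightarrow> real)" if "A \<in> sets borel" "bounded A" for A
    using that emeasure_bounded_finite[OF that(2)] by (simp add: less_top)
  have window_int: "integrable lborel (indicator (A \<inter> {-k..<k}) :: real \<Rightarrow> real)" if "A \<in> sets borel" for A k
  proof (rule bounded_int)
    show "A \<inter> {-k..<k} \<in> sets borel" using that by simp
    show "bounded (A \<inter> {-k..<k})" by (rule bounded_subset[of "{-k..k}"]) auto
  qed
  have interval: "samples N l (indicator {u..<v})" for u v
  proof (cases "u \<le> v")
    case True
    have "indicator (N n) x * indicator {u..<v} x = (indicator (N n \<inter> {u..<v}) x :: real)" for n x
      by (simp add: indicator_def)
    then show ?thesis using int[OF True] True N unfolding samples_def by simp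
  qed (simp add: samples_def)
  have window: "samples N l (indicator (A \<inter> {-k..<k}))" if "A \<in> sets borel" for A and k :: real
  proof -
    define G where "G = range (\<lambda>(a, b). {a ..< b :: real})"
    have "Int_stable G" unfolding Int_stable_def G_def
    proof safe
      fix a b c d :: real
      have "{a..<b} \<inter> {c..<d} = {max a c..<min b d}" by auto
      then show "{a..<b} \<inter> {c..<d} \<in> range (\<lambda>(a, b). {a..<b})" by auto
    qed
    moreover have "G \<subseteq> Pow UNIV" by simp
    moreover have sets_G: "sigma_sets UNIV G = sets borel"
      unfolding G_def by (subst borel_eq_atLeastLessThan) (simp add: sets_measure_of)
    ultimately have "Int_stable G" "G \<subseteq> Pow UNIV" "A \<in> sigma_sets UNIV G" using that by auto
    then show ?thesis
    proof (induction rule: sigma_sets_induct_disjoint)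
      case (basic A)
      then obtain a b where "A = {a..<b}" by (auto simp: G_def)
      then have "A \<inter> {-k..<k} = {max a (-k)..<min b k}" by auto
      then show ?case using interval by simp
    next
      case empty
      show ?case by (simp add: samples_def)
    next
      case (compl A)
      then have A: "A \<in> sets borel" by (simp add: sets_G)
      have "indicator ((UNIV - A) \<inter> {-k..<k}) = (\<lambda>x. indicator {-k..<k} x + (-1) * (indicator (A \<inter> {-k..<k}) x :: real))"
        by (rule ext) (auto simp: indicator_def)
      moreover have "samples N l (\<lambda>x. indicator {-k..<k} x + (-1) * indicator (A \<inter> {-k..<k}) x)"
        using window_int[of UNIV k] window_int[OF A, of k]
        by (intro samples_add N interval samples_scale[OF compl(2)] integrable_mult_right) simp_all
      ultimately show ?case by (simp only:)
    next
      case (union A)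
      have A: "A i \<in> sets borel" for i using union(2) by (auto simp: sets_G)
      define s where "s = (\<lambda>n x. \<Sum>i<n. indicator (A i \<inter> {-k..<k}) x :: real)"
      have A_int: "integrable lborel (indicator (A i \<inter> {-k..<k}) :: real \<Rightarrow> real)" for i
        by (rule window_int[OF A])
      have s_eq: "s n x = indicator ((\<Union>i<n. A i) \<inter> {-k..<k}) x" for n x
      proof (induction n)
        case (Suc n)
        have "A n \<inter> A i = {}" if "i < n" for i
          using union(1) that unfolding disjoint_family_on_def by simp
        then have d: "A n \<inter> (\<Union>i<n. A i) = {}" by blast
        have "s (Suc n) x = indicator ((\<Union>i<n. A i) \<inter> {-k..<k}) x + indicator (A n \<inter> {-k..<k}) x"
          unfolding Suc[symmetric] by (simp add: s_def)
        also have "\<dots> = indicator (((\<Union>i<n. A i) \<inter> {-k..<k}) \<union> (A n \<inter> {-k..<k})) x"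
          by (subst indicator_add[symmetric]) (use d in blast, simp)
        also have "((\<Union>i<n. A i) \<inter> {-k..<k}) \<union> (A n \<inter> {-k..<k}) = (\<Union>i<Suc n. A i) \<inter> {-k..<k}"
          unfolding lessThan_Suc by blast
        finally show ?case .
      qed (simp add: s_def)
      show ?case
      proof (rule samples_lim[OF N, where s = s])
        show "integrable lborel (s n)" for n unfolding s_def using A_int by auto
        show "samples N l (s n)" for n
        proof (induction n)
          case (Suc n)
          have "integrable lborel (s n)" unfolding s_def using A_int by auto
          from samples_add[OF N this A_int Suc union(3)] show ?case by (simp add: s_def)
        qed (simp add: s_def samples_def)
        show "(\<lambda>n. s n x) \<longlonglongrightarrow> indicator ((\<Union>i. A i) \<inter> {-k..<k}) x" for x
        proof -
          have "(\<lambda>n. indicator (\<Union>i<n. A i \<inter> {-k..<k}) x :: real) \<longlonglongrightarrow> indicator (\<Union>i. A i \<inter> {-k..<k}) x"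
            by (rule LIMSEQ_indicator_UN)
          moreover have "(\<Union>i\<in>I. A i \<inter> {-k..<k}) = (\<Union>i\<in>I. A i) \<inter> {-k..<k}" for I by blast
          ultimately show ?thesis unfolding s_eq by (simp only:)
        qed
        show "norm (s n x) \<le> 2 * norm (indicator ((\<Union>i. A i) \<inter> {-k..<k}) x :: real)" for n x
          unfolding s_eq by (auto simp: indicator_def)
        show "integrable lborel (indicator ((\<Union>i. A i) \<inter> {-k..<k}) :: real \<Rightarrow> real)"
          by (rule window_int) (use A in auto)
      qed
    qed
  qed
  show ?thesis using f
  proof induction
    case (base A c)
    have A: "A \<in> sets borel" using base by simp
    have "samples N l (indicator A)"
    proof (rule samples_lim[OF N, where s = "\<lambda>n. indicator (A \<inter> {- real n..<real n})"])
      show "integrable lborel (indicator (A \<inter> {- real n..<real n}) :: real \<Rightarrow> real)" for n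
        by (rule window_int[OF A])
      show "samples N l (indicator (A \<inter> {- real n..<real n}))" for n by (rule window[OF A])
      show "(\<lambda>n. indicator (A \<inter> {- real n..<real n}) x :: real) \<longlonglongrightarrow> indicator A x" for x
      proof (rule tendsto_eventually)
        obtain n0 :: nat where "\<bar>x\<bar> < n0" using reals_Archimedean2 by blast
        then show "eventually (\<lambda>n. indicator (A \<inter> {- real n..<real n}) x = (indicator A x :: real)) sequentially"
          by (intro eventually_sequentiallyI[of n0]) (auto simp: indicator_def)
      qed
      show "norm (indicator (A \<inter> {- real n..<real n}) x :: real) \<le> 2 * norm (indicator A x :: real)" for n x
        by (auto simp: indicator_def)
      show "integrable lborel (indicator A :: real \<Rightarrow> real)" using base by simp
    qed
    then show ?case using samples_scale[of N l "indicator A" c] by (simp add: mult.commute)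
  next
    case (add f g)
    then show ?case by (intro samples_add N)
  next
    case (lim f s)
    then show ?case by (intro samples_lim[OF N, where s = s and f = f]) auto
  qed
qed

lemma equidistribution_absolutely_continuous:
  fixes \<mu> :: "real measure"
  assumes N: "\<And>n. N n \<in> sets borel"
    and int: "\<And>u v. u \<le> v \<Longrightarrow> (\<lambda>n. measure lborel (N n \<inter> {u..<v})) \<longlonglongrightarrow> l * (v - u)"
    and \<mu>: "finite_measure \<mu>" "sets \<mu> = sets borel" "absolutely_continuous lborel \<mu>"
  shows "(\<lambda>n. measure \<mu> (N n)) \<longlonglongrightarrow> l * measure \<mu> (space \<mu>)"
proof -
  obtain g where g: "g \<in> borel_measurable lborel" "density lborel g = \<mu>"
    using sigma_finite_measure.Radon_Nikodym[OF sigma_finite_lborel \<mu>(3)] \<mu>(2) by auto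
  have "(\<integral>\<^sup>+x. g x \<partial>lborel) = emeasure \<mu> (space \<mu>)"
    unfolding g(2)[symmetric] using g(1) by (subst emeasure_density) (auto)
  then have fin: "(\<integral>\<^sup>+x. g x \<partial>lborel) < \<infinity>"
    using finite_measure.emeasure_finite[OF \<mu>(1), of "space \<mu>"] by (simp add: less_top)
  define f where "f = (\<lambda>x. enn2real (g x))"
  have fm[measurable]: "f \<in> borel_measurable borel" using g(1) by (simp add: f_def)
  have "AE x in lborel. g x \<noteq> \<infinity>" using g(1) fin by (intro nn_integral_PInf_AE) auto
  then have fg: "AE x in lborel. ennreal (f x) = g x"
    by eventually_elim (simp add: f_def less_top)
  have f_int: "integrable lborel f"
  proof (rule integrableI_nonneg)
    have "(\<integral>\<^sup>+x. ennreal (f x) \<partial>lborel) = (\<integral>\<^sup>+x. g x \<partial>lborel)" using fg by (intro nn_integral_cong_AE)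
    then show "(\<integral>\<^sup>+x. ennreal (f x) \<partial>lborel) < \<infinity>" using fin by simp
  qed (use fm in \<open>auto simp: f_def\<close>)
  have meas: "measure \<mu> A = (\<integral>x. indicator A x * f x \<partial>lborel)" if "A \<in> sets borel" for A
  proof -
    have "emeasure \<mu> A = (\<integral>\<^sup>+x. g x * indicator A x \<partial>lborel)"
      unfolding g(2)[symmetric] using g(1) that by (subst emeasure_density) auto
    also have "\<dots> = (\<integral>\<^sup>+x. ennreal (indicator A x * f x) \<partial>lborel)"
      using fg by (intro nn_integral_cong_AE, eventually_elim) (auto simp: indicator_def)
    also have "\<dots> = ennreal (\<integral>x. indicator A x * f x \<partial>lborel)"
      using that by (intro nn_integral_eq_integral integrable_indicator_mult f_int) (auto simp: f_def)
    finally show ?thesis by (simp add: measure_def f_def)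
  qed
  have "samples N l f" by (rule samples_all[OF N int f_int])
  moreover have "measure \<mu> (space \<mu>) = (\<integral>x. f x \<partial>lborel)"
    using meas[of UNIV] sets_eq_imp_space_eq[OF \<mu>(2)] by simp
  ultimately show ?thesis unfolding samples_def using meas N by simp
qed

section \<open>Excursions of geodesics\<close>

text \<open>The sum of exponentials is the form \<open>|q z - p|\<^sup>2 / Im z\<close> along the geodesic from \<open>\<eta>\<close> to \<open>\<xi>\<close>; its
  minimum is proportional to \<open>|(q \<xi> - p) (q \<eta> - p)|\<close>, attained at time about \<open>2 ln q\<close>.\<close>

lemma eventually_deep_of_visit:
  fixes \<xi> \<eta> A B \<kappa> \<epsilon> :: real
  assumes AB: "A > 0" "B > 0" "A * B * (\<xi> - \<eta>)\<^sup>2 = 1" and \<kappa>: "\<kappa> > 0" and \<epsilon>: "0 < \<epsilon>" "\<epsilon> < 1"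
  shows "eventually (\<lambda>T. \<forall>p q. 1 \<le> q \<longrightarrow> real_of_int q \<le> exp ((1 - \<epsilon>) * T / 2) \<longrightarrow>
      \<xi> \<in> visits (1, 1) ((1 - \<epsilon>) / (2 * \<kappa> * T)) p q \<longrightarrow>
      (\<exists>t\<in>{0..T}. A * (q * \<xi> - p)\<^sup>2 * exp t + B * (q * \<eta> - p)\<^sup>2 * exp (- t) < wt (1, 1) p q / (2 * cosh (ln (\<kappa> * T))))) at_top"
proof -
  define \<Delta> where "\<Delta> = \<bar>\<xi> - \<eta>\<bar>"
  have \<Delta>: "\<Delta> > 0" using AB by (auto simp: \<Delta>_def)
  have ABD: "A * B * \<Delta>\<^sup>2 = 1" using AB by (simp add: \<Delta>_def)
  \<comment> \<open>\<open>h T\<close> is twice \<open>cosh (ln (\<kappa> * T))\<close>. The gap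
    between the limit 1 - \<epsilon> below and 1 is the room for all lower order terms.\<close>
  define \<rho> h where "\<rho> = (\<lambda>T. (1 - \<epsilon>) / (2 * \<kappa> * T))" and "h = (\<lambda>T. \<kappa> * T + 1 / (\<kappa> * T))"
  have "((\<lambda>T. 2 * \<rho> T * (1 + 4 * \<rho> T / \<Delta>) * h T) \<longlongrightarrow> 1 - \<epsilon>) at_top"
    unfolding \<rho>_def h_def using \<kappa> \<epsilon> \<Delta> by real_asymp
  then have e1: "eventually (\<lambda>T. 2 * \<rho> T * (1 + 4 * \<rho> T / \<Delta>) * h T < 1) at_top"
    by (rule order_tendstoD(2)) (use \<epsilon> in simp)
  have "(\<rho> \<longlongrightarrow> 0) at_top" unfolding \<rho>_def using \<kappa> \<epsilon> by real_asymp
  then have e2: "eventually (\<lambda>T. \<rho> T < min 1 (\<Delta> / 4)) at_top" by (rule order_tendstoD(2)) (use \<Delta> in simp)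
  have "((\<lambda>T. 2 * h T * (B * (\<Delta> + 2)\<^sup>2) * exp (- \<epsilon> * T)) \<longlongrightarrow> 0) at_top"
    unfolding h_def using \<kappa> \<epsilon> \<Delta> AB by real_asymp
  then have e3: "eventually (\<lambda>T. 2 * h T * (B * (\<Delta> + 2)\<^sup>2) * exp (- \<epsilon> * T) < 1) at_top"
    by (rule order_tendstoD) simp
  have "filterlim h at_top at_top" unfolding h_def using \<kappa> by real_asymp
  then have e4: "eventually (\<lambda>T. h T \<ge> 1 / (B * (\<Delta> / 2)\<^sup>2)) at_top" by (simp add: filterlim_at_top)
  have e5: "eventually (\<lambda>T::real. T > 0) at_top" by (rule eventually_gt_at_top)
  show ?thesis using e1 e2 e3 e4 e5
  proof eventually_elim
    case (elim T)
    define k0 where "k0 = 2 * cosh (ln (\<kappa> * T))"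
    have hk: "k0 = h T" using elim(5) \<kappa> by (simp add: k0_def h_def cosh_ln_real field_simps)
    have hpos: "h T > 0" using elim(5) \<kappa> by (simp add: h_def add_pos_pos)
    have \<rho>0: "\<rho> T > 0" using elim(5) \<kappa> \<epsilon> by (simp add: \<rho>_def)
    show ?case
    proof (intro allI impI)
      fix p q :: int
      assume q: "1 \<le> q" "real_of_int q \<le> exp ((1 - \<epsilon>) * T / 2)" and v: "\<xi> \<in> visits (1, 1) ((1 - \<epsilon>) / (2 * \<kappa> * T)) p q"
      define k where "k = wt (1, 1) p q"
      have k: "1 \<le> k" "k \<le> 2" using wt_cases[of "(1,1)" p q] by (auto simp: k_def)
      have q1: "real_of_int q \<ge> 1" using q by simp
      define x e where "x = \<bar>q * \<xi> - p\<bar>" and "e = \<bar>q * \<eta> - p\<bar>"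
      have x0: "0 \<le> x" "0 \<le> e" by (auto simp: x_def e_def)
      have qx: "q * x < \<rho> T * k" using v by (simp add: visits_def x_def k_def \<rho>_def)
      have "x \<le> q * x" using q1 x0 mult_right_mono[of 1 "real_of_int q" x] by simp
      moreover have "\<rho> T * k \<le> \<rho> T * 2" using k \<rho>0 by (intro mult_left_mono) auto
      ultimately have x2: "x \<le> 2 * \<rho> T" using qx by linarith
      have qd: "\<bar>q * \<xi> - q * \<eta>\<bar> = q * \<Delta>" using q1 by (simp add: \<Delta>_def abs_mult flip: right_diff_distrib)
      have e_up: "e \<le> q * \<Delta> + x" and e_lo: "q * \<Delta> - x \<le> e" using qd unfolding x_def e_def by linarith+
      define \<alpha> \<beta> where "\<alpha> = A * x\<^sup>2" and "\<beta> = B * e\<^sup>2"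
      have "x * e \<le> x * (q * \<Delta> + x)" using e_up x0 by (intro mult_left_mono)
      also have "\<dots> = (q * x) * \<Delta> + x * x" by (simp add: algebra_simps)
      also have "\<dots> \<le> \<rho> T * k * \<Delta> + 2 * \<rho> T * (2 * \<rho> T)"
        using qx \<Delta> x2 x0 \<rho>0 by (intro add_mono mult_mono[of x _ x] mult_right_mono) auto
      also have "\<dots> \<le> \<rho> T * k * \<Delta> + k * (4 * \<rho> T * \<rho> T)"
        using k \<rho>0 mult_right_mono[of 1 k "4 * \<rho> T * \<rho> T"] by simp
      also have "\<dots> = k * \<rho> T * \<Delta> * (1 + 4 * \<rho> T / \<Delta>)" using \<Delta> by (simp add: field_simps)
      finally have xe: "x * e \<le> k * \<rho> T * \<Delta> * (1 + 4 * \<rho> T / \<Delta>)" .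
      have "2 * h T * (x * e) \<le> 2 * h T * (k * \<rho> T * \<Delta> * (1 + 4 * \<rho> T / \<Delta>))"
        using xe hpos by (intro mult_left_mono) auto
      also have "\<dots> = (k * \<Delta>) * (2 * \<rho> T * (1 + 4 * \<rho> T / \<Delta>) * h T)" by (simp add: algebra_simps)
      also have "\<dots> < (k * \<Delta>) * 1" using elim(1) k \<Delta> by (intro mult_strict_left_mono) auto
      finally have "2 * h T * (x * e) < k * \<Delta>" by simp
      then have "(2 * h T * (x * e))\<^sup>2 < (k * \<Delta>)\<^sup>2" using x0 hpos by (intro power_strict_mono) auto
      then have "A * B * (2 * h T * (x * e))\<^sup>2 < A * B * (k * \<Delta>)\<^sup>2" using AB by simp
      also have "\<dots> = k\<^sup>2 * (A * B * \<Delta>\<^sup>2)" by (simp add: power_mult_distrib)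
      finally have ab: "4 * (h T)\<^sup>2 * (\<alpha> * \<beta>) < k\<^sup>2"
        unfolding ABD \<alpha>_def \<beta>_def by (simp add: power_mult_distrib algebra_simps)
      have e_low2: "\<Delta> / 2 \<le> e"
      proof -
        have "\<Delta> \<le> q * \<Delta>" using q1 \<Delta> by simp
        then show ?thesis using e_lo x2 elim(2) by linarith
      qed
      then have \<beta>_low: "B * (\<Delta> / 2)\<^sup>2 \<le> \<beta>" unfolding \<beta>_def using AB \<Delta> by (intro mult_left_mono power_mono) auto
      have \<beta>0: "\<beta> > 0" using \<beta>_low AB \<Delta> by (smt (verit) zero_less_power mult_pos_pos half_gt_zero)
      have "e \<le> q * (\<Delta> + 2)"
      proof -
        have "x \<le> q * 2" using x2 elim(2) q1 by linarith
        then show ?thesis using e_up by (simp add: distrib_left)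
      qed
      then have "\<beta> \<le> B * (q * (\<Delta> + 2))\<^sup>2" unfolding \<beta>_def using AB x0 by (intro mult_left_mono power_mono) auto
      also have "\<dots> = (B * (\<Delta> + 2)\<^sup>2) * (real_of_int q)\<^sup>2" by (simp add: power_mult_distrib)
      also have "\<dots> \<le> (B * (\<Delta> + 2)\<^sup>2) * exp ((1 - \<epsilon>) * T)"
      proof (intro mult_left_mono)
        have "(real_of_int q)\<^sup>2 \<le> (exp ((1 - \<epsilon>) * T / 2))\<^sup>2" using q q1 by (intro power_mono) auto
        also have "\<dots> = exp ((1 - \<epsilon>) * T)" by (simp flip: exp_double)
        finally show "(real_of_int q)\<^sup>2 \<le> exp ((1 - \<epsilon>) * T)" .
      qed (use AB in auto)
      finally have \<beta>_up: "\<beta> \<le> (B * (\<Delta> + 2)\<^sup>2) * exp ((1 - \<epsilon>) * T)" .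
      \<comment> \<open>exp t is chosen so that the second exponential term is exactly half of
        \<open>k / h T\<close>; the bound on \<open>\<alpha> * \<beta>\<close> then makes the first
        one less than half. Assumptions \<open>e4\<close> and \<open>e3\<close> place t in
        [0, T].\<close>
      define X where "X = 2 * (h T / k) * \<beta>"
      have X_low: "1 \<le> X"
      proof -
        have "1 \<le> h T * (B * (\<Delta> / 2)\<^sup>2)" using elim(4) AB \<Delta> by (simp add: field_simps)
        also have "\<dots> \<le> h T * \<beta>" using \<beta>_low hpos by (intro mult_left_mono) auto
        also have "\<dots> \<le> X"
        proof -
          have "h T \<le> 2 * (h T / k)" using k hpos by (simp add: field_simps)
          then show ?thesis unfolding X_def using \<beta>0 by (intro mult_right_mono) auto
        qed
        finally show ?thesis .
      qed
      have X_up: "X \<le> exp T"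
      proof -
        have "2 * (h T / k) \<le> 2 * h T" using k hpos by (simp add: field_simps)
        then have "X \<le> 2 * h T * ((B * (\<Delta> + 2)\<^sup>2) * exp ((1 - \<epsilon>) * T))"
          unfolding X_def using \<beta>_up \<beta>0 k hpos by (intro mult_mono) auto
        also have "exp ((1 - \<epsilon>) * T) = exp (- \<epsilon> * T) * exp T" by (simp add: algebra_simps flip: exp_add)
        also have "2 * h T * ((B * (\<Delta> + 2)\<^sup>2) * (exp (- \<epsilon> * T) * exp T)) = (2 * h T * (B * (\<Delta> + 2)\<^sup>2) * exp (- \<epsilon> * T)) * exp T"
          by simp
        also have "\<dots> \<le> 1 * exp T" using elim(3) by (intro mult_right_mono) auto
        finally show ?thesis by simp
      qed
      define t where "t = ln X"
      have t: "t \<in> {0..T}" "exp t = X" "exp (- t) = 1 / X"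
      proof -
        have "ln X \<le> ln (exp T)" using X_up X_low by (subst ln_le_cancel_iff) auto
        then show "t \<in> {0..T}" using X_low by (auto simp: t_def)
        show "exp t = X" "exp (- t) = 1 / X" using X_low by (auto simp: t_def exp_minus field_simps)
      qed
      have "\<alpha> * X = (4 * (h T)\<^sup>2 * (\<alpha> * \<beta>)) / (2 * h T * k)"
        unfolding X_def using hpos k by (simp add: field_simps power2_eq_square)
      also have "\<dots> < k\<^sup>2 / (2 * h T * k)" using ab hpos k by (intro divide_strict_right_mono) auto
      also have "\<dots> = k / (2 * h T)" using k by (simp add: power2_eq_square)
      finally have 1: "\<alpha> * X < k / (2 * h T)" .
      have 2: "\<beta> * (1 / X) = k / (2 * h T)" unfolding X_def using \<beta>0 hpos k by (simp add: field_simps)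
      have "\<alpha> * exp t + \<beta> * exp (- t) < k / h T" unfolding t(2,3) using 1 2 by (simp add: field_simps)
      moreover have "\<alpha> = A * (q * \<xi> - p)\<^sup>2" "\<beta> = B * (q * \<eta> - p)\<^sup>2" by (simp_all add: \<alpha>_def \<beta>_def x_def e_def)
      ultimately show "\<exists>t\<in>{0..T}. A * (q * \<xi> - p)\<^sup>2 * exp t + B * (q * \<eta> - p)\<^sup>2 * exp (- t) < wt (1, 1) p q / (2 * cosh (ln (\<kappa> * T)))"
        using t(1) unfolding k_def[symmetric] k0_def[symmetric] hk by (intro bexI[of _ t]) auto
    qed
  qed
qed

text \<open>The inequality of arithmetic and geometric means bounds \<bar>(q \<xi> - p) (q \<eta> -
  p)\<bar> whatever t is, and t \<le> T bounds q through the second term. The 2 subtracted from the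
  hyperbolic cosine is the loss in \<open>qform_of_theta_dist_gt\<close>.\<close>

lemma eventually_visit_of_deep:
  fixes \<xi> \<eta> A B \<kappa> \<epsilon> :: real
  assumes AB: "A > 0" "B > 0" "A * B * (\<xi> - \<eta>)\<^sup>2 = 1" and \<kappa>: "\<kappa> > 0" and \<epsilon>: "0 < \<epsilon>"
  shows "eventually (\<lambda>T. \<forall>t\<in>{0..T}. \<forall>p q. coprime p q \<longrightarrow>
      A * (q * \<xi> - p)\<^sup>2 * exp t + B * (q * \<eta> - p)\<^sup>2 * exp (- t) < wt (1, 1) p q / (2 * (cosh (ln (\<kappa> * T)) - 2)) \<longrightarrow>
      \<xi> \<notin> avoid (1, 1) (exp ((1 + \<epsilon>) * T / 2)) ((1 + \<epsilon>) / (2 * \<kappa> * T))) at_top"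
proof -
  define \<Delta> where "\<Delta> = \<bar>\<xi> - \<eta>\<bar>"
  have \<Delta>: "\<Delta> > 0" using AB by (auto simp: \<Delta>_def)
  have ABD: "A * B * \<Delta>\<^sup>2 = 1" using AB by (simp add: \<Delta>_def)
  define \<rho> h where "\<rho> = (\<lambda>T. (1 + \<epsilon>) / (2 * \<kappa> * T))" and "h = (\<lambda>T. \<kappa> * T + 1 / (\<kappa> * T) - 4)"
  \<comment> \<open>Bounds \<bar>q \<xi> - p\<bar>, because the first term alone is at most
    \<open>2 / h T\<close>. Once it is below 1, it excludes q = 0.\<close>
  define \<epsilon>1 where "\<epsilon>1 = (\<lambda>T. sqrt (2 / (A * h T)))"
  have h_top: "filterlim h at_top at_top" unfolding h_def using \<kappa> by real_asymp
  then have e1: "eventually (\<lambda>T. h T > 0) at_top" by (simp add: filterlim_at_top_dense)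
  have "(\<epsilon>1 \<longlongrightarrow> 0) at_top" unfolding \<epsilon>1_def h_def using \<kappa> AB by real_asymp
  then have e2: "eventually (\<lambda>T. \<epsilon>1 T < min 1 (\<Delta> / 2)) at_top" by (rule order_tendstoD(2)) (use \<Delta> in simp)
  have "((\<lambda>T. 2 * \<rho> T * h T * (1 - \<epsilon>1 T / \<Delta>)) \<longlongrightarrow> 1 + \<epsilon>) at_top"
    unfolding \<rho>_def h_def \<epsilon>1_def using \<kappa> \<epsilon> \<Delta> AB by real_asymp
  then have e3: "eventually (\<lambda>T. 2 * \<rho> T * h T * (1 - \<epsilon>1 T / \<Delta>) > 1) at_top"
    by (rule order_tendstoD(1)) (use \<epsilon> in simp)
  have "((\<lambda>T. 8 / (B * \<Delta>\<^sup>2 * h T) * exp (- \<epsilon> * T)) \<longlongrightarrow> 0) at_top"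
    unfolding h_def using \<kappa> \<epsilon> \<Delta> AB by real_asymp
  then have e4: "eventually (\<lambda>T. 8 / (B * \<Delta>\<^sup>2 * h T) * exp (- \<epsilon> * T) < 1) at_top"
    by (rule order_tendstoD) simp
  have e5: "eventually (\<lambda>T::real. T > 0) at_top" by (rule eventually_gt_at_top)
  show ?thesis using e1 e2 e3 e4 e5
  proof eventually_elim
    case (elim T)
    define k0 where "k0 = 2 * (cosh (ln (\<kappa> * T)) - 2)"
    have hk: "k0 = h T" using elim(5) \<kappa> by (simp add: k0_def h_def cosh_ln_real field_simps)
    show ?case
    proof (intro ballI allI impI)
      fix t :: real and p q :: int
      assume t: "t \<in> {0..T}" and cop: "coprime p q"
        and f: "A * (q * \<xi> - p)\<^sup>2 * exp t + B * (q * \<eta> - p)\<^sup>2 * exp (- t) < wt (1, 1) p q / (2 * (cosh (ln (\<kappa> * T)) - 2))"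
      define k where "k = wt (1, 1) p q"
      have k: "1 \<le> k" "k \<le> 2" using wt_cases[of "(1,1)" p q] by (auto simp: k_def)
      define x e where "x = \<bar>q * \<xi> - p\<bar>" and "e = \<bar>q * \<eta> - p\<bar>"
      have x0: "0 \<le> x" "0 \<le> e" by (auto simp: x_def e_def)
      define \<alpha> \<beta> where "\<alpha> = A * x\<^sup>2" and "\<beta> = B * e\<^sup>2"
      have \<alpha>\<beta>0: "0 \<le> \<alpha>" "0 \<le> \<beta>" using AB by (auto simp: \<alpha>_def \<beta>_def)
      have F: "\<alpha> * exp t + \<beta> * exp (- t) < k / h T"
        using f unfolding k0_def[symmetric] hk k_def \<alpha>_def \<beta>_def x_def e_def by simp
      have kh: "k / h T \<le> 2 / h T" using k elim(1) by (intro divide_right_mono) auto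
      have "\<alpha> * 1 \<le> \<alpha> * exp t" using t \<alpha>\<beta>0 by (intro mult_left_mono) auto
      moreover have "0 \<le> \<beta> * exp (- t)" using \<alpha>\<beta>0 by simp
      ultimately have "A * x\<^sup>2 \<le> 2 / h T" using F kh unfolding \<alpha>_def by linarith
      then have "x\<^sup>2 \<le> 2 / (A * h T)" using AB elim(1) by (simp add: field_simps)
      then have xe1: "x \<le> \<epsilon>1 T" unfolding \<epsilon>1_def using x0 real_le_rsqrt by blast
      have q0: "q \<noteq> 0"
      proof
        assume "q = 0"
        then have "\<bar>p\<bar> = 1" using cop by simp
        then have "x = 1" using \<open>q = 0\<close> by (simp add: x_def)
        then show False using xe1 elim(2) by simp
      qed
      define n where "n = \<bar>real_of_int q\<bar>"
      have n1: "n \<ge> 1" using q0 unfolding n_def by linarith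
      have qd: "\<bar>q * \<xi> - q * \<eta>\<bar> = n * \<Delta>" by (simp add: n_def \<Delta>_def flip: right_diff_distrib abs_mult)
      have e_lo: "n * \<Delta> - x \<le> e" using qd unfolding x_def e_def by linarith
      have e_lo2: "n * (\<Delta> - \<epsilon>1 T) \<le> e"
      proof -
        have "\<epsilon>1 T \<ge> 0" using xe1 x0 by linarith
        then have "\<epsilon>1 T \<le> n * \<epsilon>1 T" using n1 mult_right_mono[of 1 n "\<epsilon>1 T"] by simp
        then show ?thesis using e_lo xe1 by (simp add: right_diff_distrib)
      qed
      have \<Delta>\<epsilon>: "\<Delta> - \<epsilon>1 T \<ge> \<Delta> / 2" using elim(2) by simp
      have "4 * (\<alpha> * \<beta>) \<le> (\<alpha> * exp t + \<beta> * exp (- t))\<^sup>2"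
      proof -
        have "(\<alpha> * exp t) * (\<beta> * exp (- t)) = (\<alpha> * \<beta>) * (exp t * exp (- t))" by (simp only: mult_ac)
        also have "exp t * exp (- t) = 1" by (simp flip: exp_add)
        finally have 1: "(\<alpha> * exp t) * (\<beta> * exp (- t)) = \<alpha> * \<beta>" by simp
        have "4 * (X * Y) \<le> (X + Y)\<^sup>2" for X Y :: real
          using zero_le_power2[of "X - Y"] unfolding power2_sum power2_diff by linarith
        from this[of "\<alpha> * exp t" "\<beta> * exp (- t)"] show ?thesis unfolding 1 .
      qed
      also have "\<dots> < (k / h T)\<^sup>2" using F \<alpha>\<beta>0 by (intro power_strict_mono) auto
      finally have "4 * (\<alpha> * \<beta>) < (k / h T)\<^sup>2" .
      then have "4 * (\<alpha> * \<beta>) * \<Delta>\<^sup>2 < (k / h T)\<^sup>2 * \<Delta>\<^sup>2" using \<Delta> by simp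
      moreover have "4 * (\<alpha> * \<beta>) * \<Delta>\<^sup>2 = (A * B * \<Delta>\<^sup>2) * (2 * x * e)\<^sup>2"
        by (simp add: \<alpha>_def \<beta>_def power_mult_distrib)
      ultimately have "(2 * x * e)\<^sup>2 < (k / h T * \<Delta>)\<^sup>2" unfolding ABD power_mult_distrib[of "k / h T" \<Delta>] by simp
      then have xe: "2 * x * e < k / h T * \<Delta>"
        using k elim(1) \<Delta> by (intro power_less_imp_less_base[of "2 * x * e" 2]) auto
      have nx: "n * x < \<rho> T * k"
      proof -
        have "2 * x * (n * (\<Delta> - \<epsilon>1 T)) \<le> 2 * x * e" using e_lo2 x0 by (intro mult_left_mono) auto
        then have "2 * x * (n * (\<Delta> - \<epsilon>1 T)) < k / h T * \<Delta>" using xe by linarith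
        then have 1: "(2 * h T * (\<Delta> - \<epsilon>1 T)) * (n * x) < k * \<Delta>" using elim(1) by (simp add: field_simps)
        have "k * \<Delta> * 1 < k * \<Delta> * (2 * \<rho> T * h T * (1 - \<epsilon>1 T / \<Delta>))"
          using elim(3) k \<Delta> by (intro mult_strict_left_mono) auto
        also have "\<dots> = (2 * h T * (\<Delta> - \<epsilon>1 T)) * (\<rho> T * k)" using \<Delta> by (simp add: field_simps)
        finally have "(2 * h T * (\<Delta> - \<epsilon>1 T)) * (n * x) < (2 * h T * (\<Delta> - \<epsilon>1 T)) * (\<rho> T * k)" using 1 by linarith
        moreover have "2 * h T * (\<Delta> - \<epsilon>1 T) > 0" using elim(1) \<Delta>\<epsilon> \<Delta> by (intro mult_pos_pos) auto
        ultimately show ?thesis by (simp only: mult_less_cancel_left_pos)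
      qed
      have nQ: "n \<le> exp ((1 + \<epsilon>) * T / 2)"
      proof -
        have "n * (\<Delta> / 2) \<le> e" using order.trans[OF mult_left_mono[OF \<Delta>\<epsilon>] e_lo2] n1 by simp
        then have "(n * (\<Delta> / 2))\<^sup>2 \<le> e\<^sup>2" using n1 \<Delta> by (intro power_mono) auto
        then have 1: "B * (n * (\<Delta> / 2))\<^sup>2 \<le> \<beta>" unfolding \<beta>_def using AB by (intro mult_left_mono) auto
        have "\<beta> * exp (- T) \<le> \<beta> * exp (- t)" using t \<alpha>\<beta>0 by (intro mult_left_mono) auto
        moreover have "0 \<le> \<alpha> * exp t" using \<alpha>\<beta>0 by simp
        ultimately have "\<beta> * exp (- T) \<le> 2 / h T" using F kh by linarith
        then have "\<beta> \<le> 2 / h T * exp T" by (simp add: exp_minus field_simps)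
        then have "B * (n * (\<Delta> / 2))\<^sup>2 \<le> 2 / h T * exp T" using 1 by linarith
        then have "n\<^sup>2 \<le> 8 / (B * \<Delta>\<^sup>2 * h T) * exp T"
          using AB \<Delta> elim(1) by (simp add: field_simps power2_eq_square)
        also have "exp T = exp (- \<epsilon> * T) * exp ((1 + \<epsilon>) * T)" by (simp add: algebra_simps flip: exp_add)
        also have "8 / (B * \<Delta>\<^sup>2 * h T) * (exp (- \<epsilon> * T) * exp ((1 + \<epsilon>) * T)) =
            (8 / (B * \<Delta>\<^sup>2 * h T) * exp (- \<epsilon> * T)) * exp ((1 + \<epsilon>) * T)" by simp
        also have "\<dots> \<le> 1 * exp ((1 + \<epsilon>) * T)" using elim(4) by (intro mult_right_mono) auto
        also have "\<dots> = (exp ((1 + \<epsilon>) * T / 2))\<^sup>2" by (simp flip: exp_double)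
        finally show ?thesis by (rule power2_le_imp_le) simp
      qed
      show "\<xi> \<notin> avoid (1, 1) (exp ((1 + \<epsilon>) * T / 2)) ((1 + \<epsilon>) / (2 * \<kappa> * T))"
      proof (cases "q > 0")
        case True
        then have "\<xi> \<in> visits (1, 1) (\<rho> T) p q" using nx by (simp add: visits_def n_def x_def k_def)
        then show ?thesis using True cop nQ unfolding avoid_def \<rho>_def n_def by force
      next
        case False
        then have q: "q < 0" using q0 by simp
        have "\<xi> \<in> visits (1, 1) (\<rho> T) (- p) (- q)"
          using nx q unfolding visits_neg_frac by (simp add: n_def x_def k_def)
        moreover have "coprime (- p) (- q)" using cop by simp
        ultimately show ?thesis using q nQ unfolding avoid_def \<rho>_def n_def by force
      qed
    qed
  qed
qed

section \<open>Distance in the quotient by the theta group\<close>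

text \<open>Its reciprocal is the height of z as seen from the cusp - d/c, normalised to be
  \<open>Im z\<close> at infinity; horoballs are the sets where it is small.\<close>

definition qform :: "complex \<Rightarrow> int \<Rightarrow> int \<Rightarrow> real" where
  "qform z c d = (cmod (of_int c * z + of_int d))\<^sup>2 / Im z"

text \<open>By \<open>height_eq\<close> this is the hyperbolic cosine of the distance from i to the
  image of z. Written as a mean of two row forms it can be estimated one cusp at a time.\<close>

definition height :: "int^2^2 \<Rightarrow> complex \<Rightarrow> real" where
  "height A z = (qform z (A $ 1 $ 1) (A $ 1 $ 2) + qform z (A $ 2 $ 1) (A $ 2 $ 2)) / 2"

lemma theta_det: "A \<in> theta_group \<Longrightarrow> A $ 1 $ 1 * A $ 2 $ 2 - A $ 1 $ 2 * A $ 2 $ 1 = 1"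
  by (simp add: mem_theta_group_iff)

lemma theta_denominator:
  assumes "A \<in> theta_group" "z \<in> upper_half_plane"
  shows "of_int (A $ 2 $ 1) * z + of_int (A $ 2 $ 2) \<noteq> 0"
  using moebius_denominator_nonzero[OF assms(2) theta_det[OF assms(1)]] .

lemma moebius_upper_half_plane:
  assumes "A \<in> theta_group" "z \<in> upper_half_plane"
  shows "moebius A z \<in> upper_half_plane"
  using Im_moebius[OF assms] theta_denominator[OF assms] assms(2) by (simp add: upper_half_plane_def)

lemma hyp_dist_moebius:
  assumes A: "A \<in> theta_group" and z: "z \<in> upper_half_plane" and w: "w \<in> upper_half_plane"
  shows "hyp_dist (moebius A z) (moebius A w) = hyp_dist z w"
proof -
  define a b c d where "a = A $ 1 $ 1" and "b = A $ 1 $ 2" and "c = A $ 2 $ 1" and "d = A $ 2 $ 2"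
  have "a * d - b * c = 1" using theta_det[OF A] by (simp add: a_def b_def c_def d_def)
  then have det: "(of_int a * of_int d - of_int b * of_int c :: complex) = 1"
    by (metis of_int_1 of_int_diff of_int_mult)
  define qz qw where "qz = of_int c * z + of_int d" and "qw = of_int c * w + of_int d"
  have q0: "qz \<noteq> 0" "qw \<noteq> 0"
    using theta_denominator[OF A z] theta_denominator[OF A w] by (simp_all add: qz_def qw_def c_def d_def)
  have "moebius A z - moebius A w = ((of_int a * z + of_int b) * qw - (of_int a * w + of_int b) * qz) / (qz * qw)"
    using q0 by (simp add: moebius_def diff_frac_eq flip: a_def b_def c_def d_def qz_def qw_def)
  also have "(of_int a * z + of_int b) * qw - (of_int a * w + of_int b) * qz = (of_int a * of_int d - of_int b * of_int c) * (z - w)"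
    by (simp add: qz_def qw_def algebra_simps)
  finally have "cmod (moebius A z - moebius A w) = cmod (z - w) / (cmod qz * cmod qw)"
    unfolding det by (simp add: norm_divide norm_mult)
  moreover have "Im (moebius A z) = Im z / (cmod qz)\<^sup>2" "Im (moebius A w) = Im w / (cmod qw)\<^sup>2"
    using Im_moebius[OF A z] Im_moebius[OF A w] by (simp_all add: qz_def qw_def c_def d_def)
  moreover have "cmod qz > 0" "cmod qw > 0" using q0 by auto
  ultimately have "(cmod (moebius A z - moebius A w))\<^sup>2 / (2 * Im (moebius A z) * Im (moebius A w)) = (cmod (z - w))\<^sup>2 / (2 * Im z * Im w)"
    by (simp add: power_divide power_mult_distrib)
  then show ?thesis unfolding hyp_dist_def by (simp only:)
qed

lemma theta_compose:
  assumes A: "A \<in> theta_group" and B: "B \<in> theta_group"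
  shows "\<exists>C\<in>theta_group. \<forall>z\<in>upper_half_plane. moebius C z = moebius A (moebius B z)"
proof -
  define a b c d where "a = A $ 1 $ 1" and "b = A $ 1 $ 2" and "c = A $ 2 $ 1" and "d = A $ 2 $ 2"
  define a' b' c' d' where "a' = B $ 1 $ 1" and "b' = B $ 1 $ 2" and "c' = B $ 2 $ 1" and "d' = B $ 2 $ 2"
  note defs = a_def b_def c_def d_def a'_def b'_def c'_def d'_def
  define C where "C = mat2 (a * a' + b * c') (a * b' + b * d') (c * a' + d * c') (c * b' + d * d')"
  have det: "a * d - b * c = 1" "a' * d' - b' * c' = 1"
    using theta_det[OF A] theta_det[OF B] by (simp_all add: defs)
  have "(a * a' + b * c') * (c * b' + d * d') - (a * b' + b * d') * (c * a' + d * c') = (a * d - b * c) * (a' * d' - b' * c')"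
    by (simp add: algebra_simps)
  then have "C \<in> theta_group"
    using A B det unfolding C_def mem_theta_group_iff by (simp flip: defs) auto
  moreover have "moebius C z = moebius A (moebius B z)" if z: "z \<in> upper_half_plane" for z
  proof -
    define q where "q = of_int c' * z + of_int d'"
    have q: "q \<noteq> 0" using theta_denominator[OF B z] by (simp add: q_def c'_def d'_def)
    define w where "w = (of_int a' * z + of_int b') / q"
    have w: "moebius B z = w" by (simp add: moebius_def w_def q_def flip: defs)
    have wq: "w * q = of_int a' * z + of_int b'" using q by (simp add: w_def)
    have "moebius A w = ((of_int a * w + of_int b) * q) / ((of_int c * w + of_int d) * q)"
      using q by (simp add: moebius_def flip: defs)
    also have "(of_int a * w + of_int b) * q = of_int a * (w * q) + of_int b * q" by (simp add: algebra_simps)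
    also have "(of_int c * w + of_int d) * q = of_int c * (w * q) + of_int d * q" by (simp add: algebra_simps)
    finally show ?thesis unfolding w wq unfolding q_def
      by (simp add: moebius_def C_def algebra_simps)
  qed
  ultimately show ?thesis by blast
qed

lemma theta_inverse:
  assumes A: "A \<in> theta_group"
  shows "\<exists>C\<in>theta_group. \<forall>z\<in>upper_half_plane. moebius C (moebius A z) = z"
proof -
  define a b c d where "a = A $ 1 $ 1" and "b = A $ 1 $ 2" and "c = A $ 2 $ 1" and "d = A $ 2 $ 2"
  note defs = a_def b_def c_def d_def
  define C where "C = mat2 d (- b) (- c) a"
  have deti: "a * d - b * c = 1" using theta_det[OF A] by (simp add: defs)
  then have det: "(of_int a * of_int d - of_int b * of_int c :: complex) = 1"
    by (metis of_int_1 of_int_diff of_int_mult)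
  have "C \<in> theta_group"
    using A deti unfolding C_def mem_theta_group_iff by (simp flip: defs) (auto simp: algebra_simps)
  moreover have "moebius C (moebius A z) = z" if z: "z \<in> upper_half_plane" for z
  proof -
    define q where "q = of_int c * z + of_int d"
    have q: "q \<noteq> 0" using theta_denominator[OF A z] by (simp add: q_def c_def d_def)
    define w where "w = (of_int a * z + of_int b) / q"
    have w: "moebius A z = w" by (simp add: moebius_def w_def q_def flip: defs)
    have wq: "w * q = of_int a * z + of_int b" using q by (simp add: w_def)
    have "moebius C w = ((of_int d * w - of_int b) * q) / ((- of_int c * w + of_int a) * q)"
      using q by (simp add: moebius_def C_def)
    also have "(of_int d * w - of_int b) * q = of_int d * (w * q) - of_int b * q" by (simp add: algebra_simps)
    also have "\<dots> = (of_int a * of_int d - of_int b * of_int c) * z" unfolding wq unfolding q_def by (simp add: algebra_simps)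
    also have "(- of_int c * w + of_int a) * q = - of_int c * (w * q) + of_int a * q" by (simp add: algebra_simps)
    also have "\<dots> = of_int a * of_int d - of_int b * of_int c" unfolding wq unfolding q_def by (simp add: algebra_simps)
    finally show ?thesis unfolding w det by simp
  qed
  ultimately show ?thesis by blast
qed

lemma i_upper_half_plane: "\<i> \<in> upper_half_plane"
  by (simp add: upper_half_plane_def)

lemma cosh_hyp_dist_i:
  assumes "w \<in> upper_half_plane"
  shows "cosh (hyp_dist \<i> w) = ((cmod w)\<^sup>2 + 1) / (2 * Im w)"
proof -
  have "Im w > 0" using assms by (simp add: upper_half_plane_def)
  moreover have "(cmod (\<i> - w))\<^sup>2 = (cmod w)\<^sup>2 + 1 - 2 * Im w"
    unfolding cmod_power2 by (simp add: power2_eq_square algebra_simps)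
  ultimately show ?thesis unfolding cosh_hyp_dist[OF i_upper_half_plane assms]
    by (simp add: field_simps)
qed

text \<open>The two integer vectors belong to the points that A sends to infinity and to s. s = 0
  gives the first row, hence \<open>height_eq\<close>; s = 1 and s = -1 are the corners of the
  fundamental domain at the second cusp.\<close>

lemma qform_moebius:
  assumes A: "A \<in> theta_group" and z: "z \<in> upper_half_plane"
  shows "qform z (A $ 2 $ 1) (A $ 2 $ 2) = 1 / Im (moebius A z)"
    and "qform z (A $ 1 $ 1 - s * A $ 2 $ 1) (A $ 1 $ 2 - s * A $ 2 $ 2) = (cmod (moebius A z - of_int s))\<^sup>2 / Im (moebius A z)"
proof -
  define q where "q = of_int (A $ 2 $ 1) * z + of_int (A $ 2 $ 2)"
  have q: "q \<noteq> 0" using theta_denominator[OF A z] by (simp add: q_def)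
  have y: "Im z > 0" using z by (simp add: upper_half_plane_def)
  have Im: "Im (moebius A z) = Im z / (cmod q)\<^sup>2" using Im_moebius[OF A z] by (simp add: q_def)
  show "qform z (A $ 2 $ 1) (A $ 2 $ 2) = 1 / Im (moebius A z)"
    unfolding Im qform_def q_def[symmetric] by simp
  have "moebius A z * q = of_int (A $ 1 $ 1) * z + of_int (A $ 1 $ 2)"
    using q by (simp add: moebius_def q_def)
  then have "of_int (A $ 1 $ 1 - s * A $ 2 $ 1) * z + of_int (A $ 1 $ 2 - s * A $ 2 $ 2) = (moebius A z - of_int s) * q"
    by (simp add: algebra_simps q_def)
  then have "qform z (A $ 1 $ 1 - s * A $ 2 $ 1) (A $ 1 $ 2 - s * A $ 2 $ 2) = (cmod (moebius A z - of_int s) * cmod q)\<^sup>2 / Im z"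
    unfolding qform_def by (simp only: norm_mult)
  then show "qform z (A $ 1 $ 1 - s * A $ 2 $ 1) (A $ 1 $ 2 - s * A $ 2 $ 2) = (cmod (moebius A z - of_int s))\<^sup>2 / Im (moebius A z)"
    unfolding Im by (simp add: power_mult_distrib)
qed

lemma height_eq:
  assumes A: "A \<in> theta_group" and z: "z \<in> upper_half_plane"
  shows "height A z = ((cmod (moebius A z))\<^sup>2 + 1) / (2 * Im (moebius A z))"
    and "height A z = cosh (hyp_dist \<i> (moebius A z))"
proof -
  show 1: "height A z = ((cmod (moebius A z))\<^sup>2 + 1) / (2 * Im (moebius A z))"
    unfolding height_def qform_moebius(1)[OF A z] using qform_moebius(2)[OF A z, of 0]
    by (simp add: add_divide_distrib)
  show "height A z = cosh (hyp_dist \<i> (moebius A z))"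
    unfolding 1 cosh_hyp_dist_i[OF moebius_upper_half_plane[OF A z]] ..
qed

lemma hyp_dist_nonneg:
  assumes "z \<in> upper_half_plane" "w \<in> upper_half_plane"
  shows "hyp_dist z w \<ge> 0"
proof -
  have "0 \<le> (cmod (z - w))\<^sup>2 / (2 * Im z * Im w)"
    using assms by (auto simp: upper_half_plane_def)
  then show ?thesis unfolding hyp_dist_def by simp
qed

lemma one_theta: "mat2 1 0 0 1 \<in> theta_group"
  by (simp add: mem_theta_group_iff)

lemma moebius_one: "moebius (mat2 1 0 0 1) z = z"
  by (simp add: moebius_def)

lemma theta_dist_eq_INF:
  assumes z: "z \<in> upper_half_plane"
  shows "theta_dist (theta_orbit \<i>) (theta_orbit z) = (INF A\<in>theta_group. hyp_dist \<i> (moebius A z))"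
proof -
  have "(\<lambda>(z, w). hyp_dist z w) ` (theta_orbit \<i> \<times> theta_orbit z) = (\<lambda>A. hyp_dist \<i> (moebius A z)) ` theta_group"
  proof (intro equalityI subsetI)
    fix x assume "x \<in> (\<lambda>(z, w). hyp_dist z w) ` (theta_orbit \<i> \<times> theta_orbit z)"
    then obtain B C where B: "B \<in> theta_group" and C: "C \<in> theta_group" and x: "x = hyp_dist (moebius B \<i>) (moebius C z)"
      by (auto simp: theta_orbit_def)
    obtain D where D: "D \<in> theta_group" "\<And>w. w \<in> upper_half_plane \<Longrightarrow> moebius D (moebius B w) = w"
      using theta_inverse[OF B] by blast
    obtain E where E: "E \<in> theta_group" "\<And>w. w \<in> upper_half_plane \<Longrightarrow> moebius E w = moebius D (moebius C w)"
      using theta_compose[OF D(1) C] by blast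
    have "x = hyp_dist (moebius D (moebius B \<i>)) (moebius D (moebius C z))"
      unfolding x using hyp_dist_moebius[OF D(1) moebius_upper_half_plane[OF B i_upper_half_plane] moebius_upper_half_plane[OF C z]] ..
    also have "\<dots> = hyp_dist \<i> (moebius E z)" using D(2)[OF i_upper_half_plane] E(2)[OF z] by simp
    finally show "x \<in> (\<lambda>A. hyp_dist \<i> (moebius A z)) ` theta_group" using E(1) by blast
  next
    fix x assume "x \<in> (\<lambda>A. hyp_dist \<i> (moebius A z)) ` theta_group"
    then obtain A where A: "A \<in> theta_group" "x = hyp_dist \<i> (moebius A z)" by blast
    have "\<i> \<in> theta_orbit \<i>" unfolding theta_orbit_def using one_theta moebius_one[of \<i>] by force
    then show "x \<in> (\<lambda>(z, w). hyp_dist z w) ` (theta_orbit \<i> \<times> theta_orbit z)"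
      using A by (auto simp: theta_orbit_def intro!: rev_image_eqI[of "(\<i>, moebius A z)"])
  qed
  then show ?thesis unfolding theta_dist_def by (simp only:)
qed

text \<open>The numbers X above \<open>cosh L\<close> avoid any appeal to attainment of the infimum,
  and the strict inequalities are what the measurability proof can reduce to countably many.\<close>

lemma theta_dist_le_iff:
  assumes z: "z \<in> upper_half_plane" and L: "L \<ge> 0"
  shows "theta_dist (theta_orbit \<i>) (theta_orbit z) \<le> L \<longleftrightarrow> (\<forall>X>cosh L. \<exists>A\<in>theta_group. height A z < X)"
proof -
  define f where "f = (\<lambda>A. hyp_dist \<i> (moebius A z))"
  have f0: "f A \<ge> 0" if "A \<in> theta_group" for A
    unfolding f_def by (intro hyp_dist_nonneg i_upper_half_plane moebius_upper_half_plane that z)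
  have bdd: "bdd_below (f ` theta_group)" using f0 by (intro bdd_belowI[of _ 0]) auto
  have ne: "theta_group \<noteq> {}" using one_theta by blast
  have D: "theta_dist (theta_orbit \<i>) (theta_orbit z) = (INF A\<in>theta_group. f A)"
    unfolding f_def by (rule theta_dist_eq_INF[OF z])
  have hf: "height A z = cosh (f A)" if "A \<in> theta_group" for A
    unfolding f_def by (rule height_eq(2)[OF that z])
  show ?thesis
  proof
    assume le: "theta_dist (theta_orbit \<i>) (theta_orbit z) \<le> L"
    show "\<forall>X>cosh L. \<exists>A\<in>theta_group. height A z < X"
    proof (intro allI impI)
      fix X assume X: "cosh L < X"
      define L' where "L' = arcosh X"
      have X1: "X \<ge> 1" using X cosh_real_ge_1[of L] by linarith
      have L': "cosh L' = X" "L' \<ge> 0" using X1 by (auto simp: L'_def)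
      have "L < L'" using X L L' cosh_real_nonneg_less_iff[of L L'] by simp
      then have "(INF A\<in>theta_group. f A) < L'" using le D by simp
      then obtain A where A: "A \<in> theta_group" "f A < L'" using cINF_less_iff[OF ne bdd] by blast
      then have "cosh (f A) < cosh L'" using f0[OF A(1)] L'(2) cosh_real_nonneg_less_iff[of "f A" L'] by simp
      then show "\<exists>A\<in>theta_group. height A z < X" using A(1) hf L' by auto
    qed
  next
    assume *: "\<forall>X>cosh L. \<exists>A\<in>theta_group. height A z < X"
    show "theta_dist (theta_orbit \<i>) (theta_orbit z) \<le> L"
    proof (rule ccontr)
      define I where "I = (INF A\<in>theta_group. f A)"
      assume "\<not> theta_dist (theta_orbit \<i>) (theta_orbit z) \<le> L"
      then have LI: "L < I" using D by (simp add: I_def)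
      then have "cosh L < cosh I" using L by (simp add: cosh_real_nonneg_less_iff)
      then obtain A where A: "A \<in> theta_group" "height A z < cosh I" using * by blast
      then have "f A < I" using hf[OF A(1)] f0[OF A(1)] LI L by (simp add: cosh_real_nonneg_less_iff)
      moreover have "I \<le> f A" unfolding I_def by (rule cINF_lower[OF bdd A(1)])
      ultimately show False by simp
    qed
  qed
qed

text \<open>The determinant times \<open>Im z\<close> is the imaginary part of one linear form times
  the conjugate of the other. Geometrically, z cannot lie deep in the horoballs at two distinct
  cusps.\<close>

lemma qform_mult_ge:
  assumes "z \<in> upper_half_plane"
  shows "qform z a b * qform z c d \<ge> (real_of_int (a * d - b * c))\<^sup>2"
proof -
  have y: "Im z > 0" using assms by (simp add: upper_half_plane_def)
  define p q where "p = of_int a * z + of_int b" and "q = of_int c * z + of_int d"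
  have "Im (p * cnj q) = real_of_int (a * d - b * c) * Im z"
    by (simp add: p_def q_def algebra_simps)
  then have "\<bar>real_of_int (a * d - b * c) * Im z\<bar> \<le> cmod p * cmod q"
    using abs_Im_le_cmod[of "p * cnj q"] by (simp add: norm_mult)
  then have "\<bar>real_of_int (a * d - b * c) * Im z\<bar>\<^sup>2 \<le> (cmod p * cmod q)\<^sup>2"
    by (intro power_mono) auto
  then have "(real_of_int (a * d - b * c))\<^sup>2 * (Im z)\<^sup>2 \<le> (cmod p)\<^sup>2 * (cmod q)\<^sup>2"
    by (simp only: power2_abs power_mult_distrib)
  then have "(real_of_int (a * d - b * c))\<^sup>2 \<le> (cmod p)\<^sup>2 * (cmod q)\<^sup>2 / (Im z)\<^sup>2"
    using y by (simp add: pos_le_divide_eq)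
  also have "\<dots> = qform z a b * qform z c d"
    unfolding qform_def p_def[symmetric] q_def[symmetric] by (simp add: power2_eq_square)
  finally show ?thesis .
qed

lemma qform_pos:
  assumes "z \<in> upper_half_plane" "(c, d) \<noteq> (0, 0)"
  shows "qform z c d > 0"
proof -
  have y: "Im z > 0" using assms by (simp add: upper_half_plane_def)
  have "of_int c * z + of_int d \<noteq> 0"
  proof
    assume "of_int c * z + of_int d = 0"
    then have "Im (of_int c * z + of_int d) = 0" "Re (of_int c * z + of_int d) = 0" by simp_all
    then show False using y assms(2) by auto
  qed
  then show ?thesis using y by (simp add: qform_def)
qed

text \<open>If the form at p/q has the small value f, every row (s, t) with s p + t q \<noteq> 0 has
  form at least 1/f. For odd p and q the parities of A force this for both of its rows, otherwise
  only one row is certain: here the weight 2 arises.\<close>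

lemma theta_dist_gt_of_qform:
  assumes z: "z \<in> upper_half_plane" and L: "L \<ge> 0" and pq: "q \<noteq> 0"
    and small: "qform z q (- p) < wt (1, 1) p q / (2 * cosh L)"
  shows "\<not> theta_dist (theta_orbit \<i>) (theta_orbit z) \<le> L"
proof
  assume "theta_dist (theta_orbit \<i>) (theta_orbit z) \<le> L"
  then have *: "\<And>X. X > cosh L \<Longrightarrow> \<exists>A\<in>theta_group. height A z < X"
    using theta_dist_le_iff[OF z L] by blast
  define f where "f = qform z q (- p)"
  define k where "k = wt (1, 1) p q"
  have f: "f > 0" using qform_pos[OF z] pq by (simp add: f_def)
  have fk: "f < k / (2 * cosh L)" using small by (simp add: f_def k_def)
  have "k / (2 * f) > cosh L" using fk f by (simp add: field_simps)
  then obtain A where A: "A \<in> theta_group" "height A z < k / (2 * f)" using * by blast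
  define a b c d where "a = A $ 1 $ 1" and "b = A $ 1 $ 2" and "c = A $ 2 $ 1" and "d = A $ 2 $ 2"
  note defs = a_def b_def c_def d_def
  have det: "a * d - b * c = 1" using theta_det[OF A(1)] by (simp add: defs)
  have par: "odd a \<and> even b \<and> even c \<and> odd d \<or> even a \<and> odd b \<and> odd c \<and> even d"
    using A(1) by (simp add: mem_theta_group_iff defs)
  have row: "qform z s t \<ge> 1 / f" if "s * p + t * q \<noteq> 0" for s t
  proof -
    have "1 \<le> (s * (- p) - t * q)\<^sup>2" proof -
      have "s * (- p) - t * q \<noteq> 0" using that by (simp add: algebra_simps)
      then have "0 < (s * (- p) - t * q)\<^sup>2" by simp
      then show ?thesis by linarith
    qed
    then have "1 \<le> real_of_int ((s * (- p) - t * q)\<^sup>2)" by linarith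
    also have "\<dots> \<le> qform z s t * f" using qform_mult_ge[OF z, of s "- p" t q] by (simp add: f_def)
    finally show ?thesis using f by (simp add: field_simps)
  qed
  have nn: "0 \<le> qform z s t" for s t using z by (simp add: qform_def upper_half_plane_def)
  have h: "height A z = (qform z a b + qform z c d) / 2" by (simp add: height_def defs)
  have "k / (2 * f) \<le> height A z"
  proof (cases "k = 2")
    case True
    then have "odd p" "odd q" by (auto simp: k_def wt_def split: if_splits)
    then have "odd (a * p + b * q)" "odd (c * p + d * q)" using par by auto
    then have "a * p + b * q \<noteq> 0" "c * p + d * q \<noteq> 0" by (metis even_zero)+
    from row[OF this(1)] row[OF this(2)] show ?thesis unfolding h True by simp
  next
    case False
    then have k: "k = 1" using wt_cases[of "(1,1)" p q] by (auto simp: k_def)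
    have "a * p + b * q \<noteq> 0 \<or> c * p + d * q \<noteq> 0"
    proof (rule ccontr)
      assume "\<not> ?thesis"
      then have "a * p + b * q = 0" "c * p + d * q = 0" by auto
      then have "q * (a * d - b * c) = 0" by algebra
      then show False using det pq by simp
    qed
    then have "1 / f \<le> qform z a b + qform z c d" using row nn by (smt (verit))
    then show ?thesis unfolding h k by simp
  qed
  then show False using A(2) by linarith
qed

text \<open>In the corners of the fundamental domain 1 - \<bar>x\<bar> \<le> y^2, so both quantities
  are 1/y up to O(y), and y < 1.\<close>

lemma height_near_cusp:
  fixes x y s :: real
  assumes "0 < y" "y < 1" "\<bar>s\<bar> = 1" "\<bar>x\<bar> \<le> 1" "x * s \<ge> 0" "1 \<le> x\<^sup>2 + y\<^sup>2"
  shows "(x\<^sup>2 + y\<^sup>2 + 1) / (2 * y) \<le> y / ((x - s)\<^sup>2 + y\<^sup>2) + 2"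
proof -
  define u where "u = x * s"
  have s2: "s * s = 1" using assms(3) by (auto simp: abs_if split: if_splits)
  have u: "0 \<le> u" "u \<le> 1" using assms s2 by (auto simp: u_def abs_if split: if_splits)
  have xs: "x\<^sup>2 = u\<^sup>2" "(x - s)\<^sup>2 = (1 - u)\<^sup>2"
  proof -
    show "x\<^sup>2 = u\<^sup>2" unfolding u_def using s2 by algebra
    show "(x - s)\<^sup>2 = (1 - u)\<^sup>2" unfolding u_def using s2 by algebra
  qed
  have "u\<^sup>2 \<le> u" using u by (simp add: power2_eq_square mult_left_le)
  then have u1: "1 - u \<le> y\<^sup>2" using assms(6) unfolding xs by linarith
  then have "(1 - u)\<^sup>2 \<le> (y\<^sup>2)\<^sup>2" using u by (intro power_mono) auto
  then have "(1 - u)\<^sup>2 + y\<^sup>2 \<le> y\<^sup>2 * (1 + y\<^sup>2)" by (simp add: power2_eq_square algebra_simps)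
  then have "y / (y\<^sup>2 * (1 + y\<^sup>2)) \<le> y / ((1 - u)\<^sup>2 + y\<^sup>2)"
    using assms by (intro divide_left_mono mult_pos_pos add_nonneg_pos add_pos_nonneg) auto
  moreover have "1 / y - y \<le> y / (y\<^sup>2 * (1 + y\<^sup>2))"
    using assms by (simp add: field_simps power2_eq_square add_pos_pos)
  moreover have "(x\<^sup>2 + y\<^sup>2 + 1) / (2 * y) \<le> 1 / y + y / 2"
  proof -
    have "x\<^sup>2 \<le> 1" using assms(4) by (simp add: abs_square_le_1)
    then have "(x\<^sup>2 + y\<^sup>2 + 1) / (2 * y) \<le> (2 + y\<^sup>2) / (2 * y)" using assms by (intro divide_right_mono) auto
    also have "\<dots> = 1 / y + y / 2" using assms by (simp add: field_simps power2_eq_square)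
    finally show ?thesis .
  qed
  moreover have "y / 2 + y \<le> 2" using assms by simp
  ultimately show ?thesis unfolding xs by linarith
qed

text \<open>Move z into the fundamental domain. A large height there means that z is high up, where
  the row (c, d) has entries of opposite parity and weight 1, or in a corner, where the combined row
  has both entries odd and weight 2. In the first case q may be 0.\<close>

lemma qform_of_theta_dist_gt:
  assumes z: "z \<in> upper_half_plane" and L: "L \<ge> 0" "cosh L > 2"
    and far: "\<not> theta_dist (theta_orbit \<i>) (theta_orbit z) \<le> L"
  shows "\<exists>p q. coprime p q \<and> qform z q (- p) < wt (1, 1) p q / (2 * (cosh L - 2))"
proof -
  obtain X where X: "X > cosh L" "\<And>A. A \<in> theta_group \<Longrightarrow> X \<le> height A z"
    using far theta_dist_le_iff[OF z L(1)] by (meson not_le)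
  obtain A where A: "A \<in> theta_group" "\<bar>Re (moebius A z)\<bar> \<le> 1" "cmod (moebius A z) \<ge> 1"
    using theta_domain_cover[OF z] by blast
  define w x y where "w = moebius A z" and "x = Re w" and "y = Im w"
  have y: "y > 0" using moebius_upper_half_plane[OF A(1) z] by (simp add: y_def w_def upper_half_plane_def)
  have xy: "\<bar>x\<bar> \<le> 1" "1 \<le> x\<^sup>2 + y\<^sup>2"
  proof -
    show "\<bar>x\<bar> \<le> 1" using A(2) by (simp add: x_def w_def)
    have "1\<^sup>2 \<le> (cmod w)\<^sup>2" using A(3) unfolding w_def by (intro power_mono) auto
    then show "1 \<le> x\<^sup>2 + y\<^sup>2" by (simp add: cmod_power2 x_def y_def)
  qed
  have "height A z = (x\<^sup>2 + y\<^sup>2 + 1) / (2 * y)"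
    using height_eq(1)[OF A(1) z] by (simp add: cmod_power2 x_def y_def w_def)
  then have H: "cosh L < (x\<^sup>2 + y\<^sup>2 + 1) / (2 * y)" using X(1) X(2)[OF A(1)] by linarith
  define a b c d where "a = A $ 1 $ 1" and "b = A $ 1 $ 2" and "c = A $ 2 $ 1" and "d = A $ 2 $ 2"
  note defs = a_def b_def c_def d_def
  have det: "a * d - b * c = 1" using theta_det[OF A(1)] by (simp add: defs)
  have par: "odd a \<and> even b \<and> even c \<and> odd d \<or> even a \<and> odd b \<and> odd c \<and> even d"
    using A(1) by (simp add: mem_theta_group_iff defs)
  show ?thesis
  proof (cases "y \<ge> 1")
    case True
    have "x\<^sup>2 \<le> 1" using xy(1) by (simp add: abs_square_le_1)
    then have "(x\<^sup>2 + y\<^sup>2 + 1) / (2 * y) \<le> (2 + y\<^sup>2) / (2 * y)" using y by (intro divide_right_mono) auto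
    also have "\<dots> = 1 / y + y / 2" using y by (simp add: field_simps power2_eq_square)
    finally have "cosh L < 1 / y + y / 2" using H by linarith
    moreover have "1 / y \<le> 1" using True by simp
    ultimately have "cosh L < 1 + y / 2" by (meson add_right_mono order_less_le_trans)
    then have "y > 2 * (cosh L - 1)" by (simp add: field_simps)
    moreover have "2 * (cosh L - 2) < 2 * (cosh L - 1)" by simp
    ultimately have "2 * (cosh L - 2) < y" by (rule less_trans[rotated])
    then have "1 / y < 1 / (2 * (cosh L - 2))" using L by (intro divide_strict_left_mono) auto
    also have "\<dots> \<le> wt (1, 1) (- d) c / (2 * (cosh L - 2))" using L wt_cases[of "(1,1)" "- d" c] by (intro divide_right_mono) auto
    finally have "qform z c (- (- d)) < wt (1, 1) (- d) c / (2 * (cosh L - 2))"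
      using qform_moebius(1)[OF A(1) z] by (simp add: defs y_def w_def)
    moreover have "coprime (- d) c"
    proof (rule coprimeI)
      fix r assume "r dvd - d" "r dvd c"
      then have "r dvd a * d - b * c" by simp
      then show "is_unit r" by (simp add: det)
    qed
    ultimately show ?thesis by blast
  next
    case False
    define s :: int where "s = (if x \<ge> 0 then 1 else - 1)"
    have s: "\<bar>real_of_int s\<bar> = 1" "x * real_of_int s \<ge> 0" "odd s" by (auto simp: s_def)
    define f where "f = qform z (a - s * c) (b - s * d)"
    have f_eq: "f = ((x - s)\<^sup>2 + y\<^sup>2) / y"
      using qform_moebius(2)[OF A(1) z, of s] by (simp add: f_def defs cmod_power2 x_def y_def w_def)
    have f0: "f > 0" unfolding f_eq using y by (simp add: add_nonneg_pos)
    have "(x\<^sup>2 + y\<^sup>2 + 1) / (2 * y) \<le> y / ((x - s)\<^sup>2 + y\<^sup>2) + 2"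
      using False by (intro height_near_cusp y s xy) auto
    moreover have "y / ((x - s)\<^sup>2 + y\<^sup>2) = 1 / f" unfolding f_eq by simp
    ultimately have "cosh L - 2 < 1 / f" using H by linarith
    then have "f < 1 / (cosh L - 2)" using f0 L by (simp add: field_simps)
    moreover have "wt (1, 1) (- (b - s * d)) (a - s * c) = 2"
      using par s(3) by (auto simp: wt_def)
    ultimately have "qform z (a - s * c) (- (- (b - s * d))) < wt (1, 1) (- (b - s * d)) (a - s * c) / (2 * (cosh L - 2))"
    proof -
      have "2 / (2 * x) = 1 / x" for x :: real by simp
      then show ?thesis using \<open>f < 1 / (cosh L - 2)\<close> \<open>wt _ _ _ = 2\<close> by (simp only: minus_minus f_def)
    qed
    moreover have "coprime (- (b - s * d)) (a - s * c)"
    proof (rule coprimeI)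
      fix r assume "r dvd - (b - s * d)" "r dvd a - s * c"
      then have "r dvd d * (a - s * c) + c * (- (b - s * d))" by (intro dvd_add dvd_mult)
      also have "d * (a - s * c) + c * (- (b - s * d)) = a * d - b * c" by (simp add: algebra_simps)
      finally show "is_unit r" by (simp add: det)
    qed
    ultimately show ?thesis by blast
  qed
qed

section \<open>Geodesics in coordinates\<close>

definition geodesic_form :: "complex \<times> complex \<Rightarrow> int \<Rightarrow> int \<Rightarrow> real \<Rightarrow> real" where
  "geodesic_form v c d t =
     ((c * Re (fst v) + d)\<^sup>2 * (cosh t - Im (snd v) / Im (fst v) * sinh t) +
      2 * (c * Re (fst v) + d) * c * Re (snd v) * sinh t +
      (c * Im (fst v))\<^sup>2 * (cosh t + Im (snd v) / Im (fst v) * sinh t)) / Im (fst v)"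

lemma unit_tangent_direction:
  assumes "v \<in> unit_tangent"
  defines "a \<equiv> Re (snd v) / Im (fst v)" and "b \<equiv> Im (snd v) / Im (fst v)"
  shows "Im (fst v) > 0" "a\<^sup>2 + b\<^sup>2 = 1" "\<bar>b\<bar> \<le> 1"
proof -
  show y: "Im (fst v) > 0" using assms by (auto simp: unit_tangent_def)
  have "cmod (snd v) = Im (fst v)" using assms by (auto simp: unit_tangent_def)
  then have "(Re (snd v))\<^sup>2 + (Im (snd v))\<^sup>2 = (Im (fst v))\<^sup>2" by (metis cmod_power2)
  then show ab: "a\<^sup>2 + b\<^sup>2 = 1"
    using y by (simp add: a_def b_def power_divide flip: add_divide_distrib)
  then have "b\<^sup>2 \<le> 1" by (metis le_add_same_cancel2 zero_le_power2)
  then show "\<bar>b\<bar> \<le> 1" by (simp add: abs_square_le_1)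
qed

lemma geodesic_from_upper_half_plane:
  assumes "v \<in> unit_tangent"
  shows "geodesic_from v t \<in> upper_half_plane"
  using unit_tangent_direction[OF assms] cosh_minus_pos[of "Im (snd v) / Im (fst v)" t]
  by (simp add: geodesic_from_eq[OF assms] Let_def upper_half_plane_def)

text \<open>The denominators of the geodesic formula cancel. The explicit expression that remains
  yields measurability in \<open>v\<close> and the splitting into exp t and exp (- t).\<close>

lemma qform_geodesic:
  assumes v: "v \<in> unit_tangent"
  shows "qform (geodesic_from v t) c d = geodesic_form v c d t"
proof -
  define x y a b where "x = Re (fst v)" and "y = Im (fst v)" and "a = Re (snd v) / y" and "b = Im (snd v) / y"
  have y: "y > 0" and ab: "a\<^sup>2 + b\<^sup>2 = 1" and b: "\<bar>b\<bar> \<le> 1"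
    using unit_tangent_direction[OF v] by (auto simp: y_def a_def b_def)
  define C S where "C = cosh t" and "S = sinh t"
  have CS: "C\<^sup>2 = S\<^sup>2 + 1" by (simp add: C_def S_def cosh_square_eq)
  define \<delta> where "\<delta> = C - b * S"
  have \<delta>: "\<delta> > 0" unfolding \<delta>_def C_def S_def by (rule cosh_minus_pos[OF b])
  have dd: "a\<^sup>2 * S\<^sup>2 + 1 = \<delta> * (C + b * S)" using ab CS unfolding \<delta>_def by algebra
  have w: "Re (snd v) = y * a" using y by (simp add: a_def)
  define u where "u = c * x + d"
  define s where "s = c * y"
  have g: "geodesic_from v t = Complex (x + y * a * S / \<delta>) (y / \<delta>)"
    using w by (simp add: geodesic_from_eq[OF v] Let_def \<delta>_def x_def y_def b_def C_def S_def)
  have "cmod (of_int c * geodesic_from v t + of_int d) ^ 2 = (u + s * a * S / \<delta>)\<^sup>2 + (s / \<delta>)\<^sup>2"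
    unfolding g cmod_power2 by (simp add: u_def s_def algebra_simps)
  also have "\<dots> = (u\<^sup>2 * \<delta>\<^sup>2 + 2 * u * s * a * S * \<delta> + s\<^sup>2 * (a\<^sup>2 * S\<^sup>2 + 1)) / \<delta>\<^sup>2"
    using \<delta> by (simp add: field_simps power2_eq_square)
  also have "\<dots> = (u\<^sup>2 * \<delta> + 2 * u * s * a * S + s\<^sup>2 * (C + b * S)) / \<delta>"
    unfolding dd using \<delta> by (simp add: field_simps power2_eq_square)
  finally have "qform (geodesic_from v t) c d = (u\<^sup>2 * \<delta> + 2 * u * s * a * S + s\<^sup>2 * (C + b * S)) / y"
    unfolding qform_def using \<delta> by (simp add: g)
  also have "\<dots> = geodesic_form v c d t"
    unfolding geodesic_form_def x_def[symmetric] y_def[symmetric] b_def[symmetric] w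
    by (simp add: u_def s_def \<delta>_def C_def S_def algebra_simps)
  finally show ?thesis .
qed

text \<open>The coefficients are quadratic forms with determinant (1 - b) (1 + b) - a^2 = 0, hence
  semidefinite. This covers the vertical geodesics too, for which one end point is infinite.\<close>

lemma geodesic_form_exp:
  assumes v: "v \<in> unit_tangent"
  shows "\<exists>\<alpha> \<beta>. 0 \<le> \<alpha> \<and> 0 \<le> \<beta> \<and> (\<forall>t. geodesic_form v c d t = \<alpha> * exp t + \<beta> * exp (- t))"
proof -
  define x y a b where "x = Re (fst v)" and "y = Im (fst v)" and "a = Re (snd v) / y" and "b = Im (snd v) / y"
  have y: "y > 0" and ab: "a\<^sup>2 + b\<^sup>2 = 1" and b: "\<bar>b\<bar> \<le> 1"
    using unit_tangent_direction[OF v] by (auto simp: y_def a_def b_def)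
  have w: "Re (snd v) = y * a" using y by (simp add: a_def)
  define u s where "u = c * x + d" and "s = c * y"
  have psd: "0 \<le> p * u\<^sup>2 + 2 * e * u * s + q * s\<^sup>2" if "0 \<le> p" "0 \<le> q" "p * q = e\<^sup>2" for p q e
  proof (cases "p = 0")
    case True
    then have "e = 0" using that by simp
    then show ?thesis using True that by simp
  next
    case False
    then have p: "p > 0" using that by simp
    have "0 \<le> (p * u + e * s)\<^sup>2" by simp
    also have "\<dots> = p * (p * u\<^sup>2 + 2 * e * u * s + q * s\<^sup>2)" using that(3) by algebra
    finally show ?thesis using p by (simp add: zero_le_mult_iff)
  qed
  define \<alpha> \<beta> where "\<alpha> = ((1 - b) * u\<^sup>2 + 2 * a * u * s + (1 + b) * s\<^sup>2) / (2 * y)"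
    and "\<beta> = ((1 + b) * u\<^sup>2 + 2 * (- a) * u * s + (1 - b) * s\<^sup>2) / (2 * y)"
  have pq: "(1 - b) * (1 + b) = a\<^sup>2" "(1 + b) * (1 - b) = (- a)\<^sup>2" using ab by algebra+
  have "0 \<le> \<alpha>" "0 \<le> \<beta>" unfolding \<alpha>_def \<beta>_def using b y
    by (intro divide_nonneg_pos psd pq; simp add: abs_le_iff)+
  moreover have "geodesic_form v c d t = \<alpha> * exp t + \<beta> * exp (- t)" for t
    unfolding geodesic_form_def x_def[symmetric] y_def[symmetric] b_def[symmetric] w \<alpha>_def \<beta>_def cosh_def sinh_def
    using y by (simp add: u_def s_def field_simps power2_eq_square)
  ultimately show ?thesis by blast
qed

text \<open>\<xi> and \<eta> are the end points in the future and in the past;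
  \<open>cos \<theta> = 0\<close> would be a vertical geodesic. The degenerate coefficients of
  \<open>geodesic_form_exp\<close> become squares vanishing when p/q is an end point.\<close>

lemma geodesic_form_generic:
  assumes y: "Im z > 0" and g: "cos \<theta> \<noteq> 0"
  defines "\<xi> \<equiv> Re z + Im z * cos \<theta> / (1 - sin \<theta>)" and "\<eta> \<equiv> Re z - Im z * cos \<theta> / (1 + sin \<theta>)"
    and "A \<equiv> (1 - sin \<theta>) / (2 * Im z)" and "B \<equiv> (1 + sin \<theta>) / (2 * Im z)"
  shows "A > 0" "B > 0" "A * B * (\<xi> - \<eta>)\<^sup>2 = 1"
    and "geodesic_form (z, of_real (Im z) * cis \<theta>) q (- p) t =
      A * (q * \<xi> - p)\<^sup>2 * exp t + B * (q * \<eta> - p)\<^sup>2 * exp (- t)"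
proof -
  define s k y where "s = sin \<theta>" and "k = cos \<theta>" and "y = Im z"
  have sk: "s\<^sup>2 + k\<^sup>2 = 1" by (simp add: s_def k_def)
  have k0: "k \<noteq> 0" using g by (simp add: k_def)
  have y0: "y > 0" using y by (simp add: y_def)
  have "s\<^sup>2 < 1" using sk k0 by (smt (verit) zero_less_power2)
  then have s1: "- 1 < s" "s < 1" by (auto simp: abs_square_less_1)
  have kk: "k\<^sup>2 = (1 - s) * (1 + s)" using sk by algebra
  show AB: "A > 0" "B > 0" unfolding A_def B_def s_def[symmetric] y_def[symmetric] using s1 y0 by auto
  have "\<xi> - \<eta> = y * k * (1 / (1 - s) + 1 / (1 + s))"
    unfolding \<xi>_def \<eta>_def s_def[symmetric] y_def[symmetric] k_def[symmetric] by (simp add: algebra_simps)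
  also have "1 / (1 - s) + 1 / (1 + s) = 2 / k\<^sup>2" unfolding kk using s1 by (simp add: field_simps)
  finally have d: "\<xi> - \<eta> = 2 * y / k" using k0 by (simp add: power2_eq_square)
  have "A * B = k\<^sup>2 / (4 * y\<^sup>2)"
    unfolding A_def B_def s_def[symmetric] y_def[symmetric] kk by (simp add: power2_eq_square)
  then show "A * B * (\<xi> - \<eta>)\<^sup>2 = 1" unfolding d using k0 y0 by (simp add: power_divide power_mult_distrib)
  define u r where "u = q * Re z - p" and "r = q * y"
  have gen: "m * (u + e * k / m)\<^sup>2 = m * u\<^sup>2 + 2 * k * u * e + e\<^sup>2 * (k\<^sup>2 / m)" if "m \<noteq> 0" for m e :: real
    using that by (simp add: field_simps power2_eq_square)
  have 1: "A * (q * \<xi> - p)\<^sup>2 = ((1 - s) * u\<^sup>2 + 2 * k * u * r + (1 + s) * r\<^sup>2) / (2 * y)"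
  proof -
    have e: "q * \<xi> - p = u + r * k / (1 - s)"
      unfolding \<xi>_def u_def r_def s_def[symmetric] y_def[symmetric] k_def[symmetric] by (simp add: algebra_simps)
    have "(1 - s) * (u + r * k / (1 - s))\<^sup>2 = (1 - s) * u\<^sup>2 + 2 * k * u * r + r\<^sup>2 * (k\<^sup>2 / (1 - s))"
      using s1 by (intro gen) simp
    also have "k\<^sup>2 / (1 - s) = 1 + s" unfolding kk using s1 by simp
    finally show ?thesis unfolding e A_def s_def[symmetric] y_def[symmetric] by (simp add: mult.commute)
  qed
  have 2: "B * (q * \<eta> - p)\<^sup>2 = ((1 + s) * u\<^sup>2 - 2 * k * u * r + (1 - s) * r\<^sup>2) / (2 * y)"
  proof -
    have e: "q * \<eta> - p = u - r * k / (1 + s)"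
      unfolding \<eta>_def u_def r_def s_def[symmetric] y_def[symmetric] k_def[symmetric] by (simp add: algebra_simps)
    have "(1 + s) * (u - r * k / (1 + s))\<^sup>2 = (1 + s) * u\<^sup>2 - 2 * k * u * r + r\<^sup>2 * (k\<^sup>2 / (1 + s))"
      using s1 gen[of "1 + s" "- r"] by simp
    also have "k\<^sup>2 / (1 + s) = 1 - s" unfolding kk using s1 by simp
    finally show ?thesis unfolding e B_def s_def[symmetric] y_def[symmetric] by (simp add: mult.commute)
  qed
  have "geodesic_form (z, of_real (Im z) * cis \<theta>) q (- p) t =
      (u\<^sup>2 * (cosh t - s * sinh t) + 2 * u * r * k * sinh t + r\<^sup>2 * (cosh t + s * sinh t)) / y"
    using y0 unfolding geodesic_form_def by (simp add: u_def r_def s_def k_def y_def algebra_simps)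
  also have "\<dots> = ((1 - s) * u\<^sup>2 + 2 * k * u * r + (1 + s) * r\<^sup>2) / (2 * y) * exp t +
      ((1 + s) * u\<^sup>2 - 2 * k * u * r + (1 - s) * r\<^sup>2) / (2 * y) * exp (- t)"
    unfolding cosh_def sinh_def using y0 by (simp add: field_simps)
  finally show "geodesic_form (z, of_real (Im z) * cis \<theta>) q (- p) t =
      A * (q * \<xi> - p)\<^sup>2 * exp t + B * (q * \<eta> - p)\<^sup>2 * exp (- t)"
    unfolding 1 2 .
qed

lemma moebius_has_field_derivative:
  assumes A: "A \<in> theta_group" and z: "z \<in> upper_half_plane"
  shows "(moebius A has_field_derivative 1 / (of_int (A $ 2 $ 1) * z + of_int (A $ 2 $ 2))\<^sup>2) (at z)"
proof -
  define a b c d where "a = (of_int (A $ 1 $ 1) :: complex)" and "b = (of_int (A $ 1 $ 2) :: complex)"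
    and "c = (of_int (A $ 2 $ 1) :: complex)" and "d = (of_int (A $ 2 $ 2) :: complex)"
  have det: "a * d - b * c = 1"
    using theta_det[OF A] unfolding a_def b_def c_def d_def by (metis of_int_1 of_int_diff of_int_mult)
  have q: "c * z + d \<noteq> 0" using theta_denominator[OF A z] by (simp add: c_def d_def)
  have "((\<lambda>z. (a * z + b) / (c * z + d)) has_field_derivative (a * (c * z + d) - (a * z + b) * c) / ((c * z + d) * (c * z + d))) (at z)"
    using q by (auto intro!: derivative_eq_intros)
  moreover have "a * (c * z + d) - (a * z + b) * c = 1" using det by (simp add: algebra_simps)
  moreover have "moebius A = (\<lambda>z. (a * z + b) / (c * z + d))"
    by (rule ext) (simp add: moebius_def a_def b_def c_def d_def)
  ultimately show ?thesis by (simp add: power2_eq_square c_def d_def)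
qed

lemma geodesic_from_properties:
  assumes "v \<in> unit_tangent"
  shows "unit_speed_geodesic (geodesic_from v)" "geodesic_from v 0 = fst v"
    "(geodesic_from v has_vector_derivative snd v) (at 0)"
    and "unit_speed_geodesic \<gamma> \<Longrightarrow> \<gamma> 0 = fst v \<Longrightarrow> (\<gamma> has_vector_derivative snd v) (at 0) \<Longrightarrow> \<gamma> = geodesic_from v"
proof -
  have v: "Im (fst v) > 0" "cmod (snd v) / Im (fst v) = 1" using assms by (auto simp: unit_tangent_def)
  note ex = ex1_geodesic[OF v]
  have g: "geodesic_from v = (\<lambda>t. Complex (Re (fst v) + Re (snd v) * sinh t / (cosh t - Im (snd v) / Im (fst v) * sinh t))
      (Im (fst v) / (cosh t - Im (snd v) / Im (fst v) * sinh t)))"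
    using geodesic_from_eq[OF assms] by (simp add: Let_def)
  show "unit_speed_geodesic (geodesic_from v)" "geodesic_from v 0 = fst v"
    "(geodesic_from v has_vector_derivative snd v) (at 0)" using ex(1) unfolding g by auto
  show "\<gamma> = geodesic_from v" if "unit_speed_geodesic \<gamma>" "\<gamma> 0 = fst v" "(\<gamma> has_vector_derivative snd v) (at 0)"
    unfolding g by (rule ex(2)) (use that in auto)
qed

lemma geodesic_from_moebius_tangent:
  assumes A: "A \<in> theta_group" and v: "v \<in> unit_tangent"
  shows "geodesic_from (moebius_tangent A v) t = moebius A (geodesic_from v t)"
proof -
  have z: "fst v \<in> upper_half_plane" using unit_tangent_direction(1)[OF v] by (simp add: upper_half_plane_def)
  define q where "q = of_int (A $ 2 $ 1) * fst v + of_int (A $ 2 $ 2)"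
  have q: "q \<noteq> 0" using theta_denominator[OF A z] by (simp add: q_def)
  have dm: "(moebius A has_field_derivative 1 / q\<^sup>2) (at (fst v))"
    using moebius_has_field_derivative[OF A z] by (simp add: q_def)
  have mt: "moebius_tangent A v = (moebius A (fst v), 1 / q\<^sup>2 * snd v)"
    unfolding moebius_tangent_def using DERIV_imp_deriv[OF dm] by simp
  have "Im (moebius A (fst v)) = Im (fst v) / (cmod q)\<^sup>2" using Im_moebius[OF A z] by (simp add: q_def)
  then have ut: "moebius_tangent A v \<in> unit_tangent"
    using v q moebius_upper_half_plane[OF A z]
    by (auto simp: mt unit_tangent_def upper_half_plane_def norm_mult norm_divide norm_power)
  note g = geodesic_from_properties[OF v]
  have uhp: "geodesic_from v s \<in> upper_half_plane" for s by (rule geodesic_from_upper_half_plane[OF v])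
  have "moebius A \<circ> geodesic_from v = geodesic_from (moebius_tangent A v)"
  proof (rule geodesic_from_properties(4)[OF ut])
    show "unit_speed_geodesic (moebius A \<circ> geodesic_from v)"
      using g(1) uhp moebius_upper_half_plane[OF A] hyp_dist_moebius[OF A uhp uhp]
      unfolding unit_speed_geodesic_def by auto
    show "(moebius A \<circ> geodesic_from v) 0 = fst (moebius_tangent A v)" using g(2) by (simp add: mt)
    have "(moebius A has_field_derivative 1 / q\<^sup>2) (at (geodesic_from v 0))" using dm g(2) by simp
    from field_vector_diff_chain_at[OF g(3) this]
    show "((moebius A \<circ> geodesic_from v) has_vector_derivative snd (moebius_tangent A v)) (at 0)"
      by (simp add: mt mult.commute)
  qed
  then show ?thesis by (metis comp_apply)
qed

lemma theta_geodesic_eq: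
  assumes "v \<in> unit_tangent"
  shows "theta_geodesic (theta_tangent_orbit v) t = theta_orbit (geodesic_from v t)"
  unfolding theta_geodesic_def theta_tangent_orbit_def theta_orbit_def image_image
  using geodesic_from_moebius_tangent[OF _ assms] by (intro image_cong) auto

text \<open>Positive combinations of exp t and exp (- t) grow at most like exp \<bar>s - t\<bar>.
  Since the factor does not depend on A, rational times suffice for measurability; it also bounds
  the distance over [0, T].\<close>

lemma height_geodesic_growth:
  assumes v: "v \<in> unit_tangent"
  shows "height A (geodesic_from v s) \<le> exp \<bar>s - t\<bar> * height A (geodesic_from v t)"
proof -
  have "geodesic_form v c d s \<le> exp \<bar>s - t\<bar> * geodesic_form v c d t" for c d
  proof -
    obtain \<alpha> \<beta> where ab: "0 \<le> \<alpha>" "0 \<le> \<beta>" "\<And>t. geodesic_form v c d t = \<alpha> * exp t + \<beta> * exp (- t)"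
      using geodesic_form_exp[OF v] by blast
    have "exp s \<le> exp \<bar>s - t\<bar> * exp t" "exp (- s) \<le> exp \<bar>s - t\<bar> * exp (- t)" by (auto simp flip: exp_add)
    then have "\<alpha> * exp s + \<beta> * exp (- s) \<le> \<alpha> * (exp \<bar>s - t\<bar> * exp t) + \<beta> * (exp \<bar>s - t\<bar> * exp (- t))"
      using ab by (intro add_mono mult_left_mono) auto
    then show ?thesis unfolding ab(3) by (simp add: algebra_simps)
  qed
  then show ?thesis unfolding height_def qform_geodesic[OF v] by (simp add: distrib_left add_mono)
qed

section \<open>Measurability of the excursion sets\<close>

definition shallow :: "real \<Rightarrow> real \<Rightarrow> (complex \<times> complex) set" where
  "shallow L T = {v \<in> unit_tangent. \<forall>t\<in>{0..T}. theta_dist (theta_orbit \<i>) (theta_orbit (geodesic_from v t)) \<le> L}"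

lemma countable_theta_group: "countable theta_group"
proof -
  have "inj_on (\<lambda>A::int^2^2. (A $ 1 $ 1, A $ 1 $ 2, A $ 2 $ 1, A $ 2 $ 2)) theta_group"
    by (auto simp: inj_on_def vec_eq_iff forall_2)
  then show ?thesis by (rule countable_image_inj_on[rotated]) simp
qed

text \<open>Reduces the condition to countably many: rational times clamped to [0, T] and bounds
  approaching \<open>cosh L\<close>. A real time t is reached from a rational one within ln (X / X')
  by \<open>height_geodesic_growth\<close>.\<close>

lemma shallow_iff:
  assumes v: "v \<in> unit_tangent" and T: "T \<ge> 0" and L: "L \<ge> 0"
  shows "v \<in> shallow L T \<longleftrightarrow> (\<forall>(q::rat) (n::nat). \<exists>A\<in>theta_group.
    (geodesic_form v (A $ 1 $ 1) (A $ 1 $ 2) (max 0 (min T (of_rat q))) +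
     geodesic_form v (A $ 2 $ 1) (A $ 2 $ 2) (max 0 (min T (of_rat q)))) / 2 < cosh L + 1 / real (Suc n))"
proof -
  define \<tau> where "\<tau> = (\<lambda>q::rat. max 0 (min T (of_rat q)))"
  have \<tau>: "\<tau> q \<in> {0..T}" for q using T by (auto simp: \<tau>_def)
  have h: "height A (geodesic_from v t) = (geodesic_form v (A $ 1 $ 1) (A $ 1 $ 2) t + geodesic_form v (A $ 2 $ 1) (A $ 2 $ 2) t) / 2" for A t
    unfolding height_def qform_geodesic[OF v] ..
  have uhp: "geodesic_from v t \<in> upper_half_plane" for t by (rule geodesic_from_upper_half_plane[OF v])
  have s: "v \<in> shallow L T \<longleftrightarrow> (\<forall>t\<in>{0..T}. \<forall>X>cosh L. \<exists>A\<in>theta_group. height A (geodesic_from v t) < X)"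
    unfolding shallow_def using v theta_dist_le_iff[OF uhp L] by simp
  have "v \<in> shallow L T \<longleftrightarrow> (\<forall>q n. \<exists>A\<in>theta_group. height A (geodesic_from v (\<tau> q)) < cosh L + 1 / real (Suc n))"
    unfolding s
  proof (intro iffI allI ballI impI)
    fix q :: rat and n :: nat
    assume "\<forall>t\<in>{0..T}. \<forall>X>cosh L. \<exists>A\<in>theta_group. height A (geodesic_from v t) < X"
    then have "\<forall>X>cosh L. \<exists>A\<in>theta_group. height A (geodesic_from v (\<tau> q)) < X" using \<tau> by blast
    then show "\<exists>A\<in>theta_group. height A (geodesic_from v (\<tau> q)) < cosh L + 1 / real (Suc n)"
      by (rule allE[of _ "cosh L + 1 / real (Suc n)"]) simp
  next
    fix t X assume *: "\<forall>q n. \<exists>A\<in>theta_group. height A (geodesic_from v (\<tau> q)) < cosh L + 1 / real (Suc n)"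
      and t: "t \<in> {0..T}" and X: "cosh L < X"
    obtain n where n: "1 / real (Suc n) < X - cosh L" using X nat_approx_posE[of "X - cosh L"] by auto
    define X' where "X' = cosh L + 1 / real (Suc n)"
    have X': "X' < X" "X' > 0" using n by (auto simp: X'_def add_pos_pos)
    define \<delta> where "\<delta> = ln (X / X')"
    have \<delta>: "\<delta> > 0" "exp \<delta> * X' = X" using X' by (auto simp: \<delta>_def)
    obtain q :: rat where q: "t - \<delta> < of_rat q" "of_rat q < t" using of_rat_dense[of "t - \<delta>" t] \<delta> by auto
    have close: "\<bar>t - \<tau> q\<bar> \<le> \<delta>" using q t \<delta> unfolding \<tau>_def by auto
    obtain A where A: "A \<in> theta_group" "height A (geodesic_from v (\<tau> q)) < X'" using * unfolding X'_def by blast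
    have "height A (geodesic_from v t) \<le> exp \<bar>t - \<tau> q\<bar> * height A (geodesic_from v (\<tau> q))"
      by (rule height_geodesic_growth[OF v])
    also have "\<dots> < exp \<bar>t - \<tau> q\<bar> * X'" using A(2) by simp
    also have "\<dots> \<le> exp \<delta> * X'" using close X' by (intro mult_right_mono) auto
    finally show "\<exists>A\<in>theta_group. height A (geodesic_from v t) < X" using A(1) \<delta>(2) by auto
  qed
  then show ?thesis unfolding h \<tau>_def .
qed

lemma shallow_borel:
  assumes "T \<ge> 0" "L \<ge> 0"
  shows "shallow L T \<in> sets borel"
proof -
  have meas: "(\<lambda>v::complex \<times> complex. geodesic_form v c d t) \<in> borel_measurable borel" for c d t
  proof -
    have [measurable]: "(\<lambda>v::complex \<times> complex. Re (fst v)) \<in> borel_measurable borel"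
      "(\<lambda>v::complex \<times> complex. Im (fst v)) \<in> borel_measurable borel"
      "(\<lambda>v::complex \<times> complex. Re (snd v)) \<in> borel_measurable borel"
      "(\<lambda>v::complex \<times> complex. Im (snd v)) \<in> borel_measurable borel"
      by (intro borel_measurable_continuous_onI continuous_intros)+
    show ?thesis unfolding geodesic_form_def by measurable
  qed
  define H where "H = (\<lambda>(A::int^2^2) (q::rat) (n::nat). {v. (geodesic_form v (A $ 1 $ 1) (A $ 1 $ 2) (max 0 (min T (of_rat q))) +
     geodesic_form v (A $ 2 $ 1) (A $ 2 $ 2) (max 0 (min T (of_rat q)))) / 2 < cosh L + 1 / real (Suc n)})"
  have H: "H A q n \<in> sets borel" for A q n
  proof -
    have "{v \<in> space borel. (geodesic_form v (A $ 1 $ 1) (A $ 1 $ 2) (max 0 (min T (of_rat q))) +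
     geodesic_form v (A $ 2 $ 1) (A $ 2 $ 2) (max 0 (min T (of_rat q)))) / 2 < cosh L + 1 / real (Suc n)} \<in> sets borel"
      by (intro borel_measurable_less borel_measurable_divide borel_measurable_add meas borel_measurable_const)
    then show ?thesis by (simp add: H_def)
  qed
  have "shallow L T = unit_tangent \<inter> (\<Inter>q. \<Inter>n. \<Union>A\<in>theta_group. H A q n)"
  proof (rule set_eqI)
    fix v
    show "v \<in> shallow L T \<longleftrightarrow> v \<in> unit_tangent \<inter> (\<Inter>q. \<Inter>n. \<Union>A\<in>theta_group. H A q n)"
    proof (cases "v \<in> unit_tangent")
      case True
      then show ?thesis unfolding shallow_iff[OF True assms] H_def by simp
    qed (simp add: shallow_def)
  qed
  also have "\<dots> \<in> sets borel"
    by (intro sets.Int unit_tangent_borel sets.countable_INT'' sets.countable_UN' countable_theta_group) (auto simp: H)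
  finally show ?thesis .
qed

text \<open>A supremum of reals controls its members only if the set is bounded above. The bound
  comes from the growth of the height for the identity matrix.\<close>

lemma SUP_theta_dist_le_iff:
  assumes v: "v \<in> unit_tangent" and T: "T \<ge> 0"
  shows "(SUP t\<in>{0..T}. theta_dist (theta_orbit \<i>) (theta_geodesic (theta_tangent_orbit v) t)) \<le> L \<longleftrightarrow> v \<in> shallow L T"
proof -
  define D where "D = (\<lambda>t. theta_dist (theta_orbit \<i>) (theta_orbit (geodesic_from v t)))"
  have uhp: "geodesic_from v t \<in> upper_half_plane" for t by (rule geodesic_from_upper_half_plane[OF v])
  define I where "I = mat2 1 0 0 1"
  have I: "I \<in> theta_group" by (simp add: I_def one_theta)
  define M where "M = exp T * height I (geodesic_from v 0)"
  have "D t \<le> arcosh M" if t: "t \<in> {0..T}" for t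
  proof -
    have ge1: "height I (geodesic_from v t) \<ge> 1" using height_eq(2)[OF I uhp, of t] cosh_real_ge_1 by metis
    have "height I (geodesic_from v t) \<le> exp \<bar>t - 0\<bar> * height I (geodesic_from v 0)"
      by (rule height_geodesic_growth[OF v])
    also have "\<dots> \<le> M" unfolding M_def using t height_eq(2)[OF I uhp, of 0] cosh_real_nonneg[of "hyp_dist \<i> (moebius I (geodesic_from v 0))"]
      by (intro mult_right_mono) auto
    finally have hM: "height I (geodesic_from v t) \<le> M" .
    then have M1: "M \<ge> 1" using ge1 by linarith
    have "D t \<le> hyp_dist \<i> (moebius I (geodesic_from v t))"
      unfolding D_def theta_dist_eq_INF[OF uhp]
      by (intro cINF_lower I bdd_belowI[of _ 0]) (auto intro!: hyp_dist_nonneg i_upper_half_plane moebius_upper_half_plane uhp)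
    also have "\<dots> \<le> arcosh M"
    proof -
      have "cosh (hyp_dist \<i> (moebius I (geodesic_from v t))) \<le> cosh (arcosh M)"
        using hM M1 height_eq(2)[OF I uhp, of t] by simp
      moreover have "0 \<le> hyp_dist \<i> (moebius I (geodesic_from v t))"
        by (intro hyp_dist_nonneg i_upper_half_plane moebius_upper_half_plane uhp I)
      moreover have "0 \<le> arcosh M" using M1 by simp
      ultimately show ?thesis using cosh_real_nonneg_le_iff by blast
    qed
    finally show ?thesis .
  qed
  then have bdd: "bdd_above (D ` {0..T})" by (intro bdd_aboveI[of _ "arcosh M"]) auto
  have "(SUP t\<in>{0..T}. D t) \<le> L \<longleftrightarrow> (\<forall>t\<in>{0..T}. D t \<le> L)"
    using T by (intro cSUP_le_iff bdd) auto
  then show ?thesis using v unfolding shallow_def theta_geodesic_eq[OF v] D_def by auto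
qed

section \<open>Area of the fundamental domain\<close>

lemma hyp_area_bounded_weight:
  assumes S: "S \<in> sets borel" and w: "\<And>z. z \<in> S \<Longrightarrow> Im z \<ge> h" and h: "h > 0"
  shows "emeasure hyp_area S \<le> ennreal (1 / h\<^sup>2) * emeasure lborel S"
proof -
  have "emeasure hyp_area S = (\<integral>\<^sup>+z. ennreal (indicator upper_half_plane z / (Im z)\<^sup>2) * indicator S z \<partial>lborel)"
    unfolding hyp_area_def using S by (subst emeasure_density) (auto simp: upper_half_plane_def)
  also have "\<dots> \<le> (\<integral>\<^sup>+z. ennreal (1 / h\<^sup>2) * indicator S z \<partial>lborel)"
  proof (intro nn_integral_mono)
    fix z :: complex
    show "ennreal (indicator upper_half_plane z / (Im z)\<^sup>2) * indicator S z \<le> ennreal (1 / h\<^sup>2) * indicator S z"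
    proof (cases "z \<in> S")
      case True
      then have "h\<^sup>2 \<le> (Im z)\<^sup>2" using w[of z] h by (intro power_mono) auto
      then have "indicator upper_half_plane z / (Im z)\<^sup>2 \<le> 1 / h\<^sup>2"
        using h by (intro frac_le) (auto simp: indicator_def)
      then show ?thesis using True by (simp add: ennreal_leI)
    qed simp
  qed
  also have "\<dots> = ennreal (1 / h\<^sup>2) * emeasure lborel S" using S by (simp add: nn_integral_cmult)
  finally show ?thesis .
qed

lemma emeasure_lborel_complex_cbox:
  assumes "a \<le> c" "b \<le> d"
  shows "emeasure lborel (cbox (Complex a b) (Complex c d)) = ennreal ((c - a) * (d - b))"
proof -
  have B: "(Basis :: complex set) = {1, \<i>}" by (simp add: Basis_complex_def)
  show ?thesis using assms
    by (subst emeasure_lborel_cbox) (auto simp: B inner_complex_def)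
qed

lemma theta_domain_measurable [measurable]: "theta_domain \<in> sets borel"
proof -
  have "open theta_domain" unfolding theta_domain_def
    by (intro open_Collect_conj open_Collect_less continuous_intros)
  then show ?thesis by (rule borel_open)
qed

text \<open>Dyadic boxes whose areas decay like 2^(-k): \<open>U k\<close> climbs towards infinity,
  \<open>R k\<close> and \<open>L k\<close> descend into the corners at 1 and -1, where 1 -
  \<bar>x\<bar> \<le> y^2 allows the width 4^(-k).\<close>

lemma hyp_area_theta_domain_finite: "emeasure hyp_area theta_domain < \<infinity>"
proof -
  define U where "U = (\<lambda>k::nat. cbox (Complex (- 1) (2 ^ k)) (Complex 1 (2 ^ Suc k)))"
  define R where "R = (\<lambda>k::nat. cbox (Complex (1 - (1/4) ^ k) ((1/2) ^ Suc k)) (Complex 1 ((1/2) ^ k)))"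
  define L where "L = (\<lambda>k::nat. cbox (Complex (- 1) ((1/2) ^ Suc k)) (Complex (- 1 + (1/4) ^ k) ((1/2) ^ k)))"
  define S where "S = (\<lambda>k. U k \<union> (R k \<union> L k))"
  have S_b[measurable]: "S k \<in> sets hyp_area" for k by (simp add: S_def U_def R_def L_def hyp_area_def)
  have p24: "(1/4 :: real) ^ k = ((1/2) ^ k)\<^sup>2" for k :: nat by (simp add: power2_eq_square flip: power_mult_distrib)
  have mU: "emeasure hyp_area (U k) \<le> ennreal (2 * (1/2) ^ k)" for k
  proof -
    have "emeasure hyp_area (U k) \<le> ennreal (1 / (2 ^ k)\<^sup>2) * emeasure lborel (U k)"
      by (rule hyp_area_bounded_weight) (auto simp: U_def in_cbox_complex_iff)
    also have "emeasure lborel (U k) = ennreal (2 * 2 ^ k)"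
      unfolding U_def by (subst emeasure_lborel_complex_cbox) auto
    also have "ennreal (1 / (2 ^ k)\<^sup>2) * ennreal (2 * 2 ^ k) = ennreal (2 * (1/2) ^ k)"
      by (subst ennreal_mult'[symmetric]) (auto simp: power2_eq_square power_divide)
    finally show ?thesis .
  qed
  have small: "emeasure hyp_area B \<le> ennreal (2 * (1/2) ^ k)"
    if "B = cbox (Complex a ((1/2) ^ Suc k)) (Complex (a + (1/4) ^ k) ((1/2) ^ k))" for B a k
  proof -
    have "emeasure hyp_area B \<le> ennreal (1 / ((1/2) ^ Suc k)\<^sup>2) * emeasure lborel B"
      by (rule hyp_area_bounded_weight) (auto simp: that in_cbox_complex_iff)
    also have "emeasure lborel B = ennreal ((1/4) ^ k * ((1/2) ^ k - (1/2) ^ Suc k))"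
      unfolding that by (subst emeasure_lborel_complex_cbox) auto
    also have "ennreal (1 / ((1/2) ^ Suc k)\<^sup>2) * ennreal ((1/4) ^ k * ((1/2) ^ k - (1/2) ^ Suc k)) = ennreal (2 * (1/2) ^ k)"
      unfolding p24 by (subst ennreal_mult'[symmetric]) (auto simp: power2_eq_square)
    finally show ?thesis .
  qed
  have mR: "emeasure hyp_area (R k) \<le> ennreal (2 * (1/2) ^ k)" for k
    by (rule small[of _ "1 - (1/4) ^ k"]) (simp add: R_def)
  have mL: "emeasure hyp_area (L k) \<le> ennreal (2 * (1/2) ^ k)" for k
    by (rule small[of _ "- 1"]) (simp add: L_def)
  have mS: "emeasure hyp_area (S k) \<le> ennreal (6 * (1/2) ^ k)" for k
  proof -
    have "emeasure hyp_area (S k) \<le> emeasure hyp_area (U k) + emeasure hyp_area (R k \<union> L k)"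
      unfolding S_def by (intro emeasure_subadditive) (auto simp: U_def R_def L_def hyp_area_def)
    also have "\<dots> \<le> emeasure hyp_area (U k) + (emeasure hyp_area (R k) + emeasure hyp_area (L k))"
      by (intro add_mono emeasure_subadditive order_refl) (auto simp: R_def L_def hyp_area_def)
    also have "\<dots> \<le> ennreal (2 * (1/2) ^ k) + (ennreal (2 * (1/2) ^ k) + ennreal (2 * (1/2) ^ k))"
      by (intro add_mono mU mR mL)
    also have "\<dots> = ennreal (6 * (1/2) ^ k)" by (simp flip: ennreal_plus)
    finally show ?thesis .
  qed
  have "theta_domain \<subseteq> (\<Union>k. S k)"
  proof
    fix z assume z: "z \<in> theta_domain"
    define x y where "x = Re z" and "y = Im z"
    have xy: "y > 0" "\<bar>x\<bar> < 1" "1 < x\<^sup>2 + y\<^sup>2"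
    proof -
      show "y > 0" "\<bar>x\<bar> < 1" using z by (auto simp: theta_domain_def x_def y_def)
      have "1\<^sup>2 < (cmod z)\<^sup>2" using z by (intro power_strict_mono) (auto simp: theta_domain_def)
      then show "1 < x\<^sup>2 + y\<^sup>2" by (simp add: cmod_power2 x_def y_def)
    qed
    have zz: "z = Complex x y" by (simp add: x_def y_def)
    show "z \<in> (\<Union>k. S k)"
    proof (cases "y \<ge> 1")
      case True
      define k where "k = nat \<lfloor>log 2 y\<rfloor>"
      have "0 \<le> log 2 y" using True by simp
      then have k: "real k \<le> log 2 y" "log 2 y < real k + 1" unfolding k_def by linarith+
      have "2 powr k \<le> y" using k(1) xy le_log_iff[of 2 y "real k"] by simp
      moreover have "y < 2 powr (real (Suc k))" using k(2) xy log_less_iff[of 2 y "real (Suc k)"] by simp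
      ultimately have "z \<in> U k" using xy by (auto simp: U_def zz in_cbox_complex_iff powr_realpow simp del: of_nat_Suc power_Suc)
      then show ?thesis by (auto simp: S_def)
    next
      case False
      define k where "k = nat \<lfloor>- log 2 y\<rfloor>"
      have "0 \<le> - log 2 y" using False xy by simp
      then have k: "real k \<le> - log 2 y" "- log 2 y < real k + 1" unfolding k_def by linarith+
      have half: "(1/2 :: real) ^ j = 2 powr (- real j)" for j by (simp add: powr_minus powr_realpow power_one_over inverse_eq_divide)
      have "y \<le> 2 powr (- real k)" using k(1) xy log_le_iff[of 2 y "- real k"] by simp
      then have y1: "y \<le> (1/2) ^ k" by (simp only: half)
      have "2 powr (- real (Suc k)) \<le> y" using k(2) xy le_log_iff[of 2 y "- real (Suc k)"] by simp
      then have y2: "(1/2) ^ Suc k \<le> y" by (simp only: half)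
      have "y\<^sup>2 \<le> (1/4) ^ k" unfolding p24 using y1 xy by (intro power_mono) auto
      moreover have "x\<^sup>2 \<le> \<bar>x\<bar>" using xy mult_left_mono[of "\<bar>x\<bar>" 1 "\<bar>x\<bar>"] by (simp add: power2_eq_square)
      ultimately have "1 - \<bar>x\<bar> \<le> (1/4) ^ k" using xy by linarith
      then have "z \<in> R k \<union> L k" using y1 y2 xy by (cases "x \<ge> 0") (auto simp: R_def L_def zz in_cbox_complex_iff)
      then show ?thesis by (auto simp: S_def)
    qed
  qed
  then have "emeasure hyp_area theta_domain \<le> emeasure hyp_area (\<Union>k. S k)"
    by (intro emeasure_mono sets.countable_UN) auto
  also have "\<dots> \<le> (\<Sum>k. emeasure hyp_area (S k))" by (intro emeasure_subadditive_countably) auto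
  also have "\<dots> \<le> (\<Sum>k. ennreal (6 * (1/2) ^ k))" by (intro suminf_le mS) auto
  also have "\<dots> = ennreal (\<Sum>k. 6 * (1/2) ^ k)"
    by (intro suminf_ennreal2) (auto intro!: summable_mult)
  also have "\<dots> < \<infinity>" by simp
  finally show ?thesis .
qed

lemma hyp_area_theta_domain_pos: "emeasure hyp_area theta_domain \<noteq> 0"
proof
  assume "emeasure hyp_area theta_domain = 0"
  then have "(\<integral>\<^sup>+z. ennreal (indicator upper_half_plane z / (Im z)\<^sup>2) * indicator theta_domain z \<partial>lborel) = 0"
    unfolding hyp_area_def by (subst (asm) emeasure_density) (auto simp: upper_half_plane_def)
  then have "AE z in lborel. ennreal (indicator upper_half_plane z / (Im z)\<^sup>2) * indicator theta_domain z = 0"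
    by (subst (asm) nn_integral_0_iff_AE) (auto simp: upper_half_plane_def)
  then have "AE z in lborel. z \<notin> cbox (Complex 0 2) (Complex (1/2) 3)"
  proof eventually_elim
    case (elim z)
    show ?case
    proof
      assume "z \<in> cbox (Complex 0 2) (Complex (1/2) 3)"
      then have z: "0 \<le> Re z" "Re z \<le> 1/2" "2 \<le> Im z" by (auto simp: in_cbox_complex_iff)
      have "1 < Im z" using z by simp
      then have "1 < cmod z" using abs_Im_le_cmod[of z] by linarith
      then show False using elim z by (auto simp: theta_domain_def upper_half_plane_def)
    qed
  qed
  then have "emeasure lborel (cbox (Complex 0 2) (Complex (1/2) 3)) = 0"
    using emeasure_eq_0_AE[of "\<lambda>z. z \<in> cbox (Complex 0 2) (Complex (1/2) 3)" lborel] by simp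
  then show False by (simp add: emeasure_lborel_complex_cbox)
qed

section \<open>The Liouville measure\<close>

abbreviation angle_measure :: "real measure" where
  "angle_measure \<equiv> restrict_space lborel {0..<2 * pi}"

text \<open>Polar coordinates on the vectors over the fundamental domain, in which the Liouville
  measure is a product and sections in the angle can be treated separately.\<close>

definition frame_measure :: "(complex \<times> real) measure" where
  "frame_measure = restrict_space (hyp_area \<Otimes>\<^sub>M angle_measure) (theta_domain \<times> {0..<2 * pi})"

definition frame_vector :: "complex \<times> real \<Rightarrow> complex \<times> complex" where
  "frame_vector = (\<lambda>(z, \<theta>). (z, of_real (Im z) * cis \<theta>))"

text \<open>The future end point of the geodesic. For sin \<theta> = 1 division by zero gives
  \<open>Re z\<close>; these angles are discarded by \<open>AE_frame_generic\<close>.\<close>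

definition frame_endpoint :: "complex \<times> real \<Rightarrow> real" where
  "frame_endpoint = (\<lambda>(z, \<theta>). Re z + Im z * cos \<theta> / (1 - sin \<theta>))"

lemma sigma_finite_angle_measure: "sigma_finite_measure angle_measure"
  by (rule sigma_finite_measure_restrict_space[OF sigma_finite_lborel]) simp

lemma frame_domain_sets: "theta_domain \<times> {0..<2 * pi} \<in> sets (hyp_area \<Otimes>\<^sub>M angle_measure)"
proof (rule pair_measureI)
  show "theta_domain \<in> sets hyp_area" by (simp add: hyp_area_def)
  show "{0..<2 * pi} \<in> sets angle_measure" by (simp add: sets_restrict_space) (metis Int_UNIV_right imageI sets.top space_borel)
qed

lemma space_frame_measure: "space frame_measure = theta_domain \<times> {0..<2 * pi}"
  by (auto simp: frame_measure_def space_restrict_space space_pair_measure hyp_area_def)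

lemma emeasure_frame_measure:
  assumes "E \<subseteq> theta_domain \<times> {0..<2 * pi}"
  shows "emeasure frame_measure E = emeasure (hyp_area \<Otimes>\<^sub>M angle_measure) E"
  unfolding frame_measure_def
  using frame_domain_sets sets.sets_into_space[OF frame_domain_sets] assms
  by (intro emeasure_restrict_space) (auto simp: Int_absorb2)

lemma sets_frame_measure:
  "E \<in> sets frame_measure \<longleftrightarrow> E \<subseteq> theta_domain \<times> {0..<2 * pi} \<and> E \<in> sets (hyp_area \<Otimes>\<^sub>M angle_measure)"
  unfolding frame_measure_def
  using frame_domain_sets sets.sets_into_space[OF frame_domain_sets]
  by (subst sets_restrict_space_iff) (auto simp: Int_absorb2)

lemma frame_measure_measurableI:
  assumes "f \<in> hyp_area \<Otimes>\<^sub>M angle_measure \<rightarrow>\<^sub>M N"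
  shows "f \<in> frame_measure \<rightarrow>\<^sub>M N"
  unfolding frame_measure_def by (rule measurable_restrict_space1[OF assms])

lemma frame_vector_measurable: "frame_vector \<in> frame_measure \<rightarrow>\<^sub>M borel"
  unfolding frame_vector_def by (rule frame_measure_measurableI[OF liouville_plane_measurable])

lemma angle_borel_measurable: "f \<in> borel_measurable borel \<Longrightarrow> f \<in> angle_measure \<rightarrow>\<^sub>M borel"
  by (rule measurable_restrict_space1) simp

lemma frame_endpoint_measurable: "frame_endpoint \<in> frame_measure \<rightarrow>\<^sub>M borel"
proof (rule frame_measure_measurableI)
  have [measurable]: "Re \<in> hyp_area \<rightarrow>\<^sub>M borel" "Im \<in> hyp_area \<rightarrow>\<^sub>M borel"
    by (simp_all add: hyp_area_def)
  have [measurable]: "(\<lambda>\<theta>. cos \<theta> / (1 - sin \<theta>)) \<in> angle_measure \<rightarrow>\<^sub>M borel"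
    by (rule angle_borel_measurable) measurable
  have "(\<lambda>x. Re (fst x) + Im (fst x) * (cos (snd x) / (1 - sin (snd x)))) \<in> hyp_area \<Otimes>\<^sub>M angle_measure \<rightarrow>\<^sub>M borel"
    by (intro borel_measurable_add borel_measurable_times measurable_compose[OF measurable_fst]
      measurable_compose[OF measurable_snd, of "\<lambda>\<theta>. cos \<theta> / (1 - sin \<theta>)"]) measurable
  then show "frame_endpoint \<in> hyp_area \<Otimes>\<^sub>M angle_measure \<rightarrow>\<^sub>M borel"
    by (simp add: frame_endpoint_def split_beta')
qed

lemma emeasure_frame_space:
  "emeasure frame_measure (space frame_measure) = emeasure hyp_area theta_domain * ennreal (2 * pi)"
proof -
  have "emeasure frame_measure (space frame_measure) = emeasure (hyp_area \<Otimes>\<^sub>M angle_measure) (theta_domain \<times> {0..<2 * pi})"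
    unfolding space_frame_measure by (rule emeasure_frame_measure) simp
  also have "\<dots> = emeasure hyp_area theta_domain * emeasure angle_measure {0..<2 * pi}"
    by (rule sigma_finite_measure.emeasure_pair_measure_Times[OF sigma_finite_angle_measure])
      (auto simp: hyp_area_def sets_restrict_space)
  also have "emeasure angle_measure {0..<2 * pi} = ennreal (2 * pi)"
    by (subst emeasure_restrict_space) auto
  finally show ?thesis .
qed

lemma frame_measure_finite: "finite_measure frame_measure"
  by standard
    (use hyp_area_theta_domain_finite in \<open>simp add: emeasure_frame_space ennreal_mult_eq_top_iff less_top\<close>)

lemma frame_measure_pos: "emeasure frame_measure (space frame_measure) \<noteq> 0"
  using hyp_area_theta_domain_pos by (simp add: emeasure_frame_space)

text \<open>Fubini; the sections are required to be negligible because images under differentiable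
  maps are handled in that form.\<close>

lemma frame_null_set:
  assumes E: "E \<in> sets frame_measure"
    and null: "\<And>z. z \<in> theta_domain \<Longrightarrow> negligible {\<theta> \<in> {0..<2 * pi}. (z, \<theta>) \<in> E}"
  shows "emeasure frame_measure E = 0"
proof -
  have E': "E \<subseteq> theta_domain \<times> {0..<2 * pi}" "E \<in> sets (hyp_area \<Otimes>\<^sub>M angle_measure)"
    using E by (auto simp: sets_frame_measure)
  have "emeasure frame_measure E = (\<integral>\<^sup>+z. emeasure angle_measure (Pair z -` E) \<partial>hyp_area)"
    using emeasure_frame_measure[OF E'(1)]
      sigma_finite_measure.emeasure_pair_measure_alt[OF sigma_finite_angle_measure E'(2)] by simp
  also have "\<dots> = (\<integral>\<^sup>+z. 0 \<partial>hyp_area)"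
  proof (intro nn_integral_cong)
    fix z
    have sec: "Pair z -` E = {\<theta> \<in> {0..<2 * pi}. (z, \<theta>) \<in> E}" using E'(1) by auto
    have "Pair z -` E \<in> sets angle_measure" using E'(2) by (rule sets_Pair1)
    then have b: "Pair z -` E \<in> sets borel" by (auto simp: sets_restrict_space)
    have "negligible (Pair z -` E)"
    proof (cases "z \<in> theta_domain")
      case False
      then have "Pair z -` E = {}" using E'(1) by auto
      then show ?thesis by simp
    next
      case True
      then show ?thesis unfolding sec by (rule null)
    qed
    then have "emeasure lebesgue (Pair z -` E) = 0" by (simp add: negligible_iff_null_sets null_sets_def)
    then have "emeasure lborel (Pair z -` E) = 0" using b by simp
    then show "emeasure angle_measure (Pair z -` E) = 0"
      by (subst emeasure_restrict_space) (auto simp: sec)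
  qed
  finally show ?thesis by simp
qed

lemma negligible_cos_zero: "negligible {\<theta>::real. cos \<theta> = 0}"
proof -
  have "{\<theta>::real. cos \<theta> = 0} = range (\<lambda>n::int. n * pi + pi / 2)"
    by (auto simp: cos_zero_iff_int2)
  then have "countable {\<theta>::real. cos \<theta> = 0}" by simp
  then have "{\<theta>::real. cos \<theta> = 0} \<in> null_sets lborel" by (rule countable_imp_null_set_lborel)
  then show ?thesis by (simp add: negligible_iff_null_sets null_sets_completionI)
qed

lemma AE_frame_generic: "AE x in frame_measure. cos (snd x) \<noteq> 0"
proof -
  define E where "E = {x \<in> space frame_measure. cos (snd x) = 0}"
  have "(\<lambda>x. cos (snd x)) \<in> frame_measure \<rightarrow>\<^sub>M borel"
    by (intro frame_measure_measurableI measurable_compose[OF measurable_snd] angle_borel_measurable) measurable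
  then have E: "E \<in> sets frame_measure" unfolding E_def by measurable
  have "emeasure frame_measure E = 0"
  proof (rule frame_null_set[OF E])
    fix z
    show "negligible {\<theta> \<in> {0..<2 * pi}. (z, \<theta>) \<in> E}"
      by (rule negligible_subset[OF negligible_cos_zero]) (auto simp: E_def)
  qed
  then show ?thesis using E unfolding E_def by (subst AE_iff_measurable[OF _ refl]) auto
qed

text \<open>The quotient is tan (\<theta>/2 + pi/4). Its argument runs over [pi/4, 5 pi/4), which
  crosses one pole of the tangent, so two branches of the inverse occur.\<close>

lemma angle_of_endpoint:
  assumes "0 \<le> \<theta>" "\<theta> < 2 * pi" "cos \<theta> \<noteq> 0"
  defines "\<psi> \<equiv> 2 * arctan (cos \<theta> / (1 - sin \<theta>)) - pi / 2"
  shows "\<theta> = \<psi> \<or> \<theta> = \<psi> + 2 * pi"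
proof -
  define \<tau> where "\<tau> = \<theta> / 2 + pi / 4"
  have \<theta>: "\<theta> = 2 * \<tau> - pi / 2" by (simp add: \<tau>_def)
  have c: "cos \<theta> = 2 * sin \<tau> * cos \<tau>" "sin \<theta> = 1 - 2 * (cos \<tau>)\<^sup>2"
  proof -
    have "cos \<theta> = sin (2 * \<tau>)" unfolding \<theta> by (simp add: cos_diff)
    then show "cos \<theta> = 2 * sin \<tau> * cos \<tau>" by (simp add: sin_double)
    have "sin \<theta> = - cos (2 * \<tau>)" unfolding \<theta> by (simp add: sin_diff)
    then show "sin \<theta> = 1 - 2 * (cos \<tau>)\<^sup>2" by (simp add: cos_double_cos)
  qed
  have ct: "cos \<tau> \<noteq> 0" using assms(3) c by auto
  have tan: "cos \<theta> / (1 - sin \<theta>) = tan \<tau>" unfolding c tan_def using ct by (simp add: field_simps power2_eq_square)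
  have r: "pi / 4 \<le> \<tau>" "\<tau> < 5 * pi / 4" using assms by (auto simp: \<tau>_def)
  show ?thesis
  proof (cases "\<tau> < pi / 2")
    case True
    then have "arctan (tan \<tau>) = \<tau>" using r pi_gt_zero by (intro arctan_tan) auto
    then show ?thesis unfolding \<psi>_def tan by (simp add: \<theta>)
  next
    case False
    have "\<tau> \<noteq> pi / 2" using ct cos_pi_half by metis
    then have "arctan (tan (\<tau> - pi)) = \<tau> - pi" using False r pi_gt_zero by (intro arctan_tan) auto
    moreover have "tan (\<tau> - pi) = tan \<tau>" using tan_periodic_pi[of "\<tau> - pi"] by simp
    ultimately show ?thesis unfolding \<psi>_def tan by (simp add: \<theta>)
  qed
qed

text \<open>For fixed z, the angles whose end point lies in a null set are contained, apart from
  vertical directions, in the images of that set under two differentiable maps, and these preserve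
  null sets.\<close>

lemma frame_endpoint_absolutely_continuous:
  "absolutely_continuous lborel (distr frame_measure borel frame_endpoint)"
  unfolding absolutely_continuous_def
proof
  fix S assume S: "S \<in> null_sets (lborel :: real measure)"
  then have S_b: "S \<in> sets borel" by auto
  have S_neg: "negligible S"
    using S by (simp add: negligible_iff_null_sets null_sets_completionI)
  define E where "E = frame_endpoint -` S \<inter> space frame_measure"
  have E: "E \<in> sets frame_measure" unfolding E_def using frame_endpoint_measurable S_b by (rule measurable_sets)
  have "emeasure frame_measure E = 0"
  proof (rule frame_null_set[OF E])
    fix z assume z: "z \<in> theta_domain"
    have y: "Im z > 0" using z by (simp add: theta_domain_def)
    define \<psi> where "\<psi> = (\<lambda>x. 2 * arctan ((x - Re z) / Im z) - pi / 2)"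
    have "(\<psi> has_real_derivative 2 * inverse (1 + ((x - Re z) / Im z)\<^sup>2) / Im z) (at x)" for x
      unfolding \<psi>_def using y by (auto intro!: derivative_eq_intros)
    then have d0: "\<psi> differentiable_on S"
      by (meson differentiable_at_imp_differentiable_on real_differentiable_def)
    then have d1: "\<psi> differentiable_on S" "(\<lambda>x. \<psi> x + 2 * pi) differentiable_on S"
      by (auto intro: differentiable_on_add)
    have "negligible (\<psi> ` S)" "negligible ((\<lambda>x. \<psi> x + 2 * pi) ` S)"
      by (rule negligible_differentiable_image_negligible[OF order_refl S_neg d1(1)],
          rule negligible_differentiable_image_negligible[OF order_refl S_neg d1(2)])
    then have "negligible (\<psi> ` S \<union> (\<lambda>x. \<psi> x + 2 * pi) ` S \<union> {\<theta>. cos \<theta> = 0})"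
      by (intro negligible_Un negligible_cos_zero)
    then show "negligible {\<theta> \<in> {0..<2 * pi}. (z, \<theta>) \<in> E}"
    proof (rule negligible_subset, safe)
      fix \<theta> assume \<theta>: "\<theta> \<in> {0..<2 * pi}" "(z, \<theta>) \<in> E" "\<theta> \<notin> (\<lambda>x. \<psi> x + 2 * pi) ` S" "\<theta> \<notin> \<psi> ` S"
      show "cos \<theta> = 0"
      proof (rule ccontr)
        assume c: "cos \<theta> \<noteq> 0"
        define x where "x = frame_endpoint (z, \<theta>)"
        have x: "x \<in> S" using \<theta>(2) by (simp add: E_def x_def)
        have "(x - Re z) / Im z = cos \<theta> / (1 - sin \<theta>)" using y by (simp add: x_def frame_endpoint_def)
        then have "\<theta> = \<psi> x \<or> \<theta> = \<psi> x + 2 * pi"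
          using angle_of_endpoint[of \<theta>] \<theta>(1) c unfolding \<psi>_def by simp
        then show False using x \<theta>(3,4) by blast
      qed
    qed
  qed
  then have "emeasure (distr frame_measure borel frame_endpoint) S = 0"
    using emeasure_distr[OF frame_endpoint_measurable S_b] by (simp add: E_def)
  then show "S \<in> null_sets (distr frame_measure borel frame_endpoint)" using S_b by auto
qed

text \<open>Dominated convergence for the indicators of \<open>X n - Y n\<close>; the index from
  which the implication holds may depend on x.\<close>

lemma measure_eventual_implication:
  assumes "finite_measure M" and X: "\<And>n. X n \<in> sets M" and Y: "\<And>n. Y n \<in> sets M"
    and imp: "AE x in M. eventually (\<lambda>n::nat. x \<in> X n \<longrightarrow> x \<in> Y n) sequentially" and \<delta>: "\<delta> > 0"
  shows "eventually (\<lambda>n. measure M (X n) \<le> measure M (Y n) + \<delta>) sequentially"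
proof -
  interpret finite_measure M by fact
  have "(\<lambda>n. \<integral>x. indicator (X n - Y n) x \<partial>M) \<longlonglongrightarrow> (\<integral>x. (0::real) \<partial>M)"
  proof (rule integral_dominated_convergence[where w = "\<lambda>_. 1"])
    show "AE x in M. (\<lambda>n. indicator (X n - Y n) x :: real) \<longlonglongrightarrow> 0"
      using imp
    proof eventually_elim
      case (elim x)
      show ?case by (rule tendsto_eventually) (use elim in \<open>eventually_elim, auto simp: indicator_def\<close>)
    qed
  qed (use X Y in \<open>auto simp: indicator_def\<close>)
  then have "(\<lambda>n. measure M (X n - Y n)) \<longlonglongrightarrow> 0"
    using X Y by (simp add: sets.Int_space_eq1 sets.Int_space_eq2 sets.Diff)
  then have "eventually (\<lambda>n. measure M (X n - Y n) < \<delta>) sequentially" using \<delta> by (rule order_tendstoD)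
  then show ?thesis
  proof eventually_elim
    case (elim n)
    have "measure M (X n) \<le> measure M (Y n \<union> (X n - Y n))"
      using X Y by (intro finite_measure_mono) auto
    also have "\<dots> \<le> measure M (Y n) + measure M (X n - Y n)"
      using X Y by (intro measure_subadditive) (auto simp: emeasure_eq_measure)
    finally show ?case using elim by linarith
  qed
qed

section \<open>From the quotient to frames\<close>

lemma frame_vector_unit_tangent:
  assumes "x \<in> space frame_measure"
  shows "frame_vector x \<in> unit_tangent" "fst (frame_vector x) = fst x"
proof -
  obtain z \<theta> where x: "x = (z, \<theta>)" "z \<in> theta_domain" using assms by (auto simp: space_frame_measure)
  then show "frame_vector x \<in> unit_tangent"
    by (auto simp: frame_vector_def unit_tangent_def theta_domain_def norm_mult)
  show "fst (frame_vector x) = fst x" by (simp add: x frame_vector_def)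
qed

text \<open>Unwinds the two push-forwards and the restriction in \<open>theta_liouville\<close>, so
  that events in the quotient become events in the coordinates (z, \<theta>).\<close>

lemma measure_theta_liouville:
  assumes S: "S \<subseteq> theta_unit_tangent" and V: "{v \<in> unit_tangent. theta_tangent_orbit v \<in> S} \<in> sets borel"
  shows "S \<in> sets theta_liouville"
    and "emeasure theta_liouville S = emeasure frame_measure {x \<in> space frame_measure. theta_tangent_orbit (frame_vector x) \<in> S}"
proof -
  define \<Sigma> where "\<Sigma> = {A. A \<subseteq> theta_unit_tangent \<and> {v \<in> unit_tangent. theta_tangent_orbit v \<in> A} \<in> sets borel}"
  interpret sigma_algebra theta_unit_tangent \<Sigma> unfolding \<Sigma>_def by (rule theta_liouville_sigma)
  define F where "F = {v \<in> unit_tangent. fst v \<in> theta_domain}"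
  define W where "W = {v \<in> unit_tangent. theta_tangent_orbit v \<in> S}"
  have F: "F \<in> sets borel" unfolding F_def by (rule theta_domain_borel)
  have S_in: "S \<in> \<Sigma>" using S V by (simp add: \<Sigma>_def)
  have def: "theta_liouville = distr (restrict_space liouville_plane F) (sigma theta_unit_tangent \<Sigma>) theta_tangent_orbit"
    unfolding theta_liouville_def F_def \<Sigma>_def ..
  have ms: "theta_tangent_orbit \<in> restrict_space liouville_plane F \<rightarrow>\<^sub>M sigma theta_unit_tangent \<Sigma>"
    unfolding F_def \<Sigma>_def by (rule theta_tangent_orbit_measurable)
  show "S \<in> sets theta_liouville" using S_in by (simp add: def)
  have spF: "space (restrict_space liouville_plane F) = F" by (simp add: space_restrict_space liouville_plane_def)
  have "emeasure theta_liouville S = emeasure (restrict_space liouville_plane F) (theta_tangent_orbit -` S \<inter> F)"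
    unfolding def using S_in by (subst emeasure_distr[OF ms]) (auto simp: spF)
  also have "theta_tangent_orbit -` S \<inter> F = W \<inter> F" by (auto simp: W_def F_def)
  also have "emeasure (restrict_space liouville_plane F) (W \<inter> F) = emeasure liouville_plane (W \<inter> F)"
    using F by (intro emeasure_restrict_space) (auto simp: liouville_plane_def)
  also have "\<dots> = emeasure (hyp_area \<Otimes>\<^sub>M angle_measure) (frame_vector -` (W \<inter> F) \<inter> space (hyp_area \<Otimes>\<^sub>M angle_measure))"
    unfolding liouville_plane_def frame_vector_def[symmetric]
    using V F by (intro emeasure_distr) (auto simp: W_def frame_vector_def liouville_plane_measurable)
  also have "frame_vector -` (W \<inter> F) \<inter> space (hyp_area \<Otimes>\<^sub>M angle_measure) =
      {x \<in> space frame_measure. theta_tangent_orbit (frame_vector x) \<in> S}"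
    using frame_vector_unit_tangent
    by (auto simp: W_def F_def space_frame_measure space_pair_measure hyp_area_def space_restrict_space frame_vector_def)
  also have "emeasure (hyp_area \<Otimes>\<^sub>M angle_measure) \<dots> = emeasure frame_measure \<dots>"
    by (rule emeasure_frame_measure[symmetric]) (auto simp: space_frame_measure)
  finally show "emeasure theta_liouville S = emeasure frame_measure {x \<in> space frame_measure. theta_tangent_orbit (frame_vector x) \<in> S}" .
qed

lemma theta_liouville_prob_shallow:
  assumes T: "T \<ge> 0" and L: "ln T + c \<ge> 0"
  shows "measure theta_liouville_prob {v \<in> theta_unit_tangent.
      (SUP t\<in>{0..T}. theta_dist (theta_orbit \<i>) (theta_geodesic v t)) - ln T \<le> c} =
    measure frame_measure {x \<in> space frame_measure. frame_vector x \<in> shallow (ln T + c) T} / measure frame_measure (space frame_measure)"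
proof -
  define S where "S = {v \<in> theta_unit_tangent.
      (SUP t\<in>{0..T}. theta_dist (theta_orbit \<i>) (theta_geodesic v t)) - ln T \<le> c}"
  have orb: "theta_tangent_orbit v \<in> S \<longleftrightarrow> v \<in> shallow (ln T + c) T" if "v \<in> unit_tangent" for v
  proof -
    have "theta_tangent_orbit v \<in> theta_unit_tangent" using that by (simp add: theta_unit_tangent_def)
    then show ?thesis unfolding S_def using SUP_theta_dist_le_iff[OF that T, of "ln T + c"] by (simp add: algebra_simps)
  qed
  have "{v \<in> unit_tangent. theta_tangent_orbit v \<in> S} = shallow (ln T + c) T"
    using orb by (auto simp: shallow_def)
  then have V: "{v \<in> unit_tangent. theta_tangent_orbit v \<in> S} \<in> sets borel" using shallow_borel[OF T L] by simp
  have S: "S \<subseteq> theta_unit_tangent" by (auto simp: S_def)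
  note m = measure_theta_liouville[OF S V]
  have V1: "{v \<in> unit_tangent. theta_tangent_orbit v \<in> theta_unit_tangent} \<in> sets borel"
  proof -
    have "{v \<in> unit_tangent. theta_tangent_orbit v \<in> theta_unit_tangent} = unit_tangent" by (auto simp: theta_unit_tangent_def)
    then show ?thesis using unit_tangent_borel by simp
  qed
  note m1 = measure_theta_liouville[OF order_refl V1]
  have sp: "space theta_liouville = theta_unit_tangent"
    by (simp add: theta_liouville_def space_measure_of_conv)
  have all: "{x \<in> space frame_measure. theta_tangent_orbit (frame_vector x) \<in> theta_unit_tangent} = space frame_measure"
    using frame_vector_unit_tangent(1) by (auto simp: theta_unit_tangent_def)
  have em: "emeasure theta_liouville theta_unit_tangent = emeasure frame_measure (space frame_measure)"
    using m1(2) unfolding all .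
  have "measure theta_liouville_prob S = measure theta_liouville (theta_unit_tangent \<inter> S) / measure theta_liouville theta_unit_tangent"
    unfolding theta_liouville_prob_def sp
    by (rule measure_uniform_measure)
      (use em frame_measure_pos finite_measure.emeasure_finite[OF frame_measure_finite] m(1) in auto)
  moreover have "theta_unit_tangent \<inter> S = S" using S by auto
  moreover have "measure theta_liouville S = measure frame_measure {x \<in> space frame_measure. frame_vector x \<in> shallow (ln T + c) T}"
  proof -
    have "{x \<in> space frame_measure. theta_tangent_orbit (frame_vector x) \<in> S} = {x \<in> space frame_measure. frame_vector x \<in> shallow (ln T + c) T}"
      using orb[OF frame_vector_unit_tangent(1)] by blast
    then show ?thesis using m(2) by (simp add: measure_def)
  qed
  moreover have "measure theta_liouville theta_unit_tangent = measure frame_measure (space frame_measure)"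
    using em by (simp add: measure_def)
  ultimately show ?thesis unfolding S_def by simp
qed

text \<open>Here arithmetic meets geometry: along one geodesic the forms \<open>qform\<close> are
  the sums of two exponentials studied before, and the distance bound is the logarithm of \<kappa>
  T. The threshold for T depends on the geodesic.\<close>

lemma frame_generic_shallow:
  assumes x: "x \<in> space frame_measure" "cos (snd x) \<noteq> 0" and \<kappa>: "\<kappa> > 0" and \<epsilon>: "0 < \<epsilon>" "\<epsilon> < 1"
  shows "eventually (\<lambda>T. frame_vector x \<in> shallow (ln (\<kappa> * T)) T \<longrightarrow>
      frame_endpoint x \<in> avoid (1, 1) (exp ((1 - \<epsilon>) * T / 2)) ((1 - \<epsilon>) / (2 * \<kappa> * T))) at_top"
    and "eventually (\<lambda>T. frame_endpoint x \<in> avoid (1, 1) (exp ((1 + \<epsilon>) * T / 2)) ((1 + \<epsilon>) / (2 * \<kappa> * T)) \<longrightarrow>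
      frame_vector x \<in> shallow (ln (\<kappa> * T)) T) at_top"
proof -
  obtain z \<theta> where xz: "x = (z, \<theta>)" "z \<in> theta_domain" using x by (auto simp: space_frame_measure)
  have y: "Im z > 0" using xz by (simp add: theta_domain_def)
  have c: "cos \<theta> \<noteq> 0" using x xz by simp
  define v where "v = frame_vector x"
  have v: "v \<in> unit_tangent" unfolding v_def by (rule frame_vector_unit_tangent(1)[OF x(1)])
  have vz: "v = (z, of_real (Im z) * cis \<theta>)" by (simp add: v_def xz frame_vector_def)
  define \<xi> \<eta> A B where "\<xi> = Re z + Im z * cos \<theta> / (1 - sin \<theta>)" and "\<eta> = Re z - Im z * cos \<theta> / (1 + sin \<theta>)"
    and "A = (1 - sin \<theta>) / (2 * Im z)" and "B = (1 + sin \<theta>) / (2 * Im z)"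
  have AB: "A > 0" "B > 0" "A * B * (\<xi> - \<eta>)\<^sup>2 = 1"
    using geodesic_form_generic(1-3)[OF y c] unfolding \<xi>_def \<eta>_def A_def B_def by auto
  have ep: "frame_endpoint x = \<xi>" by (simp add: frame_endpoint_def xz \<xi>_def)
  have qf: "qform (geodesic_from v t) q (- p) = A * (q * \<xi> - p)\<^sup>2 * exp t + B * (q * \<eta> - p)\<^sup>2 * exp (- t)" for p q t
    unfolding qform_geodesic[OF v] unfolding vz \<xi>_def \<eta>_def A_def B_def by (rule geodesic_form_generic(4)[OF y c])
  have uhp: "geodesic_from v t \<in> upper_half_plane" for t by (rule geodesic_from_upper_half_plane[OF v])
  have L1: "eventually (\<lambda>T. ln (\<kappa> * T) \<ge> 0) at_top"
    using eventually_ge_at_top[of "1 / \<kappa>"] by eventually_elim (use \<kappa> in \<open>simp add: field_simps\<close>)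
  have L2: "eventually (\<lambda>T. cosh (ln (\<kappa> * T)) > 2) at_top"
    using eventually_ge_at_top[of "4 / \<kappa>"]
  proof eventually_elim
    case (elim T)
    then have "\<kappa> * T \<ge> 4" using \<kappa> by (simp add: field_simps)
    then show ?case using positive_imp_inverse_positive[of "\<kappa> * T"] by (simp add: cosh_ln_real)
  qed
  show "eventually (\<lambda>T. frame_vector x \<in> shallow (ln (\<kappa> * T)) T \<longrightarrow>
      frame_endpoint x \<in> avoid (1, 1) (exp ((1 - \<epsilon>) * T / 2)) ((1 - \<epsilon>) / (2 * \<kappa> * T))) at_top"
    using eventually_deep_of_visit[OF AB \<kappa> \<epsilon>] L1
  proof eventually_elim
    case (elim T)
    show ?case
    proof (rule impI, rule ccontr)
      assume sh: "frame_vector x \<in> shallow (ln (\<kappa> * T)) T"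
        and "frame_endpoint x \<notin> avoid (1, 1) (exp ((1 - \<epsilon>) * T / 2)) ((1 - \<epsilon>) / (2 * \<kappa> * T))"
      then obtain p q where pq: "1 \<le> q" "real_of_int q \<le> exp ((1 - \<epsilon>) * T / 2)" "\<xi> \<in> visits (1, 1) ((1 - \<epsilon>) / (2 * \<kappa> * T)) p q"
        unfolding ep avoid_def by blast
      then obtain t where t: "t \<in> {0..T}" "qform (geodesic_from v t) q (- p) < wt (1, 1) p q / (2 * cosh (ln (\<kappa> * T)))"
        using elim(1) unfolding qf by blast
      have "\<not> theta_dist (theta_orbit \<i>) (theta_orbit (geodesic_from v t)) \<le> ln (\<kappa> * T)"
        by (rule theta_dist_gt_of_qform[OF uhp elim(2) _ t(2)]) (use pq in auto)
      then show False using sh t(1) unfolding v_def[symmetric] shallow_def by blast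
    qed
  qed
  show "eventually (\<lambda>T. frame_endpoint x \<in> avoid (1, 1) (exp ((1 + \<epsilon>) * T / 2)) ((1 + \<epsilon>) / (2 * \<kappa> * T)) \<longrightarrow>
      frame_vector x \<in> shallow (ln (\<kappa> * T)) T) at_top"
    using eventually_visit_of_deep[OF AB \<kappa> \<epsilon>(1)] L1 L2
  proof eventually_elim
    case (elim T)
    show ?case
    proof (rule impI, rule ccontr)
      assume av: "frame_endpoint x \<in> avoid (1, 1) (exp ((1 + \<epsilon>) * T / 2)) ((1 + \<epsilon>) / (2 * \<kappa> * T))"
        and "frame_vector x \<notin> shallow (ln (\<kappa> * T)) T"
      then obtain t where t: "t \<in> {0..T}" "\<not> theta_dist (theta_orbit \<i>) (theta_orbit (geodesic_from v t)) \<le> ln (\<kappa> * T)"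
        using v unfolding v_def[symmetric] shallow_def by blast
      obtain p q where "coprime p q" "qform (geodesic_from v t) q (- p) < wt (1, 1) p q / (2 * (cosh (ln (\<kappa> * T)) - 2))"
        using qform_of_theta_dist_gt[OF uhp elim(2,3) t(2)] by blast
      then show False using elim(1) t(1) av unfolding qf ep by blast
    qed
  qed
qed

text \<open>The parameter s = \<rho> ln Q equals a^2 / (4 \<kappa>) for every n, so
  \<open>avoid_limit\<close> gives the exponent 2 c s = c a^2 / (2 \<kappa>).\<close>

lemma frame_endpoint_avoid_limit:
  assumes equi: "\<And>u v s. u \<le> v \<Longrightarrow> s \<ge> 0 \<Longrightarrow>
      ((\<lambda>\<rho>. measure lborel (avoid (1, 1) (exp (s / \<rho>)) \<rho> \<inter> {u..<v})) \<longlongrightarrow> (v - u) * exp (- 2 * c * s)) (at_right 0)"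
    and a: "a > 0" and \<kappa>: "\<kappa> > 0" and X: "filterlim X at_top sequentially" and pos: "\<And>n. X n > 0"
  shows "(\<lambda>n. measure frame_measure {x \<in> space frame_measure.
      frame_endpoint x \<in> avoid (1, 1) (exp (a * X n / 2)) (a / (2 * \<kappa> * X n))})
    \<longlonglongrightarrow> exp (- (c * a\<^sup>2 / (2 * \<kappa>))) * measure frame_measure (space frame_measure)"
proof -
  define \<rho> where "\<rho> = (\<lambda>n. a / (2 * \<kappa> * X n))"
  define \<mu> where "\<mu> = distr frame_measure borel frame_endpoint"
  define N where "N = (\<lambda>n. avoid (1, 1) (exp (a * X n / 2)) (\<rho> n))"
  have "filterlim (\<lambda>n. 2 * \<kappa> * X n) at_top sequentially"
    by (rule filterlim_tendsto_pos_mult_at_top[OF tendsto_const _ X]) (use \<kappa> in simp)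
  then have "\<rho> \<longlonglongrightarrow> 0"
    unfolding \<rho>_def by (intro tendsto_divide_0[OF tendsto_const] filterlim_at_top_imp_at_infinity)
  moreover have \<rho>pos: "\<rho> n > 0" for n using a \<kappa> pos[of n] by (simp add: \<rho>_def)
  ultimately have \<rho>: "filterlim \<rho> (at_right 0) sequentially"
    by (simp add: filterlim_at less_imp_neq[symmetric])
  define s where "s = a\<^sup>2 / (4 * \<kappa>)"
  have s: "s / \<rho> n = a * X n / 2" for n
    using a \<kappa> pos[of n] by (simp add: s_def \<rho>_def field_simps power2_eq_square)
  then have int: "(\<lambda>n. measure lborel (N n \<inter> {u..<v})) \<longlonglongrightarrow> exp (- 2 * c * s) * (v - u)" if "u \<le> v" for u v
  proof -
    have "s \<ge> 0" using \<kappa> by (simp add: s_def)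
    from filterlim_compose[OF equi[OF that this] \<rho>] show ?thesis
      unfolding s N_def by (simp only: mult.commute)
  qed
  interpret finite_measure frame_measure by (rule frame_measure_finite)
  have "(\<lambda>n. measure \<mu> (N n)) \<longlonglongrightarrow> exp (- 2 * c * s) * measure \<mu> (space \<mu>)"
  proof (rule equidistribution_absolutely_continuous)
    show "N n \<in> sets borel" for n by (simp add: N_def)
    show "finite_measure \<mu>" unfolding \<mu>_def by (rule finite_measure_distr[OF frame_endpoint_measurable])
    show "absolutely_continuous lborel \<mu>" unfolding \<mu>_def by (rule frame_endpoint_absolutely_continuous)
  qed (use int in \<open>simp_all add: \<mu>_def\<close>)
  moreover have "measure \<mu> B = measure frame_measure {x \<in> space frame_measure. frame_endpoint x \<in> B}" if "B \<in> sets borel" for B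
    using measure_distr[OF frame_endpoint_measurable that] by (simp add: \<mu>_def vimage_def Int_def conj_commute)
  ultimately show ?thesis by (simp add: \<mu>_def N_def \<rho>_def s_def)
qed

text \<open>Squeezed between the avoidance events for a = 1 - \<epsilon> and a = 1 + \<epsilon>,
  whose limits \<open>h a\<close> tend to \<open>h 1\<close> by continuity.\<close>

lemma shallow_frames_limit:
  assumes equi: "\<And>u v s. u \<le> v \<Longrightarrow> s \<ge> 0 \<Longrightarrow>
      ((\<lambda>\<rho>. measure lborel (avoid (1, 1) (exp (s / \<rho>)) \<rho> \<inter> {u..<v})) \<longlongrightarrow> (v - u) * exp (- 2 * c * s)) (at_right 0)"
    and \<kappa>: "\<kappa> > 0" and X: "filterlim X at_top sequentially" and ge: "\<And>n. X n > 0" "\<And>n. \<kappa> * X n \<ge> 1"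
  shows "(\<lambda>n. measure frame_measure {x \<in> space frame_measure. frame_vector x \<in> shallow (ln (\<kappa> * X n)) (X n)})
    \<longlonglongrightarrow> exp (- (c / (2 * \<kappa>))) * measure frame_measure (space frame_measure)"
proof -
  define W where "W = (\<lambda>n. {x \<in> space frame_measure. frame_vector x \<in> shallow (ln (\<kappa> * X n)) (X n)})"
  define Y where "Y = (\<lambda>a n. {x \<in> space frame_measure.
      frame_endpoint x \<in> avoid (1, 1) (exp (a * X n / 2)) (a / (2 * \<kappa> * X n))})"
  define h where "h = (\<lambda>a. exp (- (c * a\<^sup>2 / (2 * \<kappa>))) * measure frame_measure (space frame_measure))"
  have W: "W n \<in> sets frame_measure" for n
  proof -
    have "shallow (ln (\<kappa> * X n)) (X n) \<in> sets borel" using ge[of n] by (intro shallow_borel) auto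
    from measurable_sets[OF frame_vector_measurable this] show ?thesis by (simp add: W_def vimage_def Int_def conj_commute)
  qed
  have Y: "Y a n \<in> sets frame_measure" for a n
    using measurable_sets[OF frame_endpoint_measurable avoid_borel] by (simp add: Y_def vimage_def Int_def conj_commute)
  have lim: "(\<lambda>n. measure frame_measure (Y a n)) \<longlonglongrightarrow> h a" if "a > 0" for a
    unfolding Y_def h_def using frame_endpoint_avoid_limit[OF equi that \<kappa> X ge(1)] .
  have space: "AE x in frame_measure. x \<in> space frame_measure" by (rule AE_space)
  have up: "eventually (\<lambda>n. measure frame_measure (W n) \<le> measure frame_measure (Y (1 - \<epsilon>) n) + \<delta>) sequentially"
    and low: "eventually (\<lambda>n. measure frame_measure (Y (1 + \<epsilon>) n) \<le> measure frame_measure (W n) + \<delta>) sequentially"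
    if \<epsilon>: "0 < \<epsilon>" "\<epsilon> < 1" and \<delta>: "\<delta> > 0" for \<epsilon> \<delta>
  proof -
    show "eventually (\<lambda>n. measure frame_measure (W n) \<le> measure frame_measure (Y (1 - \<epsilon>) n) + \<delta>) sequentially"
    proof (rule measure_eventual_implication[OF frame_measure_finite W Y _ \<delta>])
      show "AE x in frame_measure. eventually (\<lambda>n. x \<in> W n \<longrightarrow> x \<in> Y (1 - \<epsilon>) n) sequentially"
        using AE_frame_generic space
      proof eventually_elim
        case (elim x)
        from eventually_compose_filterlim[OF frame_generic_shallow(1)[OF elim(2,1) \<kappa> \<epsilon>] X] show ?case
          by eventually_elim (simp add: W_def Y_def)
      qed
    qed
    show "eventually (\<lambda>n. measure frame_measure (Y (1 + \<epsilon>) n) \<le> measure frame_measure (W n) + \<delta>) sequentially"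
    proof (rule measure_eventual_implication[OF frame_measure_finite Y W _ \<delta>])
      show "AE x in frame_measure. eventually (\<lambda>n. x \<in> Y (1 + \<epsilon>) n \<longrightarrow> x \<in> W n) sequentially"
        using AE_frame_generic space
      proof eventually_elim
        case (elim x)
        from eventually_compose_filterlim[OF frame_generic_shallow(2)[OF elim(2,1) \<kappa> \<epsilon>] X] show ?case
          by eventually_elim (simp add: W_def Y_def)
      qed
    qed
  qed
  have cont: "isCont h 1" unfolding h_def using \<kappa> by (intro continuous_intros) auto
  have "(\<lambda>n. measure frame_measure (W n)) \<longlonglongrightarrow> h 1"
  proof (rule LIMSEQ_I)
    fix \<eta> :: real assume \<eta>: "\<eta> > 0"
    then obtain d where d: "d > 0" "\<And>a. \<bar>a - 1\<bar> < d \<Longrightarrow> \<bar>h a - h 1\<bar> < \<eta> / 3"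
      using cont unfolding continuous_at_eps_delta dist_real_def by (metis divide_pos_pos zero_less_numeral)
    define \<epsilon> where "\<epsilon> = min (1 / 2) (d / 2)"
    have \<epsilon>: "0 < \<epsilon>" "\<epsilon> < 1" "\<epsilon> < d" using d(1) by (auto simp: \<epsilon>_def)
    have h: "\<bar>h (1 - \<epsilon>) - h 1\<bar> < \<eta> / 3" "\<bar>h (1 + \<epsilon>) - h 1\<bar> < \<eta> / 3"
      using d(2)[of "1 - \<epsilon>"] d(2)[of "1 + \<epsilon>"] \<epsilon> by auto
    have e: "eventually (\<lambda>n. measure frame_measure (Y (1 - \<epsilon>) n) < h (1 - \<epsilon>) + \<eta> / 3) sequentially"
      "eventually (\<lambda>n. measure frame_measure (Y (1 + \<epsilon>) n) > h (1 + \<epsilon>) - \<eta> / 3) sequentially"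
      by (rule order_tendstoD[OF lim]; use \<epsilon> \<eta> in simp)+
    have "\<eta> / 3 > 0" using \<eta> by simp
    have "eventually (\<lambda>n. \<bar>measure frame_measure (W n) - h 1\<bar> < \<eta>) sequentially"
      using e up[OF \<epsilon>(1,2) \<open>\<eta> / 3 > 0\<close>] low[OF \<epsilon>(1,2) \<open>\<eta> / 3 > 0\<close>]
    proof eventually_elim
      case (elim n)
      then show ?case using h by linarith
    qed
    then show "\<exists>n0. \<forall>n\<ge>n0. norm (measure frame_measure (W n) - h 1) < \<eta>"
      by (simp add: eventually_sequentially)
  qed
  then show ?thesis by (simp add: W_def h_def)
qed

theorem theorem1p2:
  shows "\<exists>C::real. C > 0 \<and>
    (\<forall>y::real. y > 0 \<longrightarrow>
      ((\<lambda>T::real. measure theta_liouville_prob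
          {v \<in> theta_unit_tangent.
             (SUP t\<in>{0..T}. theta_dist (theta_orbit \<i>) (theta_geodesic v t)) - ln T \<le> ln (C * y)})
        \<longlongrightarrow> exp (- 1 / y)) at_top)"
proof -
  obtain c where c: "c > 0" and equi: "\<forall>e u v s. admissible e \<longrightarrow> u \<le> v \<longrightarrow> s \<ge> 0 \<longrightarrow>
      ((\<lambda>\<rho>. measure lborel (avoid e (exp (s / \<rho>)) \<rho> \<inter> {u..<v})) \<longlongrightarrow> (v - u) * exp (- 2 * c * s)) (at_right 0)"
    using avoid_equidistribution by (elim exE conjE)
  have adm: "admissible (1, 1)" by (simp add: admissible_def)
  note equi' = equi[THEN spec, THEN spec, THEN spec, THEN spec, THEN mp, OF adm, THEN mp, THEN mp]
  define f where "f = (\<lambda>y T::real. measure theta_liouville_prob {v \<in> theta_unit_tangent.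
    (SUP t\<in>{0..T}. theta_dist (theta_orbit \<i>) (theta_geodesic v t)) - ln T \<le> ln (c / 2 * y)})"
  define M where "M = measure frame_measure (space frame_measure)"
  have M: "M > 0"
    using frame_measure_pos finite_measure.emeasure_finite[OF frame_measure_finite, of "space frame_measure"]
    unfolding M_def by (simp add: measure_def enn2real_positive_iff zero_less_iff_neq_zero less_top)
  have "(f y \<longlongrightarrow> exp (- 1 / y)) at_top" if y: "y > 0" for y
  proof (rule tendsto_at_topI_sequentially)
    fix X :: "nat \<Rightarrow> real" assume X: "filterlim X at_top sequentially"
    \<comment> \<open>C = c / 2, because \<kappa> = C y has to turn the limit exp (- c / (2
      \<kappa>)) into exp (- 1 / y).\<close>
    define \<kappa> where "\<kappa> = c / 2 * y"
    have \<kappa>: "\<kappa> > 0" using c y by (simp add: \<kappa>_def)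
    \<comment> \<open>Raises the finitely many small terms of the sequence, so that the time is
      positive and the distance bound ln (\<kappa> X') is nonnegative for every n.\<close>
    define X' where "X' = (\<lambda>n. max (X n) (1 / \<kappa>))"
    have ge: "X' n > 0" "\<kappa> * X' n \<ge> 1" for n
    proof -
      have "X' n \<ge> 1 / \<kappa>" "1 / \<kappa> > 0" using \<kappa> by (auto simp: X'_def)
      then show "X' n > 0" "\<kappa> * X' n \<ge> 1" using \<kappa> by (linarith, simp add: field_simps)
    qed
    have X': "filterlim X' at_top sequentially"
      by (rule filterlim_at_top_mono[OF X]) (simp add: X'_def)
    have f: "f y (X' n) = measure frame_measure {x \<in> space frame_measure. frame_vector x \<in> shallow (ln (\<kappa> * X' n)) (X' n)} / M" for n
    proof -
      have "ln (X' n) + ln (c / 2 * y) = ln (\<kappa> * X' n)" using ge(1)[of n] \<kappa> unfolding \<kappa>_def[symmetric] by (simp add: ln_mult)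
      moreover have "ln (\<kappa> * X' n) \<ge> 0" using ge(2)[of n] by simp
      ultimately show ?thesis
        unfolding f_def M_def using theta_liouville_prob_shallow[of "X' n" "ln (c / 2 * y)"] ge(1)[of n] by simp
    qed
    have "(\<lambda>n. f y (X' n)) \<longlonglongrightarrow> exp (- (c / (2 * \<kappa>))) * M / M"
      unfolding f M_def by (intro tendsto_divide shallow_frames_limit[OF equi' \<kappa> X' ge] tendsto_const) (use M M_def in auto)
    moreover have "exp (- (c / (2 * \<kappa>))) * M / M = exp (- 1 / y)" using c M y by (simp add: \<kappa>_def)
    moreover have "eventually (\<lambda>n. X' n = X n) sequentially"
      using filterlim_at_top_dense[THEN iffD1, OF X, THEN spec, of "1 / \<kappa>"]
      by eventually_elim (simp add: X'_def)
    then have "eventually (\<lambda>n. f y (X' n) = f y (X n)) sequentially" by eventually_elim simp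
    ultimately show "(\<lambda>n. f y (X n)) \<longlonglongrightarrow> exp (- 1 / y)" using Lim_transform_eventually by metis
  qed
  then show ?thesis using c unfolding f_def by (intro exI[of _ "c / 2"]) auto
qed

end
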